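(* Let $k$ be a commutative artinian ring and let $\mathcal{C}$ be an essentially small $k$-linear Hom-finite Krull--Schmidt exact category, with generalized Auslander--Reiten duality $\{\mathcal{C}_r,\mathcal{C}_l,\phi,\psi,\tau,\tau^-\}$. For any $Y\in\mathcal{C}$ and any $K\in\mathcal{C}_l$, the three maps $$\delta_{K,Y}\colon{}^{\tau^-K}[\to Y\rangle_{\mathrm{epi}}\longrightarrow\operatorname{sub}_{\Gamma(K)}\operatorname{Ext}^1_{\mathcal{C}}(Y,K),\qquad[d\rangle\mapsto\operatorname{Im}c(\xi_d,K),$$ $$\gamma_{K,Y}\colon\operatorname{sub}_{\Gamma(K)}\operatorname{Ext}^1_{\mathcal{C}}(Y,K)\longrightarrow\operatorname{sub}_{\Gamma(\tau^-K)^{\mathrm{op}}}\underline{\operatorname{Hom}}_{\mathcal{C}}(\tau^-K,Y),\qquad L\mapsto\psi_{K,Y}^{-1}\bigl(D(\operatorname{Ext}^1_{\mathcal{C}}(Y,K)/L)\bigr),$$ $$\eta_{\tau^-K,Y}\colon{}^{\tau^-K}[\to Y\rangle_{\mathrm{epi}}\longrightarrow\operatorname{sub}_{\Gamma(\tau^-K)^{\mathrm{op}}}\underline{\operatorname{Hom}}_{\mathcal{C}}(\tau^-K,Y),\qquad[d\rangle\mapsto\operatorname{Im}\underline{\operatorname{Hom}}_{\mathcal{C}}(\tau^-K,d),$$ are bijections, and they form a commutative triangle: $\gamma_{K,Y}\circ\delta_{K,Y}=\eta_{\tau^-K,Y}$.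
   Context: Setting. $k$ is a commutative artinian ring, $\check{k}$ is its minimal injective cogenerator, and $D=\operatorname{Hom}_k(-,\check{k})$. An exact category is an additive category with a class of kernel-cokernel pairs (conflations) $X\xrightarrow{i}Y\xrightarrow{d}Z$ satisfying the usual (Quillen/Keller) axioms; $i$ is called an inflation and $d$ a deflation. $\operatorname{Ext}^1_{\mathcal{C}}(X,Y)$ is the $k$-module of equivalence classes of conflations $Y\to E\to X$. Stable categories. A morphism $f\colon X\to Y$ is projectively trivial if $\operatorname{Ext}^1_{\mathcal{C}}(f,Z)=0$ for every $Z$, and injectively trivial if $\operatorname{Ext}^1_{\mathcal{C}}(Z,f)=0$ for every $Z$. These morphisms form ideals $\mathcal{P}$ and $\mathcal{I}$ of $\mathcal{C}$. Put $\underline{\mathcal{C}}=\mathcal{C}/\mathcal{P}$ and $\overline{\mathcal{C}}=\mathcal{C}/\mathcal{I}$, with morphism modules $\underline{\operatorname{Hom}}_{\mathcal{C}}(X,Y)=\operatorname{Hom}_{\mathcal{C}}(X,Y)/\mathcal{P}(X,Y)$ and $\overline{\operatorname{Hom}}_{\mathcal{C}}(X,Y)=\operatorname{Hom}_{\mathcal{C}}(X,Y)/\mathcal{I}(X,Y)$; $\overline{g}$ denotes the class of $g$ in $\overline{\mathcal{C}}$. The bifunctor $\operatorname{Ext}^1_{\mathcal{C}}(-,-)$ factors through $\underline{\mathcal{C}}$ in the first variable and through $\overline{\mathcal{C}}$ in the second. Generalized Auslander--Reiten duality. $\mathcal{C}_r$ is the full subcategory of those $X\in\mathcal{C}$ for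 which the contravariant functor $D\operatorname{Ext}^1_{\mathcal{C}}(X,-)$ on $\overline{\mathcal{C}}$ is representable, and $\mathcal{C}_l$ is the full subcategory of those $X\in\mathcal{C}$ for which the covariant functor $D\operatorname{Ext}^1_{\mathcal{C}}(-,X)$ on $\underline{\mathcal{C}}$ is representable. Write $\underline{\mathcal{C}_r}$ for the image of $\mathcal{C}_r$ in $\underline{\mathcal{C}}$ and $\overline{\mathcal{C}_l}$ for the image of $\mathcal{C}_l$ in $\overline{\mathcal{C}}$. It is known, and taken as given, that choosing representing objects yields mutually quasi-inverse equivalences $\tau\colon\underline{\mathcal{C}_r}\to\overline{\mathcal{C}_l}$ and $\tau^-\colon\overline{\mathcal{C}_l}\to\underline{\mathcal{C}_r}$, together with isomorphisms $\phi_{Y,X}\colon\overline{\operatorname{Hom}}_{\mathcal{C}}(X,\tau Y)\xrightarrow{\sim}D\operatorname{Ext}^1_{\mathcal{C}}(Y,X)$, natural in $X\in\mathcal{C}$ and $Y\in\mathcal{C}_r$, and $\psi_{X,Y}\colon\underline{\operatorname{Hom}}_{\mathcal{C}}(\tau^-X,Y)\xrightarrow{\sim}D\operatorname{Ext}^1_{\mathcal{C}}(Y,X)$, natural in $X\in\mathcal{C}_l$ and $Y\in\mathcal{C}$. Such data are fixed. Right equivalence and determination. Morphisms $f\colon X\to Y$ and $f'\colon X'\to Y$ are right equivalent if each factors through the other; $[f\rangle$ is the right equivalence class of $f$, and $[\to Y\rangle$ is the poset of right equivalence classes of morphisms ending at $Y$, where $[f\rangle\le[f'\rangle$ means that $f$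 factors through $f'$. $[\to Y\rangle_{\mathrm{epi}}$ is the subset of classes of deflations. For $C\in\mathcal{C}$, a morphism $f\colon X\to Y$ is right $C$-determined if for any $T\in\mathcal{C}$ and any $g\colon T\to Y$, $g$ factors through $f$ if and only if $g\circ h$ factors through $f$ for every $h\colon C\to T$. ${}^{C}[\to Y\rangle_{\mathrm{epi}}$ is the subset of $[\to Y\rangle_{\mathrm{epi}}$ consisting of the classes $[d\rangle$ with $d$ a right $C$-determined deflation. Submodule lattices and maps. For $C\in\mathcal{C}$, $\Gamma(C)=\operatorname{End}_{\mathcal{C}}(C)$; $\operatorname{sub}_{R}M$ is the lattice of $R$-submodules of $M$. $\operatorname{Ext}^1_{\mathcal{C}}(Y,K)$ is a (left) $\Gamma(K)$-module by functoriality in the second variable, and $\underline{\operatorname{Hom}}_{\mathcal{C}}(C,Y)$ is a $\Gamma(C)^{\mathrm{op}}$-module by precomposition. For a conflation $\xi\colon X\to E\to Y$ and an object $K$, the connecting map $c(\xi,K)\colon\overline{\operatorname{Hom}}_{\mathcal{C}}(X,K)\to\operatorname{Ext}^1_{\mathcal{C}}(Y,K)$ sends $\overline{g}$ to the pushout $g.\xi$ of $\xi$ along $g$. For a deflation $d\colon X\to Y$, $\xi_d$ denotes the conflation $\operatorname{Ker}d\to X\xrightarrow{d}Y$. In the definitions of $\delta_{K,Y}$ and $\eta_{\tau^-K,Y}$ a class $[d\rangle$ is represented by a deflation $d$. In the definition of $\gamma_{K,Y}$, $D(\operatorname{Ext}^1_{\mathcal{C}}(Y,K)/L)$ is identified with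 the subset of $D\operatorname{Ext}^1_{\mathcal{C}}(Y,K)$ of $k$-linear maps vanishing on $L$. *)

theory Defs
  imports "HOL-Algebra.Module" "HOL-Algebra.Ideal"
begin

section \<open>Modules over a commutative ring\<close>

definition artinian_cring :: "('k, 'z) ring_scheme \<Rightarrow> bool" where
  "artinian_cring R \<longleftrightarrow> cring R \<and>
     (\<forall>I :: nat \<Rightarrow> 'k set. (\<forall>n. ideal (I n) R \<and> I (Suc n) \<subseteq> I n) \<longrightarrow> (\<exists>n. \<forall>m\<ge>n. I m = I n))"

definition finitely_generated :: "('k, 'z) ring_scheme \<Rightarrow> ('k, 'a, 'y) module_scheme \<Rightarrow> bool" where
  "finitely_generated R M \<longleftrightarrow> (\<exists>S. finite S \<and> S \<subseteq> carrier M \<and>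
     (\<forall>x \<in> carrier M. \<exists>c \<in> S \<rightarrow> carrier R. x = (\<Oplus>\<^bsub>M\<^esub>s\<in>S. c s \<odot>\<^bsub>M\<^esub> s)))"

text \<open>Linear maps are extensional (\<open>undefined\<close> off the carrier), so that equality of maps is HOL equality.\<close>

definition lin_maps ::
  "('k, 'z) ring_scheme \<Rightarrow> ('k, 'a, 'x) module_scheme \<Rightarrow> ('k, 'b, 'y) module_scheme \<Rightarrow> ('a \<Rightarrow> 'b) set"
  where "lin_maps R M N = {h \<in> carrier M \<rightarrow>\<^sub>E carrier N.
     (\<forall>x \<in> carrier M. \<forall>y \<in> carrier M. h (x \<oplus>\<^bsub>M\<^esub> y) = h x \<oplus>\<^bsub>N\<^esub> h y) \<and>
     (\<forall>a \<in> carrier R. \<forall>x \<in> carrier M. h (a \<odot>\<^bsub>M\<^esub> x) = a \<odot>\<^bsub>N\<^esub> h x)}"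

definition lin_isos ::
  "('k, 'z) ring_scheme \<Rightarrow> ('k, 'a, 'x) module_scheme \<Rightarrow> ('k, 'b, 'y) module_scheme \<Rightarrow> ('a \<Rightarrow> 'b) set"
  where "lin_isos R M N = {h \<in> lin_maps R M N. bij_betw h (carrier M) (carrier N)}"

text \<open>HOL cannot quantify over modules on all types. The test modules below have their elements in
  the type \<open>'k\<close> of scalars. This is no restriction: by Baer's criterion injectivity is tested by the
  inclusions of ideals of \<open>R\<close>, and an injective module is a cogenerator as soon as it separates the
  points of the cyclic modules, each of which has an isomorphic copy on a subset of \<open>'k\<close>.\<close>

definition injective_module :: "('k, 'z) ring_scheme \<Rightarrow> ('k, 'j) module \<Rightarrow> bool" where
  "injective_module R J \<longleftrightarrow> module R J \<and>
     (\<forall>(M :: ('k, 'k) module) (N :: ('k, 'k) module) f g.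
        module R M \<and> module R N \<and> f \<in> lin_maps R M N \<and> inj_on f (carrier M) \<and> g \<in> lin_maps R M J
        \<longrightarrow> (\<exists>h \<in> lin_maps R N J. \<forall>x \<in> carrier M. h (f x) = g x))"

definition cogenerator :: "('k, 'z) ring_scheme \<Rightarrow> ('k, 'j) module \<Rightarrow> bool" where
  "cogenerator R J \<longleftrightarrow> module R J \<and>
     (\<forall>(M :: ('k, 'k) module) x. module R M \<and> x \<in> carrier M \<and> x \<noteq> \<zero>\<^bsub>M\<^esub>
        \<longrightarrow> (\<exists>h \<in> lin_maps R M J. h x \<noteq> \<zero>\<^bsub>J\<^esub>))"

definition minimal_injective_cogenerator :: "('k, 'z) ring_scheme \<Rightarrow> ('k, 'j) module \<Rightarrow> bool" where
  "minimal_injective_cogenerator R J \<longleftrightarrow> injective_module R J \<and> cogenerator R J \<and>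
     (\<forall>N. submodule N R J \<and> injective_module R (J\<lparr>carrier := N\<rparr>) \<and> cogenerator R (J\<lparr>carrier := N\<rparr>)
        \<longrightarrow> N = carrier J)"

text \<open>The fields \<open>mult\<close> and \<open>one\<close> of a module record carry no meaning and are left \<open>undefined\<close>
  throughout.\<close>

definition Dual :: "('k, 'z) ring_scheme \<Rightarrow> ('k, 'j) module \<Rightarrow> ('k, 'a, 'x) module_scheme \<Rightarrow> ('k, 'a \<Rightarrow> 'j) module"
  where "Dual R J M = \<lparr>carrier = lin_maps R M J, mult = undefined, one = undefined,
     zero = (\<lambda>x\<in>carrier M. \<zero>\<^bsub>J\<^esub>),
     add = (\<lambda>\<alpha> \<beta>. \<lambda>x\<in>carrier M. \<alpha> x \<oplus>\<^bsub>J\<^esub> \<beta> x),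
     smult = (\<lambda>a \<alpha>. \<lambda>x\<in>carrier M. a \<odot>\<^bsub>J\<^esub> \<alpha> x)\<rparr>"

text \<open>\<open>dual_map M h\<close> is \<open>D h\<close> for a map \<open>h\<close> with domain \<open>M\<close>.\<close>

definition dual_map :: "('k, 'a, 'x) module_scheme \<Rightarrow> ('a \<Rightarrow> 'b) \<Rightarrow> ('b \<Rightarrow> 'j) \<Rightarrow> ('a \<Rightarrow> 'j)" where
  "dual_map M h \<alpha> = (\<lambda>x\<in>carrier M. \<alpha> (h x))"

definition quot_module :: "('k, 'a, 'x) module_scheme \<Rightarrow> 'a set \<Rightarrow> ('k, 'a set) module" where
  "quot_module M N = \<lparr>carrier = a_rcosets\<^bsub>M\<^esub> N, mult = undefined, one = undefined,
     zero = N, add = set_add M, smult = (\<lambda>a A. \<Union>x\<in>A. N +>\<^bsub>M\<^esub> (a \<odot>\<^bsub>M\<^esub> x))\<rparr>"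

text \<open>\<open>submodule\<close> does not require the ring of scalars to be commutative.\<close>

definition submodules :: "('r, 'z) ring_scheme \<Rightarrow> ('r, 'a) module \<Rightarrow> 'a set set" where
  "submodules R M = {H. submodule H R M}"

definition is_local_ring :: "('a, 'z) ring_scheme \<Rightarrow> bool" where
  "is_local_ring R \<longleftrightarrow> ring R \<and> \<one>\<^bsub>R\<^esub> \<noteq> \<zero>\<^bsub>R\<^esub> \<and>
     (\<forall>a \<in> carrier R - Units R. \<forall>b \<in> carrier R - Units R. a \<oplus>\<^bsub>R\<^esub> b \<notin> Units R)"

definition op_ring :: "'a ring \<Rightarrow> 'a ring" where
  "op_ring R = R\<lparr>mult := (\<lambda>x y. y \<otimes>\<^bsub>R\<^esub> x)\<rparr>"


section \<open>Linear categories\<close>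

text \<open>Since objects and morphisms are elements of HOL types, categories are automatically small.\<close>

record ('k, 'o, 'm) lincat =
  Ob :: "'o set"
  Dom :: "'m \<Rightarrow> 'o"
  Cod :: "'m \<Rightarrow> 'o"
  Hom :: "'o \<Rightarrow> 'o \<Rightarrow> ('k, 'm) module"
  Comp :: "'m \<Rightarrow> 'm \<Rightarrow> 'm"  (infixl \<open>\<cdot>\<index>\<close> 75)
  Ide :: "'o \<Rightarrow> 'm"

abbreviation mor :: "('k, 'o, 'm, 'z) lincat_scheme \<Rightarrow> 'o \<Rightarrow> 'o \<Rightarrow> 'm set" where
  "mor C X Y \<equiv> carrier (Hom C X Y)"

definition arr :: "('k, 'o, 'm, 'z) lincat_scheme \<Rightarrow> 'm \<Rightarrow> bool" where
  "arr C f \<longleftrightarrow> Dom C f \<in> Ob C \<and> Cod C f \<in> Ob C \<and> f \<in> mor C (Dom C f) (Cod C f)"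

locale linear_category =
  fixes k :: "'k ring" and C :: "('k, 'o, 'm, 'z) lincat_scheme" (structure)
  assumes hom_module: "\<lbrakk>X \<in> Ob C; Y \<in> Ob C\<rbrakk> \<Longrightarrow> module k (Hom C X Y)"
    and dom_cod: "\<lbrakk>X \<in> Ob C; Y \<in> Ob C; f \<in> mor C X Y\<rbrakk> \<Longrightarrow> Dom C f = X \<and> Cod C f = Y"
    and ide_closed: "X \<in> Ob C \<Longrightarrow> Ide C X \<in> mor C X X"
    and comp_closed: "\<lbrakk>X \<in> Ob C; Y \<in> Ob C; Z \<in> Ob C; f \<in> mor C X Y; g \<in> mor C Y Z\<rbrakk>
      \<Longrightarrow> g \<cdot> f \<in> mor C X Z"
    and comp_assoc: "\<lbrakk>W \<in> Ob C; X \<in> Ob C; Y \<in> Ob C; Z \<in> Ob C; f \<in> mor C W X; g \<in> mor C X Y; h \<in> mor C Y Z\<rbrakk>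
      \<Longrightarrow> h \<cdot> g \<cdot> f = h \<cdot> (g \<cdot> f)"
    and ide_comp: "\<lbrakk>X \<in> Ob C; Y \<in> Ob C; f \<in> mor C X Y\<rbrakk> \<Longrightarrow> Ide C Y \<cdot> f = f"
    and comp_ide: "\<lbrakk>X \<in> Ob C; Y \<in> Ob C; f \<in> mor C X Y\<rbrakk> \<Longrightarrow> f \<cdot> Ide C X = f"
    and comp_add_left: "\<lbrakk>X \<in> Ob C; Y \<in> Ob C; Z \<in> Ob C; f \<in> mor C X Y; g \<in> mor C Y Z; h \<in> mor C Y Z\<rbrakk>
      \<Longrightarrow> (g \<oplus>\<^bsub>Hom C Y Z\<^esub> h) \<cdot> f = g \<cdot> f \<oplus>\<^bsub>Hom C X Z\<^esub> h \<cdot> f"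
    and comp_add_right: "\<lbrakk>X \<in> Ob C; Y \<in> Ob C; Z \<in> Ob C; f \<in> mor C X Y; g \<in> mor C X Y; h \<in> mor C Y Z\<rbrakk>
      \<Longrightarrow> h \<cdot> (f \<oplus>\<^bsub>Hom C X Y\<^esub> g) = h \<cdot> f \<oplus>\<^bsub>Hom C X Z\<^esub> h \<cdot> g"
    and comp_smult_left: "\<lbrakk>X \<in> Ob C; Y \<in> Ob C; Z \<in> Ob C; a \<in> carrier k; f \<in> mor C X Y; g \<in> mor C Y Z\<rbrakk>
      \<Longrightarrow> (a \<odot>\<^bsub>Hom C Y Z\<^esub> g) \<cdot> f = a \<odot>\<^bsub>Hom C X Z\<^esub> (g \<cdot> f)"
    and comp_smult_right: "\<lbrakk>X \<in> Ob C; Y \<in> Ob C; Z \<in> Ob C; a \<in> carrier k; f \<in> mor C X Y; g \<in> mor C Y Z\<rbrakk>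
      \<Longrightarrow> g \<cdot> (a \<odot>\<^bsub>Hom C X Y\<^esub> f) = a \<odot>\<^bsub>Hom C X Z\<^esub> (g \<cdot> f)"

definition End_ring :: "('k, 'o, 'm, 'z) lincat_scheme \<Rightarrow> 'o \<Rightarrow> 'm ring" where
  "End_ring C X = \<lparr>carrier = mor C X X, mult = Comp C, one = Ide C X,
     zero = \<zero>\<^bsub>Hom C X X\<^esub>, add = add (Hom C X X)\<rparr>"

definition is_iso :: "('k, 'o, 'm, 'z) lincat_scheme \<Rightarrow> 'm \<Rightarrow> bool" where
  "is_iso C f \<longleftrightarrow> arr C f \<and> (\<exists>g \<in> mor C (Cod C f) (Dom C f).
     g \<cdot>\<^bsub>C\<^esub> f = Ide C (Dom C f) \<and> f \<cdot>\<^bsub>C\<^esub> g = Ide C (Cod C f))"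

definition is_biproduct :: "('k, 'o, 'm, 'z) lincat_scheme \<Rightarrow> 'o \<Rightarrow> 'o \<Rightarrow> 'o \<Rightarrow> 'm \<times> 'm \<Rightarrow> 'm \<times> 'm \<Rightarrow> bool"
  where "is_biproduct C A B S \<iota> \<pi> \<longleftrightarrow> A \<in> Ob C \<and> B \<in> Ob C \<and> S \<in> Ob C \<and>
     fst \<iota> \<in> mor C A S \<and> snd \<iota> \<in> mor C B S \<and> fst \<pi> \<in> mor C S A \<and> snd \<pi> \<in> mor C S B \<and>
     fst \<pi> \<cdot>\<^bsub>C\<^esub> fst \<iota> = Ide C A \<and> snd \<pi> \<cdot>\<^bsub>C\<^esub> snd \<iota> = Ide C B \<and>
     snd \<pi> \<cdot>\<^bsub>C\<^esub> fst \<iota> = \<zero>\<^bsub>Hom C A B\<^esub> \<and> fst \<pi> \<cdot>\<^bsub>C\<^esub> snd \<iota> = \<zero>\<^bsub>Hom C B A\<^esub> \<and>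
     fst \<iota> \<cdot>\<^bsub>C\<^esub> fst \<pi> \<oplus>\<^bsub>Hom C S S\<^esub> snd \<iota> \<cdot>\<^bsub>C\<^esub> snd \<pi> = Ide C S"

definition additive_category :: "('k, 'o, 'm, 'z) lincat_scheme \<Rightarrow> bool" where
  "additive_category C \<longleftrightarrow>
     (\<exists>Z \<in> Ob C. \<forall>X \<in> Ob C. mor C Z X = {\<zero>\<^bsub>Hom C Z X\<^esub>} \<and> mor C X Z = {\<zero>\<^bsub>Hom C X Z\<^esub>}) \<and>
     (\<forall>A \<in> Ob C. \<forall>B \<in> Ob C. \<exists>S \<iota> \<pi>. is_biproduct C A B S \<iota> \<pi>)"

definition hom_finite :: "'k ring \<Rightarrow> ('k, 'o, 'm, 'z) lincat_scheme \<Rightarrow> bool" where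
  "hom_finite k C \<longleftrightarrow> (\<forall>X \<in> Ob C. \<forall>Y \<in> Ob C. finitely_generated k (Hom C X Y))"

text \<open>Every object is a finite (possibly empty) direct sum of objects with local endomorphism rings.\<close>

definition krull_schmidt :: "('k, 'o, 'm, 'z) lincat_scheme \<Rightarrow> bool" where
  "krull_schmidt C \<longleftrightarrow> (\<forall>X \<in> Ob C. \<exists>(n :: nat) A \<iota> \<pi>.
     (\<forall>i<n. A i \<in> Ob C \<and> is_local_ring (End_ring C (A i)) \<and> \<iota> i \<in> mor C (A i) X \<and> \<pi> i \<in> mor C X (A i)) \<and>
     (\<forall>i<n. \<forall>j<n. \<pi> i \<cdot>\<^bsub>C\<^esub> \<iota> j = (if i = j then Ide C (A i) else \<zero>\<^bsub>Hom C (A j) (A i)\<^esub>)) \<and>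
     Ide C X = (\<Oplus>\<^bsub>Hom C X X\<^esub>i\<in>{..<n}. \<iota> i \<cdot>\<^bsub>C\<^esub> \<pi> i))"

text \<open>The square \<open>p \<cdot> f = q \<cdot> g\<close> is a pushout of the span \<open>f, g\<close>;
  dually, \<open>f \<cdot> p = g \<cdot> q\<close> is a pullback of the cospan \<open>f, g\<close>.\<close>

definition pushout_square :: "('k, 'o, 'm, 'z) lincat_scheme \<Rightarrow> 'm \<Rightarrow> 'm \<Rightarrow> 'm \<Rightarrow> 'm \<Rightarrow> bool" where
  "pushout_square C f g p q \<longleftrightarrow> arr C f \<and> arr C g \<and> arr C p \<and> arr C q \<and>
     Dom C f = Dom C g \<and> Dom C p = Cod C f \<and> Dom C q = Cod C g \<and> Cod C p = Cod C q \<and>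
     p \<cdot>\<^bsub>C\<^esub> f = q \<cdot>\<^bsub>C\<^esub> g \<and>
     (\<forall>Z \<in> Ob C. \<forall>u \<in> mor C (Cod C f) Z. \<forall>v \<in> mor C (Cod C g) Z. u \<cdot>\<^bsub>C\<^esub> f = v \<cdot>\<^bsub>C\<^esub> g \<longrightarrow>
        (\<exists>!w. w \<in> mor C (Cod C p) Z \<and> w \<cdot>\<^bsub>C\<^esub> p = u \<and> w \<cdot>\<^bsub>C\<^esub> q = v))"

definition pullback_square :: "('k, 'o, 'm, 'z) lincat_scheme \<Rightarrow> 'm \<Rightarrow> 'm \<Rightarrow> 'm \<Rightarrow> 'm \<Rightarrow> bool" where
  "pullback_square C f g p q \<longleftrightarrow> arr C f \<and> arr C g \<and> arr C p \<and> arr C q \<and>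
     Cod C f = Cod C g \<and> Cod C p = Dom C f \<and> Cod C q = Dom C g \<and> Dom C p = Dom C q \<and>
     f \<cdot>\<^bsub>C\<^esub> p = g \<cdot>\<^bsub>C\<^esub> q \<and>
     (\<forall>Z \<in> Ob C. \<forall>u \<in> mor C Z (Dom C f). \<forall>v \<in> mor C Z (Dom C g). f \<cdot>\<^bsub>C\<^esub> u = g \<cdot>\<^bsub>C\<^esub> v \<longrightarrow>
        (\<exists>!w. w \<in> mor C Z (Dom C p) \<and> p \<cdot>\<^bsub>C\<^esub> w = u \<and> q \<cdot>\<^bsub>C\<^esub> w = v))"

definition is_kernel :: "('k, 'o, 'm, 'z) lincat_scheme \<Rightarrow> 'm \<Rightarrow> 'm \<Rightarrow> bool" where
  "is_kernel C i d \<longleftrightarrow> arr C i \<and> arr C d \<and> Cod C i = Dom C d \<and>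
     d \<cdot>\<^bsub>C\<^esub> i = \<zero>\<^bsub>Hom C (Dom C i) (Cod C d)\<^esub> \<and>
     (\<forall>T \<in> Ob C. \<forall>f \<in> mor C T (Dom C d). d \<cdot>\<^bsub>C\<^esub> f = \<zero>\<^bsub>Hom C T (Cod C d)\<^esub> \<longrightarrow>
        (\<exists>!u. u \<in> mor C T (Dom C i) \<and> i \<cdot>\<^bsub>C\<^esub> u = f))"

definition is_cokernel :: "('k, 'o, 'm, 'z) lincat_scheme \<Rightarrow> 'm \<Rightarrow> 'm \<Rightarrow> bool" where
  "is_cokernel C d i \<longleftrightarrow> arr C i \<and> arr C d \<and> Cod C i = Dom C d \<and>
     d \<cdot>\<^bsub>C\<^esub> i = \<zero>\<^bsub>Hom C (Dom C i) (Cod C d)\<^esub> \<and>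
     (\<forall>T \<in> Ob C. \<forall>f \<in> mor C (Cod C i) T. f \<cdot>\<^bsub>C\<^esub> i = \<zero>\<^bsub>Hom C (Dom C i) T\<^esub> \<longrightarrow>
        (\<exists>!u. u \<in> mor C (Cod C d) T \<and> u \<cdot>\<^bsub>C\<^esub> d = f))"


section \<open>Functors and quasi-inverse equivalences\<close>

definition is_functor ::
  "('k, 'o, 'm, 'z) lincat_scheme \<Rightarrow> ('l, 'p, 'n, 'y) lincat_scheme \<Rightarrow> ('o \<Rightarrow> 'p) \<Rightarrow> ('m \<Rightarrow> 'n) \<Rightarrow> bool"
  where "is_functor A B F Fm \<longleftrightarrow>
     (\<forall>X \<in> Ob A. F X \<in> Ob B \<and> Fm (Ide A X) = Ide B (F X)) \<and>
     (\<forall>X \<in> Ob A. \<forall>Y \<in> Ob A. \<forall>f \<in> mor A X Y. Fm f \<in> mor B (F X) (F Y)) \<and>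
     (\<forall>X \<in> Ob A. \<forall>Y \<in> Ob A. \<forall>Z \<in> Ob A. \<forall>f \<in> mor A X Y. \<forall>g \<in> mor A Y Z.
        Fm (g \<cdot>\<^bsub>A\<^esub> f) = Fm g \<cdot>\<^bsub>B\<^esub> Fm f)"

definition naturally_isomorphic ::
  "('k, 'o, 'm, 'z) lincat_scheme \<Rightarrow> ('l, 'p, 'n, 'y) lincat_scheme \<Rightarrow>
   ('o \<Rightarrow> 'p) \<Rightarrow> ('m \<Rightarrow> 'n) \<Rightarrow> ('o \<Rightarrow> 'p) \<Rightarrow> ('m \<Rightarrow> 'n) \<Rightarrow> bool"
  where "naturally_isomorphic A B F Fm G Gm \<longleftrightarrow> (\<exists>\<theta>.
     (\<forall>X \<in> Ob A. \<theta> X \<in> mor B (F X) (G X) \<and> is_iso B (\<theta> X)) \<and>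
     (\<forall>X \<in> Ob A. \<forall>Y \<in> Ob A. \<forall>f \<in> mor A X Y. \<theta> Y \<cdot>\<^bsub>B\<^esub> Fm f = Gm f \<cdot>\<^bsub>B\<^esub> \<theta> X))"

definition quasi_inverse_equivalences ::
  "('k, 'o, 'm, 'z) lincat_scheme \<Rightarrow> ('l, 'p, 'n, 'y) lincat_scheme \<Rightarrow>
   ('o \<Rightarrow> 'p) \<Rightarrow> ('m \<Rightarrow> 'n) \<Rightarrow> ('p \<Rightarrow> 'o) \<Rightarrow> ('n \<Rightarrow> 'm) \<Rightarrow> bool"
  where "quasi_inverse_equivalences A B F Fm G Gm \<longleftrightarrow>
     is_functor A B F Fm \<and> is_functor B A G Gm \<and>
     naturally_isomorphic A A (G \<circ> F) (Gm \<circ> Fm) id id \<and>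
     naturally_isomorphic B B (F \<circ> G) (Fm \<circ> Gm) id id"

definition full_subcategory :: "('k, 'o, 'm, 'z) lincat_scheme \<Rightarrow> 'o set \<Rightarrow> ('k, 'o, 'm, 'z) lincat_scheme"
  where "full_subcategory C S = C\<lparr>Ob := S\<rparr>"


section \<open>Quotient categories\<close>

definition ideal_class :: "('k, 'o, 'm, 'z) lincat_scheme \<Rightarrow> ('o \<Rightarrow> 'o \<Rightarrow> 'm set) \<Rightarrow> 'm \<Rightarrow> 'm set" where
  "ideal_class C I f = I (Dom C f) (Cod C f) +>\<^bsub>Hom C (Dom C f) (Cod C f)\<^esub> f"

definition quot_category ::
  "('k, 'o, 'm, 'z) lincat_scheme \<Rightarrow> ('o \<Rightarrow> 'o \<Rightarrow> 'm set) \<Rightarrow> ('k, 'o, 'm set) lincat"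
  where "quot_category C I = \<lparr>Ob = Ob C,
     Dom = (\<lambda>A. Dom C (SOME a. a \<in> A)),
     Cod = (\<lambda>A. Cod C (SOME a. a \<in> A)),
     Hom = (\<lambda>X Y. quot_module (Hom C X Y) (I X Y)),
     Comp = (\<lambda>B A. \<Union>b\<in>B. \<Union>a\<in>A. ideal_class C I (b \<cdot>\<^bsub>C\<^esub> a)),
     Ide = (\<lambda>X. ideal_class C I (Ide C X))\<rparr>"


section \<open>Exact categories\<close>

text \<open>A conflation \<open>X \<rightarrow> E \<rightarrow> Y\<close> is the pair \<open>(i, d)\<close> of its two morphisms.\<close>

record ('k, 'o, 'm) excat = "('k, 'o, 'm) lincat" +
  Confl :: "('m \<times> 'm) set"

definition inflation :: "('k, 'o, 'm) excat \<Rightarrow> 'm \<Rightarrow> bool" where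
  "inflation C i \<longleftrightarrow> (\<exists>d. (i, d) \<in> Confl C)"

definition deflation :: "('k, 'o, 'm) excat \<Rightarrow> 'm \<Rightarrow> bool" where
  "deflation C d \<longleftrightarrow> (\<exists>i. (i, d) \<in> Confl C)"

locale exact_category = linear_category k C
  for k :: "'k ring" and C :: "('k, 'o, 'm) excat" (structure) +
  assumes additive: "additive_category C"
    and kernel_cokernel: "(i, d) \<in> Confl C \<Longrightarrow> is_kernel C i d \<and> is_cokernel C d i"
    and confl_iso_closed: "\<lbrakk>(i, d) \<in> Confl C; arr C i'; arr C d'; is_iso C a; is_iso C b; is_iso C c;
      a \<in> mor C (Dom C i) (Dom C i'); b \<in> mor C (Cod C i) (Cod C i');
      b \<in> mor C (Dom C d) (Dom C d'); c \<in> mor C (Cod C d) (Cod C d');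
      b \<cdot> i = i' \<cdot> a; c \<cdot> d = d' \<cdot> b\<rbrakk> \<Longrightarrow> (i', d') \<in> Confl C"
    and ide_inflation: "X \<in> Ob C \<Longrightarrow> inflation C (Ide C X)"
    and ide_deflation: "X \<in> Ob C \<Longrightarrow> deflation C (Ide C X)"
    and inflation_comp: "\<lbrakk>inflation C i; inflation C j; Cod C i = Dom C j\<rbrakk> \<Longrightarrow> inflation C (j \<cdot> i)"
    and deflation_comp: "\<lbrakk>deflation C d; deflation C e; Cod C d = Dom C e\<rbrakk> \<Longrightarrow> deflation C (e \<cdot> d)"
    and pushout_inflation: "\<lbrakk>inflation C i; arr C g; Dom C g = Dom C i\<rbrakk>
      \<Longrightarrow> \<exists>h i'. pushout_square C i g h i' \<and> inflation C i'"
    and pullback_deflation: "\<lbrakk>deflation C d; arr C f; Cod C f = Cod C d\<rbrakk>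
      \<Longrightarrow> \<exists>h d'. pullback_square C d f h d' \<and> deflation C d'"


section \<open>The extension bifunctor\<close>

text \<open>An element of \<open>Ext\<^sup>1\<close> is a full equivalence class of conflations. The operations below map classes
  to classes by collecting all possible results, so no choices are involved.\<close>

definition ext_class :: "('k, 'o, 'm) excat \<Rightarrow> 'm \<times> 'm \<Rightarrow> ('m \<times> 'm) set" where
  "ext_class C = (\<lambda>(i, d). {(i', d') \<in> Confl C. Dom C i' = Dom C i \<and> Cod C d' = Cod C d \<and>
     (\<exists>h \<in> mor C (Cod C i) (Cod C i'). is_iso C h \<and> h \<cdot>\<^bsub>C\<^esub> i = i' \<and> d' \<cdot>\<^bsub>C\<^esub> h = d)})"

definition ext_push :: "('k, 'o, 'm) excat \<Rightarrow> 'm \<Rightarrow> ('m \<times> 'm) set \<Rightarrow> ('m \<times> 'm) set" where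
  "ext_push C g e = {(i', d') \<in> Confl C.
     \<exists>(i, d) \<in> e. \<exists>h. pushout_square C i g h i' \<and> d' \<cdot>\<^bsub>C\<^esub> h = d}"

definition ext_pull :: "('k, 'o, 'm) excat \<Rightarrow> 'm \<Rightarrow> ('m \<times> 'm) set \<Rightarrow> ('m \<times> 'm) set" where
  "ext_pull C f e = {(i', d') \<in> Confl C.
     \<exists>(i, d) \<in> e. \<exists>h. pullback_square C d f h d' \<and> h \<cdot>\<^bsub>C\<^esub> i' = i}"

text \<open>\<open>direct_sum C \<iota> \<pi> f g\<close> is \<open>f \<oplus> g\<close>, where \<open>\<pi>\<close> are the projections of the sum of the domains and
  \<open>\<iota>\<close> the injections of the sum of the codomains.\<close>

definition direct_sum :: "('k, 'o, 'm, 'z) lincat_scheme \<Rightarrow> 'm \<times> 'm \<Rightarrow> 'm \<times> 'm \<Rightarrow> 'm \<Rightarrow> 'm \<Rightarrow> 'm" where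
  "direct_sum C \<iota> \<pi> f g =
     fst \<iota> \<cdot>\<^bsub>C\<^esub> f \<cdot>\<^bsub>C\<^esub> fst \<pi> \<oplus>\<^bsub>Hom C (Dom C (fst \<pi>)) (Cod C (fst \<iota>))\<^esub> snd \<iota> \<cdot>\<^bsub>C\<^esub> g \<cdot>\<^bsub>C\<^esub> snd \<pi>"

text \<open>The Baer sum \<open>\<nabla>.(\<xi> \<oplus> \<xi>').\<Delta>\<close> of classes of conflations \<open>Y \<rightarrow> E \<rightarrow> X\<close> and \<open>Y \<rightarrow> E' \<rightarrow> X\<close>.\<close>

definition baer_sum :: "('k, 'o, 'm) excat \<Rightarrow> 'o \<Rightarrow> 'o \<Rightarrow> ('m \<times> 'm) set \<Rightarrow> ('m \<times> 'm) set \<Rightarrow> ('m \<times> 'm) set"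
  where "baer_sum C X Y e e' = {\<zeta>. \<exists>(i, d) \<in> e. \<exists>(i', d') \<in> e'. \<exists>YY EE XX \<iota>Y \<pi>Y \<iota>E \<pi>E \<iota>X \<pi>X.
     is_biproduct C Y Y YY \<iota>Y \<pi>Y \<and> is_biproduct C (Dom C d) (Dom C d') EE \<iota>E \<pi>E \<and>
     is_biproduct C X X XX \<iota>X \<pi>X \<and>
     \<zeta> \<in> ext_push C (fst \<pi>Y \<oplus>\<^bsub>Hom C YY Y\<^esub> snd \<pi>Y)
          (ext_pull C (fst \<iota>X \<oplus>\<^bsub>Hom C X XX\<^esub> snd \<iota>X)
            (ext_class C (direct_sum C \<iota>E \<pi>Y i i', direct_sum C \<iota>X \<pi>E d d')))}"

text \<open>\<open>Ext C X Y\<close> is the \<open>k\<close>-module of extensions \<open>Y \<rightarrow> E \<rightarrow> X\<close>; zero is the class of split conflations.\<close>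

definition Ext :: "('k, 'o, 'm) excat \<Rightarrow> 'o \<Rightarrow> 'o \<Rightarrow> ('k, ('m \<times> 'm) set) module" where
  "Ext C X Y = \<lparr>carrier = ext_class C ` {(i, d) \<in> Confl C. Dom C i = Y \<and> Cod C d = X},
     mult = undefined, one = undefined,
     zero = {(i, d) \<in> Confl C. Dom C i = Y \<and> Cod C d = X \<and> (\<exists>s \<in> mor C X (Dom C d). d \<cdot>\<^bsub>C\<^esub> s = Ide C X)},
     add = baer_sum C X Y,
     smult = (\<lambda>a e. ext_push C (a \<odot>\<^bsub>Hom C Y Y\<^esub> Ide C Y) e)\<rparr>"

definition Ext_End_module :: "('k, 'o, 'm) excat \<Rightarrow> 'o \<Rightarrow> 'o \<Rightarrow> ('m, ('m \<times> 'm) set) module" where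
  "Ext_End_module C X Y = \<lparr>carrier = carrier (Ext C X Y), mult = undefined, one = undefined,
     zero = \<zero>\<^bsub>Ext C X Y\<^esub>, add = add (Ext C X Y), smult = ext_push C\<rparr>"


section \<open>Stable categories\<close>

definition proj_trivial :: "('k, 'o, 'm) excat \<Rightarrow> 'o \<Rightarrow> 'o \<Rightarrow> 'm set" where
  "proj_trivial C X Y = {f \<in> mor C X Y.
     \<forall>Z \<in> Ob C. \<forall>e \<in> carrier (Ext C Y Z). ext_pull C f e = \<zero>\<^bsub>Ext C X Z\<^esub>}"

definition inj_trivial :: "('k, 'o, 'm) excat \<Rightarrow> 'o \<Rightarrow> 'o \<Rightarrow> 'm set" where
  "inj_trivial C X Y = {f \<in> mor C X Y.
     \<forall>Z \<in> Ob C. \<forall>e \<in> carrier (Ext C Z X). ext_push C f e = \<zero>\<^bsub>Ext C Z Y\<^esub>}"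

abbreviation under :: "('k, 'o, 'm) excat \<Rightarrow> ('k, 'o, 'm set) lincat" where
  "under C \<equiv> quot_category C (proj_trivial C)"

abbreviation over :: "('k, 'o, 'm) excat \<Rightarrow> ('k, 'o, 'm set) lincat" where
  "over C \<equiv> quot_category C (inj_trivial C)"

abbreviation under_class :: "('k, 'o, 'm) excat \<Rightarrow> 'm \<Rightarrow> 'm set" where
  "under_class C \<equiv> ideal_class C (proj_trivial C)"

abbreviation over_class :: "('k, 'o, 'm) excat \<Rightarrow> 'm \<Rightarrow> 'm set" where
  "over_class C \<equiv> ideal_class C (inj_trivial C)"

definition under_End_module :: "('k, 'o, 'm) excat \<Rightarrow> 'o \<Rightarrow> 'o \<Rightarrow> ('m, 'm set) module" where
  "under_End_module C X Y = \<lparr>carrier = mor (under C) X Y, mult = undefined, one = undefined,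
     zero = \<zero>\<^bsub>Hom (under C) X Y\<^esub>, add = add (Hom (under C) X Y),
     smult = (\<lambda>h a. a \<cdot>\<^bsub>under C\<^esub> under_class C h)\<rparr>"


section \<open>Generalized Auslander--Reiten duality\<close>

text \<open>\<open>T\<close> represents the functor \<open>D Ext\<^sup>1(Y, -)\<close> on \<open>over C\<close>, respectively \<open>D Ext\<^sup>1(-, X)\<close> on \<open>under C\<close>,
  via \<open>\<theta>\<close>.\<close>

definition represents_r :: "'k ring \<Rightarrow> ('k, 'j) module \<Rightarrow> ('k, 'o, 'm) excat \<Rightarrow> 'o \<Rightarrow> 'o \<Rightarrow>
    ('o \<Rightarrow> 'm set \<Rightarrow> ('m \<times> 'm) set \<Rightarrow> 'j) \<Rightarrow> bool"
  where "represents_r k J C Y T \<theta> \<longleftrightarrow>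
     (\<forall>X \<in> Ob C. \<theta> X \<in> lin_isos k (Hom (over C) X T) (Dual k J (Ext C Y X))) \<and>
     (\<forall>X \<in> Ob C. \<forall>X' \<in> Ob C. \<forall>f \<in> mor C X X'. \<forall>b \<in> mor (over C) X' T.
        \<theta> X (b \<cdot>\<^bsub>over C\<^esub> over_class C f) = dual_map (Ext C Y X) (ext_push C f) (\<theta> X' b))"

definition represents_l :: "'k ring \<Rightarrow> ('k, 'j) module \<Rightarrow> ('k, 'o, 'm) excat \<Rightarrow> 'o \<Rightarrow> 'o \<Rightarrow>
    ('o \<Rightarrow> 'm set \<Rightarrow> ('m \<times> 'm) set \<Rightarrow> 'j) \<Rightarrow> bool"
  where "represents_l k J C X T \<theta> \<longleftrightarrow>
     (\<forall>Y \<in> Ob C. \<theta> Y \<in> lin_isos k (Hom (under C) T Y) (Dual k J (Ext C Y X))) \<and>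
     (\<forall>Y \<in> Ob C. \<forall>Y' \<in> Ob C. \<forall>f \<in> mor C Y Y'. \<forall>a \<in> mor (under C) T Y.
        \<theta> Y' (under_class C f \<cdot>\<^bsub>under C\<^esub> a) = dual_map (Ext C Y' X) (ext_pull C f) (\<theta> Y a))"

definition obj_r :: "'k ring \<Rightarrow> ('k, 'j) module \<Rightarrow> ('k, 'o, 'm) excat \<Rightarrow> 'o set" where
  "obj_r k J C = {Y \<in> Ob C. \<exists>T \<in> Ob C. \<exists>\<theta>. represents_r k J C Y T \<theta>}"

definition obj_l :: "'k ring \<Rightarrow> ('k, 'j) module \<Rightarrow> ('k, 'o, 'm) excat \<Rightarrow> 'o set" where
  "obj_l k J C = {X \<in> Ob C. \<exists>T \<in> Ob C. \<exists>\<theta>. represents_l k J C X T \<theta>}"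

text \<open>\<open>\<tau>i\<close> stands for \<open>\<tau>\<^sup>-\<close>; \<open>\<tau>m\<close> and \<open>\<tau>im\<close> are the actions of \<open>\<tau>\<close> and \<open>\<tau>i\<close> on morphisms.\<close>

locale generalized_AR_duality =
  fixes k :: "'k ring" and J :: "('k, 'j) module" and C :: "('k, 'o, 'm) excat"
    and \<tau> :: "'o \<Rightarrow> 'o" and \<tau>m :: "'m set \<Rightarrow> 'm set"
    and \<tau>i :: "'o \<Rightarrow> 'o" and \<tau>im :: "'m set \<Rightarrow> 'm set"
    and \<phi> :: "'o \<Rightarrow> 'o \<Rightarrow> 'm set \<Rightarrow> ('m \<times> 'm) set \<Rightarrow> 'j"
    and \<psi> :: "'o \<Rightarrow> 'o \<Rightarrow> 'm set \<Rightarrow> ('m \<times> 'm) set \<Rightarrow> 'j"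
  assumes tau_equivalences: "quasi_inverse_equivalences
      (full_subcategory (under C) (obj_r k J C)) (full_subcategory (over C) (obj_l k J C)) \<tau> \<tau>m \<tau>i \<tau>im"
    and phi_represents: "Y \<in> obj_r k J C \<Longrightarrow> represents_r k J C Y (\<tau> Y) (\<phi> Y)"
    and phi_natural: "\<lbrakk>Y \<in> obj_r k J C; Y' \<in> obj_r k J C; X \<in> Ob C; g \<in> mor C Y Y'; b \<in> mor (over C) X (\<tau> Y)\<rbrakk>
      \<Longrightarrow> \<phi> Y' X (\<tau>m (under_class C g) \<cdot>\<^bsub>over C\<^esub> b) = dual_map (Ext C Y' X) (ext_pull C g) (\<phi> Y X b)"
    and psi_represents: "X \<in> obj_l k J C \<Longrightarrow> represents_l k J C X (\<tau>i X) (\<psi> X)"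
    and psi_natural: "\<lbrakk>X \<in> obj_l k J C; X' \<in> obj_l k J C; Y \<in> Ob C; g \<in> mor C X X'; a \<in> mor (under C) (\<tau>i X') Y\<rbrakk>
      \<Longrightarrow> \<psi> X Y (a \<cdot>\<^bsub>under C\<^esub> \<tau>im (over_class C g)) = dual_map (Ext C Y X) (ext_push C g) (\<psi> X' Y a)"


section \<open>Right equivalence and determination\<close>

definition factors_through :: "('k, 'o, 'm, 'z) lincat_scheme \<Rightarrow> 'm \<Rightarrow> 'm \<Rightarrow> bool" where
  "factors_through C g f \<longleftrightarrow> (\<exists>u \<in> mor C (Dom C g) (Dom C f). g = f \<cdot>\<^bsub>C\<^esub> u)"

definition right_class :: "('k, 'o, 'm, 'z) lincat_scheme \<Rightarrow> 'm \<Rightarrow> 'm set" where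
  "right_class C f = {f'. arr C f' \<and> Cod C f' = Cod C f \<and> factors_through C f f' \<and> factors_through C f' f}"

definition right_determined :: "('k, 'o, 'm, 'z) lincat_scheme \<Rightarrow> 'o \<Rightarrow> 'm \<Rightarrow> bool" where
  "right_determined C A f \<longleftrightarrow> (\<forall>T \<in> Ob C. \<forall>g \<in> mor C T (Cod C f).
     factors_through C g f \<longleftrightarrow> (\<forall>h \<in> mor C A T. factors_through C (g \<cdot>\<^bsub>C\<^esub> h) f))"

definition determined_epi_classes :: "('k, 'o, 'm) excat \<Rightarrow> 'o \<Rightarrow> 'o \<Rightarrow> 'm set set" where
  "determined_epi_classes C A Y =
     right_class C ` {d. deflation C d \<and> Cod C d = Y \<and> right_determined C A d}"


section \<open>The three maps\<close>

definition connecting_map :: "('k, 'o, 'm) excat \<Rightarrow> 'm \<times> 'm \<Rightarrow> 'm set \<Rightarrow> ('m \<times> 'm) set" where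
  "connecting_map C \<xi> A = (\<Union>g\<in>A. ext_push C g (ext_class C \<xi>))"

definition Im_connecting :: "('k, 'o, 'm) excat \<Rightarrow> 'm \<times> 'm \<Rightarrow> 'o \<Rightarrow> ('m \<times> 'm) set set" where
  "Im_connecting C \<xi> K = connecting_map C \<xi> ` mor (over C) (Dom C (fst \<xi>)) K"

definition Im_under_Hom :: "('k, 'o, 'm) excat \<Rightarrow> 'o \<Rightarrow> 'm \<Rightarrow> 'm set set" where
  "Im_under_Hom C P d = (\<lambda>a. under_class C d \<cdot>\<^bsub>under C\<^esub> a) ` mor (under C) P (Dom C d)"

text \<open>A conflation \<open>\<xi>\<^sub>d\<close> for some deflation \<open>d\<close> in the class \<open>c\<close>.\<close>

definition class_conflation :: "('k, 'o, 'm) excat \<Rightarrow> 'm set \<Rightarrow> 'm \<times> 'm" where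
  "class_conflation C c = (SOME \<xi>. \<xi> \<in> Confl C \<and> snd \<xi> \<in> c)"

definition delta :: "('k, 'o, 'm) excat \<Rightarrow> 'o \<Rightarrow> 'm set \<Rightarrow> ('m \<times> 'm) set set" where
  "delta C K c = Im_connecting C (class_conflation C c) K"

definition eta :: "('k, 'o, 'm) excat \<Rightarrow> 'o \<Rightarrow> 'm set \<Rightarrow> 'm set set" where
  "eta C P c = Im_under_Hom C P (snd (class_conflation C c))"

definition gamma :: "'k ring \<Rightarrow> ('k, 'j) module \<Rightarrow> ('k, 'o, 'm) excat \<Rightarrow> ('o \<Rightarrow> 'o) \<Rightarrow>
    ('o \<Rightarrow> 'o \<Rightarrow> 'm set \<Rightarrow> ('m \<times> 'm) set \<Rightarrow> 'j) \<Rightarrow> 'o \<Rightarrow> 'o \<Rightarrow> ('m \<times> 'm) set set \<Rightarrow> 'm set set"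
  where "gamma k J C \<tau>i \<psi> K Y L = {a \<in> mor (under C) (\<tau>i K) Y.
     \<psi> K Y a \<in> {\<alpha> \<in> carrier (Dual k J (Ext C Y K)). \<forall>e \<in> L. \<alpha> e = \<zero>\<^bsub>J\<^esub>}}"

end

(*
  For every morphism h into Y, exactness of D and the natural isomorphism psi identify gamma(Ker Ext(h, K))
  with the image of Hom(tau^- K, h) in the stable category; for a deflation d the long exact sequence
  identifies Ker Ext(d, K) with Im c(xi_d, K).  This is the commutative triangle, and it reduces the
  bijectivity of gamma to three facts.  L is recovered from gamma(L), since an injective cogenerator
  separates L from the elements outside of it.  Every submodule H of the stable Hom(tau^- K, Y) is the image
  of some h: H is finitely generated over k by Hopkins-Levitzki, and h is assembled from generators.  Every
  submodule L of Ext(Y, K) is of the form Ker Ext(d, K) with d determined by tau^- K: adjoin elements of L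
  one at a time, replacing the kernel term X of d by X + K; this stops because Hom(tau^- K, Y) is artinian.
  Finally d is recovered from the image of Hom(tau^- K, d), since projectively trivial morphisms factor
  through every deflation.

  The operations on Ext are handled through morphisms of conflations: (a, c) extends to a morphism from xi
  to xi' if and only if the pushout of xi along a and the pullback of xi' along c are equivalent.
*)

theory Submission
  imports Defs
begin

text \<open>The morphism \<open>h\<close> assembled from generators of \<open>H\<close> has no
  reason to be a deflation. This is why gamma(Ker Ext^1(h, K)) is computed for all morphisms: the
  kernel is a submodule of Ext^1(Y, K) in any case, and a determined deflation with the same kernel
  is then found on the Ext side. No finiteness of Ext^1(Y, K) is given in advance; it is borrowed
  from Hom(P, Y), since a growing kernel has a shrinking annihilator there.

  Two things have to be built before. Injectivity and the cogenerator property of \<open>J\<close>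
  are stated for test modules of scalars but applied to Ext^1, whose elements are sets of pairs of
  morphisms; Baer's argument carries them over. And addition on Ext^1 is a Baer sum over all choices
  of representatives and biproducts, so that even its associativity takes work; it becomes
  associativity in a Hom module once the classes involved are written as pushouts of a single
  class.\<close>

section \<open>Finiteness conditions on modules\<close>

context module
begin

lemma submoduleD:
  assumes "submodule H R M"
  shows "H \<subseteq> carrier M" "\<zero>\<^bsub>M\<^esub> \<in> H" "\<And>x y. \<lbrakk>x \<in> H; y \<in> H\<rbrakk> \<Longrightarrow> x \<oplus>\<^bsub>M\<^esub> y \<in> H"
    "\<And>x. x \<in> H \<Longrightarrow> \<ominus>\<^bsub>M\<^esub> x \<in> H" "\<And>a x. \<lbrakk>a \<in> carrier R; x \<in> H\<rbrakk> \<Longrightarrow> a \<odot>\<^bsub>M\<^esub> x \<in> H"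
    "\<And>x y. \<lbrakk>x \<in> H; y \<in> H\<rbrakk> \<Longrightarrow> x \<ominus>\<^bsub>M\<^esub> y \<in> H"
proof -
  show 1: "H \<subseteq> carrier M" "\<And>x y. \<lbrakk>x \<in> H; y \<in> H\<rbrakk> \<Longrightarrow> x \<oplus>\<^bsub>M\<^esub> y \<in> H"
    "\<And>x. x \<in> H \<Longrightarrow> \<ominus>\<^bsub>M\<^esub> x \<in> H" "\<And>a x. \<lbrakk>a \<in> carrier R; x \<in> H\<rbrakk> \<Longrightarrow> a \<odot>\<^bsub>M\<^esub> x \<in> H"
    using submoduleE[OF assms] by auto
  show "\<zero>\<^bsub>M\<^esub> \<in> H" using subgroup.one_closed[OF submodule.axioms(1)[OF assms]] by simp
  show "\<And>x y. \<lbrakk>x \<in> H; y \<in> H\<rbrakk> \<Longrightarrow> x \<ominus>\<^bsub>M\<^esub> y \<in> H"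
    using 1 by (simp add: a_minus_def)
qed

lemma submoduleI':
  assumes "H \<subseteq> carrier M" "\<zero>\<^bsub>M\<^esub> \<in> H" "\<And>x y. \<lbrakk>x \<in> H; y \<in> H\<rbrakk> \<Longrightarrow> x \<oplus>\<^bsub>M\<^esub> y \<in> H"
    "\<And>a x. \<lbrakk>a \<in> carrier R; x \<in> H\<rbrakk> \<Longrightarrow> a \<odot>\<^bsub>M\<^esub> x \<in> H"
  shows "submodule H R M"
proof (rule submoduleI)
  show "\<ominus>\<^bsub>M\<^esub> x \<in> H" if "x \<in> H" for x
    using assms(4)[of "\<ominus> \<one>" x] smult_l_minus[of \<one> x] assms(1) that by auto
qed (use assms in auto)

definition adjoin :: "'c set \<Rightarrow> 'c \<Rightarrow> 'c set" where
  "adjoin H x = {h \<oplus>\<^bsub>M\<^esub> r \<odot>\<^bsub>M\<^esub> x |h r. h \<in> H \<and> r \<in> carrier R}"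

lemma adjoin_submodule:
  assumes H: "submodule H R M" and x: "x \<in> carrier M"
  shows "submodule (adjoin H x) R M"
proof (rule submoduleI')
  note S = submoduleD[OF H]
  show "adjoin H x \<subseteq> carrier M" using S x by (auto simp: adjoin_def)
  have "\<zero>\<^bsub>M\<^esub> = \<zero>\<^bsub>M\<^esub> \<oplus>\<^bsub>M\<^esub> \<zero> \<odot>\<^bsub>M\<^esub> x" using x by simp
  then show "\<zero>\<^bsub>M\<^esub> \<in> adjoin H x" using S unfolding adjoin_def by blast
  show "u \<oplus>\<^bsub>M\<^esub> v \<in> adjoin H x" if uv: "u \<in> adjoin H x" "v \<in> adjoin H x" for u v
  proof -
    obtain h r h' r' where *: "h \<in> H" "r \<in> carrier R" "u = h \<oplus>\<^bsub>M\<^esub> r \<odot>\<^bsub>M\<^esub> x" "h' \<in> H" "r' \<in> carrier R" "v = h' \<oplus>\<^bsub>M\<^esub> r' \<odot>\<^bsub>M\<^esub> x"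
      using uv by (auto simp: adjoin_def)
    have "h \<in> carrier M" "h' \<in> carrier M" using * S by auto
    then have "u \<oplus>\<^bsub>M\<^esub> v = (h \<oplus>\<^bsub>M\<^esub> h') \<oplus>\<^bsub>M\<^esub> (r \<oplus> r') \<odot>\<^bsub>M\<^esub> x"
      using * x by (simp add: smult_l_distr M.a_ac)
    then show ?thesis using * S unfolding adjoin_def by blast
  qed
  show "a \<odot>\<^bsub>M\<^esub> u \<in> adjoin H x" if a: "a \<in> carrier R" and u: "u \<in> adjoin H x" for a u
  proof -
    obtain h r where *: "h \<in> H" "r \<in> carrier R" "u = h \<oplus>\<^bsub>M\<^esub> r \<odot>\<^bsub>M\<^esub> x" using u by (auto simp: adjoin_def)
    have "h \<in> carrier M" using * S by auto
    then have "a \<odot>\<^bsub>M\<^esub> u = a \<odot>\<^bsub>M\<^esub> h \<oplus>\<^bsub>M\<^esub> (a \<otimes> r) \<odot>\<^bsub>M\<^esub> x"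
      using * x a by (simp add: smult_r_distr smult_assoc1)
    then show ?thesis using * S a unfolding adjoin_def by blast
  qed
qed

lemma adjoin_incl:
  assumes H: "submodule H R M" and x: "x \<in> carrier M"
  shows "H \<subseteq> adjoin H x" "x \<in> adjoin H x"
proof -
  note S = submoduleD[OF H]
  show "H \<subseteq> adjoin H x"
  proof
    fix h assume h: "h \<in> H"
    then have "h = h \<oplus>\<^bsub>M\<^esub> \<zero> \<odot>\<^bsub>M\<^esub> x" using S x by auto
    then show "h \<in> adjoin H x" using h unfolding adjoin_def by blast
  qed
  have "x = \<zero>\<^bsub>M\<^esub> \<oplus>\<^bsub>M\<^esub> \<one> \<odot>\<^bsub>M\<^esub> x" using x by simp
  then show "x \<in> adjoin H x" using S unfolding adjoin_def by blast
qed

lemma adjoin_least: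
  assumes "submodule K R M" "H \<subseteq> K" "x \<in> K"
  shows "adjoin H x \<subseteq> K"
  using submoduleD[OF assms(1)] assms(2,3) by (auto simp: adjoin_def)

text \<open>Finite generation in inductive form: the chain condition, sums, lifting along a
  surjection and the construction of \<open>h\<close> in \<open>submodule_is_image\<close> are all
  inductions that add one generator.\<close>

inductive fg :: "'c set \<Rightarrow> bool" where
  zero: "fg {\<zero>\<^bsub>M\<^esub>}"
| step: "\<lbrakk>fg H; x \<in> carrier M\<rbrakk> \<Longrightarrow> fg (adjoin H x)"

lemma submodule_zero: "submodule {\<zero>\<^bsub>M\<^esub>} R M"
  by (rule submoduleI') auto

lemma fg_submodule: "fg H \<Longrightarrow> submodule H R M"
  by (induction rule: fg.induct) (auto intro: submodule_zero adjoin_submodule)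

text \<open>Only submodules of the ambient module are compared, so an induction over generators of
  \<open>K\<close> stays inside one module.\<close>

definition dcc :: "'c set \<Rightarrow> bool" where
  "dcc K \<longleftrightarrow> (\<forall>H :: nat \<Rightarrow> 'c set. (\<forall>n. submodule (H n) R M \<and> H n \<subseteq> K \<and> H (Suc n) \<subseteq> H n) \<longrightarrow>
     (\<exists>n. \<forall>m\<ge>n. H m = H n))"

lemma dccD:
  assumes "dcc K" "\<And>n. submodule (H n) R M" "\<And>n. H n \<subseteq> K" "\<And>n. H (Suc n) \<subseteq> H n"
  shows "\<exists>n :: nat. \<forall>m\<ge>n. H m = H n"
  by (rule assms(1)[unfolded dcc_def, THEN spec[of _ H], THEN mp]) (use assms(2-4) in simp)

lemma artinian_cringD:
  assumes "artinian_cring R" "\<And>n. ideal (I n) R" "\<And>n. I (Suc n) \<subseteq> I n"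
  shows "\<exists>n :: nat. \<forall>m\<ge>n. I m = I n"
  by (rule assms(1)[unfolded artinian_cring_def, THEN conjunct2, THEN spec[of _ I], THEN mp]) (use assms(2-3) in simp)

text \<open>The form in which the chain condition is applied twice: to submodules that are not
  finitely generated, and later to annihilators.\<close>

lemma dcc_minimal:
  assumes "dcc K" "H0 \<in> \<S>" and sub: "\<And>H. H \<in> \<S> \<Longrightarrow> submodule H R M \<and> H \<subseteq> K"
  obtains H where "H \<in> \<S>" "\<And>H'. \<lbrakk>H' \<in> \<S>; H' \<subseteq> H\<rbrakk> \<Longrightarrow> H' = H"
proof -
  let ?r = "{(A, B). A \<in> \<S> \<and> B \<in> \<S> \<and> A \<subset> B}"
  have "wf ?r"
    unfolding wf_iff_no_infinite_down_chain
  proof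
    assume "\<exists>f. \<forall>i. (f (Suc i), f i) \<in> ?r"
    then obtain f where f: "\<And>i. f (Suc i) \<in> \<S> \<and> f i \<in> \<S> \<and> f (Suc i) \<subset> f i" by auto
    have f': "submodule (f n) R M" "f n \<subseteq> K" "f (Suc n) \<subseteq> f n" for n using f[of n] sub[of "f n"] by auto
    from dccD[of K f, OF assms(1) f'] obtain n where "\<forall>m\<ge>n. f m = f n" ..
    then have "f (Suc n) = f n" by (meson le_SucI order_refl)
    then show False using f[of n] by simp
  qed
  from wf_eq_minimal[THEN iffD1, OF this, THEN spec[of _ \<S>]] assms(2)
  obtain H where "H \<in> \<S>" "\<forall>H'. (H', H) \<in> ?r \<longrightarrow> H' \<notin> \<S>" by blast
  then show ?thesis using that[of H] by blast
qed

lemma antimono_chain_le: "(\<And>n. F (Suc n) \<subseteq> (F n :: 'e set)) \<Longrightarrow> n \<le> m \<Longrightarrow> F m \<subseteq> F n"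
  by (rule lift_Suc_antimono_le)

text \<open>The analogue of the ideal of leading coefficients in Hilbert's basis theorem: it is the
  preimage of \<open>(H + K) / K\<close> under the map \<open>r \<mapsto> r x + K\<close> from
  \<open>R\<close> to \<open>M / K\<close>.\<close>

lemma coefficient_ideal:
  assumes K: "submodule K R M" and H: "submodule H R M" and x: "x \<in> carrier M"
  shows "ideal {r \<in> carrier R. \<exists>k\<in>K. k \<oplus>\<^bsub>M\<^esub> r \<odot>\<^bsub>M\<^esub> x \<in> H} R" (is "ideal ?I R")
proof -
  note SK = submoduleD[OF K] and SH = submoduleD[OF H]
  have add: "r \<oplus> s \<in> ?I" if rs: "r \<in> ?I" "s \<in> ?I" for r s
  proof -
    obtain k l where k: "k \<in> K" "k \<oplus>\<^bsub>M\<^esub> r \<odot>\<^bsub>M\<^esub> x \<in> H" "l \<in> K" "l \<oplus>\<^bsub>M\<^esub> s \<odot>\<^bsub>M\<^esub> x \<in> H" using rs by auto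
    have c: "k \<in> carrier M" "l \<in> carrier M" "r \<in> carrier R" "s \<in> carrier R" using k SK rs by auto
    have "(k \<oplus>\<^bsub>M\<^esub> l) \<oplus>\<^bsub>M\<^esub> (r \<oplus> s) \<odot>\<^bsub>M\<^esub> x = (k \<oplus>\<^bsub>M\<^esub> r \<odot>\<^bsub>M\<^esub> x) \<oplus>\<^bsub>M\<^esub> (l \<oplus>\<^bsub>M\<^esub> s \<odot>\<^bsub>M\<^esub> x)"
      using c x by (simp add: smult_l_distr M.a_ac)
    then show ?thesis using SH(3)[OF k(2,4)] SK(3)[OF k(1,3)] c by (auto intro!: bexI[of _ "k \<oplus>\<^bsub>M\<^esub> l"])
  qed
  have mult: "a \<otimes> r \<in> ?I" if a: "a \<in> carrier R" and r: "r \<in> ?I" for a r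
  proof -
    obtain k where k: "k \<in> K" "k \<oplus>\<^bsub>M\<^esub> r \<odot>\<^bsub>M\<^esub> x \<in> H" using r by auto
    have c: "k \<in> carrier M" "r \<in> carrier R" using k SK r by auto
    have "a \<odot>\<^bsub>M\<^esub> k \<oplus>\<^bsub>M\<^esub> (a \<otimes> r) \<odot>\<^bsub>M\<^esub> x = a \<odot>\<^bsub>M\<^esub> (k \<oplus>\<^bsub>M\<^esub> r \<odot>\<^bsub>M\<^esub> x)"
      using c x a by (simp add: smult_r_distr smult_assoc1)
    then show ?thesis using SH(5)[OF a k(2)] SK(5)[OF a k(1)] c a by (auto intro!: bexI[of _ "a \<odot>\<^bsub>M\<^esub> k"])
  qed
  have "\<zero> \<in> ?I" using SK(2) SH(2) x by (auto intro!: bexI[of _ "\<zero>\<^bsub>M\<^esub>"])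
  moreover have "\<ominus> r \<in> ?I" if "r \<in> ?I" for r
    using mult[of "\<ominus> \<one>" r] that by (simp add: R.l_minus)
  ultimately have sg: "subgroup ?I (add_monoid R)"
    using add by (intro R.add.subgroupI) (fastforce simp: a_inv_def[symmetric])+
  show ?thesis
  proof (rule idealI[OF R.ring_axioms sg])
    show "a \<otimes> r \<in> ?I" "r \<otimes> a \<in> ?I" if "r \<in> ?I" "a \<in> carrier R" for r a
      using mult[OF that(2,1)] R.m_comm[of a r] that by simp_all
  qed
qed

text \<open>Two comparable submodules of \<open>K + R x\<close> coincide as soon as they have the
  same intersection with \<open>K\<close> and the same coefficient ideal. Along a chain the
  intersections stabilize by \<open>dcc K\<close>, the ideals because \<open>R\<close> is
  artinian.\<close>

lemma dcc_adjoin: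
  assumes art: "artinian_cring R" and K: "submodule K R M" and x: "x \<in> carrier M" and "dcc K"
  shows "dcc (adjoin K x)"
  unfolding dcc_def
proof (intro allI impI)
  fix H :: "nat \<Rightarrow> 'c set"
  assume "\<forall>n. submodule (H n) R M \<and> H n \<subseteq> adjoin K x \<and> H (Suc n) \<subseteq> H n"
  then have H: "\<And>n. submodule (H n) R M" "\<And>n. H n \<subseteq> adjoin K x" and dec: "\<And>n. H (Suc n) \<subseteq> H n" by auto
  note SK = submoduleD[OF K]
  let ?I = "\<lambda>n. {r \<in> carrier R. \<exists>k\<in>K. k \<oplus>\<^bsub>M\<^esub> r \<odot>\<^bsub>M\<^esub> x \<in> H n}"
  have "?I (Suc n) \<subseteq> ?I n" for n using dec by blast
  from artinian_cringD[of ?I, OF art coefficient_ideal[OF K H(1) x] this]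
  obtain n1 where n1: "\<forall>m\<ge>n1. ?I m = ?I n1" ..
  have "submodule (H n \<inter> K) R M" for n
    using submoduleD[OF H(1)[of n]] SK by (intro submoduleI') auto
  from dccD[of K "\<lambda>n. H n \<inter> K", OF \<open>dcc K\<close> this Int_lower2 Int_mono[OF dec order_refl]]
  obtain n2 where n2: "\<forall>m\<ge>n2. H m \<inter> K = H n2 \<inter> K" ..
  let ?n = "max n1 n2"
  have "H m = H ?n" if m: "m \<ge> ?n" for m
  proof
    show sub: "H m \<subseteq> H ?n" using antimono_chain_le[of H, OF dec m] .
    show "H ?n \<subseteq> H m"
    proof
      fix h assume h: "h \<in> H ?n"
      note SH = submoduleD[OF H(1)[of "?n"]] and SM = submoduleD[OF H(1)[of m]]
      have "h \<in> adjoin K x" using h H(2) by blast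
      then obtain k r where kr: "k \<in> K" "r \<in> carrier R" "h = k \<oplus>\<^bsub>M\<^esub> r \<odot>\<^bsub>M\<^esub> x" by (auto simp: adjoin_def)
      then have "r \<in> ?I ?n" using h by auto
      also have "?I ?n = ?I m" using spec[OF n1, of ?n] spec[OF n1, of m] m by simp
      finally obtain l where l: "l \<in> K" "l \<oplus>\<^bsub>M\<^esub> r \<odot>\<^bsub>M\<^esub> x \<in> H m" by auto
      have c: "k \<in> carrier M" "l \<in> carrier M" using kr l SK by auto
      \<comment> \<open>Members of the two submodules with the same coefficient \<open>r\<close>
        differ by an element of \<open>K\<close>, where the submodules already agree.\<close>
      have eq: "h \<ominus>\<^bsub>M\<^esub> (l \<oplus>\<^bsub>M\<^esub> r \<odot>\<^bsub>M\<^esub> x) = k \<ominus>\<^bsub>M\<^esub> l"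
        using c kr x by (simp add: a_minus_def M.minus_add M.a_ac M.r_neg2 M.r_neg1 M.r_neg)
      have "k \<ominus>\<^bsub>M\<^esub> l \<in> H ?n \<inter> K"
        using SH(6)[OF h, of "l \<oplus>\<^bsub>M\<^esub> r \<odot>\<^bsub>M\<^esub> x"] l sub SK(6)[OF kr(1) l(1)] unfolding eq by auto
      then have "k \<ominus>\<^bsub>M\<^esub> l \<in> H m" using spec[OF n2, of ?n] spec[OF n2, of m] m by auto
      then have "(k \<ominus>\<^bsub>M\<^esub> l) \<oplus>\<^bsub>M\<^esub> (l \<oplus>\<^bsub>M\<^esub> r \<odot>\<^bsub>M\<^esub> x) \<in> H m" using SM(3) l by blast
      also have "(k \<ominus>\<^bsub>M\<^esub> l) \<oplus>\<^bsub>M\<^esub> (l \<oplus>\<^bsub>M\<^esub> r \<odot>\<^bsub>M\<^esub> x) = h"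
        using c kr x by (simp add: a_minus_def M.a_assoc M.r_neg1)
      finally show "h \<in> H m" .
    qed
  qed
  then show "\<exists>n. \<forall>m\<ge>n. H m = H n" by blast
qed

lemma fg_dcc: "fg K \<Longrightarrow> artinian_cring R \<Longrightarrow> dcc K"
proof (induction rule: fg.induct)
  case zero
  have "H = {\<zero>\<^bsub>M\<^esub>}" if "submodule H R M" "H \<subseteq> {\<zero>\<^bsub>M\<^esub>}" for H
    using submoduleD(2)[OF that(1)] that(2) by auto
  then show ?case unfolding dcc_def by metis
next
  case (step H x)
  then show ?case using dcc_adjoin fg_submodule by blast
qed

section \<open>Sums and extensions of finitely generated submodules\<close>

definition hsum :: "'c set \<Rightarrow> 'c set \<Rightarrow> 'c set" where
  "hsum H K = {h \<oplus>\<^bsub>M\<^esub> k |h k. h \<in> H \<and> k \<in> K}"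

lemma hsum_adjoin:
  assumes "submodule H R M" "submodule K R M" "x \<in> carrier M"
  shows "hsum H (adjoin K x) = adjoin (hsum H K) x"
proof -
  note S = submoduleD(1)[OF assms(1)] submoduleD(1)[OF assms(2)]
  have *: "h \<oplus>\<^bsub>M\<^esub> (k \<oplus>\<^bsub>M\<^esub> r \<odot>\<^bsub>M\<^esub> x) = h \<oplus>\<^bsub>M\<^esub> k \<oplus>\<^bsub>M\<^esub> r \<odot>\<^bsub>M\<^esub> x" if "h \<in> H" "k \<in> K" "r \<in> carrier R" for h k r
    using that S assms(3) by (subst M.a_assoc) auto
  show ?thesis
  proof
    show "hsum H (adjoin K x) \<subseteq> adjoin (hsum H K) x" unfolding hsum_def adjoin_def using * by blast
    show "adjoin (hsum H K) x \<subseteq> hsum H (adjoin K x)"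
    proof
      fix u assume "u \<in> adjoin (hsum H K) x"
      then obtain h k r where u: "h \<in> H" "k \<in> K" "r \<in> carrier R" "u = h \<oplus>\<^bsub>M\<^esub> k \<oplus>\<^bsub>M\<^esub> r \<odot>\<^bsub>M\<^esub> x"
        unfolding hsum_def adjoin_def by blast
      have "u = h \<oplus>\<^bsub>M\<^esub> (k \<oplus>\<^bsub>M\<^esub> r \<odot>\<^bsub>M\<^esub> x)" using *[OF u(1-3)] u(4) by simp
      then show "u \<in> hsum H (adjoin K x)" using u unfolding hsum_def adjoin_def by blast
    qed
  qed
qed

lemma fg_hsum: "fg K \<Longrightarrow> fg H \<Longrightarrow> fg (hsum H K)"
proof (induction rule: fg.induct)
  case zero
  have "hsum H {\<zero>\<^bsub>M\<^esub>} = H" using submoduleD(1)[OF fg_submodule[OF zero]] by (force simp: hsum_def)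
  with zero show ?case by simp
next
  case (step K x)
  then show ?case using hsum_adjoin[of H K x] fg_submodule fg.step by metis
qed

text \<open>Generators of the image lift to a finitely generated \<open>L\<close> inside
  \<open>H\<close>, and \<open>H\<close> is the sum of \<open>L\<close> and the kernel.
  Multiplication by a scalar is the only homomorphism along which the Hopkins-Levitzki argument
  splits a submodule.\<close>

lemma fg_extension:
  assumes r: "r \<in> carrier R" and H: "submodule H R M"
    and im: "fg ((\<lambda>x. r \<odot>\<^bsub>M\<^esub> x) ` H)" and ker: "fg {x \<in> H. r \<odot>\<^bsub>M\<^esub> x = \<zero>\<^bsub>M\<^esub>}" (is "fg ?K")
  shows "fg H"
proof -
  note S = submoduleD[OF H]
  have "\<exists>L. fg L \<and> L \<subseteq> H \<and> A \<subseteq> (\<lambda>x. r \<odot>\<^bsub>M\<^esub> x) ` L" if "fg A" "A \<subseteq> (\<lambda>x. r \<odot>\<^bsub>M\<^esub> x) ` H" for A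
    using that
  proof (induction rule: fg.induct)
    case zero
    then show ?case using r S by (intro exI[of _ "{\<zero>\<^bsub>M\<^esub>}"]) (auto intro: fg.zero)
  next
    case (step A y)
    note A = fg_submodule[OF step(1)]
    have "A \<subseteq> (\<lambda>x. r \<odot>\<^bsub>M\<^esub> x) ` H" "y \<in> (\<lambda>x. r \<odot>\<^bsub>M\<^esub> x) ` H" using step adjoin_incl[OF A step(2)] by auto
    then obtain L x where L: "fg L" "L \<subseteq> H" "A \<subseteq> (\<lambda>x. r \<odot>\<^bsub>M\<^esub> x) ` L" and x: "x \<in> H" "y = r \<odot>\<^bsub>M\<^esub> x" using step.IH by auto
    have xc: "x \<in> carrier M" using x S by auto
    have "adjoin A y \<subseteq> (\<lambda>x. r \<odot>\<^bsub>M\<^esub> x) ` adjoin L x"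
    proof
      fix u assume "u \<in> adjoin A y"
      then obtain a s where u: "a \<in> A" "s \<in> carrier R" "u = a \<oplus>\<^bsub>M\<^esub> s \<odot>\<^bsub>M\<^esub> y" by (auto simp: adjoin_def)
      then obtain l where l: "l \<in> L" "a = r \<odot>\<^bsub>M\<^esub> l" using L by auto
      have "l \<in> carrier M" using l L S by auto
      then have "u = r \<odot>\<^bsub>M\<^esub> (l \<oplus>\<^bsub>M\<^esub> s \<odot>\<^bsub>M\<^esub> x)"
        using u l x xc r by (simp add: smult_r_distr smult_assoc1[symmetric] R.m_comm)
      then show "u \<in> (\<lambda>x. r \<odot>\<^bsub>M\<^esub> x) ` adjoin L x" using l u by (auto simp: adjoin_def)
    qed
    moreover have "adjoin L x \<subseteq> H" by (rule adjoin_least[OF H L(2) x(1)])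
    ultimately show ?case using fg.step[OF L(1) xc] by blast
  qed
  from this[OF im] obtain L where L: "fg L" "L \<subseteq> H" "(\<lambda>x. r \<odot>\<^bsub>M\<^esub> x) ` H \<subseteq> (\<lambda>x. r \<odot>\<^bsub>M\<^esub> x) ` L" by auto
  have "hsum L ?K = H"
  proof
    show "hsum L ?K \<subseteq> H" using L S by (auto simp: hsum_def)
    show "H \<subseteq> hsum L ?K"
    proof
      fix h assume h: "h \<in> H"
      then obtain l where l: "l \<in> L" "r \<odot>\<^bsub>M\<^esub> h = r \<odot>\<^bsub>M\<^esub> l" using L by auto
      have c: "h \<in> carrier M" "l \<in> carrier M" using h l L S by auto
      have "r \<odot>\<^bsub>M\<^esub> (h \<ominus>\<^bsub>M\<^esub> l) = \<zero>\<^bsub>M\<^esub>"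
        using c r l(2) by (simp add: a_minus_def smult_r_distr smult_r_minus M.r_neg)
      then have "h \<ominus>\<^bsub>M\<^esub> l \<in> ?K" using S(6) h l L by auto
      moreover have "h = l \<oplus>\<^bsub>M\<^esub> (h \<ominus>\<^bsub>M\<^esub> l)" using c by (simp add: a_minus_def M.a_lcomm M.r_neg)
      ultimately show "h \<in> hsum L ?K" using l unfolding hsum_def by blast
    qed
  qed
  then show ?thesis using fg_hsum[OF ker L(1)] by simp
qed

text \<open>Both parts rest on the linearity of multiplication by \<open>r\<close>, that is, on the
  commutativity of \<open>R\<close>.\<close>

lemma image_smult_submodule:
  assumes r: "r \<in> carrier R" and H: "submodule H R M"
  shows "submodule ((\<lambda>x. r \<odot>\<^bsub>M\<^esub> x) ` H) R M" "submodule {x \<in> H. r \<odot>\<^bsub>M\<^esub> x = \<zero>\<^bsub>M\<^esub>} R M"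
proof -
  note S = submoduleD[OF H]
  show "submodule ((\<lambda>x. r \<odot>\<^bsub>M\<^esub> x) ` H) R M"
  proof (rule submoduleI')
    show "\<zero>\<^bsub>M\<^esub> \<in> (\<lambda>x. r \<odot>\<^bsub>M\<^esub> x) ` H" using S(2) r by (metis imageI smult_r_null)
    show "u \<oplus>\<^bsub>M\<^esub> v \<in> (\<lambda>x. r \<odot>\<^bsub>M\<^esub> x) ` H" if uv: "u \<in> (\<lambda>x. r \<odot>\<^bsub>M\<^esub> x) ` H" "v \<in> (\<lambda>x. r \<odot>\<^bsub>M\<^esub> x) ` H" for u v
    proof -
      obtain x y where xy: "x \<in> H" "y \<in> H" "u = r \<odot>\<^bsub>M\<^esub> x" "v = r \<odot>\<^bsub>M\<^esub> y" using uv by auto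
      then have "u \<oplus>\<^bsub>M\<^esub> v = r \<odot>\<^bsub>M\<^esub> (x \<oplus>\<^bsub>M\<^esub> y)" using r S(1) smult_r_distr[of r x y] by (simp add: subset_iff)
      then show ?thesis using S(3)[OF xy(1,2)] by blast
    qed
    show "a \<odot>\<^bsub>M\<^esub> u \<in> (\<lambda>x. r \<odot>\<^bsub>M\<^esub> x) ` H" if a: "a \<in> carrier R" and u: "u \<in> (\<lambda>x. r \<odot>\<^bsub>M\<^esub> x) ` H" for a u
    proof -
      obtain h where h: "h \<in> H" "u = r \<odot>\<^bsub>M\<^esub> h" using u by auto
      have "a \<odot>\<^bsub>M\<^esub> u = r \<odot>\<^bsub>M\<^esub> (a \<odot>\<^bsub>M\<^esub> h)"
        using h a r S(1) by (metis smult_assoc1 R.m_comm subsetD)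
      then show ?thesis using S(5)[OF a h(1)] by auto
    qed
  qed (use S r in auto)
  show "submodule {x \<in> H. r \<odot>\<^bsub>M\<^esub> x = \<zero>\<^bsub>M\<^esub>} R M"
  proof (rule submoduleI')
    show "a \<odot>\<^bsub>M\<^esub> u \<in> {x \<in> H. r \<odot>\<^bsub>M\<^esub> x = \<zero>\<^bsub>M\<^esub>}" if a: "a \<in> carrier R" and u: "u \<in> {x \<in> H. r \<odot>\<^bsub>M\<^esub> x = \<zero>\<^bsub>M\<^esub>}" for a u
    proof -
      have "r \<odot>\<^bsub>M\<^esub> (a \<odot>\<^bsub>M\<^esub> u) = a \<odot>\<^bsub>M\<^esub> (r \<odot>\<^bsub>M\<^esub> u)"
        using u a r S(1) by (metis (lifting) smult_assoc1 R.m_comm subsetD mem_Collect_eq)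
      then show ?thesis using S(5)[OF a] u a by auto
    qed
  qed (use S r in \<open>auto simp: smult_r_distr subset_iff\<close>)
qed

text \<open>The Hopkins--Levitzki argument: a minimal non-finitely generated submodule \<open>I\<close> satisfies \<open>r I = I\<close> or
  \<open>r I = 0\<close> for every scalar \<open>r\<close>, so it is a vector space over a field; a hyperplane of it is finitely
  generated by minimality, and then so is \<open>I\<close>.\<close>

lemma dcc_imp_fg:
  assumes art: "artinian_cring R" and dcc: "dcc (carrier M)" and A: "submodule A R M"
  shows "fg A"
proof (rule ccontr)
  assume "\<not> fg A"
  then have "A \<in> {H. submodule H R M \<and> \<not> fg H}" using A by simp
  then obtain I where "I \<in> {H. submodule H R M \<and> \<not> fg H}"
    and min: "\<And>H. \<lbrakk>H \<in> {H. submodule H R M \<and> \<not> fg H}; H \<subseteq> I\<rbrakk> \<Longrightarrow> H = I"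
    by (rule dcc_minimal[OF dcc]) (use submoduleD(1) in auto)
  then have I: "submodule I R M" and nfg: "\<not> fg I" by auto
  have proper: "fg H" if "submodule H R M" "H \<subseteq> I" "H \<noteq> I" for H using min that by blast
  note S = submoduleD[OF I]
  \<comment> \<open>Otherwise image and kernel of \<open>r\<close> on \<open>I\<close> are both
    proper, hence finitely generated by minimality, and so is \<open>I\<close>.\<close>
  have dich: "(\<lambda>x. r \<odot>\<^bsub>M\<^esub> x) ` I = I \<or> (\<forall>x\<in>I. r \<odot>\<^bsub>M\<^esub> x = \<zero>\<^bsub>M\<^esub>)" if r: "r \<in> carrier R" for r
  proof (rule ccontr)
    assume *: "\<not> ?thesis"
    have "fg ((\<lambda>x. r \<odot>\<^bsub>M\<^esub> x) ` I)"
      by (rule proper) (use * image_smult_submodule[OF r I] S r in auto)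
    moreover have "fg {x \<in> I. r \<odot>\<^bsub>M\<^esub> x = \<zero>\<^bsub>M\<^esub>}"
      by (rule proper) (use * image_smult_submodule[OF r I] in auto)
    ultimately show False using fg_extension[OF r I] nfg by simp
  qed
  \<comment> \<open>The powers of \<open>r\<close> generate a descending chain of ideals, so
    \<open>r^n = s r^(n+1)\<close> for some \<open>n\<close> and \<open>s\<close>. As
    \<open>r^n I = I\<close>, this says that \<open>s r\<close> is the identity on
    \<open>I\<close>.\<close>
  have inv: "\<exists>s\<in>carrier R. \<forall>x\<in>I. s \<odot>\<^bsub>M\<^esub> (r \<odot>\<^bsub>M\<^esub> x) = x" if r: "r \<in> carrier R" and onto: "(\<lambda>x. r \<odot>\<^bsub>M\<^esub> x) ` I = I" for r
  proof -
    let ?J = "\<lambda>n. PIdl (r [^] (n::nat))"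
    have J: "ideal (?J n) R" for n using r R.cgenideal_ideal by simp
    have "r [^] Suc n \<in> ?J n" for n using r by (auto simp: cgenideal_def R.m_comm)
    then have "?J (Suc n) \<subseteq> ?J n" for n using R.cgenideal_minimal[OF J] by blast
    from artinian_cringD[of ?J, OF art J this] obtain n where "\<forall>m\<ge>n. ?J m = ?J n" ..
    then have "?J (Suc n) = ?J n" by (meson le_SucI order_refl)
    then have "r [^] n \<in> ?J (Suc n)" using R.cgenideal_self[of "r [^] n"] r by simp
    then obtain s where s: "s \<in> carrier R" "r [^] n = s \<otimes> r [^] Suc n" by (auto simp: cgenideal_def)
    have pow: "(\<lambda>x. r [^] m \<odot>\<^bsub>M\<^esub> x) ` I = I" for m :: nat
    proof (induction m)
      case 0 then show ?case using S by (force simp: subset_iff)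
    next
      case (Suc m)
      have "(\<lambda>x. r [^] Suc m \<odot>\<^bsub>M\<^esub> x) ` I = (\<lambda>x. r [^] m \<odot>\<^bsub>M\<^esub> x) ` (\<lambda>x. r \<odot>\<^bsub>M\<^esub> x) ` I"
        unfolding image_image using S r by (intro image_cong) (auto simp: smult_assoc1 subset_iff)
      then show ?case using Suc onto by simp
    qed
    have "s \<odot>\<^bsub>M\<^esub> (r \<odot>\<^bsub>M\<^esub> x) = x" if x: "x \<in> I" for x
    proof -
      obtain y where y: "y \<in> I" "x = r [^] n \<odot>\<^bsub>M\<^esub> y" using pow[of n] x by blast
      have yc: "y \<in> carrier M" using y S by auto
      have "s \<odot>\<^bsub>M\<^esub> (r \<odot>\<^bsub>M\<^esub> x) = (s \<otimes> (r \<otimes> r [^] n)) \<odot>\<^bsub>M\<^esub> y"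
        unfolding y(2) using s(1) r yc by (simp add: smult_assoc1)
      also have "s \<otimes> (r \<otimes> r [^] n) = r [^] n" using s r by (simp add: R.m_comm)
      finally show ?thesis using y by simp
    qed
    then show ?thesis using s by blast
  qed
  have "I \<noteq> {\<zero>\<^bsub>M\<^esub>}" using nfg fg.zero by auto
  then obtain x where x: "x \<in> I" "x \<noteq> \<zero>\<^bsub>M\<^esub>" using S by auto
  have xc: "x \<in> carrier M" using x S by auto
  \<comment> \<open>The hyperplane is a submodule of \<open>I\<close> maximal among those avoiding
    \<open>x\<close>. It comes from Zorn's lemma because no ascending chain condition is available
    at this point.\<close>
  let ?BB = "{B. submodule B R M \<and> B \<subseteq> I \<and> x \<notin> B}"
  have "\<exists>B\<in>?BB. \<forall>B'\<in>?BB. B \<subseteq> B' \<longrightarrow> B' = B"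
  proof (rule subset_Zorn_nonempty)
    show "?BB \<noteq> {}" using submodule_zero x S by auto
    show "\<Union>CC \<in> ?BB" if ne: "CC \<noteq> {}" and ch: "subset.chain ?BB CC" for CC
    proof -
      have C: "\<And>B. B \<in> CC \<Longrightarrow> submodule B R M \<and> B \<subseteq> I \<and> x \<notin> B" using ch by (auto simp: subset.chain_def)
      have "submodule (\<Union>CC) R M"
      proof (rule submoduleI')
        show "\<Union>CC \<subseteq> carrier M" using C S by blast
        show "\<zero>\<^bsub>M\<^esub> \<in> \<Union>CC" using ne C submoduleD(2) by blast
        show "a \<odot>\<^bsub>M\<^esub> u \<in> \<Union>CC" if "a \<in> carrier R" "u \<in> \<Union>CC" for a u using that C submoduleD(5) by blast
        show "u \<oplus>\<^bsub>M\<^esub> v \<in> \<Union>CC" if uv: "u \<in> \<Union>CC" "v \<in> \<Union>CC" for u v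
        proof -
          obtain B B' where B: "B \<in> CC" "B' \<in> CC" "u \<in> B" "v \<in> B'" using uv by auto
          then have "B \<subseteq> B' \<or> B' \<subseteq> B" using ch by (auto simp: subset_chain_def)
          then show ?thesis using B C submoduleD(3) by (metis UnionI subsetD)
        qed
      qed
      then show ?thesis using C by auto
    qed
  qed
  then obtain B where "B \<in> ?BB" and maxB: "\<forall>B'\<in>?BB. B \<subseteq> B' \<longrightarrow> B' = B" ..
  then have B: "submodule B R M" "B \<subseteq> I" "x \<notin> B" by auto
  have max: "B' = B" if "submodule B' R M" "B' \<subseteq> I" "x \<notin> B'" "B \<subseteq> B'" for B'
    by (rule maxB[rule_format]) (use that in auto)
  have "I \<subseteq> adjoin B x"
  proof
    fix y assume y: "y \<in> I"
    show "y \<in> adjoin B x"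
    proof (cases "y \<in> B")
      case True then show ?thesis using adjoin_incl[OF B(1) xc] by auto
    next
      case False
      have yc: "y \<in> carrier M" using y S by auto
      note Bx = adjoin_submodule[OF B(1) xc] and Bxi = adjoin_incl[OF B(1) xc]
      \<comment> \<open>If \<open>y\<close> is not in \<open>B\<close>, maximality puts
        \<open>x\<close> into \<open>B + R y\<close>. Solving for \<open>y\<close> needs an inverse
        of \<open>r\<close>, which exists because \<open>r y\<close> is nonzero: otherwise
        \<open>x\<close> would lie in \<open>B\<close>.\<close>
      have "x \<in> adjoin B y"
        using max[OF adjoin_submodule[OF B(1) yc] adjoin_least[OF I B(2) y]] adjoin_incl[OF B(1) yc] False by auto
      then obtain b r where br: "b \<in> B" "r \<in> carrier R" "x = b \<oplus>\<^bsub>M\<^esub> r \<odot>\<^bsub>M\<^esub> y" by (auto simp: adjoin_def)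
      have bc: "b \<in> carrier M" using br B S by auto
      have "r \<odot>\<^bsub>M\<^esub> y \<noteq> \<zero>\<^bsub>M\<^esub>" using br bc B(3) by auto
      then obtain s where s: "s \<in> carrier R" "s \<odot>\<^bsub>M\<^esub> (r \<odot>\<^bsub>M\<^esub> y) = y" using dich[OF br(2)] inv[OF br(2)] y by blast
      have "r \<odot>\<^bsub>M\<^esub> y = x \<ominus>\<^bsub>M\<^esub> b" 
        using br yc bc by (simp add: a_minus_def M.a_comm[of b] M.a_assoc M.r_neg)
      moreover have "x \<ominus>\<^bsub>M\<^esub> b \<in> adjoin B x" using submoduleD(6)[OF Bx Bxi(2), of b] Bxi(1) br(1) by blast
      ultimately have "r \<odot>\<^bsub>M\<^esub> y \<in> adjoin B x" by metis
      then show ?thesis using submoduleD(5)[OF Bx s(1)] s(2) by metis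
    qed
  qed
  then have "adjoin B x = I" using adjoin_least[OF I B(2) x(1)] by auto
  moreover have "fg B" by (rule proper) (use B x in auto)
  ultimately show False using nfg fg.step[OF _ xc] by metis
qed

lemma finitely_generated_fg:
  assumes "finitely_generated R M"
  shows "fg (carrier M)"
proof -
  obtain S where S: "finite S" "S \<subseteq> carrier M"
    and gen: "\<And>x. x \<in> carrier M \<Longrightarrow> \<exists>c \<in> S \<rightarrow> carrier R. x = (\<Oplus>\<^bsub>M\<^esub>s\<in>S. c s \<odot>\<^bsub>M\<^esub> s)"
    using assms unfolding finitely_generated_def by auto
  have "\<exists>H. fg H \<and> S \<subseteq> H" using S
  proof (induction rule: finite_induct)
    case empty then show ?case using fg.zero by auto
  next
    case (insert s S)
    then obtain H where H: "fg H" "S \<subseteq> H" by auto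
    then show ?case using adjoin_incl[OF fg_submodule[OF H(1)], of s] fg.step[OF H(1), of s] insert by blast
  qed
  then obtain H where H: "fg H" "S \<subseteq> H" by auto
  note SH = submoduleD[OF fg_submodule[OF H(1)]]
  have "(\<Oplus>\<^bsub>M\<^esub>s\<in>T. c s \<odot>\<^bsub>M\<^esub> s) \<in> H" if "finite T" "T \<subseteq> S" "c \<in> S \<rightarrow> carrier R" for T c
    using that
  proof (induction rule: finite_induct)
    case empty then show ?case using SH by simp
  next
    case (insert s T)
    have "(\<lambda>s. c s \<odot>\<^bsub>M\<^esub> s) \<in> T \<rightarrow> carrier M" "c s \<odot>\<^bsub>M\<^esub> s \<in> carrier M" "c s \<odot>\<^bsub>M\<^esub> s \<in> H"
      using insert(4,5) S SH(5) H(2) by (auto simp: Pi_def intro!: smult_closed)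
    then show ?case using insert SH(3) by (simp add: M.finsum_insert)
  qed
  then have "carrier M \<subseteq> H" using gen S(1) by (metis order_refl subsetI)
  then show ?thesis using H SH by (metis subset_antisym)
qed

end

section \<open>Injective cogenerators\<close>

text \<open>Ideals of \<open>R\<close> as modules with elements in the type of scalars, which makes
  them test modules for \<open>injective_module\<close>.\<close>

definition scalar_module :: "('k, 'z) ring_scheme \<Rightarrow> 'k set \<Rightarrow> ('k, 'k) module" where
  "scalar_module R S = \<lparr>carrier = S, mult = undefined, one = undefined,
     zero = \<zero>\<^bsub>R\<^esub>, add = add R, smult = mult R\<rparr>"

lemma scalar_module_simps [simp]:
  "carrier (scalar_module R S) = S" "\<zero>\<^bsub>scalar_module R S\<^esub> = \<zero>\<^bsub>R\<^esub>"
  "add (scalar_module R S) = add R" "smult (scalar_module R S) = mult R"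
  by (simp_all add: scalar_module_def)

lemma (in cring) scalar_module: "module R (scalar_module R (carrier R))"
proof (rule moduleI)
  show "abelian_group (scalar_module R (carrier R))"
  proof (rule abelian_groupI)
    show "\<exists>y\<in>carrier (scalar_module R (carrier R)). y \<oplus>\<^bsub>scalar_module R (carrier R)\<^esub> x = \<zero>\<^bsub>scalar_module R (carrier R)\<^esub>"
      if "x \<in> carrier (scalar_module R (carrier R))" for x
      using that l_neg[of x] by auto
  qed (auto simp: a_ac)
qed (auto simp: is_cring l_distr r_distr m_assoc)

lemma (in cring) scalar_module_ideal:
  assumes "ideal I R"
  shows "module R (scalar_module R I)"
proof -
  interpret S: module R "scalar_module R (carrier R)" by (rule scalar_module)
  interpret I: ideal I R by fact
  have "submodule I R (scalar_module R (carrier R))"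
    by (rule S.submoduleI') (auto simp: I.I_l_closed I.a_Hcarr)
  from submodule.submodule_is_module[OF this scalar_module] show ?thesis
    by (simp add: scalar_module_def)
qed

text \<open>Partial linear maps are represented by their graphs, so that chains are bounded by unions in Zorn's lemma.\<close>

definition lin_graph :: "('k, 'z) ring_scheme \<Rightarrow> ('k, 'a, 'x) module_scheme \<Rightarrow> ('k, 'b, 'y) module_scheme \<Rightarrow> ('a \<times> 'b) set \<Rightarrow> bool"
  where "lin_graph R M J G \<longleftrightarrow> G \<subseteq> carrier M \<times> carrier J \<and> (\<zero>\<^bsub>M\<^esub>, \<zero>\<^bsub>J\<^esub>) \<in> G \<and>
     (\<forall>x y x' y'. (x, y) \<in> G \<longrightarrow> (x', y') \<in> G \<longrightarrow> (x \<oplus>\<^bsub>M\<^esub> x', y \<oplus>\<^bsub>J\<^esub> y') \<in> G) \<and>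
     (\<forall>a \<in> carrier R. \<forall>x y. (x, y) \<in> G \<longrightarrow> (a \<odot>\<^bsub>M\<^esub> x, a \<odot>\<^bsub>J\<^esub> y) \<in> G) \<and>
     (\<forall>y. (\<zero>\<^bsub>M\<^esub>, y) \<in> G \<longrightarrow> y = \<zero>\<^bsub>J\<^esub>)"

lemma lin_graphD:
  assumes "lin_graph R M J G"
  shows "\<And>x y. (x, y) \<in> G \<Longrightarrow> x \<in> carrier M" "\<And>x y. (x, y) \<in> G \<Longrightarrow> y \<in> carrier J" "(\<zero>\<^bsub>M\<^esub>, \<zero>\<^bsub>J\<^esub>) \<in> G"
    "\<And>x y x' y'. \<lbrakk>(x, y) \<in> G; (x', y') \<in> G\<rbrakk> \<Longrightarrow> (x \<oplus>\<^bsub>M\<^esub> x', y \<oplus>\<^bsub>J\<^esub> y') \<in> G"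
    "\<And>a x y. \<lbrakk>a \<in> carrier R; (x, y) \<in> G\<rbrakk> \<Longrightarrow> (a \<odot>\<^bsub>M\<^esub> x, a \<odot>\<^bsub>J\<^esub> y) \<in> G"
    "\<And>y. (\<zero>\<^bsub>M\<^esub>, y) \<in> G \<Longrightarrow> y = \<zero>\<^bsub>J\<^esub>"
  using assms unfolding lin_graph_def by auto

lemma lin_graph_minus:
  assumes "module R M" "module R J" "lin_graph R M J G" "(x, y) \<in> G"
  shows "(\<ominus>\<^bsub>M\<^esub> x, \<ominus>\<^bsub>J\<^esub> y) \<in> G"
proof -
  interpret M: module R M by fact
  interpret J: module R J by fact
  show ?thesis
    using lin_graphD(5)[OF assms(3), of "\<ominus>\<^bsub>R\<^esub> \<one>\<^bsub>R\<^esub>" x y] lin_graphD(1,2)[OF assms(3,4)] assms(4)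
    by (simp add: M.smult_l_minus J.smult_l_minus)
qed

text \<open>Single-valuedness is required in \<open>lin_graph\<close> only at zero; subtracting two
  pairs transports it to every point.\<close>

lemma lin_graph_unique:
  assumes "module R M" "module R J" "lin_graph R M J G" "(x, y) \<in> G" "(x, y') \<in> G"
  shows "y = y'"
proof -
  interpret M: module R M by fact
  interpret J: module R J by fact
  note c = lin_graphD(1,2)[OF assms(3,4)] lin_graphD(2)[OF assms(3,5)]
  have "(x \<oplus>\<^bsub>M\<^esub> \<ominus>\<^bsub>M\<^esub> x, y \<oplus>\<^bsub>J\<^esub> \<ominus>\<^bsub>J\<^esub> y') \<in> G"
    using lin_graphD(4)[OF assms(3,4)] lin_graph_minus[OF assms(1-3,5)] by blast
  then have "y \<oplus>\<^bsub>J\<^esub> \<ominus>\<^bsub>J\<^esub> y' = \<zero>\<^bsub>J\<^esub>" using lin_graphD(6)[OF assms(3)] c by (simp add: M.M.r_neg)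
  then show ?thesis using c by (metis J.M.minus_equality J.M.minus_minus J.M.a_inv_closed)
qed

lemma lin_mapsD:
  assumes "h \<in> lin_maps R M N"
  shows "\<And>x. x \<in> carrier M \<Longrightarrow> h x \<in> carrier N"
    "\<And>x y. \<lbrakk>x \<in> carrier M; y \<in> carrier M\<rbrakk> \<Longrightarrow> h (x \<oplus>\<^bsub>M\<^esub> y) = h x \<oplus>\<^bsub>N\<^esub> h y"
    "\<And>a x. \<lbrakk>a \<in> carrier R; x \<in> carrier M\<rbrakk> \<Longrightarrow> h (a \<odot>\<^bsub>M\<^esub> x) = a \<odot>\<^bsub>N\<^esub> h x"
  using assms by (auto simp: lin_maps_def)

lemma lin_maps_zero:
  assumes "module R M" "module R N" "h \<in> lin_maps R M N"
  shows "h \<zero>\<^bsub>M\<^esub> = \<zero>\<^bsub>N\<^esub>"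
proof -
  interpret M: module R M by fact
  interpret N: module R N by fact
  show ?thesis
    using lin_mapsD(3)[OF assms(3), of "\<zero>\<^bsub>R\<^esub>" "\<zero>\<^bsub>M\<^esub>"] lin_mapsD(1)[OF assms(3), of "\<zero>\<^bsub>M\<^esub>"] by simp
qed

text \<open>The hypothesis \<open>val\<close> is what single-valuedness at zero amounts to: if
  \<open>z + r x = 0\<close>, then \<open>r x = - z\<close> already lies in the domain with value
  \<open>- w\<close>, so \<open>val\<close> gives \<open>w + r y = 0\<close>.\<close>

lemma lin_graph_adjoin:
  assumes M: "module R M" and Jm: "module R J" and G: "lin_graph R M J G" and x: "x \<in> carrier M" and y: "y \<in> carrier J"
    and val: "\<And>r w. \<lbrakk>r \<in> carrier R; (r \<odot>\<^bsub>M\<^esub> x, w) \<in> G\<rbrakk> \<Longrightarrow> w = r \<odot>\<^bsub>J\<^esub> y"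
  shows "lin_graph R M J {(z \<oplus>\<^bsub>M\<^esub> r \<odot>\<^bsub>M\<^esub> x, w \<oplus>\<^bsub>J\<^esub> r \<odot>\<^bsub>J\<^esub> y) |z w r. (z, w) \<in> G \<and> r \<in> carrier R}" (is "lin_graph R M J ?G")
proof -
  interpret M: module R M by fact
  interpret J: module R J by fact
  note D = lin_graphD[OF G]
  show ?thesis
    unfolding lin_graph_def
  proof (intro conjI allI impI ballI)
    show "?G \<subseteq> carrier M \<times> carrier J" using D(1,2) x y by auto
    have "(\<zero>\<^bsub>M\<^esub>, \<zero>\<^bsub>J\<^esub>) = (\<zero>\<^bsub>M\<^esub> \<oplus>\<^bsub>M\<^esub> \<zero>\<^bsub>R\<^esub> \<odot>\<^bsub>M\<^esub> x, \<zero>\<^bsub>J\<^esub> \<oplus>\<^bsub>J\<^esub> \<zero>\<^bsub>R\<^esub> \<odot>\<^bsub>J\<^esub> y)" using x y by simp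
    then show "(\<zero>\<^bsub>M\<^esub>, \<zero>\<^bsub>J\<^esub>) \<in> ?G" using D(3) M.R.zero_closed by blast
    show "(u \<oplus>\<^bsub>M\<^esub> u', v \<oplus>\<^bsub>J\<^esub> v') \<in> ?G" if uv: "(u, v) \<in> ?G" "(u', v') \<in> ?G" for u v u' v'
    proof -
      obtain z w r z' w' r' where *: "(z, w) \<in> G" "(z', w') \<in> G" "r \<in> carrier R" "r' \<in> carrier R"
        "u = z \<oplus>\<^bsub>M\<^esub> r \<odot>\<^bsub>M\<^esub> x" "v = w \<oplus>\<^bsub>J\<^esub> r \<odot>\<^bsub>J\<^esub> y" "u' = z' \<oplus>\<^bsub>M\<^esub> r' \<odot>\<^bsub>M\<^esub> x" "v' = w' \<oplus>\<^bsub>J\<^esub> r' \<odot>\<^bsub>J\<^esub> y"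
        using uv by blast
      note c = D(1,2)[OF *(1)] D(1,2)[OF *(2)]
      have "u \<oplus>\<^bsub>M\<^esub> u' = (z \<oplus>\<^bsub>M\<^esub> z') \<oplus>\<^bsub>M\<^esub> (r \<oplus>\<^bsub>R\<^esub> r') \<odot>\<^bsub>M\<^esub> x" "v \<oplus>\<^bsub>J\<^esub> v' = (w \<oplus>\<^bsub>J\<^esub> w') \<oplus>\<^bsub>J\<^esub> (r \<oplus>\<^bsub>R\<^esub> r') \<odot>\<^bsub>J\<^esub> y"
        using * c x y by (simp_all add: M.smult_l_distr J.smult_l_distr M.M.a_ac J.M.a_ac)
      then show ?thesis using D(4)[OF *(1,2)] M.R.a_closed[OF *(3,4)] by blast
    qed
    show "(a \<odot>\<^bsub>M\<^esub> u, a \<odot>\<^bsub>J\<^esub> v) \<in> ?G" if a: "a \<in> carrier R" and uv: "(u, v) \<in> ?G" for a u v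
    proof -
      obtain z w r where *: "(z, w) \<in> G" "r \<in> carrier R" "u = z \<oplus>\<^bsub>M\<^esub> r \<odot>\<^bsub>M\<^esub> x" "v = w \<oplus>\<^bsub>J\<^esub> r \<odot>\<^bsub>J\<^esub> y"
        using uv by blast
      note c = D(1,2)[OF *(1)]
      have "a \<odot>\<^bsub>M\<^esub> u = a \<odot>\<^bsub>M\<^esub> z \<oplus>\<^bsub>M\<^esub> (a \<otimes>\<^bsub>R\<^esub> r) \<odot>\<^bsub>M\<^esub> x" "a \<odot>\<^bsub>J\<^esub> v = a \<odot>\<^bsub>J\<^esub> w \<oplus>\<^bsub>J\<^esub> (a \<otimes>\<^bsub>R\<^esub> r) \<odot>\<^bsub>J\<^esub> y"
        using * c x y a by (simp_all add: M.smult_r_distr J.smult_r_distr M.smult_assoc1 J.smult_assoc1)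
      then show ?thesis using D(5)[OF a *(1)] M.R.m_closed[OF a *(2)] by blast
    qed
    show "v = \<zero>\<^bsub>J\<^esub>" if "(\<zero>\<^bsub>M\<^esub>, v) \<in> ?G" for v
    proof -
      obtain z w r where *: "(z, w) \<in> G" "r \<in> carrier R" "\<zero>\<^bsub>M\<^esub> = z \<oplus>\<^bsub>M\<^esub> r \<odot>\<^bsub>M\<^esub> x" "v = w \<oplus>\<^bsub>J\<^esub> r \<odot>\<^bsub>J\<^esub> y"
        using \<open>(\<zero>\<^bsub>M\<^esub>, v) \<in> ?G\<close> by blast
      note c = D(1,2)[OF *(1)]
      have "r \<odot>\<^bsub>M\<^esub> x = \<ominus>\<^bsub>M\<^esub> z" using * c x by (metis M.M.minus_equality M.M.a_comm M.smult_closed M.M.minus_minus M.M.a_inv_closed)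
      then have "(r \<odot>\<^bsub>M\<^esub> x, \<ominus>\<^bsub>J\<^esub> w) \<in> G" using lin_graph_minus[OF M Jm G *(1)] by simp
      then have "\<ominus>\<^bsub>J\<^esub> w = r \<odot>\<^bsub>J\<^esub> y" using val * by blast
      then show ?thesis using *(4) c by (metis J.M.r_neg)
    qed
  qed
qed

text \<open>Baer's step: the value at \<open>x\<close> comes from extending a map along the ideal of scalars that move \<open>x\<close> into the domain.\<close>

lemma lin_graph_step:
  fixes J :: "('k, 'j) module"
  assumes J: "injective_module R J" and M: "module R M" and G: "lin_graph R M J G" and x: "x \<in> carrier M"
  obtains y where "y \<in> carrier J" "lin_graph R M J {(z \<oplus>\<^bsub>M\<^esub> r \<odot>\<^bsub>M\<^esub> x, w \<oplus>\<^bsub>J\<^esub> r \<odot>\<^bsub>J\<^esub> y) |z w r. (z, w) \<in> G \<and> r \<in> carrier R}"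
proof -
  have Jm: "module R J" using J by (simp add: injective_module_def)
  interpret M: module R M by fact
  interpret J: module R J by fact
  note D = lin_graphD[OF G]
  let ?I = "{r \<in> carrier R. \<exists>y. (r \<odot>\<^bsub>M\<^esub> x, y) \<in> G}"
  have I: "ideal ?I R"
  proof (rule idealI)
    show "ring R" by unfold_locales
    show "subgroup ?I (add_monoid R)"
    proof (rule M.R.add.subgroupI)
      have "(\<zero>\<^bsub>R\<^esub> \<odot>\<^bsub>M\<^esub> x, \<zero>\<^bsub>J\<^esub>) \<in> G" using D(3) x by simp
      then show "?I \<noteq> {}" by blast
      show "\<ominus>\<^bsub>R\<^esub> a \<in> ?I" if "a \<in> ?I" for a
        using that lin_graph_minus[OF M Jm G] x M.smult_l_minus[of a x] by auto
      show "a \<oplus>\<^bsub>R\<^esub> b \<in> ?I" if "a \<in> ?I" "b \<in> ?I" for a b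
        using that D(4) x M.smult_l_distr[of a b x] by auto metis
    qed auto
    show "b \<otimes>\<^bsub>R\<^esub> a \<in> ?I" if "a \<in> ?I" "b \<in> carrier R" for a b
      using that D(5) x M.smult_assoc1[of b a x] by auto
    then show "a \<otimes>\<^bsub>R\<^esub> b \<in> ?I" if "a \<in> ?I" "b \<in> carrier R" for a b
      using that M.R.m_comm[of a b] by auto
  qed
  define g where "g = (\<lambda>r\<in>?I. THE y. (r \<odot>\<^bsub>M\<^esub> x, y) \<in> G)"
  have g: "g r = y" if "r \<in> carrier R" "(r \<odot>\<^bsub>M\<^esub> x, y) \<in> G" for r y
    using that lin_graph_unique[OF M Jm G] unfolding g_def by (auto intro!: the_equality)
  have g_lin: "g \<in> lin_maps R (scalar_module R ?I) J"
    unfolding lin_maps_def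
  proof (intro CollectI conjI ballI)
    show "g \<in> carrier (scalar_module R ?I) \<rightarrow>\<^sub>E carrier J"
    proof (rule PiE_I)
      fix r assume "r \<in> carrier (scalar_module R ?I)"
      then obtain y where "(r \<odot>\<^bsub>M\<^esub> x, y) \<in> G" "r \<in> carrier R" by auto
      then show "g r \<in> carrier J" using g D(2) by auto
    next
      fix r assume "r \<notin> carrier (scalar_module R ?I)"
      then show "g r = undefined" unfolding g_def restrict_def scalar_module_simps by (rule if_not_P)
    qed
    show "g (r \<oplus>\<^bsub>scalar_module R ?I\<^esub> s) = g r \<oplus>\<^bsub>J\<^esub> g s"
      if rs: "r \<in> carrier (scalar_module R ?I)" "s \<in> carrier (scalar_module R ?I)" for r s
    proof -
      obtain y z where "(r \<odot>\<^bsub>M\<^esub> x, y) \<in> G" "(s \<odot>\<^bsub>M\<^esub> x, z) \<in> G" "r \<in> carrier R" "s \<in> carrier R" using rs by auto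
      then show ?thesis using g D(4)[of "r \<odot>\<^bsub>M\<^esub> x" y "s \<odot>\<^bsub>M\<^esub> x" z] x by (simp add: M.smult_l_distr)
    qed
    show "g (a \<odot>\<^bsub>scalar_module R ?I\<^esub> r) = a \<odot>\<^bsub>J\<^esub> g r"
      if a: "a \<in> carrier R" and r: "r \<in> carrier (scalar_module R ?I)" for a r
    proof -
      obtain y where "(r \<odot>\<^bsub>M\<^esub> x, y) \<in> G" "r \<in> carrier R" using r by auto
      then show ?thesis using g D(5)[OF a, of "r \<odot>\<^bsub>M\<^esub> x" y] x a by (simp add: M.smult_assoc1)
    qed
  qed
  have incl: "(\<lambda>r\<in>?I. r) \<in> lin_maps R (scalar_module R ?I) (scalar_module R (carrier R))"
    unfolding lin_maps_def using ideal.I_l_closed[OF I] additive_subgroup.a_closed[OF ideal.axioms(1)[OF I]] by auto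
  obtain h where h: "h \<in> lin_maps R (scalar_module R (carrier R)) J" "\<And>r. r \<in> ?I \<Longrightarrow> h ((\<lambda>r\<in>?I. r) r) = g r"
    using J[unfolded injective_module_def, THEN conjunct2, THEN spec, THEN spec, THEN spec, THEN spec,
        of "scalar_module R ?I" "scalar_module R (carrier R)" "\<lambda>r\<in>?I. r" g]
      M.R.scalar_module M.R.scalar_module_ideal[OF I] incl g_lin by (auto simp: inj_on_def)
  \<comment> \<open>A linear map on \<open>R\<close> is multiplication by its value at one, and this
    value is the one to be assigned to \<open>x\<close>.\<close>
  let ?y = "h \<one>\<^bsub>R\<^esub>"
  have y: "?y \<in> carrier J" using lin_mapsD(1)[OF h(1)] by simp
  have hr: "h r = r \<odot>\<^bsub>J\<^esub> ?y" if "r \<in> carrier R" for r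
    using lin_mapsD(3)[OF h(1) that, of "\<one>\<^bsub>R\<^esub>"] that by simp
  have val: "w = r \<odot>\<^bsub>J\<^esub> ?y" if "r \<in> carrier R" "(r \<odot>\<^bsub>M\<^esub> x, w) \<in> G" for r w
  proof -
    have r: "r \<in> ?I" using that by blast
    have "w = g r" using g[OF that] by simp
    also have "\<dots> = h r" using h(2)[OF r] r by (simp only: restrict_apply' )
    also have "\<dots> = r \<odot>\<^bsub>J\<^esub> ?y" by (rule hr[OF that(1)])
    finally show ?thesis .
  qed
  show ?thesis by (rule that[OF y lin_graph_adjoin[OF M Jm G x y val]])
qed

text \<open>Baer's criterion. It frees injectivity from the type of the test modules:
  \<open>M\<close> may be any module, in particular one of extension classes.\<close>

lemma lin_graph_extend:
  fixes J :: "('k, 'j) module"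
  assumes J: "injective_module R J" and M: "module R M" and G: "lin_graph R M J G"
  shows "\<exists>h \<in> lin_maps R M J. \<forall>x y. (x, y) \<in> G \<longrightarrow> h x = y"
proof -
  have Jm: "module R J" using J by (simp add: injective_module_def)
  interpret M: module R M by fact
  interpret J: module R J by fact
  let ?A = "{G'. lin_graph R M J G' \<and> G \<subseteq> G'}"
  have "\<exists>H\<in>?A. \<forall>H'\<in>?A. H \<subseteq> H' \<longrightarrow> H' = H"
  proof (rule subset_Zorn_nonempty)
    show "?A \<noteq> {}" using G by auto
    show "\<Union>CC \<in> ?A" if ne: "CC \<noteq> {}" and ch: "subset.chain ?A CC" for CC
    proof -
      have C: "\<And>B. B \<in> CC \<Longrightarrow> lin_graph R M J B \<and> G \<subseteq> B" using ch by (auto simp: subset.chain_def)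
      have "lin_graph R M J (\<Union>CC)"
        unfolding lin_graph_def
      proof (intro conjI allI impI ballI)
        show "\<Union>CC \<subseteq> carrier M \<times> carrier J" using C unfolding lin_graph_def by blast
        obtain B where B: "B \<in> CC" using ne by auto
        show "(\<zero>\<^bsub>M\<^esub>, \<zero>\<^bsub>J\<^esub>) \<in> \<Union>CC" using lin_graphD(3)[OF conjunct1[OF C[OF B]]] B by auto
        show "(a \<odot>\<^bsub>M\<^esub> x, a \<odot>\<^bsub>J\<^esub> y) \<in> \<Union>CC" if a: "a \<in> carrier R" and xy: "(x, y) \<in> \<Union>CC" for a x y
        proof -
          obtain B where B: "B \<in> CC" "(x, y) \<in> B" using xy by auto
          then show ?thesis using lin_graphD(5)[OF conjunct1[OF C[OF B(1)]] a B(2)] by auto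
        qed
        show "y = \<zero>\<^bsub>J\<^esub>" if y: "(\<zero>\<^bsub>M\<^esub>, y) \<in> \<Union>CC" for y
        proof -
          obtain B where B: "B \<in> CC" "(\<zero>\<^bsub>M\<^esub>, y) \<in> B" using y by auto
          then show ?thesis using lin_graphD(6)[OF conjunct1[OF C[OF B(1)]] B(2)] by simp
        qed
        show "(x \<oplus>\<^bsub>M\<^esub> x', y \<oplus>\<^bsub>J\<^esub> y') \<in> \<Union>CC" if xy: "(x, y) \<in> \<Union>CC" "(x', y') \<in> \<Union>CC" for x y x' y'
        proof -
          obtain B B' where B: "B \<in> CC" "B' \<in> CC" "(x, y) \<in> B" "(x', y') \<in> B'" using xy by auto
          then have "B \<subseteq> B' \<or> B' \<subseteq> B" using ch by (auto simp: subset_chain_def)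
          then show ?thesis
          proof
            assume "B \<subseteq> B'"
            then have "(x, y) \<in> B'" using B by auto
            then show ?thesis using lin_graphD(4)[OF conjunct1[OF C[OF B(2)]] _ B(4)] B(2) by auto
          next
            assume "B' \<subseteq> B"
            then have "(x', y') \<in> B" using B by auto
            then show ?thesis using lin_graphD(4)[OF conjunct1[OF C[OF B(1)]] B(3)] B(1) by auto
          qed
        qed
      qed
      then show ?thesis using C ne by blast
    qed
  qed
  then obtain H where "H \<in> ?A" and max: "\<forall>H'\<in>?A. H \<subseteq> H' \<longrightarrow> H' = H" ..
  then have H: "lin_graph R M J H" "G \<subseteq> H" by auto
  note D = lin_graphD[OF H(1)]
  have tot: "\<exists>y. (x, y) \<in> H" if x: "x \<in> carrier M" for x
  proof -
    obtain y where y: "y \<in> carrier J" "lin_graph R M J {(z \<oplus>\<^bsub>M\<^esub> r \<odot>\<^bsub>M\<^esub> x, w \<oplus>\<^bsub>J\<^esub> r \<odot>\<^bsub>J\<^esub> y) |z w r. (z, w) \<in> H \<and> r \<in> carrier R}" (is "lin_graph R M J ?H")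
      by (rule lin_graph_step[OF J M H(1) x])
    have "H \<subseteq> ?H"
    proof
      fix p assume p: "p \<in> H"
      obtain z w where zw: "p = (z, w)" by (metis surj_pair)
      have "p = (z \<oplus>\<^bsub>M\<^esub> \<zero>\<^bsub>R\<^esub> \<odot>\<^bsub>M\<^esub> x, w \<oplus>\<^bsub>J\<^esub> \<zero>\<^bsub>R\<^esub> \<odot>\<^bsub>J\<^esub> y)" "(z, w) \<in> H" using p zw D(1,2) x y by simp_all
      then show "p \<in> ?H" using M.R.zero_closed unfolding mem_Collect_eq by metis
    qed
    then have "?H \<in> ?A" using y(2) H(2) by blast
    then have eq: "?H = H" by (rule max[rule_format]) fact
    have "(x, y) = (\<zero>\<^bsub>M\<^esub> \<oplus>\<^bsub>M\<^esub> \<one>\<^bsub>R\<^esub> \<odot>\<^bsub>M\<^esub> x, \<zero>\<^bsub>J\<^esub> \<oplus>\<^bsub>J\<^esub> \<one>\<^bsub>R\<^esub> \<odot>\<^bsub>J\<^esub> y)" using x y by simp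
    then have "(x, y) \<in> ?H" using D(3) M.R.one_closed by blast
    then show ?thesis unfolding eq by blast
  qed
  define h where "h = (\<lambda>x\<in>carrier M. THE y. (x, y) \<in> H)"
  have h: "h x = y" if "(x, y) \<in> H" for x y
    using that D(1)[OF that] lin_graph_unique[OF M Jm H(1)] unfolding h_def by (auto intro!: the_equality)
  have hH: "(x, h x) \<in> H" if "x \<in> carrier M" for x using tot[OF that] h by auto
  have "h \<in> lin_maps R M J"
    unfolding lin_maps_def
  proof (intro CollectI conjI ballI)
    show "h \<in> carrier M \<rightarrow>\<^sub>E carrier J" using D(2)[OF hH] by (auto simp: h_def)
    show "h (x \<oplus>\<^bsub>M\<^esub> y) = h x \<oplus>\<^bsub>J\<^esub> h y" if "x \<in> carrier M" "y \<in> carrier M" for x y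
      using h[OF D(4)[OF hH hH]] that by simp
    show "h (a \<odot>\<^bsub>M\<^esub> x) = a \<odot>\<^bsub>J\<^esub> h x" if "a \<in> carrier R" "x \<in> carrier M" for a x
      using h[OF D(5)[OF _ hH]] that by simp
  qed
  then show ?thesis using h H(2) by blast
qed

section \<open>Quotient modules and transport of structure\<close>

context module
begin

lemma submodule_abelian_subgroup:
  assumes "submodule N R M"
  shows "abelian_subgroup N M"
  using submodule.axioms(1)[OF assms]
  by (intro abelian_subgroupI3 additive_subgroup.intro) (auto intro: M.abelian_group_axioms)

lemma coset_mem_iff:
  assumes N: "submodule N R M" and x: "x \<in> carrier M"
  shows "y \<in> N +>\<^bsub>M\<^esub> x \<longleftrightarrow> y \<in> carrier M \<and> y \<ominus>\<^bsub>M\<^esub> x \<in> N"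
proof -
  interpret N: abelian_subgroup N M by (rule submodule_abelian_subgroup[OF N])
  have "y \<in> carrier M" if "y \<in> N +>\<^bsub>M\<^esub> x"
    using that N.a_elemrcos_carrier[OF x] by simp
  then show ?thesis using N.a_rcos_module[OF x] by (auto simp: a_minus_def)
qed

lemma coset_eq_iff:
  assumes N: "submodule N R M" and x: "x \<in> carrier M" and y: "y \<in> carrier M"
  shows "N +>\<^bsub>M\<^esub> x = N +>\<^bsub>M\<^esub> y \<longleftrightarrow> x \<ominus>\<^bsub>M\<^esub> y \<in> N"
proof -
  interpret N: abelian_subgroup N M by (rule submodule_abelian_subgroup[OF N])
  have "N +>\<^bsub>M\<^esub> x = N +>\<^bsub>M\<^esub> y \<longleftrightarrow> x \<in> N +>\<^bsub>M\<^esub> y"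
    using N.a_repr_independence'[of x y] N.a_rcos_self[OF x] x y by auto
  then show ?thesis using coset_mem_iff[OF N y] x by simp
qed

text \<open>The scalar multiple in \<open>quot_module\<close> is a union over all representatives;
  it collapses because the multiples of two representatives differ by an element of
  \<open>N\<close>.\<close>

lemma quot_module_simps:
  assumes N: "submodule N R M"
  shows "carrier (quot_module M N) = (\<lambda>x. N +>\<^bsub>M\<^esub> x) ` carrier M" "\<zero>\<^bsub>quot_module M N\<^esub> = N +>\<^bsub>M\<^esub> \<zero>\<^bsub>M\<^esub>"
    "\<lbrakk>x \<in> carrier M; y \<in> carrier M\<rbrakk> \<Longrightarrow> (N +>\<^bsub>M\<^esub> x) \<oplus>\<^bsub>quot_module M N\<^esub> (N +>\<^bsub>M\<^esub> y) = N +>\<^bsub>M\<^esub> (x \<oplus>\<^bsub>M\<^esub> y)"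
    "\<lbrakk>a \<in> carrier R; x \<in> carrier M\<rbrakk> \<Longrightarrow> a \<odot>\<^bsub>quot_module M N\<^esub> (N +>\<^bsub>M\<^esub> x) = N +>\<^bsub>M\<^esub> (a \<odot>\<^bsub>M\<^esub> x)"
proof -
  interpret N: abelian_subgroup N M by (rule submodule_abelian_subgroup[OF N])
  note S = submoduleD[OF N]
  show "carrier (quot_module M N) = (\<lambda>x. N +>\<^bsub>M\<^esub> x) ` carrier M"
    by (auto simp: quot_module_def A_RCOSETS_def')
  show "\<zero>\<^bsub>quot_module M N\<^esub> = N +>\<^bsub>M\<^esub> \<zero>\<^bsub>M\<^esub>"
    using N.a_subset by (simp add: quot_module_def M.a_coset_add_zero)
  show "(N +>\<^bsub>M\<^esub> x) \<oplus>\<^bsub>quot_module M N\<^esub> (N +>\<^bsub>M\<^esub> y) = N +>\<^bsub>M\<^esub> (x \<oplus>\<^bsub>M\<^esub> y)" if "x \<in> carrier M" "y \<in> carrier M"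
    using N.a_rcos_sum[OF that] by (simp add: quot_module_def)
  show "a \<odot>\<^bsub>quot_module M N\<^esub> (N +>\<^bsub>M\<^esub> x) = N +>\<^bsub>M\<^esub> (a \<odot>\<^bsub>M\<^esub> x)" if a: "a \<in> carrier R" and x: "x \<in> carrier M"
  proof -
    have const: "N +>\<^bsub>M\<^esub> (a \<odot>\<^bsub>M\<^esub> y) = N +>\<^bsub>M\<^esub> (a \<odot>\<^bsub>M\<^esub> x)" if "y \<in> N +>\<^bsub>M\<^esub> x" for y
    proof -
      have y: "y \<in> carrier M" "y \<ominus>\<^bsub>M\<^esub> x \<in> N" using that coset_mem_iff[OF N x] by auto
      then have "a \<odot>\<^bsub>M\<^esub> y \<ominus>\<^bsub>M\<^esub> a \<odot>\<^bsub>M\<^esub> x \<in> N"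
        using S(5)[OF a y(2)] a x by (simp add: a_minus_def smult_r_distr smult_r_minus)
      then show ?thesis using coset_eq_iff[OF N] a x y by simp
    qed
    have "N +>\<^bsub>M\<^esub> x \<noteq> {}" using N.a_rcos_self[OF x] by auto
    then have "(\<Union>y\<in>N +>\<^bsub>M\<^esub> x. N +>\<^bsub>M\<^esub> (a \<odot>\<^bsub>M\<^esub> y)) = N +>\<^bsub>M\<^esub> (a \<odot>\<^bsub>M\<^esub> x)"
      by (rule SUP_eq_const) (rule const)
    then show ?thesis by (simp add: quot_module_def)
  qed
qed

lemma quot_module_module:
  assumes N: "submodule N R M"
  shows "module R (quot_module M N)"
proof (rule moduleI)
  note Q = quot_module_simps[OF N]
  show "abelian_group (quot_module M N)"
  proof (rule abelian_groupI)
    show "\<exists>y\<in>carrier (quot_module M N). y \<oplus>\<^bsub>quot_module M N\<^esub> A = \<zero>\<^bsub>quot_module M N\<^esub>"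
      if A: "A \<in> carrier (quot_module M N)" for A
    proof -
      obtain x where "x \<in> carrier M" "A = N +>\<^bsub>M\<^esub> x" using A Q(1) by auto
      then show ?thesis using Q(1,2) Q(3)[of "\<ominus>\<^bsub>M\<^esub> x" x] by (auto simp: M.l_neg intro!: bexI[of _ "N +>\<^bsub>M\<^esub> (\<ominus>\<^bsub>M\<^esub> x)"])
    qed
  qed (auto simp: Q M.a_ac)
qed (auto simp: quot_module_simps[OF N] R.is_cring smult_l_distr smult_r_distr smult_assoc1)

definition transport :: "('c \<Rightarrow> 'e) \<Rightarrow> ('a, 'e) module" where
  "transport f = \<lparr>carrier = f ` carrier M, mult = undefined, one = undefined, zero = f \<zero>\<^bsub>M\<^esub>,
     add = (\<lambda>x y. f (inv_into (carrier M) f x \<oplus>\<^bsub>M\<^esub> inv_into (carrier M) f y)),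
     smult = (\<lambda>a x. f (a \<odot>\<^bsub>M\<^esub> inv_into (carrier M) f x))\<rparr>"

lemma transport_module:
  assumes "inj_on f (carrier M)"
  shows "module R (transport f)"
proof (rule moduleI)
  note [simp] = inv_into_f_f[OF assms]
  show "abelian_group (transport f)"
  proof (rule abelian_groupI)
    show "\<exists>y\<in>carrier (transport f). y \<oplus>\<^bsub>transport f\<^esub> A = \<zero>\<^bsub>transport f\<^esub>"
      if A: "A \<in> carrier (transport f)" for A
    proof -
      obtain x where "x \<in> carrier M" "A = f x" using A by (auto simp: transport_def)
      then show ?thesis by (auto simp: transport_def M.l_neg intro!: bexI[of _ "\<ominus>\<^bsub>M\<^esub> x"])
    qed
  qed (auto simp: transport_def M.a_ac)
qed (auto simp: transport_def inv_into_f_f[OF assms] R.is_cring smult_l_distr smult_r_distr smult_assoc1)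

end

lemma cogeneratorD:
  fixes M :: "('k, 'k) module"
  assumes "cogenerator R J" "module R M" "x \<in> carrier M" "x \<noteq> \<zero>\<^bsub>M\<^esub>"
  shows "\<exists>h \<in> lin_maps R M J. h x \<noteq> \<zero>\<^bsub>J\<^esub>"
  using assms unfolding cogenerator_def by blast

text \<open>\<open>cogenerator\<close> only speaks about modules on the type of scalars, so \<open>R/I\<close>, where \<open>I\<close> is the ideal of scalars moving
  \<open>e\<close> into \<open>N\<close>, is transported to a set of coset representatives.\<close>

lemma separate_from_submodule:
  fixes J :: "('k, 'j) module"
  assumes J: "injective_module R J" "cogenerator R J" and M: "module R M" and N: "submodule N R M"
    and e: "e \<in> carrier M" "e \<notin> N"
  obtains h where "h \<in> lin_maps R M J" "h e \<noteq> \<zero>\<^bsub>J\<^esub>" "\<And>x. x \<in> N \<Longrightarrow> h x = \<zero>\<^bsub>J\<^esub>"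
proof -
  interpret M: module R M by fact
  have Jm: "module R J" using J by (simp add: injective_module_def)
  interpret J: module R J by fact
  note S = M.submoduleD[OF N]
  let ?I = "{r \<in> carrier R. r \<odot>\<^bsub>M\<^esub> e \<in> N}"
  interpret K: module R "scalar_module R (carrier R)" by (rule M.R.scalar_module)
  have I: "submodule ?I R (scalar_module R (carrier R))"
    by (rule K.submoduleI') (use e S in \<open>auto simp: M.smult_l_distr M.smult_assoc1\<close>)
  let ?Q = "quot_module (scalar_module R (carrier R)) ?I"
  interpret Q: module R ?Q by (rule K.quot_module_module[OF I])
  let ?c = "\<lambda>r. ?I +>\<^bsub>scalar_module R (carrier R)\<^esub> r"
  note Qs = K.quot_module_simps[OF I, simplified]
  have self: "r \<in> ?c r" if "r \<in> carrier R" for r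
    using abelian_subgroup.a_rcos_self[OF K.submodule_abelian_subgroup[OF I]] that by simp
  let ?f = "\<lambda>A. SOME r. r \<in> A"
  have inj: "inj_on ?f (carrier ?Q)"
  proof (rule inj_onI)
    fix A B assume AB: "A \<in> carrier ?Q" "B \<in> carrier ?Q" "?f A = ?f B"
    obtain r where r: "r \<in> carrier R" "A = ?c r" using AB(1) unfolding Qs(1) by auto
    obtain s where s: "s \<in> carrier R" "B = ?c s" using AB(2) unfolding Qs(1) by auto
    have 1: "?f A \<in> ?c r" unfolding r(2) using self[OF r(1)] by (rule someI)
    have 2: "?f A \<in> ?c s" unfolding AB(3) unfolding s(2) using self[OF s(1)] by (rule someI)
    have rep: "?c r = ?c t" if "t \<in> ?c r" "r \<in> carrier R" for t r
      using abelian_subgroup.a_repr_independence'[OF K.submodule_abelian_subgroup[OF I] that(1)] that(2) by simp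
    show "A = B" unfolding r(2) s(2) using rep[OF 1 r(1)] rep[OF 2 s(1)] by (rule trans[OF _ sym])
  qed
  interpret T: module R "Q.transport ?f" by (rule Q.transport_module[OF inj])
  let ?q = "?f (?c \<one>\<^bsub>R\<^esub>)"
  have c1: "?c \<one>\<^bsub>R\<^esub> \<in> carrier ?Q" using Qs(1) by auto
  have "?c \<zero>\<^bsub>R\<^esub> = ?I"
    using K.M.a_coset_add_zero[of ?I] by auto
  moreover have "\<one>\<^bsub>R\<^esub> \<notin> ?I" using e by simp
  ultimately have "?c \<one>\<^bsub>R\<^esub> \<noteq> ?c \<zero>\<^bsub>R\<^esub>" using self[of "\<one>\<^bsub>R\<^esub>"] by blast
  then have c10: "?c \<one>\<^bsub>R\<^esub> \<noteq> \<zero>\<^bsub>?Q\<^esub>" unfolding Qs(2) .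
  have T_zero: "\<zero>\<^bsub>Q.transport ?f\<^esub> = ?f \<zero>\<^bsub>?Q\<^esub>" and T_carrier: "carrier (Q.transport ?f) = ?f ` carrier ?Q"
    unfolding Q.transport_def by simp_all
  have q0: "?q \<noteq> \<zero>\<^bsub>Q.transport ?f\<^esub>"
    unfolding T_zero using inj_onD[OF inj _ c1 Q.M.zero_closed] c10 by blast
  have q: "?q \<in> carrier (Q.transport ?f)" unfolding T_carrier using c1 by (rule imageI)
  from cogeneratorD[OF J(2) T.module_axioms q q0]
  obtain h0 where h0: "h0 \<in> lin_maps R (Q.transport ?f) J" "h0 ?q \<noteq> \<zero>\<^bsub>J\<^esub>" ..
  let ?y = "h0 ?q"
  have y: "?y \<in> carrier J" using lin_mapsD(1)[OF h0(1) q] .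
  \<comment> \<open>Every scalar that moves \<open>e\<close> into \<open>N\<close> kills
    \<open>?q\<close> and hence \<open>?y\<close>; this is the compatibility needed to send
    \<open>N\<close> to zero and \<open>e\<close> to \<open>?y\<close>.\<close>
  have Iy: "r \<odot>\<^bsub>J\<^esub> ?y = \<zero>\<^bsub>J\<^esub>" if r: "r \<in> ?I" for r
  proof -
    have "r \<odot>\<^bsub>Q.transport ?f\<^esub> ?q = ?f (r \<odot>\<^bsub>?Q\<^esub> ?c \<one>\<^bsub>R\<^esub>)"
      using inv_into_f_f[OF inj c1] by (simp add: Q.transport_def)
    also have "r \<odot>\<^bsub>?Q\<^esub> ?c \<one>\<^bsub>R\<^esub> = ?c r" using Qs(4)[of r "\<one>\<^bsub>R\<^esub>"] r by simp
    also have "?c r = ?c \<zero>\<^bsub>R\<^esub>"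
      using abelian_subgroup.a_repr_independence'[OF K.submodule_abelian_subgroup[OF I], of r "\<zero>\<^bsub>R\<^esub>"] r Qs(2)
      by (metis (no_types, lifting) K.M.zero_closed K.coset_mem_iff[OF I] K.submoduleD(6)[OF I] K.submoduleD(2)[OF I] M.R.zero_closed mem_Collect_eq scalar_module_simps(1,2))
    also have "?f (?c \<zero>\<^bsub>R\<^esub>) = \<zero>\<^bsub>Q.transport ?f\<^esub>" using Qs(2) by (simp add: Q.transport_def)
    finally have "h0 (r \<odot>\<^bsub>Q.transport ?f\<^esub> ?q) = \<zero>\<^bsub>J\<^esub>" using lin_maps_zero[OF T.module_axioms Jm h0(1)] by simp
    then show ?thesis using lin_mapsD(3)[OF h0(1) _ q, of r] r by simp
  qed
  let ?N = "{(n, \<zero>\<^bsub>J\<^esub>) |n. n \<in> N}"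
  let ?G = "{(z \<oplus>\<^bsub>M\<^esub> r \<odot>\<^bsub>M\<^esub> e, w \<oplus>\<^bsub>J\<^esub> r \<odot>\<^bsub>J\<^esub> ?y) |z w r. (z, w) \<in> ?N \<and> r \<in> carrier R}"
  have Nc: "n \<in> carrier M" if "n \<in> N" for n using that S by auto
  have "lin_graph R M J ?N" using S Nc by (auto simp: lin_graph_def)
  then have "lin_graph R M J ?G" by (rule lin_graph_adjoin[OF M Jm _ e(1) y]) (use Iy in auto)
  from lin_graph_extend[OF J(1) M this]
  obtain h where h: "h \<in> lin_maps R M J" and hG: "\<forall>x y. (x, y) \<in> ?G \<longrightarrow> h x = y" ..
  have "(\<zero>\<^bsub>M\<^esub> \<oplus>\<^bsub>M\<^esub> \<one>\<^bsub>R\<^esub> \<odot>\<^bsub>M\<^esub> e, \<zero>\<^bsub>J\<^esub> \<oplus>\<^bsub>J\<^esub> \<one>\<^bsub>R\<^esub> \<odot>\<^bsub>J\<^esub> ?y) \<in> ?G" using S(2) M.R.one_closed by blast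
  from hG[rule_format, OF this] have "h e = ?y" using e y by simp
  moreover have "h n = \<zero>\<^bsub>J\<^esub>" if "n \<in> N" for n
  proof -
    have "(n \<oplus>\<^bsub>M\<^esub> \<zero>\<^bsub>R\<^esub> \<odot>\<^bsub>M\<^esub> e, \<zero>\<^bsub>J\<^esub> \<oplus>\<^bsub>J\<^esub> \<zero>\<^bsub>R\<^esub> \<odot>\<^bsub>J\<^esub> ?y) \<in> ?G" using that M.R.zero_closed by blast
    from hG[rule_format, OF this] show ?thesis using e y Nc[OF that] by simp
  qed
  ultimately show ?thesis using that h h0(2) by simp
qed

text \<open>Exactness of Hom(-, J): sending \<open>f x\<close> to \<open>h x\<close> is well defined
  on the image of \<open>f\<close>, and injectivity extends this partial map to all of
  \<open>N\<close>.\<close>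

lemma factor_through_linear:
  fixes J :: "('k, 'j) module"
  assumes J: "injective_module R J" and M: "module R M" and N: "module R N"
    and f: "\<And>x. x \<in> carrier M \<Longrightarrow> f x \<in> carrier N"
      "\<And>x y. \<lbrakk>x \<in> carrier M; y \<in> carrier M\<rbrakk> \<Longrightarrow> f (x \<oplus>\<^bsub>M\<^esub> y) = f x \<oplus>\<^bsub>N\<^esub> f y"
      "\<And>a x. \<lbrakk>a \<in> carrier R; x \<in> carrier M\<rbrakk> \<Longrightarrow> f (a \<odot>\<^bsub>M\<^esub> x) = a \<odot>\<^bsub>N\<^esub> f x"
    and h: "h \<in> lin_maps R M J" "\<And>x. \<lbrakk>x \<in> carrier M; f x = \<zero>\<^bsub>N\<^esub>\<rbrakk> \<Longrightarrow> h x = \<zero>\<^bsub>J\<^esub>"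
  obtains h' where "h' \<in> lin_maps R N J" "\<And>x. x \<in> carrier M \<Longrightarrow> h x = h' (f x)"
proof -
  interpret M: module R M by fact
  interpret N: module R N by fact
  have Jm: "module R J" using J by (simp add: injective_module_def)
  interpret J: module R J by fact
  note H = lin_mapsD[OF h(1)]
  have f0: "f \<zero>\<^bsub>M\<^esub> = \<zero>\<^bsub>N\<^esub>" using f(1)[of "\<zero>\<^bsub>M\<^esub>"] f(3)[of "\<zero>\<^bsub>R\<^esub>" "\<zero>\<^bsub>M\<^esub>"] by simp
  let ?G = "(\<lambda>x. (f x, h x)) ` carrier M"
  have "lin_graph R N J ?G"
    unfolding lin_graph_def
  proof (intro conjI allI impI ballI)
    show "?G \<subseteq> carrier N \<times> carrier J" using f H by auto
    show "(\<zero>\<^bsub>N\<^esub>, \<zero>\<^bsub>J\<^esub>) \<in> ?G" using f0 lin_maps_zero[OF M Jm h(1)] by (intro image_eqI[of _ _ "\<zero>\<^bsub>M\<^esub>"]) auto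
    show "(u \<oplus>\<^bsub>N\<^esub> u', v \<oplus>\<^bsub>J\<^esub> v') \<in> ?G" if uv: "(u, v) \<in> ?G" "(u', v') \<in> ?G" for u v u' v'
    proof -
      obtain x x' where "x \<in> carrier M" "x' \<in> carrier M" "u = f x" "v = h x" "u' = f x'" "v' = h x'" using uv by auto
      then show ?thesis using f(2) H(2) by (intro image_eqI[of _ _ "x \<oplus>\<^bsub>M\<^esub> x'"]) auto
    qed
    show "(a \<odot>\<^bsub>N\<^esub> u, a \<odot>\<^bsub>J\<^esub> v) \<in> ?G" if a: "a \<in> carrier R" and uv: "(u, v) \<in> ?G" for a u v
    proof -
      obtain x where "x \<in> carrier M" "u = f x" "v = h x" using uv by auto
      then show ?thesis using f(3) H(3) a by (intro image_eqI[of _ _ "a \<odot>\<^bsub>M\<^esub> x"]) auto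
    qed
    show "v = \<zero>\<^bsub>J\<^esub>" if "(\<zero>\<^bsub>N\<^esub>, v) \<in> ?G" for v using that h(2) by auto
  qed
  from lin_graph_extend[OF J N this]
  obtain h' where h': "h' \<in> lin_maps R N J" and hG: "\<forall>x y. (x, y) \<in> ?G \<longrightarrow> h' x = y" ..
  have "h x = h' (f x)" if "x \<in> carrier M" for x
    by (rule hG[rule_format, symmetric]) (use that in auto)
  then show ?thesis using that h' by blast
qed

section \<open>Calculus in linear categories\<close>

context linear_category
begin

abbreviation in_hom :: "'m \<Rightarrow> 'o \<Rightarrow> 'o \<Rightarrow> bool" (\<open>\<guillemotleft>_ : _ \<rightarrow> _\<guillemotright>\<close>)
  where "\<guillemotleft>f : X \<rightarrow> Y\<guillemotright> \<equiv> arr C f \<and> Dom C f = X \<and> Cod C f = Y"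

abbreviation nul :: "'o \<Rightarrow> 'o \<Rightarrow> 'm"
  where "nul X Y \<equiv> \<zero>\<^bsub>Hom C X Y\<^esub>"

text \<open>The Hom module is read off from the domain and codomain of the argument, so that sums of
  composites can be normalized by rewriting without naming objects.\<close>

definition plus :: "'m \<Rightarrow> 'm \<Rightarrow> 'm"  (infixl \<open>\<boxplus>\<close> 65)
  where "f \<boxplus> g = f \<oplus>\<^bsub>Hom C (Dom C f) (Cod C f)\<^esub> g"

definition neg :: "'m \<Rightarrow> 'm"
  where "neg f = \<ominus>\<^bsub>Hom C (Dom C f) (Cod C f)\<^esub> f"

definition scale :: "'k \<Rightarrow> 'm \<Rightarrow> 'm"
  where "scale a f = a \<odot>\<^bsub>Hom C (Dom C f) (Cod C f)\<^esub> f"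

lemma in_hom_iff: "X \<in> Ob C \<Longrightarrow> Y \<in> Ob C \<Longrightarrow> f \<in> mor C X Y \<longleftrightarrow> \<guillemotleft>f : X \<rightarrow> Y\<guillemotright>"
  unfolding arr_def using dom_cod by metis

lemma arr_mor: "arr C f \<Longrightarrow> f \<in> mor C (Dom C f) (Cod C f)"
  by (simp add: arr_def)

lemma arr_obj [simp]: "arr C f \<Longrightarrow> Dom C f \<in> Ob C" "arr C f \<Longrightarrow> Cod C f \<in> Ob C"
  by (auto simp: arr_def)

lemma arr_comp [simp]:
  assumes "arr C f" "arr C g" "Dom C g = Cod C f"
  shows "arr C (g \<cdot> f)" "Dom C (g \<cdot> f) = Dom C f" "Cod C (g \<cdot> f) = Cod C g"
proof -
  have "g \<cdot> f \<in> mor C (Dom C f) (Cod C g)"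
    using assms arr_mor[of f] arr_mor[of g] by (intro comp_closed[of _ "Cod C f"]) auto
  then show "arr C (g \<cdot> f)" "Dom C (g \<cdot> f) = Dom C f" "Cod C (g \<cdot> f) = Cod C g"
    using assms by (simp_all add: in_hom_iff)
qed

lemma arr_ide [simp]:
  assumes "X \<in> Ob C"
  shows "arr C (Ide C X)" "Dom C (Ide C X) = X" "Cod C (Ide C X) = X"
  using ide_closed[OF assms] assms by (simp_all add: in_hom_iff)

lemma arr_nul [simp]:
  assumes "X \<in> Ob C" "Y \<in> Ob C"
  shows "arr C (nul X Y)" "Dom C (nul X Y) = X" "Cod C (nul X Y) = Y"
proof -
  interpret H: module k "Hom C X Y" using hom_module assms .
  show "arr C (nul X Y)" "Dom C (nul X Y) = X" "Cod C (nul X Y) = Y"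
    using H.M.zero_closed unfolding in_hom_iff[OF assms] by simp_all
qed

lemma arr_plus [simp]:
  assumes "arr C f" "arr C g" "Dom C f = Dom C g" "Cod C f = Cod C g"
  shows "arr C (f \<boxplus> g)" "Dom C (f \<boxplus> g) = Dom C g" "Cod C (f \<boxplus> g) = Cod C g"
proof -
  interpret H: module k "Hom C (Dom C f) (Cod C f)" using hom_module assms by simp
  have "f \<boxplus> g \<in> mor C (Dom C f) (Cod C f)" unfolding plus_def
    using arr_mor[of f] arr_mor[of g] assms by (intro H.M.a_closed) auto
  then show "arr C (f \<boxplus> g)" "Dom C (f \<boxplus> g) = Dom C g" "Cod C (f \<boxplus> g) = Cod C g"
    using assms by (simp_all add: in_hom_iff)
qed

lemma arr_neg [simp]:
  assumes "arr C f"
  shows "arr C (neg f)" "Dom C (neg f) = Dom C f" "Cod C (neg f) = Cod C f"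
proof -
  interpret H: module k "Hom C (Dom C f) (Cod C f)" using hom_module assms by simp
  have "neg f \<in> mor C (Dom C f) (Cod C f)" unfolding neg_def
    using arr_mor[of f] assms by (intro H.M.a_inv_closed) auto
  then show "arr C (neg f)" "Dom C (neg f) = Dom C f" "Cod C (neg f) = Cod C f"
    using assms by (simp_all add: in_hom_iff)
qed

lemma arr_scale [simp]:
  assumes "arr C f" "a \<in> carrier k"
  shows "arr C (scale a f)" "Dom C (scale a f) = Dom C f" "Cod C (scale a f) = Cod C f"
proof -
  interpret H: module k "Hom C (Dom C f) (Cod C f)" using hom_module assms by simp
  have "scale a f \<in> mor C (Dom C f) (Cod C f)" unfolding scale_def
    using arr_mor[of f] assms by (intro H.smult_closed) auto
  then show "arr C (scale a f)" "Dom C (scale a f) = Dom C f" "Cod C (scale a f) = Cod C f"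
    using assms by (simp_all add: in_hom_iff)
qed

lemma hom_plus: "\<guillemotleft>f : X \<rightarrow> Y\<guillemotright> \<Longrightarrow> f \<oplus>\<^bsub>Hom C X Y\<^esub> g = f \<boxplus> g"
  by (auto simp: plus_def)

lemma hom_neg: "\<guillemotleft>f : X \<rightarrow> Y\<guillemotright> \<Longrightarrow> \<ominus>\<^bsub>Hom C X Y\<^esub> f = neg f"
  by (auto simp: neg_def)

lemma hom_scale: "\<guillemotleft>f : X \<rightarrow> Y\<guillemotright> \<Longrightarrow> a \<odot>\<^bsub>Hom C X Y\<^esub> f = scale a f"
  by (auto simp: scale_def)

lemma comp_assoc' [simp]:
  "\<lbrakk>arr C f; arr C g; arr C h; Dom C g = Cod C f; Dom C h = Cod C g\<rbrakk> \<Longrightarrow> h \<cdot> g \<cdot> f = h \<cdot> (g \<cdot> f)"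
  using comp_assoc[of "Dom C f" "Cod C f" "Cod C g" "Cod C h" f g h] arr_mor[of f] arr_mor[of g] arr_mor[of h]
  by simp

lemma comp_eq_comp:
  "\<lbrakk>g \<cdot> f = h; arr C x; arr C f; arr C g; Dom C f = Cod C x; Dom C g = Cod C f\<rbrakk> \<Longrightarrow> g \<cdot> (f \<cdot> x) = h \<cdot> x"
  using comp_assoc'[of x f g] by simp

lemma ide_comp' [simp]: "\<lbrakk>arr C f; Cod C f = Y\<rbrakk> \<Longrightarrow> Ide C Y \<cdot> f = f"
  using ide_comp[of "Dom C f" "Cod C f" f] arr_mor[of f] by auto

lemma comp_ide' [simp]: "\<lbrakk>arr C f; Dom C f = X\<rbrakk> \<Longrightarrow> f \<cdot> Ide C X = f"
  using comp_ide[of "Dom C f" "Cod C f" f] arr_mor[of f] by auto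

lemma comp_plus_left [simp]:
  assumes "arr C f" "arr C g" "arr C h" "Dom C g = Dom C h" "Cod C g = Cod C h" "Dom C h = Cod C f"
  shows "(g \<boxplus> h) \<cdot> f = g \<cdot> f \<boxplus> h \<cdot> f"
  using comp_add_left[of "Dom C f" "Cod C f" "Cod C h" f g h] arr_mor[of f] arr_mor[of g] arr_mor[of h] assms
  by (simp add: plus_def)

lemma comp_plus_right [simp]:
  assumes "arr C f" "arr C g" "arr C h" "Dom C f = Dom C g" "Cod C f = Cod C g" "Dom C h = Cod C g"
  shows "h \<cdot> (f \<boxplus> g) = h \<cdot> f \<boxplus> h \<cdot> g"
  using comp_add_right[of "Dom C f" "Cod C f" "Cod C h" f g h] arr_mor[of f] arr_mor[of g] arr_mor[of h] assms
  by (simp add: plus_def)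

lemma comp_scale [simp]:
  assumes "arr C f" "arr C g" "Dom C g = Cod C f" "a \<in> carrier k"
  shows "scale a g \<cdot> f = scale a (g \<cdot> f)" "g \<cdot> scale a f = scale a (g \<cdot> f)"
  using comp_smult_left[of "Dom C f" "Cod C f" "Cod C g" a f g] arr_mor[of f] arr_mor[of g] assms
    comp_smult_right[of "Dom C f" "Cod C f" "Cod C g" a f g]
  by (simp_all add: scale_def)

lemma plus_assoc [simp]:
  assumes "arr C f" "arr C g" "arr C h" "Dom C f = Dom C g" "Dom C g = Dom C h"
    "Cod C f = Cod C g" "Cod C g = Cod C h"
  shows "f \<boxplus> g \<boxplus> h = f \<boxplus> (g \<boxplus> h)"
proof -
  interpret H: module k "Hom C (Dom C h) (Cod C h)" using hom_module assms by simp
  show ?thesis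
    using H.M.a_assoc[of f g h] arr_mor[of f] arr_mor[of g] arr_mor[of h] assms arr_plus[of f g]
    by (simp add: plus_def)
qed

lemma plus_commute:
  assumes "arr C f" "arr C g" "Dom C f = Dom C g" "Cod C f = Cod C g"
  shows "f \<boxplus> g = g \<boxplus> f"
proof -
  interpret H: module k "Hom C (Dom C g) (Cod C g)" using hom_module assms by simp
  show ?thesis
    using H.M.a_comm[of f g] arr_mor[of f] arr_mor[of g] assms by (simp add: plus_def)
qed

lemma plus_left_commute:
  assumes "arr C f" "arr C g" "arr C h" "Dom C f = Dom C g" "Dom C g = Dom C h"
    "Cod C f = Cod C g" "Cod C g = Cod C h"
  shows "f \<boxplus> (g \<boxplus> h) = g \<boxplus> (f \<boxplus> h)"
  unfolding plus_assoc[of f g h, symmetric, OF assms] plus_commute[of f g, OF assms(1,2,4,6)]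
  by (rule plus_assoc) (use assms in auto)

lemma plus_nul [simp]:
  assumes "arr C f" "Dom C f = X" "Cod C f = Y"
  shows "f \<boxplus> nul X Y = f" "nul X Y \<boxplus> f = f"
proof -
  have X: "X \<in> Ob C" "Y \<in> Ob C" using assms by auto
  interpret H: module k "Hom C X Y" using hom_module X .
  show "f \<boxplus> nul X Y = f" "nul X Y \<boxplus> f = f"
    using H.M.l_zero[of f] H.M.r_zero[of f] assms X in_hom_iff[OF X, of f] by (simp_all add: plus_def)
qed

lemma plus_neg [simp]:
  assumes "arr C f"
  shows "f \<boxplus> neg f = nul (Dom C f) (Cod C f)" "neg f \<boxplus> f = nul (Dom C f) (Cod C f)"
proof -
  interpret H: module k "Hom C (Dom C f) (Cod C f)" using hom_module assms by auto
  show "f \<boxplus> neg f = nul (Dom C f) (Cod C f)" "neg f \<boxplus> f = nul (Dom C f) (Cod C f)"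
    using H.M.l_neg[of f] H.M.r_neg[of f] arr_mor[of f] assms arr_neg[of f] by (simp_all add: plus_def neg_def)
qed

lemma plus_cancel:
  assumes "arr C f" "arr C g" "arr C h" "Dom C f = Dom C g" "Dom C g = Dom C h"
    "Cod C f = Cod C g" "Cod C g = Cod C h"
  shows "h \<boxplus> f = h \<boxplus> g \<longleftrightarrow> f = g"
proof -
  interpret H: module k "Hom C (Dom C h) (Cod C h)" using hom_module assms by simp
  show ?thesis
    using H.M.add.right_cancel[of h f g] arr_mor[of f] arr_mor[of g] arr_mor[of h] assms
      plus_commute[of h f] plus_commute[of h g]
    by (simp add: plus_def)
qed

lemma plus_self_nul:
  assumes "arr C f" "f \<boxplus> f = f"
  shows "f = nul (Dom C f) (Cod C f)"
  using plus_cancel[of f "nul (Dom C f) (Cod C f)" f] assms by simp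

lemma comp_nul [simp]:
  assumes "arr C f" "X \<in> Ob C"
  shows "f \<cdot> nul X (Dom C f) = nul X (Cod C f)" "nul (Cod C f) X \<cdot> f = nul (Dom C f) X"
  using plus_self_nul[of "f \<cdot> nul X (Dom C f)"] plus_self_nul[of "nul (Cod C f) X \<cdot> f"] assms
    comp_plus_right[of "nul X (Dom C f)" "nul X (Dom C f)" f]
    comp_plus_left[of f "nul (Cod C f) X" "nul (Cod C f) X"] by simp_all

lemma comp_nul' [simp]:
  assumes "arr C f" "X \<in> Ob C"
  shows "Dom C f = Y \<Longrightarrow> f \<cdot> nul X Y = nul X (Cod C f)" "Cod C f = Y \<Longrightarrow> nul Y X \<cdot> f = nul (Dom C f) X"
  using assms by auto

lemma comp_neg [simp]:
  assumes "arr C f" "arr C g" "Dom C g = Cod C f"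
  shows "g \<cdot> neg f = neg (g \<cdot> f)" "neg g \<cdot> f = neg (g \<cdot> f)"
proof -
  have "g \<cdot> f \<boxplus> g \<cdot> neg f = g \<cdot> f \<boxplus> neg (g \<cdot> f)"
    using assms comp_plus_right[of f "neg f" g] by (simp del: comp_plus_right)
  then show "g \<cdot> neg f = neg (g \<cdot> f)"
    by (rule iffD1[OF plus_cancel, rotated -1]) (use assms in auto)
  have "g \<cdot> f \<boxplus> neg g \<cdot> f = g \<cdot> f \<boxplus> neg (g \<cdot> f)"
    using assms comp_plus_left[of f g "neg g"] by (simp del: comp_plus_left)
  then show "neg g \<cdot> f = neg (g \<cdot> f)"
    by (rule iffD1[OF plus_cancel, rotated -1]) (use assms in auto)
qed

lemma neg_nul [simp]: "X \<in> Ob C \<Longrightarrow> Y \<in> Ob C \<Longrightarrow> neg (nul X Y) = nul X Y"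
  using plus_neg(1)[of "nul X Y"] plus_nul(2)[of "neg (nul X Y)" X Y] by simp

lemma plus_diff_cancel:
  assumes "arr C f" "arr C g" "Dom C f = Dom C g" "Cod C f = Cod C g"
  shows "f \<boxplus> (g \<boxplus> neg f) = g"
  by (subst plus_left_commute) (use assms in auto)

lemma iso_inverse:
  assumes "is_iso C f"
  obtains g where "\<guillemotleft>g : Cod C f \<rightarrow> Dom C f\<guillemotright>" "g \<cdot> f = Ide C (Dom C f)" "f \<cdot> g = Ide C (Cod C f)"
proof -
  have "arr C f" using assms by (simp add: is_iso_def)
  then show ?thesis using assms that by (auto simp: is_iso_def in_hom_iff)
qed

lemma isoI:
  assumes "\<guillemotleft>f : X \<rightarrow> Y\<guillemotright>" "\<guillemotleft>g : Y \<rightarrow> X\<guillemotright>" "g \<cdot> f = Ide C X" "f \<cdot> g = Ide C Y"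
  shows "is_iso C f"
  using assms arr_mor[of g] by (auto simp: is_iso_def)

lemma iso_ide: "X \<in> Ob C \<Longrightarrow> is_iso C (Ide C X)"
  by (rule isoI[of _ X X "Ide C X"]) auto

section \<open>Biproducts\<close>

lemma biproductD:
  assumes "is_biproduct C A B S \<iota> \<pi>"
  shows "A \<in> Ob C" "B \<in> Ob C" "S \<in> Ob C"
    "\<guillemotleft>fst \<iota> : A \<rightarrow> S\<guillemotright>" "\<guillemotleft>snd \<iota> : B \<rightarrow> S\<guillemotright>" "\<guillemotleft>fst \<pi> : S \<rightarrow> A\<guillemotright>" "\<guillemotleft>snd \<pi> : S \<rightarrow> B\<guillemotright>"
    "fst \<pi> \<cdot> fst \<iota> = Ide C A" "snd \<pi> \<cdot> snd \<iota> = Ide C B"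
    "snd \<pi> \<cdot> fst \<iota> = nul A B" "fst \<pi> \<cdot> snd \<iota> = nul B A"
    "fst \<iota> \<cdot> fst \<pi> \<boxplus> snd \<iota> \<cdot> snd \<pi> = Ide C S"
proof -
  show 1: "A \<in> Ob C" "B \<in> Ob C" "S \<in> Ob C"
    using assms by (auto simp: is_biproduct_def)
  show "\<guillemotleft>fst \<iota> : A \<rightarrow> S\<guillemotright>" "\<guillemotleft>snd \<iota> : B \<rightarrow> S\<guillemotright>" "\<guillemotleft>fst \<pi> : S \<rightarrow> A\<guillemotright>" "\<guillemotleft>snd \<pi> : S \<rightarrow> B\<guillemotright>"
    "fst \<pi> \<cdot> fst \<iota> = Ide C A" "snd \<pi> \<cdot> snd \<iota> = Ide C B"
    "snd \<pi> \<cdot> fst \<iota> = nul A B" "fst \<pi> \<cdot> snd \<iota> = nul B A"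
    "fst \<iota> \<cdot> fst \<pi> \<boxplus> snd \<iota> \<cdot> snd \<pi> = Ide C S"
    using assms 1 by (auto simp: is_biproduct_def in_hom_iff hom_plus)
qed

lemma biproduct_comp:
  assumes "is_biproduct C A B S \<iota> \<pi>"
  shows "\<lbrakk>arr C x; Cod C x = A\<rbrakk> \<Longrightarrow> fst \<pi> \<cdot> (fst \<iota> \<cdot> x) = x" "\<lbrakk>arr C x; Cod C x = B\<rbrakk> \<Longrightarrow> snd \<pi> \<cdot> (snd \<iota> \<cdot> x) = x"
    "\<lbrakk>arr C x; Cod C x = A\<rbrakk> \<Longrightarrow> snd \<pi> \<cdot> (fst \<iota> \<cdot> x) = nul (Dom C x) B"
    "\<lbrakk>arr C x; Cod C x = B\<rbrakk> \<Longrightarrow> fst \<pi> \<cdot> (snd \<iota> \<cdot> x) = nul (Dom C x) A"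
proof -
  note B = biproductD[OF assms]
  show "fst \<pi> \<cdot> (fst \<iota> \<cdot> x) = x" if "arr C x" "Cod C x = A"
    using comp_eq_comp[OF B(8), of x] B(1-7) that by simp
  show "snd \<pi> \<cdot> (snd \<iota> \<cdot> x) = x" if "arr C x" "Cod C x = B"
    using comp_eq_comp[OF B(9), of x] B(1-7) that by simp
  show "snd \<pi> \<cdot> (fst \<iota> \<cdot> x) = nul (Dom C x) B" if "arr C x" "Cod C x = A"
    using comp_eq_comp[OF B(10), of x] B(1-7) that by simp
  show "fst \<pi> \<cdot> (snd \<iota> \<cdot> x) = nul (Dom C x) A" if "arr C x" "Cod C x = B"
    using comp_eq_comp[OF B(11), of x] B(1-7) that by simp
qed

lemma biproduct_decomp:
  assumes "is_biproduct C A B S \<iota> \<pi>"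
  shows "\<lbrakk>arr C f; Dom C f = S\<rbrakk> \<Longrightarrow> f \<cdot> (fst \<iota> \<cdot> fst \<pi>) \<boxplus> f \<cdot> (snd \<iota> \<cdot> snd \<pi>) = f"
    "\<lbrakk>arr C f; Cod C f = S\<rbrakk> \<Longrightarrow> fst \<iota> \<cdot> (fst \<pi> \<cdot> f) \<boxplus> snd \<iota> \<cdot> (snd \<pi> \<cdot> f) = f"
proof -
  note B = biproductD[OF assms]
  show "f \<cdot> (fst \<iota> \<cdot> fst \<pi>) \<boxplus> f \<cdot> (snd \<iota> \<cdot> snd \<pi>) = f" if f: "arr C f" "Dom C f = S"
  proof -
    have "f = f \<cdot> (fst \<iota> \<cdot> fst \<pi> \<boxplus> snd \<iota> \<cdot> snd \<pi>)" unfolding B(12) using f by simp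
    also have "\<dots> = f \<cdot> (fst \<iota> \<cdot> fst \<pi>) \<boxplus> f \<cdot> (snd \<iota> \<cdot> snd \<pi>)" by (rule comp_plus_right) (use B f in auto)
    finally show ?thesis by simp
  qed
  show "fst \<iota> \<cdot> (fst \<pi> \<cdot> f) \<boxplus> snd \<iota> \<cdot> (snd \<pi> \<cdot> f) = f" if f: "arr C f" "Cod C f = S"
  proof -
    have "f = (fst \<iota> \<cdot> fst \<pi> \<boxplus> snd \<iota> \<cdot> snd \<pi>) \<cdot> f" unfolding B(12) using f by simp
    also have "\<dots> = fst \<iota> \<cdot> fst \<pi> \<cdot> f \<boxplus> snd \<iota> \<cdot> snd \<pi> \<cdot> f" by (rule comp_plus_left) (use B f in auto)
    finally show ?thesis using B(4-7) f by simp
  qed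
qed

lemma biproduct_swap:
  assumes "is_biproduct C A B S \<iota> \<pi>"
  shows "is_biproduct C B A S (prod.swap \<iota>) (prod.swap \<pi>)"
  using assms biproductD[OF assms] plus_commute[of "fst \<iota> \<cdot> fst \<pi>" "snd \<iota> \<cdot> snd \<pi>"]
  by (simp add: is_biproduct_def hom_plus)

lemma scale_add:
  assumes "arr C f" "a \<in> carrier k" "b \<in> carrier k"
  shows "scale (a \<oplus>\<^bsub>k\<^esub> b) f = scale a f \<boxplus> scale b f" "scale (a \<otimes>\<^bsub>k\<^esub> b) f = scale a (scale b f)"
    "scale \<one>\<^bsub>k\<^esub> f = f"
proof -
  interpret H: module k "Hom C (Dom C f) (Cod C f)" using hom_module assms by simp
  show "scale (a \<oplus>\<^bsub>k\<^esub> b) f = scale a f \<boxplus> scale b f" "scale (a \<otimes>\<^bsub>k\<^esub> b) f = scale a (scale b f)"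
    "scale \<one>\<^bsub>k\<^esub> f = f"
    using H.smult_l_distr[of a b f] H.smult_assoc1[of a b f] H.smult_one[of f] arr_mor[of f] assms
      arr_scale[of f a] arr_scale[of f b]
    by (simp_all add: plus_def scale_def)
qed

end

section \<open>Morphisms of conflations\<close>

context exact_category
begin

lemma conflD:
  assumes "(i, d) \<in> Confl C"
  shows "arr C i" "arr C d" "Cod C i = Dom C d" "d \<cdot> i = nul (Dom C i) (Cod C d)"
  using kernel_cokernel[OF assms] by (auto simp: is_kernel_def)

lemma kernel_lift:
  assumes "(i, d) \<in> Confl C" "arr C f" "Cod C f = Dom C d" "d \<cdot> f = nul (Dom C f) (Cod C d)"
  obtains u where "\<guillemotleft>u : Dom C f \<rightarrow> Dom C i\<guillemotright>" "i \<cdot> u = f"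
proof -
  have "is_kernel C i d" using kernel_cokernel assms(1) by blast
  then have "\<exists>!u. u \<in> mor C (Dom C f) (Dom C i) \<and> i \<cdot> u = f"
    using assms arr_mor[of f] unfolding is_kernel_def by (metis arr_obj(1))
  then show ?thesis using that conflD[OF assms(1)] assms(2) by (auto simp: in_hom_iff)
qed

lemma inflation_cancel:
  assumes "(i, d) \<in> Confl C" "arr C u" "arr C v" "Dom C u = Dom C v" "Cod C u = Dom C i" "Cod C v = Dom C i"
    "i \<cdot> u = i \<cdot> v"
  shows "u = v"
proof -
  note I = conflD[OF assms(1)]
  have "is_kernel C i d" using kernel_cokernel assms(1) by blast
  moreover have "d \<cdot> (i \<cdot> v) = nul (Dom C v) (Cod C d)"
    using I assms comp_assoc'[of v i d] by (simp del: comp_assoc')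
  moreover have "i \<cdot> v \<in> mor C (Dom C v) (Dom C d)" "u \<in> mor C (Dom C v) (Dom C i)" "v \<in> mor C (Dom C v) (Dom C i)"
    using I assms by (auto simp: in_hom_iff)
  ultimately show ?thesis using assms arr_obj(1)[OF assms(3)] unfolding is_kernel_def by metis
qed

lemma cokernel_lift:
  assumes "(i, d) \<in> Confl C" "arr C f" "Dom C f = Dom C d" "f \<cdot> i = nul (Dom C i) (Cod C f)"
  obtains u where "\<guillemotleft>u : Cod C d \<rightarrow> Cod C f\<guillemotright>" "u \<cdot> d = f"
proof -
  note I = conflD[OF assms(1)]
  have "is_cokernel C d i" using kernel_cokernel assms(1) by blast
  then have "\<exists>!u. u \<in> mor C (Cod C d) (Cod C f) \<and> u \<cdot> d = f"
    using I assms arr_mor[of f] unfolding is_cokernel_def by (metis arr_obj(2))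
  then show ?thesis using that conflD[OF assms(1)] assms(2) by (auto simp: in_hom_iff)
qed

lemma deflation_cancel:
  assumes "(i, d) \<in> Confl C" "arr C u" "arr C v" "Cod C u = Cod C v" "Dom C u = Cod C d" "Dom C v = Cod C d"
    "u \<cdot> d = v \<cdot> d"
  shows "u = v"
proof -
  note I = conflD[OF assms(1)]
  have "is_cokernel C d i" using kernel_cokernel assms(1) by blast
  moreover have "v \<cdot> d \<cdot> i = nul (Dom C i) (Cod C v)"
    using I assms by simp
  moreover have "v \<cdot> d \<in> mor C (Cod C i) (Cod C v)" "u \<in> mor C (Cod C d) (Cod C v)" "v \<in> mor C (Cod C d) (Cod C v)"
    using I assms by (auto simp: in_hom_iff)
  ultimately show ?thesis using assms arr_obj(2)[OF assms(3)] unfolding is_cokernel_def by metis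
qed

section \<open>Pullback and pushout squares\<close>

lemma pullback_squareD:
  assumes "pullback_square C f g p q"
  shows "arr C f" "arr C g" "arr C p" "arr C q" "Cod C f = Cod C g" "Cod C p = Dom C f" "Cod C q = Dom C g"
    "Dom C p = Dom C q" "f \<cdot> p = g \<cdot> q"
  using assms by (auto simp: pullback_square_def)

lemma pullback_ex1:
  assumes "pullback_square C f g p q" "arr C u" "arr C v" "Dom C u = Dom C v" "Cod C u = Dom C f"
    "Cod C v = Dom C g" "f \<cdot> u = g \<cdot> v"
  shows "\<exists>!w. w \<in> mor C (Dom C u) (Dom C p) \<and> p \<cdot> w = u \<and> q \<cdot> w = v"
  using assms arr_mor[of u] arr_mor[of v] arr_obj(1)[of u] unfolding pullback_square_def by metis

lemma pullback_lift:
  assumes "pullback_square C f g p q" "arr C u" "arr C v" "Dom C u = Dom C v" "Cod C u = Dom C f"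
    "Cod C v = Dom C g" "f \<cdot> u = g \<cdot> v"
  obtains w where "\<guillemotleft>w : Dom C u \<rightarrow> Dom C p\<guillemotright>" "p \<cdot> w = u" "q \<cdot> w = v"
  using pullback_ex1[OF assms] that assms pullback_squareD[OF assms(1)] by (auto simp: in_hom_iff)

lemma pullback_cancel:
  assumes "pullback_square C f g p q" "arr C u" "arr C v" "Dom C u = Dom C v" "Cod C u = Dom C p"
    "Cod C v = Dom C p" "p \<cdot> u = p \<cdot> v" "q \<cdot> u = q \<cdot> v"
  shows "u = v"
proof -
  note P = pullback_squareD[OF assms(1)]
  have "\<exists>!w. w \<in> mor C (Dom C (p \<cdot> v)) (Dom C p) \<and> p \<cdot> w = p \<cdot> v \<and> q \<cdot> w = q \<cdot> v"
    using P assms comp_assoc'[of v p f] comp_assoc'[of v q g]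
    by (intro pullback_ex1[OF assms(1)]) (simp_all del: comp_assoc')
  moreover have "u \<in> mor C (Dom C (p \<cdot> v)) (Dom C p)" "v \<in> mor C (Dom C (p \<cdot> v)) (Dom C p)"
    using P assms by (auto simp: in_hom_iff)
  ultimately show ?thesis using assms by blast
qed

lemma pushout_squareD:
  assumes "pushout_square C f g p q"
  shows "arr C f" "arr C g" "arr C p" "arr C q" "Dom C f = Dom C g" "Dom C p = Cod C f" "Dom C q = Cod C g"
    "Cod C p = Cod C q" "p \<cdot> f = q \<cdot> g"
  using assms by (auto simp: pushout_square_def)

lemma pushout_ex1:
  assumes "pushout_square C f g p q" "arr C u" "arr C v" "Cod C u = Cod C v" "Dom C u = Cod C f"
    "Dom C v = Cod C g" "u \<cdot> f = v \<cdot> g"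
  shows "\<exists>!w. w \<in> mor C (Cod C p) (Cod C u) \<and> w \<cdot> p = u \<and> w \<cdot> q = v"
  using assms arr_mor[of u] arr_mor[of v] arr_obj(2)[of u] unfolding pushout_square_def by metis

lemma pushout_lift:
  assumes "pushout_square C f g p q" "arr C u" "arr C v" "Cod C u = Cod C v" "Dom C u = Cod C f"
    "Dom C v = Cod C g" "u \<cdot> f = v \<cdot> g"
  obtains w where "\<guillemotleft>w : Cod C p \<rightarrow> Cod C u\<guillemotright>" "w \<cdot> p = u" "w \<cdot> q = v"
  using pushout_ex1[OF assms] that assms pushout_squareD[OF assms(1)] by (auto simp: in_hom_iff)

lemma pushout_cancel:
  assumes "pushout_square C f g p q" "arr C u" "arr C v" "Cod C u = Cod C v" "Dom C u = Cod C p"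
    "Dom C v = Cod C p" "u \<cdot> p = v \<cdot> p" "u \<cdot> q = v \<cdot> q"
  shows "u = v"
proof -
  note P = pushout_squareD[OF assms(1)]
  have "\<exists>!w. w \<in> mor C (Cod C p) (Cod C (v \<cdot> p)) \<and> w \<cdot> p = v \<cdot> p \<and> w \<cdot> q = v \<cdot> q"
    using P assms by (intro pushout_ex1[OF assms(1)]) simp_all
  moreover have "u \<in> mor C (Cod C p) (Cod C (v \<cdot> p))" "v \<in> mor C (Cod C p) (Cod C (v \<cdot> p))"
    using P assms by (auto simp: in_hom_iff)
  ultimately show ?thesis using assms by blast
qed

text \<open>The inflation of any conflation of \<open>q\<close> factors through \<open>j\<close>, so
  killing \<open>j\<close> is enough for the cokernel property. This is used where the kernel of a
  pulled back deflation is only known by hand.\<close>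

lemma deflation_lift_any_kernel:
  assumes "deflation C q" "\<guillemotleft>j : Y \<rightarrow> Dom C q\<guillemotright>" "q \<cdot> j = nul Y (Cod C q)"
    and ker: "\<And>t. arr C t \<Longrightarrow> Cod C t = Dom C q \<Longrightarrow> q \<cdot> t = nul (Dom C t) (Cod C q)
      \<Longrightarrow> \<exists>u. \<guillemotleft>u : Dom C t \<rightarrow> Y\<guillemotright> \<and> j \<cdot> u = t"
    and f: "arr C f" "Dom C f = Dom C q" "f \<cdot> j = nul Y (Cod C f)"
  obtains u where "\<guillemotleft>u : Cod C q \<rightarrow> Cod C f\<guillemotright>" "u \<cdot> q = f"
proof -
  obtain i where i: "(i, q) \<in> Confl C" using assms(1) by (auto simp: deflation_def)
  note I = conflD[OF i]
  obtain u where u: "\<guillemotleft>u : Dom C i \<rightarrow> Y\<guillemotright>" "j \<cdot> u = i" using ker[of i] I by auto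
  have "f \<cdot> i = (f \<cdot> j) \<cdot> u"
    using comp_assoc'[of u j f] u f assms(2) by (simp del: comp_assoc')
  also have "\<dots> = nul (Dom C i) (Cod C f)" unfolding f(3) using u f by simp
  finally show ?thesis using cokernel_lift[OF i f(1,2)] that by blast
qed

text \<open>In terms of elements, the inverse of \<open>v\<close> is found on pairs
  \<open>(e, e')\<close> of the pullback of \<open>d\<close> and \<open>d'\<close>. There
  \<open>e' - v e\<close> has the form \<open>i' r\<close>, so \<open>v\<close> maps
  \<open>e + i r\<close>, the morphism \<open>?q\<close>, to \<open>e'\<close>. It depends only on
  \<open>e'\<close>, because it vanishes on pairs \<open>(e, 0)\<close>, and so factors through the
  second projection as \<open>w\<close>.\<close>

lemma short_five:
  assumes xi: "(i, d) \<in> Confl C" "(i', d') \<in> Confl C"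
    and v: "\<guillemotleft>v : Dom C d \<rightarrow> Dom C d'\<guillemotright>" "v \<cdot> i = i'" "d' \<cdot> v = d"
  shows "is_iso C v"
proof -
  note I = conflD[OF xi(1)] and I' = conflD[OF xi(2)]
  have Y: "Dom C i' = Dom C i" and X: "Cod C d' = Cod C d"
    using I I' v arr_comp(2)[of i v] arr_comp(3)[of v d'] by auto
  have "\<exists>h q. pullback_square C d d' h q \<and> deflation C q"
    by (rule pullback_deflation) (use xi I I' X in \<open>auto simp: deflation_def\<close>)
  then obtain p1 p2 where P: "pullback_square C d d' p1 p2" and defl: "deflation C p2" by blast
  note sq = pullback_squareD[OF P]
  \<comment> \<open>\<open>s\<close> is the pair \<open>(1, v)\<close> and \<open>j\<close> the pair
    \<open>(i, 0)\<close>; the latter is a kernel of the second projection.\<close>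
  obtain s where s: "\<guillemotleft>s : Dom C d \<rightarrow> Dom C p1\<guillemotright>" "p1 \<cdot> s = Ide C (Dom C d)" "p2 \<cdot> s = v"
    by (rule pullback_lift[OF P, of "Ide C (Dom C d)" v]) (use I I' v in auto)
  obtain j where j: "\<guillemotleft>j : Dom C i \<rightarrow> Dom C p1\<guillemotright>" "p1 \<cdot> j = i" "p2 \<cdot> j = nul (Dom C i) (Dom C d')"
    by (rule pullback_lift[OF P, of i "nul (Dom C i) (Dom C d')"]) (use I I' v X in auto)
  let ?t = "p2 \<boxplus> neg (v \<cdot> p1)"
  have t: "\<guillemotleft>?t : Dom C p1 \<rightarrow> Dom C d'\<guillemotright>" using sq v by simp
  have "d' \<cdot> (v \<cdot> p1) = d \<cdot> p1" using sq v I' comp_assoc'[of p1 v d'] by (simp del: comp_assoc')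
  then have "d' \<cdot> ?t = nul (Dom C ?t) (Cod C d')" using sq v I' by simp
  then obtain r where r: "\<guillemotleft>r : Dom C p1 \<rightarrow> Dom C i\<guillemotright>" "i' \<cdot> r = ?t"
    using kernel_lift[OF xi(2), of ?t] t Y by auto
  have "i' \<cdot> (r \<cdot> j) = ?t \<cdot> j" using r j I' Y comp_assoc'[of j r i'] by (simp del: comp_assoc')
  also have "\<dots> = neg i'" using sq v j I I' Y by simp
  also have "\<dots> = i' \<cdot> neg (Ide C (Dom C i))" using I I' Y by simp
  finally have rj: "r \<cdot> j = neg (Ide C (Dom C i))"
    by (rule inflation_cancel[OF xi(2), rotated -1]) (use r j I Y in auto)
  have "i' \<cdot> (r \<cdot> s) = ?t \<cdot> s" using r s I' Y comp_assoc'[of s r i'] by (simp del: comp_assoc')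
  also have "\<dots> = i' \<cdot> nul (Dom C d) (Dom C i)" using sq v s I I' Y by simp
  finally have rs: "r \<cdot> s = nul (Dom C d) (Dom C i)"
    by (rule inflation_cancel[OF xi(2), rotated -1]) (use r s I Y in auto)
  let ?q = "p1 \<boxplus> i \<cdot> r"
  have q: "\<guillemotleft>?q : Dom C p1 \<rightarrow> Dom C d\<guillemotright>" using sq r I by simp
  obtain w where w: "\<guillemotleft>w : Dom C d' \<rightarrow> Dom C d\<guillemotright>" "w \<cdot> p2 = ?q"
  proof (rule deflation_lift_any_kernel[OF defl, of j "Dom C i" ?q])
    show "\<guillemotleft>j : Dom C i \<rightarrow> Dom C p2\<guillemotright>" "p2 \<cdot> j = nul (Dom C i) (Cod C p2)" "arr C ?q" "Dom C ?q = Dom C p2"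
      using j sq I r by auto
    show "?q \<cdot> j = nul (Dom C i) (Cod C ?q)"
      using j sq I r rj by simp
    show "\<exists>u. \<guillemotleft>u : Dom C t \<rightarrow> Dom C i\<guillemotright> \<and> j \<cdot> u = t"
      if t: "arr C t" "Cod C t = Dom C p2" "p2 \<cdot> t = nul (Dom C t) (Cod C p2)" for t
    proof -
      have "d \<cdot> (p1 \<cdot> t) = d' \<cdot> (p2 \<cdot> t)"
        using comp_assoc'[of t p1 d] comp_assoc'[of t p2 d'] sq t by (simp del: comp_assoc')
      then have "d \<cdot> (p1 \<cdot> t) = nul (Dom C (p1 \<cdot> t)) (Cod C d)"
        using t sq I' by simp
      then obtain u where u: "\<guillemotleft>u : Dom C t \<rightarrow> Dom C i\<guillemotright>" "i \<cdot> u = p1 \<cdot> t"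
        using kernel_lift[OF xi(1), of "p1 \<cdot> t"] t sq by auto
      have e1: "p1 \<cdot> (j \<cdot> u) = p1 \<cdot> t"
        using u(1) j(1) sq unfolding u(2)[symmetric] by (intro comp_eq_comp[OF j(2)]) auto
      have "p2 \<cdot> (j \<cdot> u) = nul (Dom C i) (Dom C d') \<cdot> u"
        using u(1) j(1) sq by (intro comp_eq_comp[OF j(3)]) auto
      then have e2: "p2 \<cdot> (j \<cdot> u) = p2 \<cdot> t" using u(1) t sq(4,7,8) I' by simp
      have "j \<cdot> u = t"
        by (rule pullback_cancel[OF P _ _ _ _ _ e1 e2]) (use u(1) j(1) sq(8) t(1,2) in auto)
      with u show ?thesis by blast
    qed
  qed (use sq I' q in auto)
  show ?thesis
  proof (rule isoI[OF v(1) w(1)])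
    have "w \<cdot> v = ?q \<cdot> s" using w s sq comp_assoc'[of s p2 w] by (simp del: comp_assoc')
    also have "\<dots> = Ide C (Dom C d)" using s sq r rs I by simp
    finally show "w \<cdot> v = Ide C (Dom C d)" .
    have "v \<cdot> w \<cdot> p2 = v \<cdot> ?q" using w v sq by simp
    also have "\<dots> = v \<cdot> p1 \<boxplus> i' \<cdot> r"
      using v sq r I comp_assoc'[of r i v] by (simp del: comp_assoc')
    also have "\<dots> = p2" unfolding r(2)
      by (rule plus_diff_cancel) (use sq(3,4,6,7,8) v(1) in auto)
    finally have *: "v \<cdot> w \<cdot> p2 = Ide C (Dom C d') \<cdot> p2" using sq by simp
    obtain i2 where "(i2, p2) \<in> Confl C" using defl by (auto simp: deflation_def)
    then show "v \<cdot> w = Ide C (Dom C d')"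
      by (rule deflation_cancel[OF _ _ _ _ _ _ *]) (use v w sq I' in auto)
  qed
qed

text \<open>The axiom says only that \<open>i'\<close> is an inflation, with some cokernel
  \<open>d''\<close>. The morphism \<open>d'\<close> induced by \<open>d\<close> and zero differs
  from \<open>d''\<close> by an isomorphism \<open>c\<close>, whose inverse is induced by
  \<open>d'' h\<close>; closure under isomorphism then puts \<open>d'\<close> in place of
  \<open>d''\<close>.\<close>

lemma pushout_conflation:
  assumes xi: "(i, d) \<in> Confl C" and g: "arr C g" "Dom C g = Dom C i"
  obtains h i' d' where "pushout_square C i g h i'" "(i', d') \<in> Confl C" "d' \<cdot> h = d" "Cod C d' = Cod C d"
proof -
  note I = conflD[OF xi]
  have "\<exists>h i'. pushout_square C i g h i' \<and> inflation C i'"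
    by (rule pushout_inflation) (use xi g in \<open>auto simp: inflation_def\<close>)
  then obtain h i' d'' where P: "pushout_square C i g h i'" and xi': "(i', d'') \<in> Confl C"
    by (auto simp: inflation_def)
  note sq = pushout_squareD[OF P] and I' = conflD[OF xi']
  obtain d' where d': "\<guillemotleft>d' : Cod C i' \<rightarrow> Cod C d\<guillemotright>" "d' \<cdot> h = d" "d' \<cdot> i' = nul (Dom C i') (Cod C d)"
    by (rule pushout_lift[OF P, of d "nul (Dom C i') (Cod C d)"]) (use sq I I' g in auto)
  obtain c where c: "\<guillemotleft>c : Cod C d'' \<rightarrow> Cod C d\<guillemotright>" "c \<cdot> d'' = d'"
    using cokernel_lift[OF xi', of d'] d' I' by auto
  have "d'' \<cdot> h \<cdot> i = d'' \<cdot> (i' \<cdot> g)" using sq I I' g by simp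
  also have "\<dots> = nul (Dom C i') (Cod C d'') \<cdot> g"
    by (rule comp_eq_comp[OF I'(4)]) (use sq I' g in auto)
  also have "\<dots> = nul (Dom C i) (Cod C d'')" using I' sq by simp
  finally obtain c' where c': "\<guillemotleft>c' : Cod C d \<rightarrow> Cod C d''\<guillemotright>" "c' \<cdot> d = d'' \<cdot> h"
    using cokernel_lift[OF xi, of "d'' \<cdot> h"] sq I I' by auto
  have c'd': "c' \<cdot> d' = d''"
  proof (rule pushout_cancel[OF P])
    show "c' \<cdot> d' \<cdot> h = d'' \<cdot> h" "c' \<cdot> d' \<cdot> i' = d'' \<cdot> i'" using c' d' sq I' by simp_all
  qed (use c' d' sq I' in auto)
  have 1: "c' \<cdot> c \<cdot> d'' = Ide C (Cod C d'') \<cdot> d''" using c c' c'd' I' by simp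
  have "c \<cdot> c' \<cdot> d = c \<cdot> (d'' \<cdot> h)" using c(1) c' I by simp
  also have "\<dots> = d' \<cdot> h" by (rule comp_eq_comp[OF c(2)]) (use c(1) sq I' in auto)
  also have "\<dots> = Ide C (Cod C d) \<cdot> d" using c d' I by simp
  finally have 2: "c \<cdot> c' \<cdot> d = Ide C (Cod C d) \<cdot> d" .
  have "is_iso C c"
    using c c' I I' deflation_cancel[OF xi' _ _ _ _ _ 1] deflation_cancel[OF xi _ _ _ _ _ 2]
    by (intro isoI[of c _ _ c']) auto
  have "(i', d') \<in> Confl C"
    by (rule confl_iso_closed[OF xi', of _ _ "Ide C (Dom C i')" "Ide C (Cod C i')" c])
      (use \<open>is_iso C c\<close> c d' I I' in \<open>simp_all add: iso_ide in_hom_iff\<close>)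
  then show ?thesis using that P d' by simp
qed

text \<open>The comparison \<open>u\<close> with a true pushout along \<open>g\<close> commutes with
  the inflations and the deflations, hence is invertible by \<open>short_five\<close>.\<close>

lemma pushout_square_of_mor:
  assumes xi: "(i, d) \<in> Confl C" "(i', d') \<in> Confl C"
    and g: "\<guillemotleft>g : Dom C i \<rightarrow> Dom C i'\<guillemotright>" and b: "\<guillemotleft>b : Cod C i \<rightarrow> Cod C i'\<guillemotright>" "b \<cdot> i = i' \<cdot> g" "d' \<cdot> b = d"
  shows "pushout_square C i g b i'"
proof -
  note I = conflD[OF xi(1)] and I' = conflD[OF xi(2)]
  obtain h j e where P: "pushout_square C i g h j" and je: "(j, e) \<in> Confl C" "e \<cdot> h = d" "Cod C e = Cod C d"
    using pushout_conflation[OF xi(1), of g] g by metis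
  note sq = pushout_squareD[OF P] and J = conflD[OF je(1)]
  have X: "Cod C d' = Cod C d" using b I I' arr_comp(3)[of b d'] by auto
  obtain u where u: "\<guillemotleft>u : Cod C h \<rightarrow> Cod C i'\<guillemotright>" "u \<cdot> h = b" "u \<cdot> j = i'"
    by (rule pushout_lift[OF P, of b i']) (use sq I I' g b in auto)
  have "d' \<cdot> u = e"
    by (rule pushout_cancel[OF P]) (use u je sq I I' J g b X in auto)
  then have "is_iso C u"
    by (intro short_five[OF je(1) xi(2)]) (use u J I' sq in auto)
  then obtain u' where u': "\<guillemotleft>u' : Cod C i' \<rightarrow> Cod C h\<guillemotright>" "u' \<cdot> u = Ide C (Cod C h)" "u \<cdot> u' = Ide C (Cod C i')"
    using iso_inverse[of u] u by metis
  have u'b: "u' \<cdot> b = h" "u' \<cdot> i' = j"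
    using u u' sq comp_assoc'[of h u u'] comp_assoc'[of j u u'] by (simp_all del: comp_assoc')
  have "\<exists>!w. w \<in> mor C (Cod C b) Z \<and> w \<cdot> b = p \<and> w \<cdot> i' = q"
    if Z: "Z \<in> Ob C" "p \<in> mor C (Cod C i) Z" "q \<in> mor C (Cod C g) Z" "p \<cdot> i = q \<cdot> g" for Z p q
  proof -
    have pq: "\<guillemotleft>p : Cod C i \<rightarrow> Z\<guillemotright>" "\<guillemotleft>q : Cod C g \<rightarrow> Z\<guillemotright>" using Z I g in_hom_iff arr_obj by metis+
    then obtain w where w: "\<guillemotleft>w : Cod C h \<rightarrow> Z\<guillemotright>" "w \<cdot> h = p" "w \<cdot> j = q"
      using pushout_lift[OF P, of p q] Z by auto
    have "\<guillemotleft>w \<cdot> u' : Cod C b \<rightarrow> Z\<guillemotright>" "w \<cdot> u' \<cdot> b = p" "w \<cdot> u' \<cdot> i' = q"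
      using w u' u'b b I' by auto
    moreover have "w' = w \<cdot> u'" if "w' \<in> mor C (Cod C b) Z" "w' \<cdot> b = p" "w' \<cdot> i' = q" for w'
    proof -
      have w': "\<guillemotleft>w' : Cod C b \<rightarrow> Z\<guillemotright>" using that b Z in_hom_iff arr_obj by metis
      have "w' \<cdot> u = w"
        by (rule pushout_cancel[OF P]) (use w' w u b I' sq that in auto)
      then have "w \<cdot> u' = w' \<cdot> (u \<cdot> u')" using w' u u' b by auto
      then show ?thesis using u' w' b by simp
    qed
    ultimately show ?thesis using Z b in_hom_iff[of "Cod C b" Z] by (metis arr_obj(2))
  qed
  then show ?thesis unfolding pushout_square_def using I I' g b by simp
qed

end

section \<open>The opposite exact category\<close>

text \<open>It halves the work: \<open>pull_exists\<close>, \<open>pull_universal\<close> and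
  \<open>ext_pull_class\<close> are obtained by reading their pushout counterparts in this
  category.\<close>

definition op_cat :: "('k, 'o, 'm) excat \<Rightarrow> ('k, 'o, 'm) excat" where
  "op_cat C = \<lparr>Ob = Ob C, Dom = Cod C, Cod = Dom C, Hom = (\<lambda>X Y. Hom C Y X),
     Comp = (\<lambda>g f. f \<cdot>\<^bsub>C\<^esub> g), Ide = Ide C, Confl = {(d, i). (i, d) \<in> Confl C}\<rparr>"

lemma op_cat_simps [simp]:
  "Ob (op_cat C) = Ob C" "Dom (op_cat C) = Cod C" "Cod (op_cat C) = Dom C" "Hom (op_cat C) X Y = Hom C Y X"
  "g \<cdot>\<^bsub>op_cat C\<^esub> f = f \<cdot>\<^bsub>C\<^esub> g" "Ide (op_cat C) = Ide C" "(d, i) \<in> Confl (op_cat C) \<longleftrightarrow> (i, d) \<in> Confl C"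
  by (simp_all add: op_cat_def)

lemma op_Confl_swap [simp]: "prod.swap \<xi> \<in> Confl (op_cat C) \<longleftrightarrow> \<xi> \<in> Confl C"
  by (cases \<xi>) simp

lemma op_arr [simp]: "arr (op_cat C) f = arr C f"
  by (auto simp: arr_def)

lemma op_iso [simp]: "is_iso (op_cat C) f = is_iso C f"
  by (auto simp: is_iso_def)

lemma op_pushout_square [simp]: "pushout_square (op_cat C) f g p q = pullback_square C f g p q"
  unfolding pushout_square_def pullback_square_def by auto

lemma op_pullback_square [simp]: "pullback_square (op_cat C) f g p q = pushout_square C f g p q"
  unfolding pushout_square_def pullback_square_def by auto

lemma op_kernel [simp]: "is_kernel (op_cat C) d i = is_cokernel C d i"
  unfolding is_kernel_def is_cokernel_def by auto

lemma op_cokernel [simp]: "is_cokernel (op_cat C) i d = is_kernel C i d"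
  unfolding is_kernel_def is_cokernel_def by auto

lemma op_biproduct [simp]: "is_biproduct (op_cat C) A B S \<pi> \<iota> = is_biproduct C A B S \<iota> \<pi>"
  unfolding is_biproduct_def by auto

lemma op_inflation [simp]: "inflation (op_cat C) d = deflation C d"
  by (simp add: inflation_def deflation_def)

lemma op_deflation [simp]: "deflation (op_cat C) i = inflation C i"
  by (simp add: inflation_def deflation_def)

context exact_category
begin

text \<open>Passing to the opposite category reverses the three isomorphisms, so
  \<open>op_exact_category\<close> calls for the closure axiom in this direction.\<close>

lemma confl_iso_closed_rev:
  assumes xi: "(i, d) \<in> Confl C" and arr: "arr C i'" "arr C d'" and iso: "is_iso C a" "is_iso C b" "is_iso C c"
    and a: "\<guillemotleft>a : Dom C i' \<rightarrow> Dom C i\<guillemotright>" and b: "\<guillemotleft>b : Cod C i' \<rightarrow> Cod C i\<guillemotright>" "\<guillemotleft>b : Dom C d' \<rightarrow> Dom C d\<guillemotright>"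
    and c: "\<guillemotleft>c : Cod C d' \<rightarrow> Cod C d\<guillemotright>" and eq: "b \<cdot> i' = i \<cdot> a" "c \<cdot> d' = d \<cdot> b"
  shows "(i', d') \<in> Confl C"
proof -
  note I = conflD[OF xi]
  obtain a' where a': "\<guillemotleft>a' : Dom C i \<rightarrow> Dom C i'\<guillemotright>" "a' \<cdot> a = Ide C (Dom C i')" "a \<cdot> a' = Ide C (Dom C i)"
    using iso_inverse[OF iso(1)] a by metis
  obtain b' where b': "\<guillemotleft>b' : Cod C i \<rightarrow> Cod C i'\<guillemotright>" "b' \<cdot> b = Ide C (Cod C i')" "b \<cdot> b' = Ide C (Cod C i)"
    using iso_inverse[OF iso(2)] b by metis
  obtain c' where c': "\<guillemotleft>c' : Cod C d \<rightarrow> Cod C d'\<guillemotright>" "c' \<cdot> c = Ide C (Cod C d')" "c \<cdot> c' = Ide C (Cod C d)"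
    using iso_inverse[OF iso(3)] c by metis
  have bD: "Cod C i' = Dom C d'" using b by simp
  have "b' \<cdot> i = b' \<cdot> (i \<cdot> a \<cdot> a')" using a a' I b' by simp
  also have "i \<cdot> a \<cdot> a' = b \<cdot> (i' \<cdot> a')"
    by (rule comp_eq_comp[OF eq(1), symmetric]) (use a' b arr in auto)
  also have "b' \<cdot> (b \<cdot> (i' \<cdot> a')) = Ide C (Cod C i') \<cdot> (i' \<cdot> a')"
    by (rule comp_eq_comp[OF b'(2)]) (use a' b b' arr in auto)
  finally have 1: "b' \<cdot> i = i' \<cdot> a'" using a' arr by simp
  have "c' \<cdot> d = c' \<cdot> (d \<cdot> (b \<cdot> b'))" using b b' I c' by simp
  also have "d \<cdot> (b \<cdot> b') = c \<cdot> (d' \<cdot> b')"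
    by (rule trans[OF comp_eq_comp[OF eq(2)[symmetric]] comp_assoc']) (use b b'(1) c arr I bD in auto)
  also have "c' \<cdot> (c \<cdot> (d' \<cdot> b')) = Ide C (Cod C d') \<cdot> (d' \<cdot> b')"
    by (rule comp_eq_comp[OF c'(2)]) (use c' c b' arr bD in auto)
  finally have 2: "c' \<cdot> d = d' \<cdot> b'" using b' arr bD by simp
  have "is_iso C a'" "is_iso C b'" "is_iso C c'"
    using isoI[of a' _ _ a] isoI[of b' _ _ b] isoI[of c' _ _ c] a a' b b' c c' by auto
  then show ?thesis
    by (rule confl_iso_closed[OF xi arr _ _ _ _ _ _ _ 1 2]) (use a' b' c' I arr bD in \<open>auto simp: in_hom_iff\<close>)
qed

lemma op_exact_category: "exact_category k (op_cat C)"
proof (intro exact_category.intro linear_category.intro exact_category_axioms.intro, goal_cases)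
  case (1 X Y) then show ?case using hom_module by simp
next
  case (2 X Y f) then show ?case using dom_cod[of Y X f] by simp
next
  case (3 X) then show ?case using ide_closed by simp
next
  case (4 X Y Z f g) then show ?case using comp_closed[of Z Y X g f] by simp
next
  case (5 W X Y Z f g h) then show ?case using comp_assoc[of Z Y X W h g f] by simp
next
  case (6 X Y f) then show ?case using comp_ide[of Y X f] by simp
next
  case (7 X Y f) then show ?case using ide_comp[of Y X f] by simp
next
  case (8 X Y Z f g h) then show ?case using comp_add_right[of Z Y X g h f] by simp
next
  case (9 X Y Z f g h) then show ?case using comp_add_left[of Z Y X h f g] by simp
next
  case (10 X Y Z a f g) then show ?case using comp_smult_right[of Z Y X a g f] by simp
next
  case (11 X Y Z a f g) then show ?case using comp_smult_left[of Z Y X a g f] by simp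
next
  case 12
  then show ?case using additive unfolding additive_category_def by (simp; metis)
next
  case (13 i d) then show ?case using kernel_cokernel[of d i] by simp
next
  case (14 i d i' d' a b c)
  have xi: "(d, i) \<in> Confl C" using 14 by simp
  show ?case unfolding op_cat_simps
    by (rule confl_iso_closed_rev[OF xi, of d' i' c b a]) (use 14 conflD[OF xi] in \<open>simp_all add: in_hom_iff\<close>)
next
  case (15 X) then show ?case using ide_deflation by simp
next
  case (16 X) then show ?case using ide_inflation by simp
next
  case (17 i j) then show ?case using deflation_comp[of j i] by simp
next
  case (18 d e) then show ?case using inflation_comp[of e d] by simp
next
  case (19 i g) then show ?case using pullback_deflation[of i g] by simp
next
  case (20 d f) then show ?case using pushout_inflation[of d f] by simp
qed

section \<open>Morphisms of conflations with prescribed ends\<close>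

text \<open>Only the end components are data. The middle one is in general not unique, but its
  existence amounts to an equation between extension classes, see
  \<open>push_eq_pull_iff\<close>.\<close>

definition confl_mor :: "'m \<Rightarrow> 'm \<Rightarrow> 'm \<times> 'm \<Rightarrow> 'm \<times> 'm \<Rightarrow> bool" where
  "confl_mor a c \<xi> \<xi>' \<longleftrightarrow> \<xi> \<in> Confl C \<and> \<xi>' \<in> Confl C \<and>
     \<guillemotleft>a : Dom C (fst \<xi>) \<rightarrow> Dom C (fst \<xi>')\<guillemotright> \<and> \<guillemotleft>c : Cod C (snd \<xi>) \<rightarrow> Cod C (snd \<xi>')\<guillemotright> \<and>
     (\<exists>b. \<guillemotleft>b : Cod C (fst \<xi>) \<rightarrow> Cod C (fst \<xi>')\<guillemotright> \<and> b \<cdot> fst \<xi> = fst \<xi>' \<cdot> a \<and> snd \<xi>' \<cdot> b = c \<cdot> snd \<xi>)"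

lemma confl_morI:
  assumes "(i, d) \<in> Confl C" "(i', d') \<in> Confl C" "\<guillemotleft>a : Dom C i \<rightarrow> Dom C i'\<guillemotright>" "\<guillemotleft>c : Cod C d \<rightarrow> Cod C d'\<guillemotright>"
    "\<guillemotleft>b : Dom C d \<rightarrow> Dom C d'\<guillemotright>" "b \<cdot> i = i' \<cdot> a" "d' \<cdot> b = c \<cdot> d"
  shows "confl_mor a c (i, d) (i', d')"
  using assms conflD[OF assms(1)] conflD[OF assms(2)] by (auto simp: confl_mor_def)

lemma confl_morE:
  assumes "confl_mor a c (i, d) (i', d')"
  obtains b where "(i, d) \<in> Confl C" "(i', d') \<in> Confl C" "\<guillemotleft>a : Dom C i \<rightarrow> Dom C i'\<guillemotright>" "\<guillemotleft>c : Cod C d \<rightarrow> Cod C d'\<guillemotright>"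
    "\<guillemotleft>b : Dom C d \<rightarrow> Dom C d'\<guillemotright>" "b \<cdot> i = i' \<cdot> a" "d' \<cdot> b = c \<cdot> d"
  using assms conflD[of i d] conflD[of i' d'] by (auto simp: confl_mor_def)

lemma confl_morD:
  assumes "confl_mor a c \<xi> \<xi>'"
  shows "\<xi> \<in> Confl C" "\<xi>' \<in> Confl C" "\<guillemotleft>a : Dom C (fst \<xi>) \<rightarrow> Dom C (fst \<xi>')\<guillemotright>"
    "\<guillemotleft>c : Cod C (snd \<xi>) \<rightarrow> Cod C (snd \<xi>')\<guillemotright>"
  using assms by (auto simp: confl_mor_def)

lemma confl_mor_refl:
  assumes "\<xi> \<in> Confl C"
  shows "confl_mor (Ide C (Dom C (fst \<xi>))) (Ide C (Cod C (snd \<xi>))) \<xi> \<xi>"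
proof (cases \<xi>)
  case (Pair i d)
  note I = conflD[OF assms[unfolded Pair]]
  show ?thesis unfolding Pair fst_conv snd_conv
    by (rule confl_morI[of _ _ _ _ _ _ "Ide C (Dom C d)"]) (use I assms[unfolded Pair] in simp_all)
qed

lemma confl_mor_comp:
  assumes "confl_mor a c \<xi> \<xi>'" "confl_mor a' c' \<xi>' \<xi>''"
  shows "confl_mor (a' \<cdot> a) (c' \<cdot> c) \<xi> \<xi>''"
proof -
  obtain i d i' d' i'' d'' where *: "\<xi> = (i, d)" "\<xi>' = (i', d')" "\<xi>'' = (i'', d'')" by (metis surj_pair)
  from assms[unfolded *] obtain b b' where
    1: "(i, d) \<in> Confl C" "(i', d') \<in> Confl C" "\<guillemotleft>a : Dom C i \<rightarrow> Dom C i'\<guillemotright>" "\<guillemotleft>c : Cod C d \<rightarrow> Cod C d'\<guillemotright>"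
    "\<guillemotleft>b : Dom C d \<rightarrow> Dom C d'\<guillemotright>" "b \<cdot> i = i' \<cdot> a" "d' \<cdot> b = c \<cdot> d" and
    2: "(i'', d'') \<in> Confl C" "\<guillemotleft>a' : Dom C i' \<rightarrow> Dom C i''\<guillemotright>" "\<guillemotleft>c' : Cod C d' \<rightarrow> Cod C d''\<guillemotright>"
    "\<guillemotleft>b' : Dom C d' \<rightarrow> Dom C d''\<guillemotright>" "b' \<cdot> i' = i'' \<cdot> a'" "d'' \<cdot> b' = c' \<cdot> d'"
    by (elim confl_morE) blast
  note I = conflD[OF 1(1)] conflD[OF 1(2)] conflD[OF 2(1)]
  have "b' \<cdot> b \<cdot> i = b' \<cdot> (i' \<cdot> a)" using 1 2 I by simp
  also have "\<dots> = i'' \<cdot> a' \<cdot> a" by (rule comp_eq_comp[OF 2(5)]) (use 1(3) 2(4) I in auto)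
  finally have b1: "b' \<cdot> b \<cdot> i = i'' \<cdot> (a' \<cdot> a)" using 1(3) 2(2) I by simp
  have "d'' \<cdot> (b' \<cdot> b) = c' \<cdot> d' \<cdot> b" by (rule comp_eq_comp[OF 2(6)]) (use 1(5) 2(4) I in auto)
  also have "\<dots> = c' \<cdot> (c \<cdot> d)" using 1(5,7) 2(3) I by simp
  finally have b2: "d'' \<cdot> (b' \<cdot> b) = c' \<cdot> c \<cdot> d" using 1(4) 2(3) I by simp
  show ?thesis unfolding *
    by (rule confl_morI[OF 1(1) 2(1) _ _ _ b1 b2]) (use 1(3-5) 2(2-4) in auto)
qed

lemma push_exists:
  assumes "\<xi> \<in> Confl C" "arr C a" "Dom C a = Dom C (fst \<xi>)"
  obtains \<zeta> where "confl_mor a (Ide C (Cod C (snd \<xi>))) \<xi> \<zeta>" "Dom C (fst \<zeta>) = Cod C a" "Cod C (snd \<zeta>) = Cod C (snd \<xi>)"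
proof (cases \<xi>)
  case (Pair i d)
  then have xi: "(i, d) \<in> Confl C" "arr C a" "Dom C a = Dom C i" using assms by auto
  obtain h i' d' where P: "pushout_square C i a h i'" and xi': "(i', d') \<in> Confl C" "d' \<cdot> h = d" "Cod C d' = Cod C d"
    using pushout_conflation[OF xi] .
  note sq = pushout_squareD[OF P] and I = conflD[OF xi(1)] and I' = conflD[OF xi'(1)]
  have "confl_mor a (Ide C (Cod C d)) (i, d) (i', d')"
    by (rule confl_morI[of _ _ _ _ _ _ h]) (use xi xi' sq I I' in auto)
  then show ?thesis using that[of "(i', d')"] sq xi' Pair by auto
qed

text \<open>The left square of \<open>\<xi> \<rightarrow> \<zeta>\<close> is a pushout by
  \<open>pushout_square_of_mor\<close>, so the middle component of
  \<open>\<xi> \<rightarrow> \<xi>'\<close> and the composite \<open>i' a'\<close> together induce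
  the new middle component. Its compatibility with the deflations is checked on the two legs of the
  pushout.\<close>

lemma push_universal:
  assumes "confl_mor a (Ide C (Cod C (snd \<xi>))) \<xi> \<zeta>" "confl_mor (a' \<cdot> a) c \<xi> \<xi>'"
    and a': "arr C a'" "Dom C a' = Cod C a"
  shows "confl_mor a' c \<zeta> \<xi>'"
proof -
  obtain i d i' d' j e where *: "\<xi> = (i, d)" "\<xi>' = (i', d')" "\<zeta> = (j, e)" by (metis surj_pair)
  from assms(1,2)[unfolded *] obtain h b where
    1: "(i, d) \<in> Confl C" "(j, e) \<in> Confl C" "\<guillemotleft>a : Dom C i \<rightarrow> Dom C j\<guillemotright>" "\<guillemotleft>Ide C (Cod C d) : Cod C d \<rightarrow> Cod C e\<guillemotright>"
    "\<guillemotleft>h : Dom C d \<rightarrow> Dom C e\<guillemotright>" "h \<cdot> i = j \<cdot> a" "e \<cdot> h = Ide C (Cod C d) \<cdot> d" and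
    2: "(i', d') \<in> Confl C" "\<guillemotleft>a' \<cdot> a : Dom C i \<rightarrow> Dom C i'\<guillemotright>" "\<guillemotleft>c : Cod C d \<rightarrow> Cod C d'\<guillemotright>"
    "\<guillemotleft>b : Dom C d \<rightarrow> Dom C d'\<guillemotright>" "b \<cdot> i = i' \<cdot> (a' \<cdot> a)" "d' \<cdot> b = c \<cdot> d"
    by (elim confl_morE) auto
  note I = conflD[OF 1(1)] and J = conflD[OF 1(2)] and I' = conflD[OF 2(1)]
  have eh: "e \<cdot> h = d" "Cod C e = Cod C d" using 1 I by auto
  have P: "pushout_square C i a h j"
    by (rule pushout_square_of_mor[OF 1(1,2)]) (use 1 I J eh in auto)
  have ca': "Cod C a' = Dom C i'" using 2(2) 1(3) a' by simp
  obtain u where u: "\<guillemotleft>u : Dom C e \<rightarrow> Dom C d'\<guillemotright>" "u \<cdot> h = b" "u \<cdot> j = i' \<cdot> a'"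
    using pushout_lift[OF P, of b "i' \<cdot> a'"] 1(3,5) 2(4,5) a' ca' I J I' by auto
  have e1: "d' \<cdot> u \<cdot> h = c \<cdot> e \<cdot> h"
    using u(1,2) 1(5) 2(3,6) eh I I' J by simp
  have "d' \<cdot> (i' \<cdot> a') = nul (Dom C i') (Cod C d') \<cdot> a'"
    by (rule comp_eq_comp[OF I'(4)]) (use a' ca' I' in auto)
  then have e2: "d' \<cdot> u \<cdot> j = c \<cdot> e \<cdot> j"
    using u(1,3) a' ca' 1(3) 2(3) eh(2) I' J by simp
  have "d' \<cdot> u = c \<cdot> e"
    by (rule pushout_cancel[OF P _ _ _ _ _ e1 e2]) (use u(1) 1(5) 2(3) eh(2) I' J in auto)
  then show ?thesis unfolding *
    by (intro confl_morI[OF 1(2) 2(1) _ _ u(1,3)]) (use a' ca' 1(3) 2(3) eh(2) in auto)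
qed

lemma confl_mor_op: "exact_category.confl_mor (op_cat C) c a (prod.swap \<xi>) (prod.swap \<xi>') \<longleftrightarrow> confl_mor a c \<xi>' \<xi>"
proof -
  interpret op: exact_category k "op_cat C" by (rule op_exact_category)
  obtain i d i' d' where *: "\<xi> = (i, d)" "\<xi>' = (i', d')" by (metis surj_pair)
  show ?thesis unfolding *
    using conflD[of i d] conflD[of i' d'] by (auto simp: op.confl_mor_def confl_mor_def)
qed

lemma pull_exists:
  assumes "\<xi> \<in> Confl C" "arr C c" "Cod C c = Cod C (snd \<xi>)"
  obtains \<zeta> where "confl_mor (Ide C (Dom C (fst \<xi>))) c \<zeta> \<xi>" "Cod C (snd \<zeta>) = Dom C c" "Dom C (fst \<zeta>) = Dom C (fst \<xi>)"
proof -
  interpret op: exact_category k "op_cat C" by (rule op_exact_category)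
  obtain \<zeta> where "op.confl_mor c (Ide C (Dom C (fst \<xi>))) (prod.swap \<xi>) \<zeta>" "Cod C (fst \<zeta>) = Dom C c" "Dom C (snd \<zeta>) = Dom C (fst \<xi>)"
    by (rule op.push_exists[of "prod.swap \<xi>" c]) (use assms in auto)
  then show ?thesis using that[of "prod.swap \<zeta>"] confl_mor_op[of c _ \<xi> "prod.swap \<zeta>"] by simp
qed

lemma pull_universal:
  assumes "confl_mor (Ide C (Dom C (fst \<xi>))) c \<zeta> \<xi>" "confl_mor a (c \<cdot> c') \<xi>' \<xi>"
    and c': "arr C c'" "Cod C c' = Dom C c"
  shows "confl_mor a c' \<xi>' \<zeta>"
proof -
  interpret op: exact_category k "op_cat C" by (rule op_exact_category)
  show ?thesis
    using op.push_universal[of c "prod.swap \<xi>" "prod.swap \<zeta>" c' a "prod.swap \<xi>'"] assms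
    by (simp add: confl_mor_op)
qed

section \<open>The Ext bifunctor\<close>

text \<open>The middle component is invertible by \<open>short_five\<close>, so this is membership
  in \<open>ext_class\<close>, in a form that composes like any other morphism of
  conflations.\<close>

definition confl_eqv :: "'m \<times> 'm \<Rightarrow> 'm \<times> 'm \<Rightarrow> bool" where
  "confl_eqv \<xi> \<zeta> \<longleftrightarrow> confl_mor (Ide C (Dom C (fst \<xi>))) (Ide C (Cod C (snd \<xi>))) \<xi> \<zeta>"

lemma confl_eqvD:
  assumes "confl_eqv \<xi> \<zeta>"
  shows "\<xi> \<in> Confl C" "\<zeta> \<in> Confl C" "Dom C (fst \<zeta>) = Dom C (fst \<xi>)" "Cod C (snd \<zeta>) = Cod C (snd \<xi>)"
    "arr C (fst \<xi>)" "arr C (snd \<xi>)"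
proof -
  note D = confl_morD[OF assms[unfolded confl_eqv_def]]
  show 1: "\<xi> \<in> Confl C" "\<zeta> \<in> Confl C" using D by auto
  show "arr C (fst \<xi>)" "arr C (snd \<xi>)" using conflD(1,2)[of "fst \<xi>" "snd \<xi>"] 1 by auto
  then show "Dom C (fst \<zeta>) = Dom C (fst \<xi>)" "Cod C (snd \<zeta>) = Cod C (snd \<xi>)" using D by auto
qed

lemma confl_arr [simp]: "\<xi> \<in> Confl C \<Longrightarrow> arr C (fst \<xi>)" "\<xi> \<in> Confl C \<Longrightarrow> arr C (snd \<xi>)"
  using conflD(1,2)[of "fst \<xi>" "snd \<xi>"] by auto

lemma confl_eqv_refl: "\<xi> \<in> Confl C \<Longrightarrow> confl_eqv \<xi> \<xi>"
  unfolding confl_eqv_def by (rule confl_mor_refl)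

lemma push_unique:
  assumes "confl_mor a (Ide C (Cod C (snd \<xi>))) \<xi> \<zeta>" "confl_mor a (Ide C (Cod C (snd \<xi>))) \<xi> \<zeta>'"
  shows "confl_eqv \<zeta> \<zeta>'"
proof -
  note D = confl_morD[OF assms(1)]
  have "confl_mor (Ide C (Dom C (fst \<zeta>))) (Ide C (Cod C (snd \<xi>))) \<zeta> \<zeta>'"
    by (rule push_universal[OF assms(1)]) (use assms(2) D in simp_all)
  then show ?thesis using D by (simp add: confl_eqv_def)
qed

text \<open>Both \<open>\<zeta>\<close> and \<open>\<xi>\<close> are pushouts of
  \<open>\<xi>\<close> along the identity, and pushouts are unique up to this relation.\<close>

lemma confl_eqv_sym:
  assumes "confl_eqv \<xi> \<zeta>" shows "confl_eqv \<zeta> \<xi>"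
  by (rule push_unique[OF assms[unfolded confl_eqv_def]])
    (use confl_mor_refl[of \<xi>] confl_eqvD[OF assms] in simp)

lemma confl_eqv_trans:
  assumes "confl_eqv \<xi> \<zeta>" "confl_eqv \<zeta> \<chi>" shows "confl_eqv \<xi> \<chi>"
  using confl_mor_comp[OF assms[unfolded confl_eqv_def]] confl_eqvD[OF assms(1)]
  by (simp add: confl_eqv_def)

lemma confl_mor_eqv:
  assumes "confl_mor a c \<xi> \<xi>'" "confl_eqv \<zeta> \<xi>" "confl_eqv \<xi>' \<zeta>'"
  shows "confl_mor a c \<zeta> \<zeta>'"
  using confl_mor_comp[OF confl_mor_comp[OF assms(2)[unfolded confl_eqv_def] assms(1)] assms(3)[unfolded confl_eqv_def]]
    confl_eqvD[OF assms(2)] confl_eqvD[OF assms(3)] confl_morD[OF assms(1)] by simp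

lemma ext_class_eq_eqv: "\<xi> \<in> Confl C \<Longrightarrow> ext_class C \<xi> = {\<zeta>. confl_eqv \<xi> \<zeta>}"
proof (cases \<xi>)
  case (Pair i d)
  assume "\<xi> \<in> Confl C"
  then have xi: "(i, d) \<in> Confl C" using Pair by simp
  note I = conflD[OF xi]
  have "(i', d') \<in> ext_class C (i, d) \<longleftrightarrow> confl_eqv (i, d) (i', d')" for i' d'
  proof
    assume "(i', d') \<in> ext_class C (i, d)"
    then obtain h where h: "(i', d') \<in> Confl C" "Dom C i' = Dom C i" "Cod C d' = Cod C d"
      "h \<in> mor C (Cod C i) (Cod C i')" "h \<cdot> i = i'" "d' \<cdot> h = d"
      by (auto simp: ext_class_def)
    note I' = conflD[OF h(1)]
    show "confl_eqv (i, d) (i', d')" unfolding confl_eqv_def fst_conv snd_conv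
      by (rule confl_morI[OF xi h(1), of _ _ h]) (use h I I' in \<open>simp_all add: in_hom_iff\<close>)
  next
    assume *: "confl_eqv (i, d) (i', d')"
    from *[unfolded confl_eqv_def fst_conv snd_conv] obtain b where
      b: "(i', d') \<in> Confl C" "\<guillemotleft>b : Dom C d \<rightarrow> Dom C d'\<guillemotright>" "b \<cdot> i = i' \<cdot> Ide C (Dom C i)" "d' \<cdot> b = Ide C (Cod C d) \<cdot> d"
      by (elim confl_morE)
    have D: "Dom C i' = Dom C i" "Cod C d' = Cod C d" using confl_eqvD[OF *] by auto
    note I' = conflD[OF b(1)]
    have "is_iso C b" by (rule short_five[OF xi b(1,2)]) (use b I I' D in auto)
    moreover have "b \<in> mor C (Cod C i) (Cod C i')" using b(2) I I' by (simp add: in_hom_iff)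
    moreover have "b \<cdot> i = i'" "d' \<cdot> b = d" using b(3,4) I I' D by simp_all
    ultimately show "(i', d') \<in> ext_class C (i, d)"
      unfolding ext_class_def using b(1) D by blast
  qed
  then show ?thesis unfolding Pair by auto
qed

lemma ext_class_self: "\<xi> \<in> Confl C \<Longrightarrow> \<xi> \<in> ext_class C \<xi>"
  by (simp add: ext_class_eq_eqv confl_eqv_refl)

lemma ext_class_cong: "confl_eqv \<xi> \<zeta> \<Longrightarrow> ext_class C \<xi> = ext_class C \<zeta>"
  unfolding ext_class_eq_eqv[OF confl_eqvD(1)] ext_class_eq_eqv[OF confl_eqvD(2)]
  using confl_eqv_sym confl_eqv_trans by blast

lemma ext_class_eq_iff: "\<xi> \<in> Confl C \<Longrightarrow> \<zeta> \<in> Confl C \<Longrightarrow> ext_class C \<xi> = ext_class C \<zeta> \<longleftrightarrow> confl_eqv \<xi> \<zeta>"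
  by (metis ext_class_cong ext_class_self ext_class_eq_eqv mem_Collect_eq)

text \<open>\<open>ext_push\<close> collects the outcomes for all representatives and all pushouts.
  Uniqueness of pushouts makes any two outcomes equivalent, and every conflation equivalent to an
  outcome is itself one, by \<open>pushout_square_of_mor\<close>.\<close>

lemma ext_push_class:
  assumes "confl_mor a (Ide C (Cod C (snd \<xi>))) \<xi> \<zeta>"
  shows "ext_push C a (ext_class C \<xi>) = ext_class C \<zeta>"
proof -
  note D = confl_morD[OF assms]
  have "(i', d') \<in> ext_push C a (ext_class C \<xi>) \<longleftrightarrow> confl_eqv \<zeta> (i', d')" for i' d'
  proof
    assume "(i', d') \<in> ext_push C a (ext_class C \<xi>)"
    then obtain i d h where h: "(i', d') \<in> Confl C" "confl_eqv \<xi> (i, d)" "pushout_square C i a h i'" "d' \<cdot> h = d"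
      using D by (auto simp: ext_push_def ext_class_eq_eqv)
    note sq = pushout_squareD[OF h(3)] and I' = conflD[OF h(1)] and E = confl_eqvD[OF h(2)]
    have I: "(i, d) \<in> Confl C" using E by simp
    have X: "Cod C d' = Cod C d" using h(4) sq I' by auto
    have "confl_mor a (Ide C (Cod C d)) (i, d) (i', d')"
      by (rule confl_morI[OF I h(1), of _ _ h]) (use sq h X I' E conflD[OF I] in auto)
    then have "confl_mor a (Ide C (Cod C (snd \<xi>))) \<xi> (i', d')"
      using confl_mor_eqv[OF _ h(2) confl_eqv_refl[OF h(1)]] E by simp
    then show "confl_eqv \<zeta> (i', d')" using push_unique[OF assms] by simp
  next
    assume *: "confl_eqv \<zeta> (i', d')"
    obtain i d where Pair: "\<xi> = (i, d)" by (metis surj_pair)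
    have "confl_mor a (Ide C (Cod C d)) (i, d) (i', d')"
      using confl_mor_eqv[OF assms confl_eqv_refl[OF D(1)] *] Pair by simp
    then obtain b where b: "(i, d) \<in> Confl C" "(i', d') \<in> Confl C" "\<guillemotleft>a : Dom C i \<rightarrow> Dom C i'\<guillemotright>"
      "\<guillemotleft>b : Dom C d \<rightarrow> Dom C d'\<guillemotright>" "b \<cdot> i = i' \<cdot> a" "d' \<cdot> b = Ide C (Cod C d) \<cdot> d"
      by (elim confl_morE)
    note I = conflD[OF b(1)] conflD[OF b(2)]
    have "pushout_square C i a b i'"
      by (rule pushout_square_of_mor[OF b(1,2)]) (use b I in auto)
    then show "(i', d') \<in> ext_push C a (ext_class C \<xi>)"
      using b I ext_class_self[OF b(1)] Pair by (auto simp: ext_push_def)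
  qed
  then show ?thesis using D by (auto simp: ext_class_eq_eqv)
qed

text \<open>In the opposite category a morphism with identity ends runs backwards, so the symmetry
  of \<open>confl_eqv\<close> enters here.\<close>

lemma ext_class_op: "\<xi> \<in> Confl C \<Longrightarrow> ext_class (op_cat C) (prod.swap \<xi>) = prod.swap ` ext_class C \<xi>"
proof -
  assume xi: "\<xi> \<in> Confl C"
  interpret op: exact_category k "op_cat C" by (rule op_exact_category)
  have "op.confl_eqv (prod.swap \<xi>) (prod.swap \<zeta>) \<longleftrightarrow> confl_eqv \<xi> \<zeta>" for \<zeta>
  proof -
    have "op.confl_eqv (prod.swap \<xi>) (prod.swap \<zeta>) \<longleftrightarrow> confl_mor (Ide C (Dom C (fst \<xi>))) (Ide C (Cod C (snd \<xi>))) \<zeta> \<xi>"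
      unfolding op.confl_eqv_def by (simp add: confl_mor_op)
    also have "\<dots> \<longleftrightarrow> confl_eqv \<zeta> \<xi>"
    proof
      assume *: "confl_mor (Ide C (Dom C (fst \<xi>))) (Ide C (Cod C (snd \<xi>))) \<zeta> \<xi>"
      then have "Dom C (fst \<zeta>) = Dom C (fst \<xi>)" "Cod C (snd \<zeta>) = Cod C (snd \<xi>)"
        using confl_morD[OF *] xi by simp_all
      with * show "confl_eqv \<zeta> \<xi>" by (simp add: confl_eqv_def)
    next
      assume *: "confl_eqv \<zeta> \<xi>"
      show "confl_mor (Ide C (Dom C (fst \<xi>))) (Ide C (Cod C (snd \<xi>))) \<zeta> \<xi>"
        unfolding confl_eqvD(3,4)[OF *] by (rule *[unfolded confl_eqv_def])
    qed
    finally show ?thesis using confl_eqv_sym by blast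
  qed
  moreover have "prod.swap \<xi> \<in> Confl (op_cat C)" using xi by (cases \<xi>) simp
  ultimately show ?thesis using xi by (auto simp: ext_class_eq_eqv op.ext_class_eq_eqv image_iff)
qed

lemma ext_pull_op: "ext_push (op_cat C) c (prod.swap ` e) = prod.swap ` ext_pull C c e"
proof -
  have mem: "(a, b) \<in> prod.swap ` A \<longleftrightarrow> (b, a) \<in> A" for a b :: 'm and A by force
  have "(d, i) \<in> ext_push (op_cat C) c (prod.swap ` e) \<longleftrightarrow> (i, d) \<in> ext_pull C c e" for i d
    unfolding ext_push_def ext_pull_def Bex_def split_paired_Ex by (simp add: mem) blast
  then show ?thesis by (auto simp: mem)
qed

lemma ext_pull_class:
  assumes "confl_mor (Ide C (Dom C (fst \<xi>))) c \<zeta> \<xi>"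
  shows "ext_pull C c (ext_class C \<xi>) = ext_class C \<zeta>"
proof -
  interpret op: exact_category k "op_cat C" by (rule op_exact_category)
  note D = confl_morD[OF assms]
  have "prod.swap ` ext_pull C c (ext_class C \<xi>) = prod.swap ` ext_class C \<zeta>"
    using op.ext_push_class[of c "prod.swap \<xi>" "prod.swap \<zeta>"] assms D
    by (simp add: confl_mor_op ext_class_op ext_pull_op)
  then show ?thesis by (simp add: inj_image_eq_iff)
qed

text \<open>The identities satisfied by pushouts and pullbacks of extension classes are all read off from this equivalence.\<close>

lemma push_eq_pull_iff:
  assumes "\<xi> \<in> Confl C" "\<xi>' \<in> Confl C" "\<guillemotleft>a : Dom C (fst \<xi>) \<rightarrow> Dom C (fst \<xi>')\<guillemotright>"
    "\<guillemotleft>c : Cod C (snd \<xi>) \<rightarrow> Cod C (snd \<xi>')\<guillemotright>"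
  shows "ext_push C a (ext_class C \<xi>) = ext_pull C c (ext_class C \<xi>') \<longleftrightarrow> confl_mor a c \<xi> \<xi>'"
proof -
  obtain \<zeta> where z: "confl_mor a (Ide C (Cod C (snd \<xi>))) \<xi> \<zeta>" "Dom C (fst \<zeta>) = Cod C a" "Cod C (snd \<zeta>) = Cod C (snd \<xi>)"
    by (rule push_exists[of \<xi> a]) (use assms in auto)
  obtain \<chi> where x: "confl_mor (Ide C (Dom C (fst \<xi>'))) c \<chi> \<xi>'" "Cod C (snd \<chi>) = Dom C c" "Dom C (fst \<chi>) = Dom C (fst \<xi>')"
    by (rule pull_exists[of \<xi>' c]) (use assms in auto)
  note D = confl_morD[OF z(1)] confl_morD[OF x(1)]
  have "ext_push C a (ext_class C \<xi>) = ext_pull C c (ext_class C \<xi>') \<longleftrightarrow> confl_eqv \<zeta> \<chi>"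
    using ext_push_class[OF z(1)] ext_pull_class[OF x(1)] D by (simp add: ext_class_eq_iff)
  also have "\<dots> \<longleftrightarrow> confl_mor a c \<xi> \<xi>'"
  proof
    assume "confl_eqv \<zeta> \<chi>"
    from confl_mor_comp[OF z(1) confl_mor_comp[OF this[unfolded confl_eqv_def] x(1)]]
    show "confl_mor a c \<xi> \<xi>'" using assms z(2,3) x(2,3) by simp
  next
    assume "confl_mor a c \<xi> \<xi>'"
    then have "confl_mor (Ide C (Dom C (fst \<zeta>))) c \<zeta> \<xi>'"
      by (intro push_universal[OF z(1)]) (use assms z in simp_all)
    then have "confl_mor (Ide C (Dom C (fst \<zeta>))) (Ide C (Cod C (snd \<zeta>))) \<zeta> \<chi>"
      by (intro pull_universal[OF x(1)]) (use assms x z in simp_all)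
    then show "confl_eqv \<zeta> \<chi>" by (simp add: confl_eqv_def)
  qed
  finally show ?thesis .
qed

lemma ext_carrierE:
  assumes "e \<in> carrier (Ext C X Y)"
  obtains \<xi> where "\<xi> \<in> Confl C" "Dom C (fst \<xi>) = Y" "Cod C (snd \<xi>) = X" "e = ext_class C \<xi>"
  using assms by (auto simp: Ext_def)

lemma ext_classI:
  assumes "\<xi> \<in> Confl C" "Dom C (fst \<xi>) = Y" "Cod C (snd \<xi>) = X"
  shows "ext_class C \<xi> \<in> carrier (Ext C X Y)"
  using assms by (auto simp: Ext_def)

lemma ext_obj: "e \<in> carrier (Ext C X Y) \<Longrightarrow> X \<in> Ob C \<and> Y \<in> Ob C"
  by (erule ext_carrierE) (metis arr_obj confl_arr)

lemma ext_rep: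
  assumes "e \<in> carrier (Ext C X Y)" "\<xi> \<in> e"
  shows "\<xi> \<in> Confl C" "Dom C (fst \<xi>) = Y" "Cod C (snd \<xi>) = X" "e = ext_class C \<xi>"
proof -
  obtain \<zeta> where z: "\<zeta> \<in> Confl C" "Dom C (fst \<zeta>) = Y" "Cod C (snd \<zeta>) = X" "e = ext_class C \<zeta>"
    using ext_carrierE[OF assms(1)] .
  then have E: "confl_eqv \<zeta> \<xi>" using assms(2) by (simp add: ext_class_eq_eqv)
  then show "\<xi> \<in> Confl C" "Dom C (fst \<xi>) = Y" "Cod C (snd \<xi>) = X" "e = ext_class C \<xi>"
    using confl_eqvD[OF E] z ext_class_cong[OF E] by simp_all
qed

lemma push_rep:
  assumes "\<xi> \<in> Confl C" "\<guillemotleft>a : Dom C (fst \<xi>) \<rightarrow> Y'\<guillemotright>"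
  obtains \<zeta> where "confl_mor a (Ide C (Cod C (snd \<xi>))) \<xi> \<zeta>" "\<zeta> \<in> Confl C" "Dom C (fst \<zeta>) = Y'"
    "Cod C (snd \<zeta>) = Cod C (snd \<xi>)" "ext_push C a (ext_class C \<xi>) = ext_class C \<zeta>"
proof -
  obtain \<zeta> where z: "confl_mor a (Ide C (Cod C (snd \<xi>))) \<xi> \<zeta>" "Dom C (fst \<zeta>) = Cod C a" "Cod C (snd \<zeta>) = Cod C (snd \<xi>)"
    by (rule push_exists[of \<xi> a]) (use assms in auto)
  then show ?thesis using that assms ext_push_class[OF z(1)] confl_morD[OF z(1)] by simp
qed

lemma pull_rep:
  assumes "\<xi> \<in> Confl C" "\<guillemotleft>c : X' \<rightarrow> Cod C (snd \<xi>)\<guillemotright>"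
  obtains \<zeta> where "confl_mor (Ide C (Dom C (fst \<xi>))) c \<zeta> \<xi>" "\<zeta> \<in> Confl C" "Cod C (snd \<zeta>) = X'"
    "Dom C (fst \<zeta>) = Dom C (fst \<xi>)" "ext_pull C c (ext_class C \<xi>) = ext_class C \<zeta>"
proof -
  obtain \<zeta> where z: "confl_mor (Ide C (Dom C (fst \<xi>))) c \<zeta> \<xi>" "Cod C (snd \<zeta>) = Dom C c" "Dom C (fst \<zeta>) = Dom C (fst \<xi>)"
    by (rule pull_exists[of \<xi> c]) (use assms in auto)
  then show ?thesis using that assms ext_pull_class[OF z(1)] confl_morD[OF z(1)] by simp
qed

lemma push_closed:
  assumes "e \<in> carrier (Ext C X Y)" "\<guillemotleft>a : Y \<rightarrow> Y'\<guillemotright>"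
  shows "ext_push C a e \<in> carrier (Ext C X Y')"
  using assms(1)
proof (rule ext_carrierE)
  fix \<xi> assume x: "\<xi> \<in> Confl C" "Dom C (fst \<xi>) = Y" "Cod C (snd \<xi>) = X" "e = ext_class C \<xi>"
  obtain \<zeta> where "\<zeta> \<in> Confl C" "Dom C (fst \<zeta>) = Y'" "Cod C (snd \<zeta>) = Cod C (snd \<xi>)" "ext_push C a (ext_class C \<xi>) = ext_class C \<zeta>"
    by (rule push_rep[of \<xi> a Y']) (use assms x in auto)
  then show ?thesis using x ext_classI by simp
qed

lemma pull_closed:
  assumes "e \<in> carrier (Ext C X Y)" "\<guillemotleft>c : X' \<rightarrow> X\<guillemotright>"
  shows "ext_pull C c e \<in> carrier (Ext C X' Y)"
  using assms(1)
proof (rule ext_carrierE)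
  fix \<xi> assume x: "\<xi> \<in> Confl C" "Dom C (fst \<xi>) = Y" "Cod C (snd \<xi>) = X" "e = ext_class C \<xi>"
  obtain \<zeta> where "\<zeta> \<in> Confl C" "Cod C (snd \<zeta>) = X'" "Dom C (fst \<zeta>) = Dom C (fst \<xi>)" "ext_pull C c (ext_class C \<xi>) = ext_class C \<zeta>"
    by (rule pull_rep[of \<xi> c X']) (use assms x in auto)
  then show ?thesis using x ext_classI by simp
qed

lemma push_ide: "e \<in> carrier (Ext C X Y) \<Longrightarrow> ext_push C (Ide C Y) e = e"
  by (erule ext_carrierE) (use confl_mor_refl ext_push_class in blast)

lemma pull_ide: "e \<in> carrier (Ext C X Y) \<Longrightarrow> ext_pull C (Ide C X) e = e"
  by (erule ext_carrierE) (use confl_mor_refl ext_pull_class in blast)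

lemma push_comp:
  assumes "e \<in> carrier (Ext C X Y)" "\<guillemotleft>a : Y \<rightarrow> Y'\<guillemotright>" "\<guillemotleft>b : Y' \<rightarrow> Y''\<guillemotright>"
  shows "ext_push C b (ext_push C a e) = ext_push C (b \<cdot> a) e"
  using assms(1)
proof (rule ext_carrierE)
  fix \<xi> assume x: "\<xi> \<in> Confl C" "Dom C (fst \<xi>) = Y" "Cod C (snd \<xi>) = X" "e = ext_class C \<xi>"
  obtain \<zeta> where z: "confl_mor a (Ide C (Cod C (snd \<xi>))) \<xi> \<zeta>" "\<zeta> \<in> Confl C" "Dom C (fst \<zeta>) = Y'" "Cod C (snd \<zeta>) = Cod C (snd \<xi>)"
    "ext_push C a (ext_class C \<xi>) = ext_class C \<zeta>"
    by (rule push_rep[of \<xi> a Y']) (use assms x in auto)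
  obtain \<chi> where c: "confl_mor b (Ide C (Cod C (snd \<zeta>))) \<zeta> \<chi>" "\<chi> \<in> Confl C" "ext_push C b (ext_class C \<zeta>) = ext_class C \<chi>"
    by (rule push_rep[of \<zeta> b Y'']) (use assms z in auto)
  have "confl_mor (b \<cdot> a) (Ide C (Cod C (snd \<xi>))) \<xi> \<chi>"
    using confl_mor_comp[OF z(1) c(1)] z(4) x(1) by simp
  then show ?thesis using ext_push_class z c x by simp
qed

lemma pull_comp:
  assumes "e \<in> carrier (Ext C X Y)" "\<guillemotleft>a : X' \<rightarrow> X\<guillemotright>" "\<guillemotleft>b : X'' \<rightarrow> X'\<guillemotright>"
  shows "ext_pull C b (ext_pull C a e) = ext_pull C (a \<cdot> b) e"
  using assms(1)
proof (rule ext_carrierE)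
  fix \<xi> assume x: "\<xi> \<in> Confl C" "Dom C (fst \<xi>) = Y" "Cod C (snd \<xi>) = X" "e = ext_class C \<xi>"
  obtain \<zeta> where z: "confl_mor (Ide C (Dom C (fst \<xi>))) a \<zeta> \<xi>" "\<zeta> \<in> Confl C" "Cod C (snd \<zeta>) = X'" "Dom C (fst \<zeta>) = Dom C (fst \<xi>)"
    "ext_pull C a (ext_class C \<xi>) = ext_class C \<zeta>"
    by (rule pull_rep[of \<xi> a X']) (use assms x in auto)
  obtain \<chi> where c: "confl_mor (Ide C (Dom C (fst \<zeta>))) b \<chi> \<zeta>" "\<chi> \<in> Confl C" "ext_pull C b (ext_class C \<zeta>) = ext_class C \<chi>"
    by (rule pull_rep[of \<zeta> b X'']) (use assms z in auto)
  have "confl_mor (Ide C (Dom C (fst \<xi>))) (a \<cdot> b) \<chi> \<xi>"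
    using confl_mor_comp[OF c(1) z(1)] z(4) x(1) by simp
  then show ?thesis using ext_pull_class z c x by simp
qed

text \<open>Both orders are witnessed by one composite
  \<open>\<zeta> \<rightarrow> \<xi> \<rightarrow> \<chi>\<close> of the pullback and the pushout
  morphism, whose ends are \<open>a\<close> and \<open>c\<close>.\<close>

lemma push_pull:
  assumes "e \<in> carrier (Ext C X Y)" "\<guillemotleft>a : Y \<rightarrow> Y'\<guillemotright>" "\<guillemotleft>c : X' \<rightarrow> X\<guillemotright>"
  shows "ext_push C a (ext_pull C c e) = ext_pull C c (ext_push C a e)"
  using assms(1)
proof (rule ext_carrierE)
  fix \<xi> assume x: "\<xi> \<in> Confl C" "Dom C (fst \<xi>) = Y" "Cod C (snd \<xi>) = X" "e = ext_class C \<xi>"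
  obtain \<zeta> where z: "confl_mor (Ide C (Dom C (fst \<xi>))) c \<zeta> \<xi>" "\<zeta> \<in> Confl C" "Cod C (snd \<zeta>) = X'" "Dom C (fst \<zeta>) = Dom C (fst \<xi>)"
    "ext_pull C c (ext_class C \<xi>) = ext_class C \<zeta>"
    by (rule pull_rep[of \<xi> c X']) (use assms x in auto)
  obtain \<chi> where c: "confl_mor a (Ide C (Cod C (snd \<xi>))) \<xi> \<chi>" "\<chi> \<in> Confl C" "Dom C (fst \<chi>) = Y'" "Cod C (snd \<chi>) = Cod C (snd \<xi>)"
    "ext_push C a (ext_class C \<xi>) = ext_class C \<chi>"
    by (rule push_rep[of \<xi> a Y']) (use assms x in auto)
  have "confl_mor a c \<zeta> \<chi>"
    using confl_mor_comp[OF z(1) c(1)] assms x by simp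
  then show ?thesis
    unfolding x(4) z(5) c(5) by (subst push_eq_pull_iff) (use assms x z c in auto)
qed

lemma confl_mor_iff:
  assumes "\<xi> \<in> Confl C" "Dom C (fst \<xi>) = Y" "Cod C (snd \<xi>) = X"
    "\<xi>' \<in> Confl C" "Dom C (fst \<xi>') = Y'" "Cod C (snd \<xi>') = X" "\<guillemotleft>a : Y \<rightarrow> Y'\<guillemotright>"
  shows "confl_mor a (Ide C X) \<xi> \<xi>' \<longleftrightarrow> ext_push C a (ext_class C \<xi>) = ext_class C \<xi>'"
proof -
  have "X \<in> Ob C" using assms(4,6) confl_arr arr_obj by metis
  then show ?thesis
    using push_eq_pull_iff[of \<xi> \<xi>' a "Ide C X"] assms by (simp add: pull_ide[OF ext_classI[OF assms(4,5,6)]])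
qed

text \<open>Composition is bilinear, so middle components add. This is the source of the additivity
  of Ext^1 in both variables.\<close>

lemma confl_mor_plus:
  assumes "confl_mor a c \<xi> \<xi>'" "confl_mor a' c' \<xi> \<xi>'"
  shows "confl_mor (a \<boxplus> a') (c \<boxplus> c') \<xi> \<xi>'"
proof -
  obtain i d i' d' where *: "\<xi> = (i, d)" "\<xi>' = (i', d')" by (metis surj_pair)
  from assms[unfolded *] obtain b b' where
    1: "(i, d) \<in> Confl C" "(i', d') \<in> Confl C" "\<guillemotleft>a : Dom C i \<rightarrow> Dom C i'\<guillemotright>" "\<guillemotleft>c : Cod C d \<rightarrow> Cod C d'\<guillemotright>"
    "\<guillemotleft>b : Dom C d \<rightarrow> Dom C d'\<guillemotright>" "b \<cdot> i = i' \<cdot> a" "d' \<cdot> b = c \<cdot> d" and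
    2: "\<guillemotleft>a' : Dom C i \<rightarrow> Dom C i'\<guillemotright>" "\<guillemotleft>c' : Cod C d \<rightarrow> Cod C d'\<guillemotright>"
    "\<guillemotleft>b' : Dom C d \<rightarrow> Dom C d'\<guillemotright>" "b' \<cdot> i = i' \<cdot> a'" "d' \<cdot> b' = c' \<cdot> d"
    by (elim confl_morE) blast
  note I = conflD[OF 1(1)] conflD[OF 1(2)]
  show ?thesis unfolding *
    by (rule confl_morI[OF 1(1,2), of _ _ "b \<boxplus> b'"]) (use 1 2 I in auto)
qed

subsection \<open>Direct sums of conflations\<close>

text \<open>Up to the isomorphism \<open>u\<close>, with inverse \<open>?v\<close>, the sum of
  \<open>i\<close> and an identity is the pushout of \<open>i\<close> along the injection
  \<open>fst \<iota>S\<close>.\<close>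

lemma inflation_sum_ide:
  assumes "inflation C i" and S: "is_biproduct C (Dom C i) B S \<iota>S \<pi>S" and T: "is_biproduct C (Cod C i) B T \<iota>T \<pi>T"
  shows "inflation C (fst \<iota>T \<cdot> i \<cdot> fst \<pi>S \<boxplus> snd \<iota>T \<cdot> snd \<pi>S)" (is "inflation C ?J")
proof -
  obtain d where xi: "(i, d) \<in> Confl C" using assms(1) by (auto simp: inflation_def)
  note I = conflD[OF xi] and S' = biproductD[OF S] and T' = biproductD[OF T]
  have "\<exists>h j. pushout_square C i (fst \<iota>S) h j \<and> inflation C j"
    by (rule pushout_inflation) (use assms(1) S' in auto)
  then obtain h j q where P: "pushout_square C i (fst \<iota>S) h j" and jq: "(j, q) \<in> Confl C"
    by (auto simp: inflation_def)
  note sq = pushout_squareD[OF P] and J = conflD[OF jq]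
  have J: "\<guillemotleft>?J : S \<rightarrow> T\<guillemotright>" using S' T' I by simp
  have "fst \<iota>T \<cdot> i = ?J \<cdot> fst \<iota>S" using S' T' I by simp
  then obtain u where u: "\<guillemotleft>u : Cod C h \<rightarrow> T\<guillemotright>" "u \<cdot> h = fst \<iota>T" "u \<cdot> j = ?J"
    using pushout_lift[OF P, of "fst \<iota>T" ?J] J S'(1-7) T'(1-7) by auto
  let ?v = "h \<cdot> fst \<pi>T \<boxplus> j \<cdot> snd \<iota>S \<cdot> snd \<pi>T"
  have v: "\<guillemotleft>?v : T \<rightarrow> Cod C h\<guillemotright>" using sq S'(1-7) T'(1-7) by simp
  have v1: "?v \<cdot> u \<cdot> h = Ide C (Cod C h) \<cdot> h"
    using u(1,2) v sq S'(1-7) T'(1-11) by simp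
  have "?v \<cdot> u \<cdot> j = ?v \<cdot> ?J" using u(1,3) v sq S'(1-7) by simp
  also have "\<dots> = h \<cdot> (i \<cdot> fst \<pi>S) \<boxplus> j \<cdot> (snd \<iota>S \<cdot> snd \<pi>S)"
    using sq S'(1-7) T'(1-7) I by (simp add: biproduct_comp[OF T])
  also have "h \<cdot> (i \<cdot> fst \<pi>S) = j \<cdot> fst \<iota>S \<cdot> fst \<pi>S"
    by (rule comp_eq_comp[OF sq(9)]) (use sq S'(1-7) in auto)
  also have "j \<cdot> fst \<iota>S \<cdot> fst \<pi>S \<boxplus> j \<cdot> (snd \<iota>S \<cdot> snd \<pi>S) = Ide C (Cod C h) \<cdot> j"
    using sq S'(1-7) by (simp add: biproduct_decomp[OF S])
  finally have v2: "?v \<cdot> u \<cdot> j = Ide C (Cod C h) \<cdot> j" .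
  have "?v \<cdot> u = Ide C (Cod C h)"
    by (rule pushout_cancel[OF P _ _ _ _ _ v1 v2]) (use u(1) v sq in auto)
  moreover have "u \<cdot> ?v = Ide C T"
  proof -
    have "u \<cdot> ?v = fst \<iota>T \<cdot> fst \<pi>T \<boxplus> ?J \<cdot> (snd \<iota>S \<cdot> snd \<pi>T)"
      using u(1) sq S'(1-7) T'(1-7) comp_eq_comp[OF u(2), of "fst \<pi>T"] comp_eq_comp[OF u(3), of "snd \<iota>S \<cdot> snd \<pi>T"]
      by (simp del: comp_plus_left)
    also have "\<dots> = Ide C T"
      using S'(1-7) T' I by (simp add: biproduct_comp[OF S])
    finally show ?thesis .
  qed
  ultimately have "is_iso C u" "is_iso C ?v" using isoI[OF u(1) v] isoI[OF v u(1)] by auto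
  have "(?J, q \<cdot> ?v) \<in> Confl C"
  proof (rule confl_iso_closed[OF jq, of ?J "q \<cdot> ?v" "Ide C S" u "Ide C (Cod C q)"])
    show "Ide C (Cod C q) \<cdot> q = q \<cdot> ?v \<cdot> u"
      using \<open>?v \<cdot> u = Ide C (Cod C h)\<close> u(1) v conflD[OF jq] sq by (simp del: comp_plus_left comp_plus_right)
    show "u \<cdot> j = ?J \<cdot> Ide C S" using u(3) J by (simp del: comp_plus_left comp_plus_right)
  qed (use u(1) v J sq S'(3,4) T'(3) conflD[OF jq] \<open>is_iso C u\<close> in \<open>simp_all add: in_hom_iff iso_ide del: comp_plus_left comp_plus_right\<close>)
  then show ?thesis by (auto simp: inflation_def)
qed

lemma arr_direct_sum:
  assumes "is_biproduct C A B S \<iota>S \<pi>S" "is_biproduct C A' B' T \<iota>T \<pi>T" "\<guillemotleft>f : A \<rightarrow> A'\<guillemotright>" "\<guillemotleft>g : B \<rightarrow> B'\<guillemotright>"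
  shows "direct_sum C \<iota>T \<pi>S f g = fst \<iota>T \<cdot> (f \<cdot> fst \<pi>S) \<boxplus> snd \<iota>T \<cdot> (g \<cdot> snd \<pi>S)"
    "\<guillemotleft>direct_sum C \<iota>T \<pi>S f g : S \<rightarrow> T\<guillemotright>"
proof -
  note S = biproductD[OF assms(1)] and T = biproductD[OF assms(2)]
  show "direct_sum C \<iota>T \<pi>S f g = fst \<iota>T \<cdot> (f \<cdot> fst \<pi>S) \<boxplus> snd \<iota>T \<cdot> (g \<cdot> snd \<pi>S)"
    using S(1-7) T(1-7) assms(3,4) by (simp add: direct_sum_def hom_plus)
  then show "\<guillemotleft>direct_sum C \<iota>T \<pi>S f g : S \<rightarrow> T\<guillemotright>"
    using S(1-7) T(1-7) assms(3,4) by simp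
qed

lemma biproduct_exists:
  assumes "A \<in> Ob C" "B \<in> Ob C"
  obtains S \<iota> \<pi> where "is_biproduct C A B S \<iota> \<pi>"
  using additive assms unfolding additive_category_def by blast

text \<open>The sum of \<open>i\<close> and \<open>i'\<close> is the composite of
  \<open>i + 1\<close> and \<open>1 + i'\<close> through the biproduct of \<open>Cod C i\<close> and
  \<open>Dom C i'\<close>, and inflations compose.\<close>

lemma direct_sum_inflation:
  assumes i: "inflation C i" "inflation C i'"
    and S: "is_biproduct C (Dom C i) (Dom C i') S \<iota>S \<pi>S" and E: "is_biproduct C (Cod C i) (Cod C i') E \<iota>E \<pi>E"
  shows "inflation C (direct_sum C \<iota>E \<pi>S i i')"
proof -
  have ar: "arr C i" "arr C i'" using i conflD by (auto simp: inflation_def)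
  obtain T \<iota>T \<pi>T where T: "is_biproduct C (Cod C i) (Dom C i') T \<iota>T \<pi>T"
    using biproduct_exists[OF arr_obj(2)[OF ar(1)] arr_obj(1)[OF ar(2)]] by blast
  note S' = biproductD[OF S] and E' = biproductD[OF E] and T' = biproductD[OF T]
  let ?J1 = "fst \<iota>T \<cdot> i \<cdot> fst \<pi>S \<boxplus> snd \<iota>T \<cdot> snd \<pi>S" and ?J2 = "snd \<iota>E \<cdot> i' \<cdot> snd \<pi>T \<boxplus> fst \<iota>E \<cdot> fst \<pi>T"
  have "inflation C ?J1" by (rule inflation_sum_ide[OF i(1) S T])
  moreover have "inflation C ?J2"
    using inflation_sum_ide[OF i(2) biproduct_swap[OF T] biproduct_swap[OF E]] by simp
  ultimately have "inflation C (?J2 \<cdot> ?J1)"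
    by (rule inflation_comp) (use ar S'(1-7) E'(1-7) T'(1-7) in auto)
  also have "?J2 \<cdot> ?J1 = fst \<iota>E \<cdot> (i \<cdot> fst \<pi>S) \<boxplus> snd \<iota>E \<cdot> (i' \<cdot> snd \<pi>S)"
    using ar S'(1-7) E'(1-7) T'(1-7) by (simp add: biproduct_comp[OF T])
  also have "\<dots> = direct_sum C \<iota>E \<pi>S i i'"
    using arr_direct_sum(1)[OF S E, of i i'] ar by simp
  finally show ?thesis .
qed

text \<open>The inflation \<open>?I\<close> has some cokernel \<open>q\<close>. The morphisms
  \<open>g1\<close> and \<open>g2\<close> that \<open>q\<close> induces on the cokernels
  \<open>d\<close> and \<open>d'\<close> of the summands assemble to an inverse \<open>?c\<close> of
  the comparison \<open>c\<close>, so \<open>?D\<close> may replace \<open>q\<close>.\<close>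

lemma direct_sum_confl:
  assumes xi: "(i, d) \<in> Confl C" "(i', d') \<in> Confl C"
    and S: "is_biproduct C (Dom C i) (Dom C i') S \<iota>S \<pi>S" and E: "is_biproduct C (Dom C d) (Dom C d') E \<iota>E \<pi>E"
    and X: "is_biproduct C (Cod C d) (Cod C d') X \<iota>X \<pi>X"
  shows "(direct_sum C \<iota>E \<pi>S i i', direct_sum C \<iota>X \<pi>E d d') \<in> Confl C" (is "(?I, ?D) \<in> _")
proof -
  note I = conflD[OF xi(1)] conflD[OF xi(2)]
  note S' = biproductD[OF S] and E' = biproductD[OF E] and X' = biproductD[OF X]
  note obs = S'(1-7) E'(1-7) X'(1-7) I(1-3,5-7)
  have I_eq: "?I = fst \<iota>E \<cdot> (i \<cdot> fst \<pi>S) \<boxplus> snd \<iota>E \<cdot> (i' \<cdot> snd \<pi>S)" and I_hom: "\<guillemotleft>?I : S \<rightarrow> E\<guillemotright>"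
    using arr_direct_sum[OF S E, of i i'] I by auto
  have D_eq: "?D = fst \<iota>X \<cdot> (d \<cdot> fst \<pi>E) \<boxplus> snd \<iota>X \<cdot> (d' \<cdot> snd \<pi>E)" and D_hom: "\<guillemotleft>?D : E \<rightarrow> X\<guillemotright>"
    using arr_direct_sum[OF E X, of d d'] I by auto
  have "inflation C ?I"
    by (rule direct_sum_inflation[OF _ _ S]) (use xi E I in \<open>auto simp: inflation_def\<close>)
  then obtain q where q: "(?I, q) \<in> Confl C" by (auto simp: inflation_def)
  note Q = conflD[OF q]
  have q_hom: "\<guillemotleft>q : E \<rightarrow> Cod C q\<guillemotright>" using Q I_hom by simp
  have "?D \<cdot> ?I = nul S X"
  proof -
    have "d \<cdot> (i \<cdot> fst \<pi>S) = nul (Dom C i) (Cod C d) \<cdot> fst \<pi>S" "d' \<cdot> (i' \<cdot> snd \<pi>S) = nul (Dom C i') (Cod C d') \<cdot> snd \<pi>S"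
      by (rule comp_eq_comp[OF I(4)] comp_eq_comp[OF I(8)]; use obs in auto)+
    then show ?thesis unfolding I_eq D_eq using obs by (simp add: biproduct_comp[OF E])
  qed
  then obtain c where c: "\<guillemotleft>c : Cod C q \<rightarrow> X\<guillemotright>" "c \<cdot> q = ?D"
    using cokernel_lift[OF q, of ?D] D_hom I_hom q_hom by auto
  have "q \<cdot> fst \<iota>E \<cdot> i = q \<cdot> (?I \<cdot> fst \<iota>S)"
    unfolding I_eq using q_hom S' obs by (simp add: biproduct_comp[OF S])
  also have "\<dots> = nul S (Cod C q) \<cdot> fst \<iota>S"
    by (rule comp_eq_comp) (use Q I_hom S'(4) in auto)
  finally have "q \<cdot> fst \<iota>E \<cdot> i = nul (Dom C i) (Cod C q)" using S' q_hom by simp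
  then obtain g1 where g1: "\<guillemotleft>g1 : Cod C d \<rightarrow> Cod C q\<guillemotright>" "g1 \<cdot> d = q \<cdot> fst \<iota>E"
    using cokernel_lift[OF xi(1), of "q \<cdot> fst \<iota>E"] q_hom obs by auto
  have "q \<cdot> snd \<iota>E \<cdot> i' = q \<cdot> (?I \<cdot> snd \<iota>S)"
    unfolding I_eq using q_hom S' obs by (simp add: biproduct_comp[OF S])
  also have "\<dots> = nul S (Cod C q) \<cdot> snd \<iota>S"
    by (rule comp_eq_comp) (use Q I_hom S'(5) in auto)
  finally have "q \<cdot> snd \<iota>E \<cdot> i' = nul (Dom C i') (Cod C q)" using S' q_hom by simp
  then obtain g2 where g2: "\<guillemotleft>g2 : Cod C d' \<rightarrow> Cod C q\<guillemotright>" "g2 \<cdot> d' = q \<cdot> snd \<iota>E"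
    using cokernel_lift[OF xi(2), of "q \<cdot> snd \<iota>E"] q_hom obs by auto
  let ?c = "g1 \<cdot> fst \<pi>X \<boxplus> g2 \<cdot> snd \<pi>X"
  have c'_hom: "\<guillemotleft>?c : X \<rightarrow> Cod C q\<guillemotright>" using g1(1) g2(1) obs by simp
  have "?c \<cdot> ?D = g1 \<cdot> (d \<cdot> fst \<pi>E) \<boxplus> g2 \<cdot> (d' \<cdot> snd \<pi>E)"
    unfolding D_eq using g1(1) g2(1) obs by (simp add: biproduct_comp[OF X])
  also have "g1 \<cdot> (d \<cdot> fst \<pi>E) = q \<cdot> fst \<iota>E \<cdot> fst \<pi>E"
    by (rule comp_eq_comp[OF g1(2)]) (use g1(1) obs in auto)
  also have "g2 \<cdot> (d' \<cdot> snd \<pi>E) = q \<cdot> snd \<iota>E \<cdot> snd \<pi>E"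
    by (rule comp_eq_comp[OF g2(2)]) (use g2(1) obs in auto)
  also have "q \<cdot> fst \<iota>E \<cdot> fst \<pi>E \<boxplus> q \<cdot> snd \<iota>E \<cdot> snd \<pi>E = q"
    using q_hom E' by (simp add: biproduct_decomp[OF E])
  finally have c'D: "?c \<cdot> ?D = q" .
  have "?c \<cdot> c \<cdot> q = ?c \<cdot> (c \<cdot> q)" by (rule comp_assoc') (use c(1) q_hom c'_hom in auto)
  then have 1: "?c \<cdot> c \<cdot> q = Ide C (Cod C q) \<cdot> q" unfolding c(2) c'D using q_hom by simp
  have cg1: "c \<cdot> g1 = fst \<iota>X"
  proof (rule deflation_cancel[OF xi(1)])
    have "c \<cdot> g1 \<cdot> d = c \<cdot> (q \<cdot> fst \<iota>E)" using c(1) g1 I by simp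
    also have "\<dots> = ?D \<cdot> fst \<iota>E" by (rule comp_eq_comp[OF c(2)]) (use c(1) q_hom obs in auto)
    also have "\<dots> = fst \<iota>X \<cdot> d" unfolding D_eq using E' X' obs by simp
    finally show "c \<cdot> g1 \<cdot> d = fst \<iota>X \<cdot> d" .
  qed (use c(1) g1(1) obs in auto)
  have cg2: "c \<cdot> g2 = snd \<iota>X"
  proof (rule deflation_cancel[OF xi(2)])
    have "c \<cdot> g2 \<cdot> d' = c \<cdot> (q \<cdot> snd \<iota>E)" using c(1) g2 I by simp
    also have "\<dots> = ?D \<cdot> snd \<iota>E" by (rule comp_eq_comp[OF c(2)]) (use c(1) q_hom obs in auto)
    also have "\<dots> = snd \<iota>X \<cdot> d'" unfolding D_eq using E' X' obs by simp
    finally show "c \<cdot> g2 \<cdot> d' = snd \<iota>X \<cdot> d'" .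
  qed (use c(1) g2(1) obs in auto)
  have 2: "c \<cdot> ?c = Ide C X"
    using c(1) g1(1) g2(1) obs comp_eq_comp[OF cg1, of "fst \<pi>X"] comp_eq_comp[OF cg2, of "snd \<pi>X"] X'(12)
    by simp
  have "?c \<cdot> c = Ide C (Cod C q)"
    by (rule deflation_cancel[OF q _ _ _ _ _ 1]) (use c(1) c'_hom q_hom in auto)
  then have "is_iso C c" using isoI[OF c(1) c'_hom] 2 by simp
  then show ?thesis
    by (intro confl_iso_closed[OF q, of _ _ "Ide C S" "Ide C E" c])
      (use I_hom D_hom q_hom c obs in \<open>simp_all add: iso_ide in_hom_iff\<close>)
qed

text \<open>\<open>baer_sum\<close> leaves three biproducts free; they are bundled with the two
  conflations so that every choice can be treated at once.\<close>

definition sum_data where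
  "sum_data \<xi> \<xi>' Y \<iota>Y \<pi>Y E \<iota>E \<pi>E X \<iota>X \<pi>X \<longleftrightarrow> \<xi> \<in> Confl C \<and> \<xi>' \<in> Confl C \<and>
     is_biproduct C (Dom C (fst \<xi>)) (Dom C (fst \<xi>')) Y \<iota>Y \<pi>Y \<and>
     is_biproduct C (Dom C (snd \<xi>)) (Dom C (snd \<xi>')) E \<iota>E \<pi>E \<and>
     is_biproduct C (Cod C (snd \<xi>)) (Cod C (snd \<xi>')) X \<iota>X \<pi>X"

abbreviation confl_sum where
  "confl_sum \<xi> \<xi>' \<iota>E \<pi>Y \<iota>X \<pi>E \<equiv> (direct_sum C \<iota>E \<pi>Y (fst \<xi>) (fst \<xi>'), direct_sum C \<iota>X \<pi>E (snd \<xi>) (snd \<xi>'))"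

lemma confl_sum_mor:
  assumes "sum_data \<xi> \<xi>' Y \<iota>Y \<pi>Y E \<iota>E \<pi>E X \<iota>X \<pi>X"
  shows "confl_mor (fst \<iota>Y) (fst \<iota>X) \<xi> (confl_sum \<xi> \<xi>' \<iota>E \<pi>Y \<iota>X \<pi>E)"
    "confl_mor (snd \<iota>Y) (snd \<iota>X) \<xi>' (confl_sum \<xi> \<xi>' \<iota>E \<pi>Y \<iota>X \<pi>E)"
    "confl_mor (fst \<pi>Y) (fst \<pi>X) (confl_sum \<xi> \<xi>' \<iota>E \<pi>Y \<iota>X \<pi>E) \<xi>"
    "confl_mor (snd \<pi>Y) (snd \<pi>X) (confl_sum \<xi> \<xi>' \<iota>E \<pi>Y \<iota>X \<pi>E) \<xi>'"
proof -
  obtain i d i' d' where *: "\<xi> = (i, d)" "\<xi>' = (i', d')" by (metis surj_pair)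
  from assms have xi: "(i, d) \<in> Confl C" "(i', d') \<in> Confl C"
    and S: "is_biproduct C (Dom C i) (Dom C i') Y \<iota>Y \<pi>Y" and E: "is_biproduct C (Dom C d) (Dom C d') E \<iota>E \<pi>E"
    and X: "is_biproduct C (Cod C d) (Cod C d') X \<iota>X \<pi>X"
    by (auto simp: sum_data_def *)
  note D = direct_sum_confl[OF xi S E X]
  note I = conflD[OF xi(1)] conflD[OF xi(2)]
  note S' = biproductD[OF S] and E' = biproductD[OF E] and X' = biproductD[OF X]
  note obs = S'(1-7) E'(1-7) X'(1-7) I(1-3,5-7)
  note I_eq = arr_direct_sum(1)[OF S, of "Dom C d" "Dom C d'" E \<iota>E \<pi>E i i'] arr_direct_sum(2)[OF S, of "Dom C d" "Dom C d'" E \<iota>E \<pi>E i i']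
  note D_eq = arr_direct_sum(1)[OF E X, of d d'] arr_direct_sum(2)[OF E X, of d d']
  note eqs = I_eq D_eq
  show "confl_mor (fst \<iota>Y) (fst \<iota>X) \<xi> (confl_sum \<xi> \<xi>' \<iota>E \<pi>Y \<iota>X \<pi>E)" unfolding * fst_conv snd_conv
    by (rule confl_morI[OF xi(1) D, of _ _ "fst \<iota>E"])
      (use E obs eqs S' E' X' in \<open>simp_all add: biproduct_comp[OF S] biproduct_comp[OF E]\<close>)
  show "confl_mor (snd \<iota>Y) (snd \<iota>X) \<xi>' (confl_sum \<xi> \<xi>' \<iota>E \<pi>Y \<iota>X \<pi>E)" unfolding * fst_conv snd_conv
    by (rule confl_morI[OF xi(2) D, of _ _ "snd \<iota>E"])
      (use E obs eqs S' E' X' in \<open>simp_all add: biproduct_comp[OF S] biproduct_comp[OF E]\<close>)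
  show "confl_mor (fst \<pi>Y) (fst \<pi>X) (confl_sum \<xi> \<xi>' \<iota>E \<pi>Y \<iota>X \<pi>E) \<xi>" unfolding * fst_conv snd_conv
    by (rule confl_morI[OF D xi(1), of _ _ "fst \<pi>E"])
      (use E obs eqs in \<open>simp_all add: biproduct_comp[OF X] biproduct_comp[OF E]\<close>)
  show "confl_mor (snd \<pi>Y) (snd \<pi>X) (confl_sum \<xi> \<xi>' \<iota>E \<pi>Y \<iota>X \<pi>E) \<xi>'" unfolding * fst_conv snd_conv
    by (rule confl_morI[OF D xi(2), of _ _ "snd \<pi>E"])
      (use E obs eqs in \<open>simp_all add: biproduct_comp[OF X] biproduct_comp[OF E]\<close>)
qed

lemma sum_data_bip:
  assumes "sum_data \<xi> \<xi>' Y \<iota>Y \<pi>Y E \<iota>E \<pi>E X \<iota>X \<pi>X"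
  shows "is_biproduct C (Dom C (fst \<xi>)) (Dom C (fst \<xi>')) Y \<iota>Y \<pi>Y"
     "is_biproduct C (Dom C (snd \<xi>)) (Dom C (snd \<xi>')) E \<iota>E \<pi>E"
     "is_biproduct C (Cod C (snd \<xi>)) (Cod C (snd \<xi>')) X \<iota>X \<pi>X"
  using assms by (auto simp: sum_data_def)

lemma sum_data_exists:
  assumes "\<xi> \<in> Confl C" "\<xi>' \<in> Confl C"
  obtains Y \<iota>Y \<pi>Y E \<iota>E \<pi>E X \<iota>X \<pi>X where "sum_data \<xi> \<xi>' Y \<iota>Y \<pi>Y E \<iota>E \<pi>E X \<iota>X \<pi>X"
proof -
  note ob = arr_obj[OF confl_arr(1)[OF assms(1)]] arr_obj[OF confl_arr(2)[OF assms(1)]]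
    arr_obj[OF confl_arr(1)[OF assms(2)]] arr_obj[OF confl_arr(2)[OF assms(2)]]
  obtain Y \<iota>Y \<pi>Y where Y: "is_biproduct C (Dom C (fst \<xi>)) (Dom C (fst \<xi>')) Y \<iota>Y \<pi>Y"
    using biproduct_exists ob by metis
  obtain E \<iota>E \<pi>E where E: "is_biproduct C (Dom C (snd \<xi>)) (Dom C (snd \<xi>')) E \<iota>E \<pi>E"
    using biproduct_exists ob by metis
  obtain X \<iota>X \<pi>X where "is_biproduct C (Cod C (snd \<xi>)) (Cod C (snd \<xi>')) X \<iota>X \<pi>X"
    using biproduct_exists ob by metis
  with Y E show ?thesis using that assms by (auto simp: sum_data_def)
qed

lemma confl_sum_in:
  assumes "sum_data \<xi> \<xi>' Y \<iota>Y \<pi>Y E \<iota>E \<pi>E X \<iota>X \<pi>X"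
  shows "confl_sum \<xi> \<xi>' \<iota>E \<pi>Y \<iota>X \<pi>E \<in> Confl C" "Dom C (fst (confl_sum \<xi> \<xi>' \<iota>E \<pi>Y \<iota>X \<pi>E)) = Y"
    "Cod C (snd (confl_sum \<xi> \<xi>' \<iota>E \<pi>Y \<iota>X \<pi>E)) = X"
proof -
  note D = confl_morD[OF confl_sum_mor(1)[OF assms]]
  show "confl_sum \<xi> \<xi>' \<iota>E \<pi>Y \<iota>X \<pi>E \<in> Confl C" by (rule D(2))
  have "\<guillemotleft>fst \<iota>Y : Dom C (fst \<xi>) \<rightarrow> Y\<guillemotright>" "\<guillemotleft>fst \<iota>X : Cod C (snd \<xi>) \<rightarrow> X\<guillemotright>"
    using biproductD(4)[OF sum_data_bip(1)[OF assms]] biproductD(4)[OF sum_data_bip(3)[OF assms]] by auto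
  then show "Dom C (fst (confl_sum \<xi> \<xi>' \<iota>E \<pi>Y \<iota>X \<pi>E)) = Y" "Cod C (snd (confl_sum \<xi> \<xi>' \<iota>E \<pi>Y \<iota>X \<pi>E)) = X"
    using D(3,4) by auto
qed

lemma confl_mor_pair:
  assumes "sum_data \<xi> \<xi>' Y \<iota>Y \<pi>Y E \<iota>E \<pi>E X \<iota>X \<pi>X" "confl_mor a c \<zeta> \<xi>" "confl_mor a' c' \<zeta> \<xi>'"
  shows "confl_mor (fst \<iota>Y \<cdot> a \<boxplus> snd \<iota>Y \<cdot> a') (fst \<iota>X \<cdot> c \<boxplus> snd \<iota>X \<cdot> c') \<zeta> (confl_sum \<xi> \<xi>' \<iota>E \<pi>Y \<iota>X \<pi>E)"
  by (intro confl_mor_plus confl_mor_comp[OF assms(2) confl_sum_mor(1)[OF assms(1)]]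
    confl_mor_comp[OF assms(3) confl_sum_mor(2)[OF assms(1)]])

lemma confl_mor_copair:
  assumes "sum_data \<xi> \<xi>' Y \<iota>Y \<pi>Y E \<iota>E \<pi>E X \<iota>X \<pi>X" "confl_mor a c \<xi> \<zeta>" "confl_mor a' c' \<xi>' \<zeta>"
  shows "confl_mor (a \<cdot> fst \<pi>Y \<boxplus> a' \<cdot> snd \<pi>Y) (c \<cdot> fst \<pi>X \<boxplus> c' \<cdot> snd \<pi>X) (confl_sum \<xi> \<xi>' \<iota>E \<pi>Y \<iota>X \<pi>E) \<zeta>"
  by (intro confl_mor_plus confl_mor_comp[OF confl_sum_mor(3)[OF assms(1)] assms(2)]
    confl_mor_comp[OF confl_sum_mor(4)[OF assms(1)] assms(3)])

section \<open>Baer sums\<close>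

text \<open>A class \<open>w\<close> with the two summands as components computes the Baer sum; in particular no choice matters.\<close>

lemma baer_value_push:
  assumes sd: "sum_data \<xi> \<xi>' YY \<iota>Y \<pi>Y E \<iota>E \<pi>E XX \<iota>X \<pi>X"
    and Y: "Dom C (fst \<xi>) = Y" "Dom C (fst \<xi>') = Y" and X: "Cod C (snd \<xi>) = X" "Cod C (snd \<xi>') = X"
    and w: "w \<in> carrier (Ext C X Y0)" and a: "\<guillemotleft>a : Y0 \<rightarrow> Y\<guillemotright>" and b: "\<guillemotleft>b : Y0 \<rightarrow> Y\<guillemotright>"
    and wa: "ext_push C a w = ext_class C \<xi>" and wb: "ext_push C b w = ext_class C \<xi>'"
  shows "ext_push C (fst \<pi>Y \<boxplus> snd \<pi>Y) (ext_pull C (fst \<iota>X \<boxplus> snd \<iota>X) (ext_class C (confl_sum \<xi> \<xi>' \<iota>E \<pi>Y \<iota>X \<pi>E)))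
    = ext_push C (a \<boxplus> b) w"
proof -
  have xi: "\<xi> \<in> Confl C" "\<xi>' \<in> Confl C" using sd by (auto simp: sum_data_def)
  obtain \<omega> where o: "\<omega> \<in> Confl C" "Dom C (fst \<omega>) = Y0" "Cod C (snd \<omega>) = X" "w = ext_class C \<omega>"
    using ext_carrierE[OF w] .
  have XO: "X \<in> Ob C" using ext_obj[OF w] by simp
  note BY = sum_data_bip(1)[OF sd, unfolded Y] and BX = sum_data_bip(3)[OF sd, unfolded X]
  note Y' = biproductD[OF BY] and X' = biproductD[OF BX] and S = confl_sum_in[OF sd]
  have "confl_mor a (Ide C X) \<omega> \<xi>" "confl_mor b (Ide C X) \<omega> \<xi>'"
    using confl_mor_iff[OF o(1,2,3) xi(1) Y(1) X(1) a] confl_mor_iff[OF o(1,2,3) xi(2) Y(2) X(2) b] wa wb o(4) by auto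
  from confl_mor_pair[OF sd this]
  have m: "confl_mor (fst \<iota>Y \<cdot> a \<boxplus> snd \<iota>Y \<cdot> b) (fst \<iota>X \<boxplus> snd \<iota>X) \<omega> (confl_sum \<xi> \<xi>' \<iota>E \<pi>Y \<iota>X \<pi>E)" (is "confl_mor ?a ?c _ ?s")
    using X' by simp
  have ah: "\<guillemotleft>?a : Y0 \<rightarrow> YY\<guillemotright>" using Y'(1-7) a b by simp
  have nh: "\<guillemotleft>fst \<pi>Y \<boxplus> snd \<pi>Y : YY \<rightarrow> Y\<guillemotright>" using Y'(1-7) by simp
  have "ext_pull C ?c (ext_class C ?s) = ext_push C ?a w"
    unfolding o(4) using push_eq_pull_iff[OF o(1) S(1), of ?a ?c] m confl_morD[OF m] by simp
  then have "ext_push C (fst \<pi>Y \<boxplus> snd \<pi>Y) (ext_pull C ?c (ext_class C ?s)) = ext_push C ((fst \<pi>Y \<boxplus> snd \<pi>Y) \<cdot> ?a) w"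
    using push_comp[OF w ah nh] by simp
  also have "(fst \<pi>Y \<boxplus> snd \<pi>Y) \<cdot> ?a = a \<boxplus> b"
    using Y'(1-7) a b by (simp add: biproduct_comp[OF BY])
  finally show ?thesis .
qed

text \<open>\<open>w\<close> is the sum of two representatives, pulled back along the diagonal of
  \<open>X\<close>. Pushing out along a projection becomes pulling back along a projection at the
  other end, and this cancels the diagonal.\<close>

lemma ext_pair_exists:
  assumes e: "e \<in> carrier (Ext C X A)" "e' \<in> carrier (Ext C X B)" and S: "is_biproduct C A B S \<iota> \<pi>"
  obtains w where "w \<in> carrier (Ext C X S)" "ext_push C (fst \<pi>) w = e" "ext_push C (snd \<pi>) w = e'"
proof -
  obtain \<xi> where x: "\<xi> \<in> Confl C" "Dom C (fst \<xi>) = A" "Cod C (snd \<xi>) = X" "e = ext_class C \<xi>"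
    using ext_carrierE[OF e(1)] .
  obtain \<xi>' where x': "\<xi>' \<in> Confl C" "Dom C (fst \<xi>') = B" "Cod C (snd \<xi>') = X" "e' = ext_class C \<xi>'"
    using ext_carrierE[OF e(2)] .
  obtain E \<iota>E \<pi>E XX \<iota>X \<pi>X where sd: "sum_data \<xi> \<xi>' S \<iota> \<pi> E \<iota>E \<pi>E XX \<iota>X \<pi>X"
    using sum_data_exists[OF x(1) x'(1)] x x' S by (metis sum_data_def)
  note X' = biproductD[OF sum_data_bip(3)[OF sd, unfolded x(3) x'(3)]] and S' = biproductD[OF S]
  let ?s = "confl_sum \<xi> \<xi>' \<iota>E \<pi> \<iota>X \<pi>E" and ?c = "fst \<iota>X \<boxplus> snd \<iota>X"
  note s = confl_sum_in[OF sd]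
  have s_in: "ext_class C ?s \<in> carrier (Ext C XX S)" using ext_classI[OF s] .
  have ch: "\<guillemotleft>?c : X \<rightarrow> XX\<guillemotright>" using X' by simp
  let ?w = "ext_pull C ?c (ext_class C ?s)"
  have w: "?w \<in> carrier (Ext C X S)" using pull_closed[OF s_in ch] .
  have "ext_push C (fst \<pi>) ?w = ext_pull C ?c (ext_push C (fst \<pi>) (ext_class C ?s))"
    by (rule push_pull[OF s_in S'(6) ch])
  also have "ext_push C (fst \<pi>) (ext_class C ?s) = ext_pull C (fst \<pi>X) e"
    unfolding x(4) using push_eq_pull_iff[OF s(1) x(1), of "fst \<pi>" "fst \<pi>X"] confl_sum_mor(3)[OF sd] S'(6) X'(6) s x by simp
  also have "ext_pull C ?c \<dots> = e"
    using pull_comp[OF e(1) X'(6) ch] X' pull_ide[OF e(1)] by simp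
  finally have 1: "ext_push C (fst \<pi>) ?w = e" .
  have "ext_push C (snd \<pi>) ?w = ext_pull C ?c (ext_push C (snd \<pi>) (ext_class C ?s))"
    by (rule push_pull[OF s_in S'(7) ch])
  also have "ext_push C (snd \<pi>) (ext_class C ?s) = ext_pull C (snd \<pi>X) e'"
    unfolding x'(4) using push_eq_pull_iff[OF s(1) x'(1), of "snd \<pi>" "snd \<pi>X"] confl_sum_mor(4)[OF sd] S'(7) X'(7) s x' by simp
  also have "ext_pull C ?c \<dots> = e'"
    using pull_comp[OF e(2) X'(7) ch] X' pull_ide[OF e(2)] by simp
  finally have 2: "ext_push C (snd \<pi>) ?w = e'" .
  show ?thesis using that w 1 2 by blast
qed

text \<open>A union over all choices equals the common value of the choices, given that some choice
  exists; existence comes from \<open>sum_data_exists\<close>.\<close>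

lemma baer_sum_eq:
  assumes e: "e \<in> carrier (Ext C X Y)" "e' \<in> carrier (Ext C X Y)"
    and V: "\<And>\<xi> \<xi>' YY \<iota>Y \<pi>Y E \<iota>E \<pi>E XX \<iota>X \<pi>X. \<lbrakk>sum_data \<xi> \<xi>' YY \<iota>Y \<pi>Y E \<iota>E \<pi>E XX \<iota>X \<pi>X; \<xi> \<in> e; \<xi>' \<in> e'\<rbrakk> \<Longrightarrow>
      ext_push C (fst \<pi>Y \<boxplus> snd \<pi>Y) (ext_pull C (fst \<iota>X \<boxplus> snd \<iota>X) (ext_class C (confl_sum \<xi> \<xi>' \<iota>E \<pi>Y \<iota>X \<pi>E))) = V"
  shows "baer_sum C X Y e e' = V"
proof -
  have iff: "is_biproduct C Y Y YY \<iota>Y \<pi>Y \<and> is_biproduct C (Dom C (snd \<xi>)) (Dom C (snd \<xi>')) EE \<iota>E \<pi>E \<and>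
     is_biproduct C X X XX \<iota>X \<pi>X \<longleftrightarrow> sum_data \<xi> \<xi>' YY \<iota>Y \<pi>Y EE \<iota>E \<pi>E XX \<iota>X \<pi>X"
    if "\<xi> \<in> e" "\<xi>' \<in> e'" for \<xi> \<xi>' YY \<iota>Y \<pi>Y EE \<iota>E \<pi>E XX \<iota>X \<pi>X
    using ext_rep[OF e(1) that(1)] ext_rep[OF e(2) that(2)] by (simp add: sum_data_def)
  have V': "ext_push C (fst \<pi>Y \<oplus>\<^bsub>Hom C YY Y\<^esub> snd \<pi>Y) (ext_pull C (fst \<iota>X \<oplus>\<^bsub>Hom C X XX\<^esub> snd \<iota>X)
      (ext_class C (confl_sum \<xi> \<xi>' \<iota>E \<pi>Y \<iota>X \<pi>E))) = V"
    if sd: "sum_data \<xi> \<xi>' YY \<iota>Y \<pi>Y EE \<iota>E \<pi>E XX \<iota>X \<pi>X" and x: "\<xi> \<in> e" "\<xi>' \<in> e'"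
    for \<xi> \<xi>' YY \<iota>Y \<pi>Y EE \<iota>E \<pi>E XX \<iota>X \<pi>X
  proof -
    note r = ext_rep[OF e(1) x(1)] ext_rep[OF e(2) x(2)]
    have "\<guillemotleft>fst \<pi>Y : YY \<rightarrow> Y\<guillemotright>" "\<guillemotleft>fst \<iota>X : X \<rightarrow> XX\<guillemotright>"
      using biproductD[OF sum_data_bip(1)[OF sd]] biproductD[OF sum_data_bip(3)[OF sd]] r by auto
    then show ?thesis using V[OF sd x] by (simp add: hom_plus)
  qed
  have "\<zeta> \<in> baer_sum C X Y e e' \<longleftrightarrow> \<zeta> \<in> V" for \<zeta>
  proof
    assume "\<zeta> \<in> baer_sum C X Y e e'"
    then obtain \<xi> \<xi>' YY EE XX \<iota>Y \<pi>Y \<iota>E \<pi>E \<iota>X \<pi>X where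
      x: "\<xi> \<in> e" "\<xi>' \<in> e'" and b: "is_biproduct C Y Y YY \<iota>Y \<pi>Y" "is_biproduct C (Dom C (snd \<xi>)) (Dom C (snd \<xi>')) EE \<iota>E \<pi>E"
       "is_biproduct C X X XX \<iota>X \<pi>X" and z: "\<zeta> \<in> ext_push C (fst \<pi>Y \<oplus>\<^bsub>Hom C YY Y\<^esub> snd \<pi>Y)
          (ext_pull C (fst \<iota>X \<oplus>\<^bsub>Hom C X XX\<^esub> snd \<iota>X) (ext_class C (confl_sum \<xi> \<xi>' \<iota>E \<pi>Y \<iota>X \<pi>E)))"
      unfolding baer_sum_def by force
    have sd: "sum_data \<xi> \<xi>' YY \<iota>Y \<pi>Y EE \<iota>E \<pi>E XX \<iota>X \<pi>X" by (rule iffD1[OF iff[OF x]]) (use b in blast)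
    show "\<zeta> \<in> V" using z unfolding V'[OF sd x] .
  next
    assume z: "\<zeta> \<in> V"
    obtain i d where x: "(i, d) \<in> e" using ext_carrierE[OF e(1)] ext_class_self by (metis surj_pair)
    obtain i' d' where x': "(i', d') \<in> e'" using ext_carrierE[OF e(2)] ext_class_self by (metis surj_pair)
    obtain YY \<iota>Y \<pi>Y EE \<iota>E \<pi>E XX \<iota>X \<pi>X where sd: "sum_data (i, d) (i', d') YY \<iota>Y \<pi>Y EE \<iota>E \<pi>E XX \<iota>X \<pi>X"
      using sum_data_exists[OF ext_rep(1)[OF e(1) x] ext_rep(1)[OF e(2) x']] .
    have "\<exists>YY EE XX \<iota>Y \<pi>Y \<iota>E \<pi>E \<iota>X \<pi>X.
     is_biproduct C Y Y YY \<iota>Y \<pi>Y \<and> is_biproduct C (Dom C d) (Dom C d') EE \<iota>E \<pi>E \<and>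
     is_biproduct C X X XX \<iota>X \<pi>X \<and>
     \<zeta> \<in> ext_push C (fst \<pi>Y \<oplus>\<^bsub>Hom C YY Y\<^esub> snd \<pi>Y)
          (ext_pull C (fst \<iota>X \<oplus>\<^bsub>Hom C X XX\<^esub> snd \<iota>X)
            (ext_class C (direct_sum C \<iota>E \<pi>Y i i', direct_sum C \<iota>X \<pi>E d d')))"
      using V'[OF sd x x'] z iff[OF x x'] sd unfolding fst_conv snd_conv by blast
    then show "\<zeta> \<in> baer_sum C X Y e e'"
      unfolding baer_sum_def using x x' by blast
  qed
  then show ?thesis by blast
qed

text \<open>This replaces the Baer sum by addition of morphisms, since by
  \<open>ext_pair_exists\<close> any two classes in Ext^1(X, Y) are pushouts of a common
  \<open>w\<close>.\<close>

lemma baer_sum_push: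
  assumes w: "w \<in> carrier (Ext C X Y0)" and a: "\<guillemotleft>a : Y0 \<rightarrow> Y\<guillemotright>" and b: "\<guillemotleft>b : Y0 \<rightarrow> Y\<guillemotright>"
  shows "baer_sum C X Y (ext_push C a w) (ext_push C b w) = ext_push C (a \<boxplus> b) w"
proof (rule baer_sum_eq)
  show e: "ext_push C a w \<in> carrier (Ext C X Y)" "ext_push C b w \<in> carrier (Ext C X Y)"
    using push_closed w a b by blast+
  show "ext_push C (fst \<pi>Y \<boxplus> snd \<pi>Y) (ext_pull C (fst \<iota>X \<boxplus> snd \<iota>X) (ext_class C (confl_sum \<xi> \<xi>' \<iota>E \<pi>Y \<iota>X \<pi>E)))
    = ext_push C (a \<boxplus> b) w"
    if "sum_data \<xi> \<xi>' YY \<iota>Y \<pi>Y E \<iota>E \<pi>E XX \<iota>X \<pi>X" "\<xi> \<in> ext_push C a w" "\<xi>' \<in> ext_push C b w"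
    for \<xi> \<xi>' YY \<iota>Y \<pi>Y E \<iota>E \<pi>E XX \<iota>X \<pi>X
    using that ext_rep[OF e(1)] ext_rep[OF e(2)] by (intro baer_value_push[OF _ _ _ _ _ w a b]) auto
qed

lemma Ext_add: "e \<oplus>\<^bsub>Ext C X Y\<^esub> e' = baer_sum C X Y e e'"
  by (simp add: Ext_def)

lemma push_plus:
  "\<lbrakk>e \<in> carrier (Ext C X Y); \<guillemotleft>a : Y \<rightarrow> Y'\<guillemotright>; \<guillemotleft>b : Y \<rightarrow> Y'\<guillemotright>\<rbrakk>
    \<Longrightarrow> ext_push C (a \<boxplus> b) e = ext_push C a e \<oplus>\<^bsub>Ext C X Y'\<^esub> ext_push C b e"
  by (simp add: Ext_add baer_sum_push)

text \<open>The pullbacks \<open>\<zeta>\<close> and \<open>\<zeta>'\<close> both map to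
  \<open>\<xi>\<close>, so their sum maps to it with the codiagonal of \<open>Y\<close> on the left
  end and the row \<open>(c, c')\<close> on the right; the row composed with the diagonal of
  \<open>X'\<close> is \<open>c + c'\<close>.\<close>

lemma pull_plus:
  assumes e: "e \<in> carrier (Ext C X Y)" and c: "\<guillemotleft>c : X' \<rightarrow> X\<guillemotright>" "\<guillemotleft>c' : X' \<rightarrow> X\<guillemotright>"
  shows "ext_pull C (c \<boxplus> c') e = ext_pull C c e \<oplus>\<^bsub>Ext C X' Y\<^esub> ext_pull C c' e"
proof -
  have "baer_sum C X' Y (ext_pull C c e) (ext_pull C c' e) = ext_pull C (c \<boxplus> c') e"
  proof (rule baer_sum_eq)
    show pc: "ext_pull C c e \<in> carrier (Ext C X' Y)" "ext_pull C c' e \<in> carrier (Ext C X' Y)"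
      using pull_closed e c by blast+
    fix \<zeta> \<zeta>' YY \<iota>Y \<pi>Y E \<iota>E \<pi>E XX \<iota>X \<pi>X
    assume sd: "sum_data \<zeta> \<zeta>' YY \<iota>Y \<pi>Y E \<iota>E \<pi>E XX \<iota>X \<pi>X" and z: "\<zeta> \<in> ext_pull C c e" "\<zeta>' \<in> ext_pull C c' e"
    note r = ext_rep[OF pc(1) z(1)] and r' = ext_rep[OF pc(2) z(2)]
    obtain \<xi> where x: "\<xi> \<in> Confl C" "Dom C (fst \<xi>) = Y" "Cod C (snd \<xi>) = X" "e = ext_class C \<xi>"
      using ext_carrierE[OF e] .
    have YO: "Y \<in> Ob C" "X' \<in> Ob C" using ext_obj[OF pc(1)] by auto
    note BY = sum_data_bip(1)[OF sd, unfolded r(2) r'(2)] and BX = sum_data_bip(3)[OF sd, unfolded r(3) r'(3)]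
    note Y' = biproductD[OF BY] and X' = biproductD[OF BX] and S = confl_sum_in[OF sd]
    have "confl_mor (Ide C Y) c \<zeta> \<xi>"
      using push_eq_pull_iff[OF r(1) x(1), of "Ide C Y" c] r x c YO push_ide[OF pc(1)] by simp
    moreover have "confl_mor (Ide C Y) c' \<zeta>' \<xi>"
      using push_eq_pull_iff[OF r'(1) x(1), of "Ide C Y" c'] r' x c YO push_ide[OF pc(2)] by simp
    ultimately have "confl_mor (fst \<pi>Y \<boxplus> snd \<pi>Y) (c \<cdot> fst \<pi>X \<boxplus> c' \<cdot> snd \<pi>X) (confl_sum \<zeta> \<zeta>' \<iota>E \<pi>Y \<iota>X \<pi>E) \<xi>"
      (is "confl_mor ?n ?c ?s _")
      using confl_mor_copair[OF sd, of "Ide C Y" c \<xi> "Ide C Y" c'] Y' by simp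
    then have "ext_push C ?n (ext_class C ?s) = ext_pull C ?c e"
      using push_eq_pull_iff[OF S(1) x(1), of ?n ?c] x(4) confl_morD by blast
    moreover have s_in: "ext_class C ?s \<in> carrier (Ext C XX YY)" using ext_classI[OF S] .
    moreover have nh: "\<guillemotleft>?n : YY \<rightarrow> Y\<guillemotright>" and dh: "\<guillemotleft>fst \<iota>X \<boxplus> snd \<iota>X : X' \<rightarrow> XX\<guillemotright>" and ch: "\<guillemotleft>?c : XX \<rightarrow> X\<guillemotright>"
      using Y' X' c by auto
    ultimately have "ext_push C ?n (ext_pull C (fst \<iota>X \<boxplus> snd \<iota>X) (ext_class C ?s)) = ext_pull C (?c \<cdot> (fst \<iota>X \<boxplus> snd \<iota>X)) e"
      using push_pull[OF s_in nh dh] pull_comp[OF e ch dh] by simp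
    also have "?c \<cdot> (fst \<iota>X \<boxplus> snd \<iota>X) = c \<boxplus> c'" using X' c by simp
    finally show "ext_push C ?n (ext_pull C (fst \<iota>X \<boxplus> snd \<iota>X) (ext_class C ?s)) = ext_pull C (c \<boxplus> c') e" .
  qed
  then show ?thesis by (simp add: Ext_add)
qed

subsection \<open>Split conflations\<close>

text \<open>A section \<open>s\<close> yields a retraction \<open>r\<close> of \<open>i\<close>,
  which makes the middle term a sum of the ends; so \<open>a\<close> on the kernel and
  \<open>g\<close> on the quotient can be prescribed independently.\<close>

lemma split_confl_mor:
  assumes xi: "(i, d) \<in> Confl C" and s: "\<guillemotleft>s : Cod C d \<rightarrow> Dom C d\<guillemotright>" "d \<cdot> s = Ide C (Cod C d)"
    and xi': "(i', d') \<in> Confl C" and a: "\<guillemotleft>a : Dom C i \<rightarrow> Dom C i'\<guillemotright>" and g: "\<guillemotleft>g : Cod C d \<rightarrow> Dom C d'\<guillemotright>"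
  shows "confl_mor a (d' \<cdot> g) (i, d) (i', d')"
proof -
  note I = conflD[OF xi] and I' = conflD[OF xi']
  let ?t = "Ide C (Dom C d) \<boxplus> neg (s \<cdot> d)"
  have t: "\<guillemotleft>?t : Dom C d \<rightarrow> Dom C d\<guillemotright>" using I s by simp
  have "d \<cdot> (s \<cdot> d) = Ide C (Cod C d) \<cdot> d" by (rule comp_eq_comp[OF s(2)]) (use I s in auto)
  then have "d \<cdot> ?t = nul (Dom C d) (Cod C d)" using I s by simp
  then obtain r where r: "\<guillemotleft>r : Dom C d \<rightarrow> Dom C i\<guillemotright>" "i \<cdot> r = ?t"
    using kernel_lift[OF xi, of ?t] t by auto
  have "i \<cdot> (r \<cdot> i) = ?t \<cdot> i" by (rule comp_eq_comp[OF r(2)]) (use r I in auto)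
  also have "\<dots> = i \<cdot> Ide C (Dom C i)" using I s by simp
  finally have ri: "r \<cdot> i = Ide C (Dom C i)"
    by (rule inflation_cancel[OF xi, rotated -1]) (use r I in auto)
  let ?b = "i' \<cdot> (a \<cdot> r) \<boxplus> g \<cdot> d"
  show ?thesis
  proof (rule confl_morI[OF xi xi' a, of _ ?b])
    show "\<guillemotleft>?b : Dom C d \<rightarrow> Dom C d'\<guillemotright>" "\<guillemotleft>d' \<cdot> g : Cod C d \<rightarrow> Cod C d'\<guillemotright>" using r a g I I' by simp_all
    show "?b \<cdot> i = i' \<cdot> a" using r ri a g I I' by simp
    have "d' \<cdot> (i' \<cdot> (a \<cdot> r)) = nul (Dom C i') (Cod C d') \<cdot> (a \<cdot> r)"
      by (rule comp_eq_comp[OF I'(4)]) (use r a I' in auto)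
    then show "d' \<cdot> ?b = d' \<cdot> g \<cdot> d" using r a g I I' by simp
  qed
qed

text \<open>The identity of \<open>X\<close> is a deflation with some kernel. Pushing its conflation
  out along zero changes the kernel to \<open>Y\<close>, and the middle component of the pushout
  morphism is a section.\<close>

lemma split_confl_exists:
  assumes "X \<in> Ob C" "Y \<in> Ob C"
  obtains i d s where "(i, d) \<in> Confl C" "Dom C i = Y" "Cod C d = X" "\<guillemotleft>s : X \<rightarrow> Dom C d\<guillemotright>" "d \<cdot> s = Ide C X"
proof -
  obtain j where j: "(j, Ide C X) \<in> Confl C" using ide_deflation[OF assms(1)] by (auto simp: deflation_def)
  note J = conflD[OF j]
  obtain \<zeta> where z: "confl_mor (nul (Dom C j) Y) (Ide C (Cod C (snd (j, Ide C X)))) (j, Ide C X) \<zeta>"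
    "Dom C (fst \<zeta>) = Cod C (nul (Dom C j) Y)" "Cod C (snd \<zeta>) = Cod C (snd (j, Ide C X))"
    by (rule push_exists[OF j, of "nul (Dom C j) Y"]) (use J assms in auto)
  obtain i d where zeta: "\<zeta> = (i, d)" by (metis surj_pair)
  from z(1)[unfolded zeta snd_conv] obtain b where
    b: "(i, d) \<in> Confl C" "\<guillemotleft>b : Dom C (Ide C X) \<rightarrow> Dom C d\<guillemotright>" "d \<cdot> b = Ide C (Cod C (Ide C X)) \<cdot> Ide C X"
    by (elim confl_morE)
  show ?thesis
    by (rule that[OF b(1), of b]) (use b(2,3) z(2,3) zeta J assms in auto)
qed

lemma Ext_zero: "\<zero>\<^bsub>Ext C X Y\<^esub> = {(i, d) \<in> Confl C. Dom C i = Y \<and> Cod C d = X \<and> (\<exists>s \<in> mor C X (Dom C d). d \<cdot> s = Ide C X)}"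
  by (simp add: Ext_def)

lemma Ext_zero_mem:
  assumes "X \<in> Ob C"
  shows "(i, d) \<in> \<zero>\<^bsub>Ext C X Y\<^esub> \<longleftrightarrow> (i, d) \<in> Confl C \<and> Dom C i = Y \<and> Cod C d = X \<and> (\<exists>s. \<guillemotleft>s : X \<rightarrow> Dom C d\<guillemotright> \<and> d \<cdot> s = Ide C X)"
proof -
  have "s \<in> mor C X (Dom C d) \<longleftrightarrow> \<guillemotleft>s : X \<rightarrow> Dom C d\<guillemotright>" if "(i, d) \<in> Confl C" for s
    by (rule in_hom_iff[OF assms]) (use conflD[OF that] in auto)
  then show ?thesis unfolding Ext_zero by blast
qed

text \<open>Split conflations with the same ends are equivalent by \<open>split_confl_mor\<close>,
  and a section is carried along by any equivalence; so the zero of \<open>Ext\<close> is one full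
  class.\<close>

lemma split_class_zero:
  assumes xi: "(i, d) \<in> Confl C" and s: "\<guillemotleft>s : Cod C d \<rightarrow> Dom C d\<guillemotright>" "d \<cdot> s = Ide C (Cod C d)"
  shows "ext_class C (i, d) = \<zero>\<^bsub>Ext C (Cod C d) (Dom C i)\<^esub>"
proof -
  note I = conflD[OF xi]
  have "(i', d') \<in> ext_class C (i, d) \<longleftrightarrow> (i', d') \<in> \<zero>\<^bsub>Ext C (Cod C d) (Dom C i)\<^esub>" for i' d'
  proof
    assume "(i', d') \<in> ext_class C (i, d)"
    then have E: "confl_eqv (i, d) (i', d')" using ext_class_eq_eqv[OF xi] by simp
    from E[unfolded confl_eqv_def fst_conv snd_conv] obtain b where
      b: "(i', d') \<in> Confl C" "\<guillemotleft>b : Dom C d \<rightarrow> Dom C d'\<guillemotright>" "d' \<cdot> b = Ide C (Cod C d) \<cdot> d"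
      by (elim confl_morE)
    have D: "Dom C i' = Dom C i" "Cod C d' = Cod C d" using confl_eqvD[OF E] by auto
    have "d' \<cdot> b = d" using b I by simp
    then have "d' \<cdot> (b \<cdot> s) = d \<cdot> s" by (rule comp_eq_comp) (use b s conflD[OF b(1)] in auto)
    moreover have "\<guillemotleft>b \<cdot> s : Cod C d \<rightarrow> Dom C d'\<guillemotright>" using b(2) s by simp
    ultimately show "(i', d') \<in> \<zero>\<^bsub>Ext C (Cod C d) (Dom C i)\<^esub>"
      using b(1) D s(2) I by (auto simp: Ext_zero_mem)
  next
    assume "(i', d') \<in> \<zero>\<^bsub>Ext C (Cod C d) (Dom C i)\<^esub>"
    then obtain s' where *: "(i', d') \<in> Confl C" "Dom C i' = Dom C i" "Cod C d' = Cod C d"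
      "\<guillemotleft>s' : Cod C d \<rightarrow> Dom C d'\<guillemotright>" "d' \<cdot> s' = Ide C (Cod C d)"
      using Ext_zero_mem I by (metis arr_obj(2))
    have "confl_mor (Ide C (Dom C i)) (d' \<cdot> s') (i, d) (i', d')"
      by (rule split_confl_mor[OF xi s *(1) _ *(4)]) (use * I in auto)
    then have "confl_eqv (i, d) (i', d')" using *(5) by (simp add: confl_eqv_def)
    then show "(i', d') \<in> ext_class C (i, d)" using ext_class_eq_eqv[OF xi] by simp
  qed
  then show ?thesis by auto
qed

lemma Ext_zero_closed:
  assumes "X \<in> Ob C" "Y \<in> Ob C"
  shows "\<zero>\<^bsub>Ext C X Y\<^esub> \<in> carrier (Ext C X Y)"
proof -
  obtain i d s where *: "(i, d) \<in> Confl C" "Dom C i = Y" "Cod C d = X" "\<guillemotleft>s : X \<rightarrow> Dom C d\<guillemotright>" "d \<cdot> s = Ide C X"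
    using split_confl_exists[OF assms] .
  then have "ext_class C (i, d) = \<zero>\<^bsub>Ext C X Y\<^esub>" using split_class_zero[OF *(1)] by simp
  moreover have "ext_class C (i, d) \<in> carrier (Ext C X Y)" using ext_classI[OF *(1)] *(2,3) by simp
  ultimately show ?thesis by simp
qed

lemma push_nul:
  assumes e: "e \<in> carrier (Ext C X Y)" and "Y' \<in> Ob C"
  shows "ext_push C (nul Y Y') e = \<zero>\<^bsub>Ext C X Y'\<^esub>"
proof -
  have ob: "X \<in> Ob C" "Y \<in> Ob C" using ext_obj[OF e] by auto
  obtain i d where xi: "(i, d) \<in> Confl C" "Dom C i = Y" "Cod C d = X" "e = ext_class C (i, d)"
    by (rule ext_carrierE[OF e]) (metis surj_pair fst_conv snd_conv)
  obtain i' d' s where *: "(i', d') \<in> Confl C" "Dom C i' = Y'" "Cod C d' = X" "\<guillemotleft>s : X \<rightarrow> Dom C d'\<guillemotright>" "d' \<cdot> s = Ide C X"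
    using split_confl_exists[OF ob(1) assms(2)] .
  note I = conflD[OF xi(1)] and I' = conflD[OF *(1)]
  have "d' \<cdot> (s \<cdot> d) = Ide C X \<cdot> d" by (rule comp_eq_comp[OF *(5)]) (use * xi I I' in auto)
  then have "confl_mor (nul Y Y') (Ide C X) (i, d) (i', d')"
    by (intro confl_morI[OF xi(1) *(1), of _ _ "s \<cdot> d"]) (use * xi(2,3) I I' ob assms in auto)
  then have "ext_push C (nul Y Y') (ext_class C (i, d)) = ext_class C (i', d')"
    using ext_push_class[of "nul Y Y'" "(i, d)" "(i', d')"] xi(3) by simp
  also have "\<dots> = \<zero>\<^bsub>Ext C X Y'\<^esub>" using split_class_zero[OF *(1)] * by simp
  finally show ?thesis using xi by simp
qed

text \<open>The long exact sequence at \<open>Hom(T, Y) \<rightarrow> Ext\<^sup>1(T, Ker d)\<close>.\<close>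

lemma pull_zero_iff:
  assumes xi: "(i, d) \<in> Confl C" and c: "\<guillemotleft>c : T \<rightarrow> Cod C d\<guillemotright>"
  shows "ext_pull C c (ext_class C (i, d)) = \<zero>\<^bsub>Ext C T (Dom C i)\<^esub> \<longleftrightarrow> (\<exists>g. \<guillemotleft>g : T \<rightarrow> Dom C d\<guillemotright> \<and> d \<cdot> g = c)"
proof -
  note I = conflD[OF xi]
  have ob: "T \<in> Ob C" "Dom C i \<in> Ob C" using c I by auto
  obtain i' d' s where *: "(i', d') \<in> Confl C" "Dom C i' = Dom C i" "Cod C d' = T" "\<guillemotleft>s : T \<rightarrow> Dom C d'\<guillemotright>" "d' \<cdot> s = Ide C T"
    using split_confl_exists[OF ob] .
  note I' = conflD[OF *(1)]
  have z: "\<zero>\<^bsub>Ext C T (Dom C i)\<^esub> = ext_class C (i', d')" using split_class_zero[OF *(1)] * by simp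
  have "ext_class C (i', d') \<in> carrier (Ext C T (Dom C i))" using ext_classI[OF *(1)] * by simp
  then have "ext_push C (Ide C (Dom C i)) (ext_class C (i', d')) = ext_class C (i', d')" by (rule push_ide)
  \<comment> \<open>A vanishing pullback means a morphism from the split conflation to
    \<open>(i, d)\<close> with ends \<open>1\<close> and \<open>c\<close>; composing its middle
    component with the section \<open>s\<close> lifts \<open>c\<close>.\<close>
  then have "ext_pull C c (ext_class C (i, d)) = \<zero>\<^bsub>Ext C T (Dom C i)\<^esub> \<longleftrightarrow> confl_mor (Ide C (Dom C i)) c (i', d') (i, d)"
    using push_eq_pull_iff[OF *(1) xi, of "Ide C (Dom C i)" c] * c I ob unfolding z by auto
  also have "\<dots> \<longleftrightarrow> (\<exists>g. \<guillemotleft>g : T \<rightarrow> Dom C d\<guillemotright> \<and> d \<cdot> g = c)"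
  proof
    assume "confl_mor (Ide C (Dom C i)) c (i', d') (i, d)"
    then obtain b where b: "\<guillemotleft>b : Dom C d' \<rightarrow> Dom C d\<guillemotright>" "d \<cdot> b = c \<cdot> d'" by (elim confl_morE)
    have "d \<cdot> (b \<cdot> s) = c \<cdot> d' \<cdot> s" by (rule comp_eq_comp[OF b(2)]) (use b * I in auto)
    also have "\<dots> = c" using * c I' by simp
    finally show "\<exists>g. \<guillemotleft>g : T \<rightarrow> Dom C d\<guillemotright> \<and> d \<cdot> g = c" using b(1) *(4) by (intro exI[of _ "b \<cdot> s"]) simp
  next
    assume "\<exists>g. \<guillemotleft>g : T \<rightarrow> Dom C d\<guillemotright> \<and> d \<cdot> g = c"
    then obtain g where g: "\<guillemotleft>g : T \<rightarrow> Dom C d\<guillemotright>" "d \<cdot> g = c" by blast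
    have "confl_mor (Ide C (Dom C i)) (d \<cdot> g) (i', d') (i, d)"
      by (rule split_confl_mor[OF *(1) _ _ xi]) (use * g I in auto)
    then show "confl_mor (Ide C (Dom C i)) c (i', d') (i, d)" using g by simp
  qed
  finally show ?thesis .
qed

text \<open>The long exact sequence at \<open>Ext\<^sup>1(Y, K)\<close>.\<close>

lemma image_connecting:
  assumes xi: "(i, d) \<in> Confl C" and K: "K \<in> Ob C"
  shows "(\<lambda>g. ext_push C g (ext_class C (i, d))) ` {g. \<guillemotleft>g : Dom C i \<rightarrow> K\<guillemotright>} =
    {e \<in> carrier (Ext C (Cod C d) K). ext_pull C d e = \<zero>\<^bsub>Ext C (Dom C d) K\<^esub>}"
proof -
  note I = conflD[OF xi]
  have xi_in: "ext_class C (i, d) \<in> carrier (Ext C (Cod C d) (Dom C i))" using ext_classI[OF xi] by simp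
  have d: "\<guillemotleft>d : Dom C d \<rightarrow> Cod C d\<guillemotright>" using I by simp
  \<comment> \<open>\<open>d\<close> lifts through itself, so the pullback of its own conflation
    splits.\<close>
  have d0: "ext_pull C d (ext_class C (i, d)) = \<zero>\<^bsub>Ext C (Dom C d) (Dom C i)\<^esub>"
    unfolding pull_zero_iff[OF xi d] by (rule exI[of _ "Ide C (Dom C d)"]) (use I in simp)
  show ?thesis
  proof (intro equalityI subsetI)
    fix e assume "e \<in> (\<lambda>g. ext_push C g (ext_class C (i, d))) ` {g. \<guillemotleft>g : Dom C i \<rightarrow> K\<guillemotright>}"
    then obtain g where g: "\<guillemotleft>g : Dom C i \<rightarrow> K\<guillemotright>" "e = ext_push C g (ext_class C (i, d))" by auto
    have z: "\<zero>\<^bsub>Ext C (Dom C d) (Dom C i)\<^esub> \<in> carrier (Ext C (Dom C d) (Dom C i))" using Ext_zero_closed I by simp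
    have "ext_pull C d e = ext_push C g \<zero>\<^bsub>Ext C (Dom C d) (Dom C i)\<^esub>"
      unfolding g(2) using push_pull[OF xi_in g(1) d] d0 by simp
    also have "\<dots> = ext_push C g (ext_push C (nul (Dom C i) (Dom C i)) \<zero>\<^bsub>Ext C (Dom C d) (Dom C i)\<^esub>)"
      using push_nul[OF z, of "Dom C i"] I by simp
    also have "\<dots> = ext_push C (nul (Dom C i) K) \<zero>\<^bsub>Ext C (Dom C d) (Dom C i)\<^esub>"
      using push_comp[OF z, of "nul (Dom C i) (Dom C i)" "Dom C i" g K] g I by auto
    also have "\<dots> = \<zero>\<^bsub>Ext C (Dom C d) K\<^esub>" by (rule push_nul[OF z K])
    finally show "e \<in> {e \<in> carrier (Ext C (Cod C d) K). ext_pull C d e = \<zero>\<^bsub>Ext C (Dom C d) K\<^esub>}"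
      using push_closed[OF xi_in g(1)] g(2) by simp
  next
    fix e assume "e \<in> {e \<in> carrier (Ext C (Cod C d) K). ext_pull C d e = \<zero>\<^bsub>Ext C (Dom C d) K\<^esub>}"
    then have e: "e \<in> carrier (Ext C (Cod C d) K)" "ext_pull C d e = \<zero>\<^bsub>Ext C (Dom C d) K\<^esub>" by auto
    obtain j f where jf: "(j, f) \<in> Confl C" "Dom C j = K" "Cod C f = Cod C d" "e = ext_class C (j, f)"
      by (rule ext_carrierE[OF e(1)]) (metis surj_pair fst_conv snd_conv)
    note J = conflD[OF jf(1)]
    \<comment> \<open>As the pullback of \<open>e\<close> along \<open>d\<close> vanishes,
      \<open>d\<close> lifts through \<open>f\<close>; the lift restricts to a morphism
      \<open>g\<close> of kernels, along which the pushout is \<open>e\<close>.\<close>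
    have "ext_pull C d (ext_class C (j, f)) = \<zero>\<^bsub>Ext C (Dom C d) (Dom C j)\<^esub>" using e(2) jf by simp
    then obtain b where b: "\<guillemotleft>b : Dom C d \<rightarrow> Dom C f\<guillemotright>" "f \<cdot> b = d"
      using pull_zero_iff[OF jf(1), of d "Dom C d"] jf(3) I by auto
    have "f \<cdot> (b \<cdot> i) = d \<cdot> i" by (rule comp_eq_comp[OF b(2)]) (use b(1) I J in auto)
    then obtain g where g: "\<guillemotleft>g : Dom C i \<rightarrow> Dom C j\<guillemotright>" "j \<cdot> g = b \<cdot> i"
      using kernel_lift[OF jf(1), of "b \<cdot> i"] b(1) I jf(3) by auto
    have "confl_mor g (Ide C (Cod C d)) (i, d) (j, f)"
      by (rule confl_morI[OF xi jf(1), of _ _ b]) (use g b I J jf(3) in auto)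
    then have "ext_push C g (ext_class C (i, d)) = e"
      using ext_push_class[of g "(i, d)" "(j, f)"] jf(4) by simp
    then show "e \<in> (\<lambda>g. ext_push C g (ext_class C (i, d))) ` {g. \<guillemotleft>g : Dom C i \<rightarrow> K\<guillemotright>}"
      using g(1) jf(2) by auto
  qed
qed

subsection \<open>The module structure\<close>

lemma k_cring: "cring k"
proof -
  obtain Z where "Z \<in> Ob C" using additive unfolding additive_category_def by blast
  then show ?thesis using hom_module module.axioms(1) by blast
qed

lemma Ext_smult: "X \<in> Ob C \<Longrightarrow> Y \<in> Ob C \<Longrightarrow> a \<odot>\<^bsub>Ext C X Y\<^esub> e = ext_push C (scale a (Ide C Y)) e"
  by (simp add: Ext_def hom_scale)

text \<open>The module axioms involve at most three classes. Written as pushouts of one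
  \<open>w\<close>, they obey the axioms because morphisms \<open>W \<rightarrow> Y\<close>
  do.\<close>

lemma ext_triple_exists:
  assumes e: "e1 \<in> carrier (Ext C X Y)" "e2 \<in> carrier (Ext C X Y)" "e3 \<in> carrier (Ext C X Y)"
  obtains W w p1 p2 p3 where "w \<in> carrier (Ext C X W)" "\<guillemotleft>p1 : W \<rightarrow> Y\<guillemotright>" "\<guillemotleft>p2 : W \<rightarrow> Y\<guillemotright>" "\<guillemotleft>p3 : W \<rightarrow> Y\<guillemotright>"
    "e1 = ext_push C p1 w" "e2 = ext_push C p2 w" "e3 = ext_push C p3 w"
proof -
  have Y: "Y \<in> Ob C" using ext_obj[OF e(1)] by simp
  obtain S \<iota> \<pi> where S: "is_biproduct C Y Y S \<iota> \<pi>" using biproduct_exists[OF Y Y] .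
  note S' = biproductD[OF S]
  obtain W \<kappa> \<rho> where W: "is_biproduct C S Y W \<kappa> \<rho>" using biproduct_exists[OF S'(3) Y] .
  note W' = biproductD[OF W]
  obtain v where v: "v \<in> carrier (Ext C X S)" "ext_push C (fst \<pi>) v = e1" "ext_push C (snd \<pi>) v = e2"
    using ext_pair_exists[OF e(1,2) S] .
  obtain w where w: "w \<in> carrier (Ext C X W)" "ext_push C (fst \<rho>) w = v" "ext_push C (snd \<rho>) w = e3"
    using ext_pair_exists[OF v(1) e(3) W] .
  have p: "\<guillemotleft>fst \<pi> \<cdot> fst \<rho> : W \<rightarrow> Y\<guillemotright>" "\<guillemotleft>snd \<pi> \<cdot> fst \<rho> : W \<rightarrow> Y\<guillemotright>" "\<guillemotleft>snd \<rho> : W \<rightarrow> Y\<guillemotright>" using S'(6,7) W'(6,7) by auto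
  show ?thesis
    by (rule that[OF w(1) p])
      (use push_comp[OF w(1) W'(6) S'(6)] push_comp[OF w(1) W'(6) S'(7)] v w in auto)
qed

lemma ext_module:
  assumes X: "X \<in> Ob C" and Y: "Y \<in> Ob C"
  shows "module k (Ext C X Y)"
proof (rule moduleI)
  interpret k: cring k by (rule k_cring)
  have add: "ext_push C p w \<oplus>\<^bsub>Ext C X Y\<^esub> ext_push C q w = ext_push C (p \<boxplus> q) w"
    if "w \<in> carrier (Ext C X W)" "\<guillemotleft>p : W \<rightarrow> Y\<guillemotright>" "\<guillemotleft>q : W \<rightarrow> Y\<guillemotright>" for w p q W
    using push_plus[OF that] by simp
  have sc: "\<guillemotleft>scale a (Ide C Y) : Y \<rightarrow> Y\<guillemotright>" if "a \<in> carrier k" for a using that Y by simp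
  show "cring k" by (rule k_cring)
  show "abelian_group (Ext C X Y)"
  proof (rule abelian_groupI)
    fix e1 e2 assume e: "e1 \<in> carrier (Ext C X Y)" "e2 \<in> carrier (Ext C X Y)"
    obtain W w p1 p2 p3 where *: "w \<in> carrier (Ext C X W)" "\<guillemotleft>p1 : W \<rightarrow> Y\<guillemotright>" "\<guillemotleft>p2 : W \<rightarrow> Y\<guillemotright>" "\<guillemotleft>p3 : W \<rightarrow> Y\<guillemotright>"
      "e1 = ext_push C p1 w" "e2 = ext_push C p2 w" "e2 = ext_push C p3 w" using ext_triple_exists[OF e e(2)] .
    show "e1 \<oplus>\<^bsub>Ext C X Y\<^esub> e2 \<in> carrier (Ext C X Y)"
      unfolding *(5,6) add[OF *(1,2,3)] by (rule push_closed[OF *(1)]) (use * in simp)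
    have "p1 \<boxplus> p2 = p2 \<boxplus> p1" by (rule plus_commute) (use * in auto)
    then show "e1 \<oplus>\<^bsub>Ext C X Y\<^esub> e2 = e2 \<oplus>\<^bsub>Ext C X Y\<^esub> e1"
      unfolding *(5,6) add[OF *(1,2,3)] add[OF *(1,3,2)] by simp
  next
    show "\<zero>\<^bsub>Ext C X Y\<^esub> \<in> carrier (Ext C X Y)" by (rule Ext_zero_closed[OF X Y])
  next
    fix e1 e2 e3 assume e: "e1 \<in> carrier (Ext C X Y)" "e2 \<in> carrier (Ext C X Y)" "e3 \<in> carrier (Ext C X Y)"
    obtain W w p1 p2 p3 where *: "w \<in> carrier (Ext C X W)" "\<guillemotleft>p1 : W \<rightarrow> Y\<guillemotright>" "\<guillemotleft>p2 : W \<rightarrow> Y\<guillemotright>" "\<guillemotleft>p3 : W \<rightarrow> Y\<guillemotright>"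
      "e1 = ext_push C p1 w" "e2 = ext_push C p2 w" "e3 = ext_push C p3 w" using ext_triple_exists[OF e] .
    have h: "\<guillemotleft>p1 \<boxplus> p2 : W \<rightarrow> Y\<guillemotright>" "\<guillemotleft>p2 \<boxplus> p3 : W \<rightarrow> Y\<guillemotright>" using * by auto
    show "e1 \<oplus>\<^bsub>Ext C X Y\<^esub> e2 \<oplus>\<^bsub>Ext C X Y\<^esub> e3 = e1 \<oplus>\<^bsub>Ext C X Y\<^esub> (e2 \<oplus>\<^bsub>Ext C X Y\<^esub> e3)"
      unfolding *(5-7) add[OF *(1,2,3)] add[OF *(1,3,4)] add[OF *(1) h(1) *(4)] add[OF *(1,2) h(2)] using * by simp
  next
    fix e assume e: "e \<in> carrier (Ext C X Y)"
    \<comment> \<open>Zero, \<open>e\<close> and the opposite of \<open>e\<close> are the pushouts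
      of \<open>e\<close> along \<open>0\<close>, \<open>1\<close> and \<open>- 1\<close>.\<close>
    have "ext_push C (nul Y Y) e \<oplus>\<^bsub>Ext C X Y\<^esub> ext_push C (Ide C Y) e = ext_push C (nul Y Y \<boxplus> Ide C Y) e"
      by (rule add[OF e]) (use Y in auto)
    then show "\<zero>\<^bsub>Ext C X Y\<^esub> \<oplus>\<^bsub>Ext C X Y\<^esub> e = e" using push_nul[OF e Y] push_ide[OF e] Y by simp
    have "ext_push C (neg (Ide C Y)) e \<oplus>\<^bsub>Ext C X Y\<^esub> ext_push C (Ide C Y) e = ext_push C (neg (Ide C Y) \<boxplus> Ide C Y) e"
      by (rule add[OF e]) (use Y in auto)
    then have "ext_push C (neg (Ide C Y)) e \<oplus>\<^bsub>Ext C X Y\<^esub> e = \<zero>\<^bsub>Ext C X Y\<^esub>" using push_nul[OF e Y] push_ide[OF e] Y by simp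
    moreover have "ext_push C (neg (Ide C Y)) e \<in> carrier (Ext C X Y)" by (rule push_closed[OF e]) (use Y in auto)
    ultimately show "\<exists>e'\<in>carrier (Ext C X Y). e' \<oplus>\<^bsub>Ext C X Y\<^esub> e = \<zero>\<^bsub>Ext C X Y\<^esub>" by blast
  qed
  fix a e assume a: "a \<in> carrier k" and e: "e \<in> carrier (Ext C X Y)"
  show "a \<odot>\<^bsub>Ext C X Y\<^esub> e \<in> carrier (Ext C X Y)"
    unfolding Ext_smult[OF X Y] by (rule push_closed[OF e sc[OF a]])
  show "(a \<oplus>\<^bsub>k\<^esub> b) \<odot>\<^bsub>Ext C X Y\<^esub> e = a \<odot>\<^bsub>Ext C X Y\<^esub> e \<oplus>\<^bsub>Ext C X Y\<^esub> b \<odot>\<^bsub>Ext C X Y\<^esub> e" if b: "b \<in> carrier k" for b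
    unfolding Ext_smult[OF X Y] add[OF e sc[OF a] sc[OF b]] using a b Y by (simp add: scale_add)
  show "a \<otimes>\<^bsub>k\<^esub> b \<odot>\<^bsub>Ext C X Y\<^esub> e = a \<odot>\<^bsub>Ext C X Y\<^esub> (b \<odot>\<^bsub>Ext C X Y\<^esub> e)" if b: "b \<in> carrier k" for b
    unfolding Ext_smult[OF X Y] push_comp[OF e sc[OF b] sc[OF a]]
    using a b Y comp_scale(1)[of "scale b (Ide C Y)" "Ide C Y" a] by (simp add: scale_add del: comp_scale)
  show "a \<odot>\<^bsub>Ext C X Y\<^esub> (e \<oplus>\<^bsub>Ext C X Y\<^esub> e') = a \<odot>\<^bsub>Ext C X Y\<^esub> e \<oplus>\<^bsub>Ext C X Y\<^esub> a \<odot>\<^bsub>Ext C X Y\<^esub> e'"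
    if e': "e' \<in> carrier (Ext C X Y)" for e'
  proof -
    obtain W w p1 p2 p3 where *: "w \<in> carrier (Ext C X W)" "\<guillemotleft>p1 : W \<rightarrow> Y\<guillemotright>" "\<guillemotleft>p2 : W \<rightarrow> Y\<guillemotright>" "\<guillemotleft>p3 : W \<rightarrow> Y\<guillemotright>"
      "e = ext_push C p1 w" "e' = ext_push C p2 w" "e' = ext_push C p3 w" using ext_triple_exists[OF e e' e'] .
    have h: "\<guillemotleft>p1 \<boxplus> p2 : W \<rightarrow> Y\<guillemotright>" "\<guillemotleft>scale a (Ide C Y) \<cdot> p1 : W \<rightarrow> Y\<guillemotright>" "\<guillemotleft>scale a (Ide C Y) \<cdot> p2 : W \<rightarrow> Y\<guillemotright>"
      using * a Y by auto
    have "scale a (Ide C Y) \<cdot> (p1 \<boxplus> p2) = scale a (Ide C Y) \<cdot> p1 \<boxplus> scale a (Ide C Y) \<cdot> p2"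
      by (rule comp_plus_right) (use * a Y in auto)
    then show ?thesis
      unfolding Ext_smult[OF X Y] *(5,6) add[OF *(1,2,3)] push_comp[OF *(1) h(1) sc[OF a]]
        push_comp[OF *(1,2) sc[OF a]] push_comp[OF *(1,3) sc[OF a]] add[OF *(1) h(2,3)] by simp
  qed
next
  show "\<one>\<^bsub>k\<^esub> \<odot>\<^bsub>Ext C X Y\<^esub> e = e" if e: "e \<in> carrier (Ext C X Y)" for e
    unfolding Ext_smult[OF X Y] using push_ide[OF e] scale_add(3)[of "Ide C Y"] Y cring.cring_simprules(6)[OF k_cring] by simp
qed

lemma pull_add:
  assumes e: "e \<in> carrier (Ext C X Y)" "e' \<in> carrier (Ext C X Y)" and c: "\<guillemotleft>c : X' \<rightarrow> X\<guillemotright>"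
  shows "ext_pull C c (e \<oplus>\<^bsub>Ext C X Y\<^esub> e') = ext_pull C c e \<oplus>\<^bsub>Ext C X' Y\<^esub> ext_pull C c e'"
proof -
  obtain W w p1 p2 p3 where *: "w \<in> carrier (Ext C X W)" "\<guillemotleft>p1 : W \<rightarrow> Y\<guillemotright>" "\<guillemotleft>p2 : W \<rightarrow> Y\<guillemotright>" "\<guillemotleft>p3 : W \<rightarrow> Y\<guillemotright>"
    "e = ext_push C p1 w" "e' = ext_push C p2 w" "e' = ext_push C p3 w" using ext_triple_exists[OF e e(2)] .
  have h: "\<guillemotleft>p1 \<boxplus> p2 : W \<rightarrow> Y\<guillemotright>" using * by auto
  note cw = pull_closed[OF *(1) c]
  show ?thesis
    unfolding *(5,6) push_plus[OF *(1,2,3), symmetric] push_pull[OF *(1) h c, symmetric]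
      push_pull[OF *(1,2) c, symmetric] push_pull[OF *(1,3) c, symmetric] by (rule push_plus[OF cw *(2,3)])
qed

lemma pull_smult:
  assumes e: "e \<in> carrier (Ext C X Y)" and c: "\<guillemotleft>c : X' \<rightarrow> X\<guillemotright>" and a: "a \<in> carrier k"
  shows "ext_pull C c (a \<odot>\<^bsub>Ext C X Y\<^esub> e) = a \<odot>\<^bsub>Ext C X' Y\<^esub> ext_pull C c e"
proof -
  have ob: "X \<in> Ob C" "Y \<in> Ob C" "X' \<in> Ob C" using ext_obj[OF e] c by auto
  show ?thesis unfolding Ext_smult[OF ob(1,2)] Ext_smult[OF ob(3,2)]
    by (rule push_pull[OF e _ c, symmetric]) (use a ob in simp)
qed

lemma push_zero:
  assumes g: "\<guillemotleft>g : Y \<rightarrow> Y'\<guillemotright>" and X: "X \<in> Ob C"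
  shows "ext_push C g \<zero>\<^bsub>Ext C X Y\<^esub> = \<zero>\<^bsub>Ext C X Y'\<^esub>"
proof -
  have ob: "Y \<in> Ob C" "Y' \<in> Ob C" using g by auto
  have z: "\<zero>\<^bsub>Ext C X Y\<^esub> \<in> carrier (Ext C X Y)" by (rule Ext_zero_closed[OF X ob(1)])
  have "ext_push C g (ext_push C (nul Y Y) \<zero>\<^bsub>Ext C X Y\<^esub>) = ext_push C (nul Y Y') \<zero>\<^bsub>Ext C X Y\<^esub>"
    using push_comp[OF z, of "nul Y Y" Y g Y'] g ob by simp
  then show ?thesis using push_nul[OF z ob(1)] push_nul[OF z ob(2)] by simp
qed

lemma pull_zero:
  assumes c: "\<guillemotleft>c : X' \<rightarrow> X\<guillemotright>" and Y: "Y \<in> Ob C"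
  shows "ext_pull C c \<zero>\<^bsub>Ext C X Y\<^esub> = \<zero>\<^bsub>Ext C X' Y\<^esub>"
proof -
  have ob: "X \<in> Ob C" "X' \<in> Ob C" using c by auto
  have z: "\<zero>\<^bsub>Ext C X Y\<^esub> \<in> carrier (Ext C X Y)" by (rule Ext_zero_closed[OF ob(1) Y])
  have "\<zero>\<^bsub>Ext C X Y\<^esub> = ext_push C (nul Y Y) \<zero>\<^bsub>Ext C X Y\<^esub>" using push_nul[OF z Y] by simp
  then have "ext_pull C c \<zero>\<^bsub>Ext C X Y\<^esub> = ext_push C (nul Y Y) (ext_pull C c \<zero>\<^bsub>Ext C X Y\<^esub>)"
    using push_pull[OF z, of "nul Y Y" Y c X'] c Y by simp
  then show ?thesis using push_nul[OF pull_closed[OF z c] Y] by simp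
qed

end

section \<open>The stable categories\<close>

text \<open>The records over \<open>k\<close> and over the endomorphism rings share their additive
  group but not their scalars; this carries subgroups across.\<close>

lemma subgroup_add_monoid_cong:
  assumes "carrier A = carrier B" "add A = add B" "\<zero>\<^bsub>A\<^esub> = \<zero>\<^bsub>B\<^esub>"
  shows "subgroup H (add_monoid A) \<longleftrightarrow> subgroup H (add_monoid B)"
  using assms by (simp add: subgroup_def m_inv_def)

context exact_category
begin

lemma ext_sum_zero: "X \<in> Ob C \<Longrightarrow> Y \<in> Ob C \<Longrightarrow> \<zero>\<^bsub>Ext C X Y\<^esub> \<oplus>\<^bsub>Ext C X Y\<^esub> \<zero>\<^bsub>Ext C X Y\<^esub> = \<zero>\<^bsub>Ext C X Y\<^esub>"
proof -
  assume "X \<in> Ob C" "Y \<in> Ob C"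
  then interpret E: module k "Ext C X Y" by (rule ext_module)
  show ?thesis by simp
qed

lemma pull_nul:
  assumes e: "e \<in> carrier (Ext C X Y)" and X': "X' \<in> Ob C"
  shows "ext_pull C (nul X' X) e = \<zero>\<^bsub>Ext C X' Y\<^esub>"
proof -
  have ob: "X \<in> Ob C" "Y \<in> Ob C" using ext_obj[OF e] by auto
  interpret E: module k "Ext C X' Y" by (rule ext_module[OF X' ob(2)])
  have n: "\<guillemotleft>nul X' X : X' \<rightarrow> X\<guillemotright>" using ob X' by simp
  have "ext_pull C (nul X' X) e \<oplus>\<^bsub>Ext C X' Y\<^esub> ext_pull C (nul X' X) e = ext_pull C (nul X' X) e"
    using pull_plus[OF e n n] ob X' by simp
  then show ?thesis using pull_closed[OF e n] by simp
qed

section \<open>The ideals of projectively and injectively trivial morphisms\<close>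

lemma proj_trivial_iff:
  assumes "X \<in> Ob C" "Y \<in> Ob C"
  shows "f \<in> proj_trivial C X Y \<longleftrightarrow> \<guillemotleft>f : X \<rightarrow> Y\<guillemotright> \<and> (\<forall>Z e. e \<in> carrier (Ext C Y Z) \<longrightarrow> ext_pull C f e = \<zero>\<^bsub>Ext C X Z\<^esub>)"
  using assms ext_obj unfolding proj_trivial_def mem_Collect_eq in_hom_iff[OF assms] by meson

lemma inj_trivial_iff:
  assumes "X \<in> Ob C" "Y \<in> Ob C"
  shows "f \<in> inj_trivial C X Y \<longleftrightarrow> \<guillemotleft>f : X \<rightarrow> Y\<guillemotright> \<and> (\<forall>Z e. e \<in> carrier (Ext C Z X) \<longrightarrow> ext_push C f e = \<zero>\<^bsub>Ext C Z Y\<^esub>)"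
  using assms ext_obj unfolding inj_trivial_def mem_Collect_eq in_hom_iff[OF assms] by meson

lemma proj_trivial_comp:
  assumes "f \<in> proj_trivial C X Y" "X \<in> Ob C" "Y \<in> Ob C"
  shows "\<guillemotleft>g : Y \<rightarrow> Z\<guillemotright> \<Longrightarrow> g \<cdot> f \<in> proj_trivial C X Z" "\<guillemotleft>h : W \<rightarrow> X\<guillemotright> \<Longrightarrow> f \<cdot> h \<in> proj_trivial C W Y"
proof -
  have f: "\<guillemotleft>f : X \<rightarrow> Y\<guillemotright>" "\<And>Z e. e \<in> carrier (Ext C Y Z) \<Longrightarrow> ext_pull C f e = \<zero>\<^bsub>Ext C X Z\<^esub>"
    using assms(1) proj_trivial_iff[OF assms(2,3)] by auto
  show "g \<cdot> f \<in> proj_trivial C X Z" if g: "\<guillemotleft>g : Y \<rightarrow> Z\<guillemotright>"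
  proof -
    have Z: "Z \<in> Ob C" using g by auto
    have "ext_pull C (g \<cdot> f) e = \<zero>\<^bsub>Ext C X V\<^esub>" if e: "e \<in> carrier (Ext C Z V)" for V e
      using pull_comp[OF e g f(1)] f(2)[OF pull_closed[OF e g]] by simp
    then show ?thesis unfolding proj_trivial_iff[OF assms(2) Z] using f(1) g by simp
  qed
  show "f \<cdot> h \<in> proj_trivial C W Y" if h: "\<guillemotleft>h : W \<rightarrow> X\<guillemotright>"
  proof -
    have W: "W \<in> Ob C" using h by auto
    have "ext_pull C (f \<cdot> h) e = \<zero>\<^bsub>Ext C W V\<^esub>" if e: "e \<in> carrier (Ext C Y V)" for V e
      using pull_comp[OF e f(1) h] f(2)[OF e] pull_zero[OF h] ext_obj[OF e] by simp
    then show ?thesis unfolding proj_trivial_iff[OF W assms(3)] using f(1) h by simp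
  qed
qed

text \<open>Scalars act through endomorphisms, so anything closed under composition with
  endomorphisms is closed under \<open>k\<close>.\<close>

lemma scale_as_comp: "\<guillemotleft>f : X \<rightarrow> Y\<guillemotright> \<Longrightarrow> a \<in> carrier k \<Longrightarrow> scale a f = f \<cdot> scale a (Ide C X)"
  by auto

lemma scale_as_comp': "\<guillemotleft>f : X \<rightarrow> Y\<guillemotright> \<Longrightarrow> a \<in> carrier k \<Longrightarrow> scale a f = scale a (Ide C Y) \<cdot> f"
  by auto

lemma proj_trivial_submodule:
  assumes X: "X \<in> Ob C" and Y: "Y \<in> Ob C"
  shows "submodule (proj_trivial C X Y) k (Hom C X Y)"
proof -
  interpret H: module k "Hom C X Y" by (rule hom_module[OF X Y])
  note iff = proj_trivial_iff[OF X Y]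
  show ?thesis
  proof (rule H.submoduleI')
    show "proj_trivial C X Y \<subseteq> mor C X Y" by (auto simp: proj_trivial_def)
    show "\<zero>\<^bsub>Hom C X Y\<^esub> \<in> proj_trivial C X Y" unfolding iff using X Y pull_nul by simp
    show "f \<oplus>\<^bsub>Hom C X Y\<^esub> g \<in> proj_trivial C X Y" if fg: "f \<in> proj_trivial C X Y" "g \<in> proj_trivial C X Y" for f g
    proof -
      have fh: "\<guillemotleft>f : X \<rightarrow> Y\<guillemotright>" "\<guillemotleft>g : X \<rightarrow> Y\<guillemotright>" using fg iff by auto
      have "ext_pull C (f \<boxplus> g) e = \<zero>\<^bsub>Ext C X Z\<^esub>" if e: "e \<in> carrier (Ext C Y Z)" for Z e
        using pull_plus[OF e fh] fg e ext_sum_zero[OF X] ext_obj[OF e] unfolding iff by simp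
      then show ?thesis unfolding hom_plus[OF fh(1)] iff using fh by simp
    qed
    show "a \<odot>\<^bsub>Hom C X Y\<^esub> f \<in> proj_trivial C X Y" if a: "a \<in> carrier k" and f: "f \<in> proj_trivial C X Y" for a f
    proof -
      have fh: "\<guillemotleft>f : X \<rightarrow> Y\<guillemotright>" using f iff by auto
      show ?thesis unfolding hom_scale[OF fh] scale_as_comp[OF fh a]
        by (rule proj_trivial_comp(2)[OF f X Y]) (use X a in simp)
    qed
  qed
qed

lemma inj_trivial_submodule:
  assumes X: "X \<in> Ob C" and Y: "Y \<in> Ob C"
  shows "submodule (inj_trivial C X Y) k (Hom C X Y)"
proof -
  interpret H: module k "Hom C X Y" by (rule hom_module[OF X Y])
  note iff = inj_trivial_iff[OF X Y]
  show ?thesis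
  proof (rule H.submoduleI')
    show "inj_trivial C X Y \<subseteq> mor C X Y" by (auto simp: inj_trivial_def)
    show "\<zero>\<^bsub>Hom C X Y\<^esub> \<in> inj_trivial C X Y" unfolding iff using X Y push_nul by simp
    show "f \<oplus>\<^bsub>Hom C X Y\<^esub> g \<in> inj_trivial C X Y" if fg: "f \<in> inj_trivial C X Y" "g \<in> inj_trivial C X Y" for f g
    proof -
      have fh: "\<guillemotleft>f : X \<rightarrow> Y\<guillemotright>" "\<guillemotleft>g : X \<rightarrow> Y\<guillemotright>" using fg iff by auto
      have "ext_push C (f \<boxplus> g) e = \<zero>\<^bsub>Ext C Z Y\<^esub>" if e: "e \<in> carrier (Ext C Z X)" for Z e
        using push_plus[OF e fh] fg e ext_sum_zero[OF _ Y] ext_obj[OF e] unfolding iff by simp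
      then show ?thesis unfolding hom_plus[OF fh(1)] iff using fh by simp
    qed
    show "a \<odot>\<^bsub>Hom C X Y\<^esub> f \<in> inj_trivial C X Y" if a: "a \<in> carrier k" and f: "f \<in> inj_trivial C X Y" for a f
    proof -
      have fh: "\<guillemotleft>f : X \<rightarrow> Y\<guillemotright>" using f iff by auto
      have s: "\<guillemotleft>scale a (Ide C Y) : Y \<rightarrow> Y\<guillemotright>" using a Y by simp
      have "ext_push C (scale a (Ide C Y) \<cdot> f) e = \<zero>\<^bsub>Ext C Z Y\<^esub>" if e: "e \<in> carrier (Ext C Z X)" for Z e
        using push_comp[OF e fh s] f e push_zero[OF s] ext_obj[OF e] unfolding iff by simp
      then show ?thesis unfolding hom_scale[OF fh] scale_as_comp'[OF fh a] iff using fh s by simp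
    qed
  qed
qed

section \<open>Hom modules and composition in the stable categories\<close>

lemma under_simps [simp]:
  "Ob (under C) = Ob C" "Hom (under C) X Y = quot_module (Hom C X Y) (proj_trivial C X Y)"
  by (simp_all add: quot_category_def)

lemma over_simps [simp]:
  "Ob (over C) = Ob C" "Hom (over C) X Y = quot_module (Hom C X Y) (inj_trivial C X Y)"
  by (simp_all add: quot_category_def)

lemma under_class_coset: "\<guillemotleft>f : X \<rightarrow> Y\<guillemotright> \<Longrightarrow> under_class C f = proj_trivial C X Y +>\<^bsub>Hom C X Y\<^esub> f"
  by (auto simp: ideal_class_def)

lemma over_class_coset: "\<guillemotleft>f : X \<rightarrow> Y\<guillemotright> \<Longrightarrow> over_class C f = inj_trivial C X Y +>\<^bsub>Hom C X Y\<^esub> f"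
  by (auto simp: ideal_class_def)

lemma hom_minus: "\<lbrakk>\<guillemotleft>f : X \<rightarrow> Y\<guillemotright>; \<guillemotleft>g : X \<rightarrow> Y\<guillemotright>\<rbrakk> \<Longrightarrow> f \<ominus>\<^bsub>Hom C X Y\<^esub> g = f \<boxplus> neg g"
  by (auto simp: a_minus_def hom_neg hom_plus)

lemma mem_under_class:
  assumes f: "\<guillemotleft>f : X \<rightarrow> Y\<guillemotright>"
  shows "g \<in> under_class C f \<longleftrightarrow> \<guillemotleft>g : X \<rightarrow> Y\<guillemotright> \<and> g \<boxplus> neg f \<in> proj_trivial C X Y"
proof -
  have ob: "X \<in> Ob C" "Y \<in> Ob C" using f by auto
  interpret H: module k "Hom C X Y" by (rule hom_module[OF ob])
  show ?thesis
    unfolding under_class_coset[OF f] using H.coset_mem_iff[OF proj_trivial_submodule[OF ob], of f g] f hom_minus[of g X Y f]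
      in_hom_iff[OF ob, of f] in_hom_iff[OF ob, of g] by auto
qed

lemma mem_over_class:
  assumes f: "\<guillemotleft>f : X \<rightarrow> Y\<guillemotright>"
  shows "g \<in> over_class C f \<longleftrightarrow> \<guillemotleft>g : X \<rightarrow> Y\<guillemotright> \<and> g \<boxplus> neg f \<in> inj_trivial C X Y"
proof -
  have ob: "X \<in> Ob C" "Y \<in> Ob C" using f by auto
  interpret H: module k "Hom C X Y" by (rule hom_module[OF ob])
  show ?thesis
    unfolding over_class_coset[OF f] using H.coset_mem_iff[OF inj_trivial_submodule[OF ob], of f g] f hom_minus[of g X Y f]
      in_hom_iff[OF ob, of f] in_hom_iff[OF ob, of g] by auto
qed

lemma under_class_eq_iff:
  assumes f: "\<guillemotleft>f : X \<rightarrow> Y\<guillemotright>" and g: "\<guillemotleft>g : X \<rightarrow> Y\<guillemotright>"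
  shows "under_class C f = under_class C g \<longleftrightarrow> f \<boxplus> neg g \<in> proj_trivial C X Y"
proof -
  have ob: "X \<in> Ob C" "Y \<in> Ob C" using f by auto
  interpret H: module k "Hom C X Y" by (rule hom_module[OF ob])
  show ?thesis
    unfolding under_class_coset[OF f] under_class_coset[OF g] hom_minus[OF f g, symmetric]
    by (rule H.coset_eq_iff[OF proj_trivial_submodule[OF ob]]) (use f g in_hom_iff[OF ob] in auto)
qed

lemma under_module: "X \<in> Ob C \<Longrightarrow> Y \<in> Ob C \<Longrightarrow> module k (Hom (under C) X Y)"
  unfolding under_simps by (rule module.quot_module_module[OF hom_module proj_trivial_submodule])

lemma under_carrier:
  assumes ob: "X \<in> Ob C" "Y \<in> Ob C"
  shows "mor (under C) X Y = under_class C ` {f. \<guillemotleft>f : X \<rightarrow> Y\<guillemotright>}"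
proof -
  have "mor (under C) X Y = (\<lambda>f. proj_trivial C X Y +>\<^bsub>Hom C X Y\<^esub> f) ` mor C X Y"
    unfolding under_simps by (rule module.quot_module_simps(1)[OF hom_module[OF ob] proj_trivial_submodule[OF ob]])
  also have "\<dots> = under_class C ` {f. \<guillemotleft>f : X \<rightarrow> Y\<guillemotright>}"
    by (rule image_cong) (use under_class_coset in_hom_iff[OF ob] in auto)
  finally show ?thesis .
qed

lemma over_carrier:
  assumes ob: "X \<in> Ob C" "Y \<in> Ob C"
  shows "mor (over C) X Y = over_class C ` {f. \<guillemotleft>f : X \<rightarrow> Y\<guillemotright>}"
proof -
  have "mor (over C) X Y = (\<lambda>f. inj_trivial C X Y +>\<^bsub>Hom C X Y\<^esub> f) ` mor C X Y"
    unfolding over_simps by (rule module.quot_module_simps(1)[OF hom_module[OF ob] inj_trivial_submodule[OF ob]])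
  also have "\<dots> = over_class C ` {f. \<guillemotleft>f : X \<rightarrow> Y\<guillemotright>}"
    by (rule image_cong) (use over_class_coset in_hom_iff[OF ob] in auto)
  finally show ?thesis .
qed

lemma under_class_plus:
  assumes f: "\<guillemotleft>f : X \<rightarrow> Y\<guillemotright>" and g: "\<guillemotleft>g : X \<rightarrow> Y\<guillemotright>"
  shows "under_class C f \<oplus>\<^bsub>Hom (under C) X Y\<^esub> under_class C g = under_class C (f \<boxplus> g)"
proof -
  have ob: "X \<in> Ob C" "Y \<in> Ob C" using f by auto
  have s: "\<guillemotleft>f \<boxplus> g : X \<rightarrow> Y\<guillemotright>" using f g by simp
  show ?thesis
    unfolding under_class_coset[OF f] under_class_coset[OF g] under_class_coset[OF s] unfolding under_simps hom_plus[OF f, symmetric]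
    by (rule module.quot_module_simps(3)[OF hom_module[OF ob] proj_trivial_submodule[OF ob]]) (use f g in_hom_iff[OF ob] in auto)
qed

lemma under_class_scale:
  assumes f: "\<guillemotleft>f : X \<rightarrow> Y\<guillemotright>" and a: "a \<in> carrier k"
  shows "a \<odot>\<^bsub>Hom (under C) X Y\<^esub> under_class C f = under_class C (scale a f)"
proof -
  have ob: "X \<in> Ob C" "Y \<in> Ob C" using f by auto
  have s: "\<guillemotleft>scale a f : X \<rightarrow> Y\<guillemotright>" using f a by simp
  show ?thesis
    unfolding under_class_coset[OF f] under_class_coset[OF s] unfolding under_simps hom_scale[OF f, symmetric]
    by (rule module.quot_module_simps(4)[OF hom_module[OF ob] proj_trivial_submodule[OF ob] a]) (use f in_hom_iff[OF ob] in auto)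
qed

lemma under_class_nul:
  assumes ob: "X \<in> Ob C" "Y \<in> Ob C"
  shows "\<zero>\<^bsub>Hom (under C) X Y\<^esub> = under_class C (nul X Y)"
proof -
  have n: "\<guillemotleft>nul X Y : X \<rightarrow> Y\<guillemotright>" using ob by simp
  show ?thesis unfolding under_class_coset[OF n] under_simps
    by (rule module.quot_module_simps(2)[OF hom_module[OF ob] proj_trivial_submodule[OF ob]])
qed

lemma proj_trivial_plus:
  assumes "f \<in> proj_trivial C X Y" "g \<in> proj_trivial C X Y" "X \<in> Ob C" "Y \<in> Ob C"
  shows "f \<boxplus> g \<in> proj_trivial C X Y"
  using module.submoduleD(3)[OF hom_module[OF assms(3,4)] proj_trivial_submodule[OF assms(3,4)] assms(1,2)]
    hom_plus[of f X Y g] proj_trivial_iff[OF assms(3,4)] assms(1) by simp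

text \<open>\<open>b a - g f = b (a - f) + (b - g) f\<close> lies in the ideal, so the union over
  representatives in \<open>quot_category\<close> collapses to one class.\<close>

lemma under_comp:
  assumes f: "\<guillemotleft>f : X \<rightarrow> Y\<guillemotright>" and g: "\<guillemotleft>g : Y \<rightarrow> Z\<guillemotright>"
  shows "under_class C g \<cdot>\<^bsub>under C\<^esub> under_class C f = under_class C (g \<cdot> f)"
proof -
  have ob: "X \<in> Ob C" "Y \<in> Ob C" "Z \<in> Ob C" using f g by auto
  have gf: "\<guillemotleft>g \<cdot> f : X \<rightarrow> Z\<guillemotright>" using f g by simp
  have const: "under_class C (b \<cdot> a) = under_class C (g \<cdot> f)" if ab: "b \<in> under_class C g" "a \<in> under_class C f" for a b
  proof -
    have b: "\<guillemotleft>b : Y \<rightarrow> Z\<guillemotright>" "b \<boxplus> neg g \<in> proj_trivial C Y Z" using ab(1) mem_under_class[OF g] by auto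
    have a: "\<guillemotleft>a : X \<rightarrow> Y\<guillemotright>" "a \<boxplus> neg f \<in> proj_trivial C X Y" using ab(2) mem_under_class[OF f] by auto
    have ba: "\<guillemotleft>b \<cdot> a : X \<rightarrow> Z\<guillemotright>" using a b by simp
    have 1: "(b \<boxplus> neg g) \<cdot> f \<in> proj_trivial C X Z" by (rule proj_trivial_comp(2)[OF b(2) ob(2,3) f])
    have 2: "b \<cdot> (a \<boxplus> neg f) \<in> proj_trivial C X Z" by (rule proj_trivial_comp(1)[OF a(2) ob(1,2) b(1)])
    have "b \<cdot> (a \<boxplus> neg f) \<boxplus> (b \<boxplus> neg g) \<cdot> f = b \<cdot> a \<boxplus> (neg (b \<cdot> f) \<boxplus> (b \<cdot> f \<boxplus> neg (g \<cdot> f)))"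
      using a(1) b(1) f g by simp
    also have "neg (b \<cdot> f) \<boxplus> (b \<cdot> f \<boxplus> neg (g \<cdot> f)) = neg (b \<cdot> f) \<boxplus> b \<cdot> f \<boxplus> neg (g \<cdot> f)"
      by (rule plus_assoc[symmetric]) (use b(1) f g in auto)
    also have "\<dots> = neg (g \<cdot> f)" using b(1) f g by (simp del: plus_assoc)
    finally show ?thesis
      unfolding under_class_eq_iff[OF ba gf] using proj_trivial_plus[OF 2 1 ob(1,3)] by simp
  qed
  have ne: "under_class C g \<noteq> {}" "under_class C f \<noteq> {}"
    using mem_under_class[OF f, of f] mem_under_class[OF g, of g] f g
      module.submoduleD(2)[OF hom_module proj_trivial_submodule] ob by auto
  have "under_class C g \<cdot>\<^bsub>under C\<^esub> under_class C f = (\<Union>b\<in>under_class C g. \<Union>a\<in>under_class C f. under_class C (b \<cdot> a))"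
    by (simp add: quot_category_def)
  also have "\<dots> = under_class C (g \<cdot> f)"
    by (rule SUP_eq_const[OF ne(1)], rule SUP_eq_const[OF ne(2)], rule const)
  finally show ?thesis .
qed

section \<open>Images of stable Hom, kernels of Ext and connecting maps\<close>

lemma Im_under_Hom_eq:
  assumes "\<guillemotleft>h : Q \<rightarrow> Y\<guillemotright>" "P \<in> Ob C"
  shows "Im_under_Hom C P h = (\<lambda>u. under_class C (h \<cdot> u)) ` {u. \<guillemotleft>u : P \<rightarrow> Q\<guillemotright>}"
proof -
  have Q: "Q \<in> Ob C" using assms by auto
  have "Im_under_Hom C P h = (\<lambda>u. under_class C h \<cdot>\<^bsub>under C\<^esub> under_class C u) ` {u. \<guillemotleft>u : P \<rightarrow> Q\<guillemotright>}"
    unfolding Im_under_Hom_def using assms(1) under_carrier[OF assms(2) Q] by (simp add: image_image)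
  also have "\<dots> = (\<lambda>u. under_class C (h \<cdot> u)) ` {u. \<guillemotleft>u : P \<rightarrow> Q\<guillemotright>}"
    by (rule image_cong) (use under_comp assms(1) in auto)
  finally show ?thesis .
qed

text \<open>This is Ker Ext^1(h, K). For a deflation it is the image of the connecting map
  (\<open>Im_connecting_eq\<close>), but it makes sense for every \<open>h\<close> into
  \<open>Y\<close>, and by \<open>pull_kernel_mono\<close> it depends only on the right equivalence
  class of \<open>h\<close>.\<close>

definition pull_kernel :: "'m \<Rightarrow> 'o \<Rightarrow> ('m \<times> 'm) set set" where
  "pull_kernel h K = {e \<in> carrier (Ext C (Cod C h) K). ext_pull C h e = \<zero>\<^bsub>Ext C (Dom C h) K\<^esub>}"

text \<open>Two representatives differ by an injectively trivial morphism, along which the pushout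
  of the conflation is zero.\<close>

lemma connecting_map_over_class:
  assumes xi: "(i, d) \<in> Confl C" and g: "\<guillemotleft>g : Dom C i \<rightarrow> K\<guillemotright>"
  shows "connecting_map C (i, d) (over_class C g) = ext_push C g (ext_class C (i, d))"
proof -
  have ob: "Dom C i \<in> Ob C" "K \<in> Ob C" "Cod C d \<in> Ob C" using g conflD[OF xi] by auto
  have xi_in: "ext_class C (i, d) \<in> carrier (Ext C (Cod C d) (Dom C i))" using ext_classI[OF xi] by simp
  interpret E: module k "Ext C (Cod C d) K" by (rule ext_module[OF ob(3,2)])
  have const: "ext_push C g' (ext_class C (i, d)) = ext_push C g (ext_class C (i, d))" if "g' \<in> over_class C g" for g'
  proof -
    have g': "\<guillemotleft>g' : Dom C i \<rightarrow> K\<guillemotright>" "g' \<boxplus> neg g \<in> inj_trivial C (Dom C i) K" using that mem_over_class[OF g] by auto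
    have t: "\<guillemotleft>g' \<boxplus> neg g : Dom C i \<rightarrow> K\<guillemotright>" "ext_push C (g' \<boxplus> neg g) (ext_class C (i, d)) = \<zero>\<^bsub>Ext C (Cod C d) K\<^esub>"
      using g'(2) inj_trivial_iff[OF ob(1,2)] xi_in by auto
    have "g \<boxplus> (g' \<boxplus> neg g) = g'" by (rule plus_diff_cancel) (use g g' in auto)
    then have "ext_push C g' (ext_class C (i, d)) = ext_push C g (ext_class C (i, d)) \<oplus>\<^bsub>Ext C (Cod C d) K\<^esub> ext_push C (g' \<boxplus> neg g) (ext_class C (i, d))"
      using push_plus[OF xi_in g t(1)] by simp
    then show ?thesis using t(2) push_closed[OF xi_in g] by simp
  qed
  have "over_class C g \<noteq> {}"
    using mem_over_class[OF g, of g] g module.submoduleD(2)[OF hom_module inj_trivial_submodule] ob by auto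
  then show ?thesis unfolding connecting_map_def by (rule SUP_eq_const) (rule const)
qed

lemma Im_connecting_eq:
  assumes xi: "(i, d) \<in> Confl C" and K: "K \<in> Ob C"
  shows "Im_connecting C (i, d) K = pull_kernel d K"
proof -
  have ob: "Dom C i \<in> Ob C" using conflD[OF xi] by auto
  have "Im_connecting C (i, d) K = connecting_map C (i, d) ` over_class C ` {g. \<guillemotleft>g : Dom C i \<rightarrow> K\<guillemotright>}"
    unfolding Im_connecting_def fst_conv over_carrier[OF ob K] ..
  also have "\<dots> = (\<lambda>g. ext_push C g (ext_class C (i, d))) ` {g. \<guillemotleft>g : Dom C i \<rightarrow> K\<guillemotright>}"
    unfolding image_image by (rule image_cong) (use connecting_map_over_class[OF xi] in auto)
  also have "\<dots> = pull_kernel d K" unfolding pull_kernel_def by (rule image_connecting[OF xi K])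
  finally show ?thesis .
qed

section \<open>Right equivalence\<close>

lemma factors_through_iff:
  assumes "arr C g" "arr C f" "Cod C f = Cod C g"
  shows "factors_through C g f \<longleftrightarrow> (\<exists>u. \<guillemotleft>u : Dom C g \<rightarrow> Dom C f\<guillemotright> \<and> f \<cdot> u = g)"
  unfolding factors_through_def using in_hom_iff[of "Dom C g" "Dom C f"] assms by auto

lemma factors_through_refl: "arr C f \<Longrightarrow> factors_through C f f"
  unfolding factors_through_def using ide_closed by force

lemma factors_through_trans:
  assumes "factors_through C f g" "factors_through C g h" "arr C f" "arr C g" "arr C h" "Cod C f = Cod C g" "Cod C g = Cod C h"
  shows "factors_through C f h"
proof -
  obtain u where u: "\<guillemotleft>u : Dom C f \<rightarrow> Dom C g\<guillemotright>" "g \<cdot> u = f" using assms factors_through_iff[of f g] by auto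
  obtain v where v: "\<guillemotleft>v : Dom C g \<rightarrow> Dom C h\<guillemotright>" "h \<cdot> v = g" using assms factors_through_iff[of g h] by auto
  have "h \<cdot> (v \<cdot> u) = g \<cdot> u" by (rule comp_eq_comp[OF v(2)]) (use u v assms in auto)
  then have "\<guillemotleft>v \<cdot> u : Dom C f \<rightarrow> Dom C h\<guillemotright> \<and> h \<cdot> (v \<cdot> u) = f" using u v by simp
  then show ?thesis unfolding factors_through_iff[OF assms(3,5) trans[OF assms(6,7), symmetric]] by blast
qed

lemma right_class_eqI:
  assumes "arr C f" "arr C g" "Cod C f = Cod C g" "factors_through C f g" "factors_through C g f"
  shows "right_class C f = right_class C g"
  using assms factors_through_trans[of f g] factors_through_trans[of g f] factors_through_trans[of _ f g] factors_through_trans[of _ g f]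
  unfolding right_class_def by (intro Collect_cong) metis

lemma pull_kernel_mono:
  assumes "factors_through C f g" "arr C f" "arr C g" "Cod C f = Cod C g" "K \<in> Ob C"
  shows "pull_kernel g K \<subseteq> pull_kernel f K"
proof
  fix e assume "e \<in> pull_kernel g K"
  then have e: "e \<in> carrier (Ext C (Cod C g) K)" "ext_pull C g e = \<zero>\<^bsub>Ext C (Dom C g) K\<^esub>" by (auto simp: pull_kernel_def)
  obtain u where u: "\<guillemotleft>u : Dom C f \<rightarrow> Dom C g\<guillemotright>" "g \<cdot> u = f" using assms factors_through_iff[of f g] by auto
  have "ext_pull C f e = ext_pull C u (ext_pull C g e)"
    using pull_comp[OF e(1), of g "Dom C g" u "Dom C f"] u assms by simp
  then show "e \<in> pull_kernel f K" unfolding pull_kernel_def using e assms pull_zero[OF u(1) assms(5)] by simp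
qed

lemma right_classD:
  "g \<in> right_class C f \<Longrightarrow> arr C g \<and> Cod C g = Cod C f \<and> factors_through C f g \<and> factors_through C g f"
  by (simp add: right_class_def)

section \<open>Submodules over the endomorphism rings\<close>

text \<open>Functionals into \<open>J\<close> separate \<open>k\<close>-submodules, so stability
  under the endomorphisms of \<open>K\<close> is split off as a closure property of its own.\<close>

lemma ext_submodules_iff:
  assumes ob: "Y \<in> Ob C" "K \<in> Ob C"
  shows "L \<in> submodules (End_ring C K) (Ext_End_module C Y K) \<longleftrightarrow>
    submodule L k (Ext C Y K) \<and> (\<forall>g e. \<guillemotleft>g : K \<rightarrow> K\<guillemotright> \<longrightarrow> e \<in> L \<longrightarrow> ext_push C g e \<in> L)"
proof -
  have am: "subgroup L (add_monoid (Ext_End_module C Y K)) \<longleftrightarrow> subgroup L (add_monoid (Ext C Y K))"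
    by (rule subgroup_add_monoid_cong) (simp_all add: Ext_End_module_def)
  have "submodule L (End_ring C K) (Ext_End_module C Y K) \<longleftrightarrow> subgroup L (add_monoid (Ext C Y K)) \<and>
    (\<forall>g e. \<guillemotleft>g : K \<rightarrow> K\<guillemotright> \<longrightarrow> e \<in> L \<longrightarrow> ext_push C g e \<in> L)"
    unfolding submodule_def submodule_axioms_def am using in_hom_iff[OF ob(2,2)]
    by (auto simp: End_ring_def Ext_End_module_def)
  also have "\<dots> \<longleftrightarrow> submodule L k (Ext C Y K) \<and> (\<forall>g e. \<guillemotleft>g : K \<rightarrow> K\<guillemotright> \<longrightarrow> e \<in> L \<longrightarrow> ext_push C g e \<in> L)"
    unfolding submodule_def submodule_axioms_def Ext_smult[OF ob] using ob(2) by auto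
  finally show ?thesis by (simp add: submodules_def)
qed

lemma under_submodules_iff:
  assumes ob: "P \<in> Ob C" "Y \<in> Ob C"
  shows "H \<in> submodules (op_ring (End_ring C P)) (under_End_module C P Y) \<longleftrightarrow>
    submodule H k (Hom (under C) P Y) \<and> (\<forall>h a. \<guillemotleft>h : P \<rightarrow> P\<guillemotright> \<longrightarrow> a \<in> H \<longrightarrow> a \<cdot>\<^bsub>under C\<^esub> under_class C h \<in> H)"
proof -
  have am: "subgroup H (add_monoid (under_End_module C P Y)) \<longleftrightarrow> subgroup H (add_monoid (Hom (under C) P Y))"
    by (rule subgroup_add_monoid_cong) (simp_all add: under_End_module_def)
  have "submodule H (op_ring (End_ring C P)) (under_End_module C P Y) \<longleftrightarrow> subgroup H (add_monoid (Hom (under C) P Y)) \<and>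
    (\<forall>h a. \<guillemotleft>h : P \<rightarrow> P\<guillemotright> \<longrightarrow> a \<in> H \<longrightarrow> a \<cdot>\<^bsub>under C\<^esub> under_class C h \<in> H)"
    unfolding submodule_def submodule_axioms_def am using in_hom_iff[OF ob(1,1)]
    by (auto simp: End_ring_def op_ring_def under_End_module_def)
  also have "\<dots> \<longleftrightarrow> submodule H k (Hom (under C) P Y) \<and> (\<forall>h a. \<guillemotleft>h : P \<rightarrow> P\<guillemotright> \<longrightarrow> a \<in> H \<longrightarrow> a \<cdot>\<^bsub>under C\<^esub> under_class C h \<in> H)"
  proof -
    have "a \<odot>\<^bsub>Hom (under C) P Y\<^esub> x \<in> H"
      if sg: "subgroup H (add_monoid (Hom (under C) P Y))" and cl: "\<forall>h a. \<guillemotleft>h : P \<rightarrow> P\<guillemotright> \<longrightarrow> a \<in> H \<longrightarrow> a \<cdot>\<^bsub>under C\<^esub> under_class C h \<in> H"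
        and a: "a \<in> carrier k" and x: "x \<in> H" for a x
    proof -
      have "x \<in> mor (under C) P Y" using subgroup.subset[OF sg] x by auto
      then obtain f where f: "\<guillemotleft>f : P \<rightarrow> Y\<guillemotright>" "x = under_class C f" using under_carrier[OF ob] by auto
      have s: "\<guillemotleft>scale a (Ide C P) : P \<rightarrow> P\<guillemotright>" using a ob by simp
      have "a \<odot>\<^bsub>Hom (under C) P Y\<^esub> x = x \<cdot>\<^bsub>under C\<^esub> under_class C (scale a (Ide C P))"
        unfolding f(2) under_class_scale[OF f(1) a] under_comp[OF s f(1)] scale_as_comp[OF f(1) a] ..
      then show ?thesis using cl s x by simp
    qed
    then show ?thesis unfolding submodule_def submodule_axioms_def by blast
  qed
  finally show ?thesis by (simp add: submodules_def)
qed

lemma pull_kernel_submodule: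
  assumes h: "\<guillemotleft>h : Q \<rightarrow> Y\<guillemotright>" and K: "K \<in> Ob C"
  shows "pull_kernel h K \<in> submodules (End_ring C K) (Ext_End_module C Y K)"
proof -
  have ob: "Q \<in> Ob C" "Y \<in> Ob C" using h by auto
  interpret E: module k "Ext C Y K" by (rule ext_module[OF ob(2) K])
  interpret F: module k "Ext C Q K" by (rule ext_module[OF ob(1) K])
  have eq: "pull_kernel h K = {e \<in> carrier (Ext C Y K). ext_pull C h e = \<zero>\<^bsub>Ext C Q K\<^esub>}"
    using h by (simp add: pull_kernel_def)
  have "submodule (pull_kernel h K) k (Ext C Y K)"
    unfolding eq by (rule E.submoduleI') (use pull_zero[OF h K] pull_add[OF _ _ h] pull_smult[OF _ h] in auto)
  moreover have "ext_push C g e \<in> pull_kernel h K" if g: "\<guillemotleft>g : K \<rightarrow> K\<guillemotright>" and "e \<in> pull_kernel h K" for g e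
  proof -
    have e: "e \<in> carrier (Ext C Y K)" "ext_pull C h e = \<zero>\<^bsub>Ext C Q K\<^esub>" using that unfolding eq by auto
    show ?thesis unfolding eq using push_closed[OF e(1) g] push_pull[OF e(1) g h] e(2) push_zero[OF g ob(1)] by simp
  qed
  ultimately show ?thesis unfolding ext_submodules_iff[OF ob(2) K] by blast
qed

lemma Im_under_Hom_submodule:
  assumes h: "\<guillemotleft>h : Q \<rightarrow> Y\<guillemotright>" and P: "P \<in> Ob C"
  shows "Im_under_Hom C P h \<in> submodules (op_ring (End_ring C P)) (under_End_module C P Y)"
proof -
  have ob: "Q \<in> Ob C" "Y \<in> Ob C" using h by auto
  interpret U: module k "Hom (under C) P Y" by (rule under_module[OF P ob(2)])
  note eq = Im_under_Hom_eq[OF h P]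
  have "submodule (Im_under_Hom C P h) k (Hom (under C) P Y)"
  proof (rule U.submoduleI')
    show "Im_under_Hom C P h \<subseteq> mor (under C) P Y" unfolding eq under_carrier[OF P ob(2)] using h by auto
    have "under_class C (h \<cdot> nul P Q) \<in> Im_under_Hom C P h" unfolding eq using P ob by auto
    then show "\<zero>\<^bsub>Hom (under C) P Y\<^esub> \<in> Im_under_Hom C P h" unfolding under_class_nul[OF P ob(2)] using h P by simp
    show "x \<oplus>\<^bsub>Hom (under C) P Y\<^esub> y \<in> Im_under_Hom C P h" if xy: "x \<in> Im_under_Hom C P h" "y \<in> Im_under_Hom C P h" for x y
    proof -
      obtain u v where *: "\<guillemotleft>u : P \<rightarrow> Q\<guillemotright>" "\<guillemotleft>v : P \<rightarrow> Q\<guillemotright>" "x = under_class C (h \<cdot> u)" "y = under_class C (h \<cdot> v)"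
        using xy unfolding eq by auto
      have "x \<oplus>\<^bsub>Hom (under C) P Y\<^esub> y = under_class C (h \<cdot> u \<boxplus> h \<cdot> v)"
        unfolding *(3,4) by (rule under_class_plus) (use * h in auto)
      also have "h \<cdot> u \<boxplus> h \<cdot> v = h \<cdot> (u \<boxplus> v)" using * h by simp
      finally show ?thesis unfolding eq using * by auto
    qed
    show "a \<odot>\<^bsub>Hom (under C) P Y\<^esub> x \<in> Im_under_Hom C P h" if a: "a \<in> carrier k" and x: "x \<in> Im_under_Hom C P h" for a x
    proof -
      obtain u where *: "\<guillemotleft>u : P \<rightarrow> Q\<guillemotright>" "x = under_class C (h \<cdot> u)" using x unfolding eq by auto
      have "a \<odot>\<^bsub>Hom (under C) P Y\<^esub> x = under_class C (scale a (h \<cdot> u))"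
        unfolding *(2) by (rule under_class_scale[OF _ a]) (use * h in auto)
      also have "scale a (h \<cdot> u) = h \<cdot> scale a u" using * h a by simp
      finally show ?thesis unfolding eq using * a by auto
    qed
  qed
  moreover have "x \<cdot>\<^bsub>under C\<^esub> under_class C g \<in> Im_under_Hom C P h" if g: "\<guillemotleft>g : P \<rightarrow> P\<guillemotright>" and x: "x \<in> Im_under_Hom C P h" for g x
  proof -
    obtain u where *: "\<guillemotleft>u : P \<rightarrow> Q\<guillemotright>" "x = under_class C (h \<cdot> u)" using x unfolding eq by auto
    have hu: "\<guillemotleft>h \<cdot> u : P \<rightarrow> Y\<guillemotright>" using * h by simp
    have "x \<cdot>\<^bsub>under C\<^esub> under_class C g = under_class C (h \<cdot> (u \<cdot> g))"
      unfolding *(2) under_comp[OF g hu] using * h g by simp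
    then show ?thesis unfolding eq using * g by auto
  qed
  ultimately show ?thesis unfolding under_submodules_iff[OF P ob(2)] by blast
qed

end

section \<open>Determination by the representing object\<close>

text \<open>One \<open>K\<close> is fixed; \<open>P\<close> stands for \<open>\<tau>i K\<close> and
  \<open>\<psi>\<close> for the family \<open>\<psi> K\<close> of the duality.\<close>

locale represented_ext = exact_category k C
  for k :: "'k ring" and C :: "('k, 'o, 'm) excat" (structure) +
  fixes J :: "('k, 'j) module" and K P :: 'o and \<psi> :: "'o \<Rightarrow> 'm set \<Rightarrow> ('m \<times> 'm) set \<Rightarrow> 'j"
  assumes art: "artinian_cring k" and J_inj: "injective_module k J" and J_cog: "cogenerator k J"
    and hom_fin: "hom_finite k C" and K: "K \<in> Ob C" and P: "P \<in> Ob C" and rep: "represents_l k J C K P \<psi>"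
begin

section \<open>The representing isomorphism on representatives\<close>

lemma J_module: "module k J"
  using J_inj by (simp add: injective_module_def)

lemma psi_iso: "Y \<in> Ob C \<Longrightarrow> \<psi> Y \<in> lin_isos k (Hom (under C) P Y) (Dual k J (Ext C Y K))"
  using rep by (simp add: represents_l_def)

lemma psi_lin:
  assumes "\<guillemotleft>f : P \<rightarrow> Y\<guillemotright>"
  shows "\<psi> Y (under_class C f) \<in> lin_maps k (Ext C Y K) J"
proof -
  have Y: "Y \<in> Ob C" using assms by auto
  then have "under_class C f \<in> mor (under C) P Y" using under_carrier[OF P] assms by auto
  moreover have "bij_betw (\<psi> Y) (mor (under C) P Y) (lin_maps k (Ext C Y K) J)"
    using psi_iso[OF Y] by (simp add: lin_isos_def Dual_def)
  ultimately show ?thesis using bij_betwE by blast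
qed

lemma psi_surj:
  assumes "\<alpha> \<in> lin_maps k (Ext C Y K) J" "Y \<in> Ob C"
  obtains f where "\<guillemotleft>f : P \<rightarrow> Y\<guillemotright>" "\<psi> Y (under_class C f) = \<alpha>"
proof -
  have "\<alpha> \<in> \<psi> Y ` mor (under C) P Y"
    using psi_iso[OF assms(2)] assms(1) unfolding lin_isos_def bij_betw_def by (simp add: Dual_def)
  then show ?thesis using that under_carrier[OF P assms(2)] by auto
qed

lemma psi_eqD:
  assumes f: "\<guillemotleft>f : P \<rightarrow> Y\<guillemotright>" and g: "\<guillemotleft>g : P \<rightarrow> Y\<guillemotright>"
    and eq: "\<And>e. e \<in> carrier (Ext C Y K) \<Longrightarrow> \<psi> Y (under_class C f) e = \<psi> Y (under_class C g) e"
  shows "under_class C f = under_class C g"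
proof -
  have Y: "Y \<in> Ob C" using f by auto
  have "\<psi> Y (under_class C f) = \<psi> Y (under_class C g)"
    using psi_lin[OF f] psi_lin[OF g] eq unfolding lin_maps_def by (auto intro: PiE_ext)
  moreover have "inj_on (\<psi> Y) (mor (under C) P Y)" using psi_iso[OF Y] by (auto simp: lin_isos_def bij_betw_def)
  moreover have "under_class C f \<in> mor (under C) P Y" "under_class C g \<in> mor (under C) P Y"
    using under_carrier[OF P Y] f g by auto
  ultimately show ?thesis using inj_onD by metis
qed

lemma psi_natural:
  assumes f: "\<guillemotleft>f : P \<rightarrow> Y\<guillemotright>" and h: "\<guillemotleft>h : Y \<rightarrow> Y'\<guillemotright>" and e: "e \<in> carrier (Ext C Y' K)"
  shows "\<psi> Y' (under_class C (h \<cdot> f)) e = \<psi> Y (under_class C f) (ext_pull C h e)"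
proof -
  have ob: "Y \<in> Ob C" "Y' \<in> Ob C" using h by auto
  have "h \<in> mor C Y Y'" "under_class C f \<in> mor (under C) P Y"
    using h in_hom_iff[OF ob] under_carrier[OF P ob(1)] f by auto
  then have "\<psi> Y' (under_class C h \<cdot>\<^bsub>under C\<^esub> under_class C f) = dual_map (Ext C Y' K) (ext_pull C h) (\<psi> Y (under_class C f))"
    using rep ob unfolding represents_l_def by blast
  then show ?thesis using e under_comp[OF f h] by (simp add: dual_map_def)
qed

lemma psi_plus:
  assumes f: "\<guillemotleft>f : P \<rightarrow> Y\<guillemotright>" and g: "\<guillemotleft>g : P \<rightarrow> Y\<guillemotright>" and e: "e \<in> carrier (Ext C Y K)"
  shows "\<psi> Y (under_class C (f \<boxplus> g)) e = \<psi> Y (under_class C f) e \<oplus>\<^bsub>J\<^esub> \<psi> Y (under_class C g) e"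
proof -
  have Y: "Y \<in> Ob C" using f by auto
  have "\<psi> Y \<in> lin_maps k (Hom (under C) P Y) (Dual k J (Ext C Y K))" using psi_iso[OF Y] by (simp add: lin_isos_def)
  from lin_mapsD(2)[OF this, of "under_class C f" "under_class C g"]
  show ?thesis using under_carrier[OF P Y] f g e under_class_plus[OF f g] by (simp add: Dual_def)
qed

lemma psi_scale:
  assumes f: "\<guillemotleft>f : P \<rightarrow> Y\<guillemotright>" and a: "a \<in> carrier k" and e: "e \<in> carrier (Ext C Y K)"
  shows "\<psi> Y (under_class C (scale a f)) e = a \<odot>\<^bsub>J\<^esub> \<psi> Y (under_class C f) e"
proof -
  have Y: "Y \<in> Ob C" using f by auto
  have "\<psi> Y \<in> lin_maps k (Hom (under C) P Y) (Dual k J (Ext C Y K))" using psi_iso[OF Y] by (simp add: lin_isos_def)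
  from lin_mapsD(3)[OF this a, of "under_class C f"]
  show ?thesis using under_carrier[OF P Y] f e under_class_scale[OF f a] by (simp add: Dual_def)
qed

lemma psi_zero:
  assumes f: "\<guillemotleft>f : P \<rightarrow> Y\<guillemotright>"
  shows "\<psi> Y (under_class C f) \<zero>\<^bsub>Ext C Y K\<^esub> = \<zero>\<^bsub>J\<^esub>"
proof -
  have Y: "Y \<in> Ob C" using f by auto
  show ?thesis by (rule lin_maps_zero[OF ext_module[OF Y K] J_module psi_lin[OF f]])
qed

section \<open>Annihilators\<close>

text \<open>\<open>\<gamma>(L)\<close> before passing to the stable category.\<close>

definition annihilator :: "'o \<Rightarrow> ('m \<times> 'm) set set \<Rightarrow> 'm set" where
  "annihilator Y L = {f. \<guillemotleft>f : P \<rightarrow> Y\<guillemotright> \<and> (\<forall>e\<in>L. \<psi> Y (under_class C f) e = \<zero>\<^bsub>J\<^esub>)}"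

lemma gamma_eq:
  assumes "\<psi>' K = \<psi>" "\<tau> K = P" "Y \<in> Ob C"
  shows "gamma k J C \<tau> \<psi>' K Y L = under_class C ` annihilator Y L"
proof -
  have "gamma k J C \<tau> \<psi>' K Y L = {a \<in> mor (under C) P Y. \<forall>e\<in>L. \<psi> Y a e = \<zero>\<^bsub>J\<^esub>}"
    unfolding gamma_def using under_carrier[OF P assms(3)] psi_lin assms by (auto simp: Dual_def)
  then show ?thesis unfolding under_carrier[OF P assms(3)] annihilator_def by auto
qed

text \<open>A functional that vanishes on \<open>L\<close> but not at a given element of
  \<open>L'\<close> outside \<open>L\<close> is \<open>\<psi>\<close> of some \<open>f\<close>, and
  the stable class of \<open>f\<close> tells the two annihilators apart. The one-sided form serves
  both the injectivity of \<open>gamma\<close> and the termination of the enlargement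
  process.\<close>

lemma annihilator_antimono:
  assumes L: "submodule L k (Ext C Y K)" and L': "L' \<subseteq> carrier (Ext C Y K)" and Y: "Y \<in> Ob C"
    and sub: "under_class C ` annihilator Y L \<subseteq> under_class C ` annihilator Y L'"
  shows "L' \<subseteq> L"
proof (rule subsetI, rule ccontr)
  fix e assume e: "e \<in> L'" "e \<notin> L"
  have ec: "e \<in> carrier (Ext C Y K)" using e(1) L' by auto
  obtain \<alpha> where a: "\<alpha> \<in> lin_maps k (Ext C Y K) J" "\<alpha> e \<noteq> \<zero>\<^bsub>J\<^esub>" "\<And>x. x \<in> L \<Longrightarrow> \<alpha> x = \<zero>\<^bsub>J\<^esub>"
    by (rule separate_from_submodule[OF J_inj J_cog ext_module[OF Y K] L ec e(2)]) blast
  obtain f where f: "\<guillemotleft>f : P \<rightarrow> Y\<guillemotright>" "\<psi> Y (under_class C f) = \<alpha>" using psi_surj[OF a(1) Y] .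
  have "f \<in> annihilator Y L" using f a(3) by (simp add: annihilator_def)
  then obtain g where "g \<in> annihilator Y L'" "under_class C f = under_class C g" using sub by blast
  then have "\<psi> Y (under_class C f) e = \<zero>\<^bsub>J\<^esub>" using e(1) by (simp add: annihilator_def)
  then show False using f a(2) by simp
qed

text \<open>Exactness of \<open>D\<close>; this is where the injectivity of \<open>J\<close> enters.\<close>

lemma annihilator_pull_kernel:
  assumes h: "\<guillemotleft>h : Q \<rightarrow> Y\<guillemotright>"
  shows "under_class C ` annihilator Y (pull_kernel h K) = Im_under_Hom C P h"
proof -
  have ob: "Q \<in> Ob C" "Y \<in> Ob C" using h by auto
  have ker: "pull_kernel h K = {e \<in> carrier (Ext C Y K). ext_pull C h e = \<zero>\<^bsub>Ext C Q K\<^esub>}"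
    using h by (simp add: pull_kernel_def)
  show ?thesis unfolding Im_under_Hom_eq[OF h P]
  proof (intro equalityI subsetI)
    fix a assume "a \<in> (\<lambda>u. under_class C (h \<cdot> u)) ` {u. \<guillemotleft>u : P \<rightarrow> Q\<guillemotright>}"
    then obtain u where u: "\<guillemotleft>u : P \<rightarrow> Q\<guillemotright>" "a = under_class C (h \<cdot> u)" by auto
    have "h \<cdot> u \<in> annihilator Y (pull_kernel h K)"
      unfolding annihilator_def ker using u(1) h psi_natural[OF u(1) h] psi_zero[OF u(1)] by simp
    then show "a \<in> under_class C ` annihilator Y (pull_kernel h K)" using u(2) by blast
  next
    fix a assume "a \<in> under_class C ` annihilator Y (pull_kernel h K)"
    then obtain f where f: "\<guillemotleft>f : P \<rightarrow> Y\<guillemotright>" "\<And>e. e \<in> pull_kernel h K \<Longrightarrow> \<psi> Y (under_class C f) e = \<zero>\<^bsub>J\<^esub>"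
      and a: "a = under_class C f" by (auto simp: annihilator_def)
    \<comment> \<open>\<open>\<psi> f\<close> kills the kernel of Ext^1(h, K), hence factors through
      that map as \<open>\<beta>\<close>. As \<open>\<beta>\<close> is in turn
      \<open>\<psi> u\<close> for some \<open>u\<close>, naturality turns the factorization into
      \<open>f = h u\<close> in the stable category.\<close>
    obtain \<beta> where b: "\<beta> \<in> lin_maps k (Ext C Q K) J"
      "\<And>e. e \<in> carrier (Ext C Y K) \<Longrightarrow> \<psi> Y (under_class C f) e = \<beta> (ext_pull C h e)"
    proof (rule factor_through_linear[OF J_inj ext_module[OF ob(2) K] ext_module[OF ob(1) K] _ _ _ psi_lin[OF f(1)]])
      show "\<psi> Y (under_class C f) e = \<zero>\<^bsub>J\<^esub>" if "e \<in> carrier (Ext C Y K)" "ext_pull C h e = \<zero>\<^bsub>Ext C Q K\<^esub>" for e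
        using f(2) that unfolding ker by simp
    qed (use pull_closed[OF _ h] pull_add[OF _ _ h] pull_smult[OF _ h] in auto)
    obtain u where u: "\<guillemotleft>u : P \<rightarrow> Q\<guillemotright>" "\<psi> Q (under_class C u) = \<beta>" using psi_surj[OF b(1) ob(1)] .
    have hu: "\<guillemotleft>h \<cdot> u : P \<rightarrow> Y\<guillemotright>" using u h by simp
    have "under_class C f = under_class C (h \<cdot> u)"
      by (rule psi_eqD[OF f(1) hu]) (use b(2) psi_natural[OF u(1) h] u(2) in simp)
    then show "a \<in> (\<lambda>u. under_class C (h \<cdot> u)) ` {u. \<guillemotleft>u : P \<rightarrow> Q\<guillemotright>}" using a u(1) by blast
  qed
qed

lemma hom_fg:
  assumes "X \<in> Ob C" "Y \<in> Ob C"
  shows "module.fg k (Hom C X Y) (mor C X Y)"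
  by (rule module.finitely_generated_fg[OF hom_module[OF assms]]) (use hom_fin assms in \<open>simp add: hom_finite_def\<close>)

lemma hom_dcc:
  assumes "X \<in> Ob C" "Y \<in> Ob C"
  shows "module.dcc k (Hom C X Y) (mor C X Y)"
  by (rule module.fg_dcc[OF hom_module[OF assms] hom_fg[OF assms] art])

text \<open>Annihilators are compared in \<open>Hom C P Y\<close> itself and not in its stable
  quotient, since hom-finiteness provides the chain condition there.\<close>

lemma annihilator_submodule:
  assumes Y: "Y \<in> Ob C" and L: "L \<subseteq> carrier (Ext C Y K)"
  shows "submodule (annihilator Y L) k (Hom C P Y)"
proof -
  interpret H: module k "Hom C P Y" by (rule hom_module[OF P Y])
  interpret J: module k J by (rule J_module)
  note Le = subsetD[OF L]
  have ann: "\<guillemotleft>f : P \<rightarrow> Y\<guillemotright>" "\<And>e. e \<in> L \<Longrightarrow> \<psi> Y (under_class C f) e = \<zero>\<^bsub>J\<^esub>" if "f \<in> annihilator Y L" for f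
    using that by (auto simp: annihilator_def)
  show ?thesis
  proof (rule H.submoduleI')
    show "annihilator Y L \<subseteq> mor C P Y" using ann(1) in_hom_iff[OF P Y] by auto
    have n: "\<guillemotleft>nul P Y : P \<rightarrow> Y\<guillemotright>" using P Y by simp
    have "\<psi> Y (under_class C (nul P Y)) e = \<zero>\<^bsub>J\<^esub>" if "e \<in> L" for e
    proof -
      have "\<psi> Y (under_class C (nul P Y)) e \<oplus>\<^bsub>J\<^esub> \<psi> Y (under_class C (nul P Y)) e = \<psi> Y (under_class C (nul P Y)) e"
        using psi_plus[OF n n Le[OF that]] P Y by simp
      then show ?thesis using lin_mapsD(1)[OF psi_lin[OF n] Le[OF that]] by simp
    qed
    then show "\<zero>\<^bsub>Hom C P Y\<^esub> \<in> annihilator Y L" using n by (simp add: annihilator_def)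
    show "f \<oplus>\<^bsub>Hom C P Y\<^esub> g \<in> annihilator Y L" if "f \<in> annihilator Y L" "g \<in> annihilator Y L" for f g
      using ann(1)[OF that(1)] ann(1)[OF that(2)] ann(2)[OF that(1)] ann(2)[OF that(2)] Le
      unfolding hom_plus[OF ann(1)[OF that(1)]] annihilator_def by (simp add: psi_plus)
    show "a \<odot>\<^bsub>Hom C P Y\<^esub> f \<in> annihilator Y L" if "a \<in> carrier k" "f \<in> annihilator Y L" for a f
      using ann(1)[OF that(2)] ann(2)[OF that(2)] Le that(1)
      unfolding hom_scale[OF ann(1)[OF that(2)]] annihilator_def by (simp add: psi_scale)
  qed
qed

section \<open>Construction of deflations determined by \<open>P\<close>\<close>

text \<open>As far as \<open>Ext\<^sup>1(-, X)\<close> can see, \<open>X\<close> is a summand of a power of \<open>K\<close>.\<close>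

definition K_cogenerated :: "'o \<Rightarrow> bool" where
  "K_cogenerated X \<longleftrightarrow> (\<forall>T \<eta>. \<eta> \<in> carrier (Ext C T X) \<longrightarrow> (\<forall>u. \<guillemotleft>u : X \<rightarrow> K\<guillemotright> \<longrightarrow> ext_push C u \<eta> = \<zero>\<^bsub>Ext C T K\<^esub>) \<longrightarrow> \<eta> = \<zero>\<^bsub>Ext C T X\<^esub>)"

lemma K_cogeneratedD:
  assumes "K_cogenerated X" "\<eta> \<in> carrier (Ext C T X)" "\<And>u. \<guillemotleft>u : X \<rightarrow> K\<guillemotright> \<Longrightarrow> ext_push C u \<eta> = \<zero>\<^bsub>Ext C T K\<^esub>"
  shows "\<eta> = \<zero>\<^bsub>Ext C T X\<^esub>"
  using assms unfolding K_cogenerated_def by blast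

lemma K_cogenerated_K: "K_cogenerated K"
  unfolding K_cogenerated_def using push_ide K by (metis arr_ide)

text \<open>The identity of \<open>S\<close> splits \<open>\<eta>\<close> into two components: the
  one at \<open>K\<close> is killed directly, the one at \<open>X\<close> by the hypothesis on
  \<open>X\<close>.\<close>

lemma K_cogenerated_biproduct:
  assumes X: "K_cogenerated X" and S: "is_biproduct C X K S \<iota> \<pi>"
  shows "K_cogenerated S"
  unfolding K_cogenerated_def
proof (intro allI impI)
  fix T \<eta> assume e: "\<eta> \<in> carrier (Ext C T S)" and van: "\<forall>u. \<guillemotleft>u : S \<rightarrow> K\<guillemotright> \<longrightarrow> ext_push C u \<eta> = \<zero>\<^bsub>Ext C T K\<^esub>"
  note B = biproductD[OF S]
  have T: "T \<in> Ob C" using ext_obj[OF e] by simp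
  have 1: "ext_push C (fst \<pi>) \<eta> = \<zero>\<^bsub>Ext C T X\<^esub>"
  proof (rule K_cogeneratedD[OF X push_closed[OF e B(6)]])
    fix u assume u: "\<guillemotleft>u : X \<rightarrow> K\<guillemotright>"
    show "ext_push C u (ext_push C (fst \<pi>) \<eta>) = \<zero>\<^bsub>Ext C T K\<^esub>"
      unfolding push_comp[OF e B(6) u] using van u B(6) by simp
  qed
  have 2: "ext_push C (snd \<pi>) \<eta> = \<zero>\<^bsub>Ext C T K\<^esub>" using van B(7) by simp
  have h: "\<guillemotleft>fst \<iota> \<cdot> fst \<pi> : S \<rightarrow> S\<guillemotright>" "\<guillemotleft>snd \<iota> \<cdot> snd \<pi> : S \<rightarrow> S\<guillemotright>" using B by auto
  have "\<eta> = ext_push C (fst \<iota> \<cdot> fst \<pi> \<boxplus> snd \<iota> \<cdot> snd \<pi>) \<eta>" unfolding B(12) using push_ide[OF e] by simp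
  also have "\<dots> = ext_push C (fst \<iota>) (ext_push C (fst \<pi>) \<eta>) \<oplus>\<^bsub>Ext C T S\<^esub> ext_push C (snd \<iota>) (ext_push C (snd \<pi>) \<eta>)"
    unfolding push_plus[OF e h] push_comp[OF e B(6,4)] push_comp[OF e B(7,5)] ..
  also have "\<dots> = \<zero>\<^bsub>Ext C T S\<^esub>"
    unfolding 1 2 push_zero[OF B(4) T] push_zero[OF B(5) T] by (rule ext_sum_zero[OF T B(3)])
  finally show "\<eta> = \<zero>\<^bsub>Ext C T S\<^esub>" .
qed

text \<open>Factoring through \<open>d\<close> means that the pullback of its conflation vanishes. A
  nonzero pullback \<open>\<eta>\<close> along \<open>g\<close> stays nonzero under some
  \<open>u\<close> into \<open>K\<close>, is then detected by a functional on Ext^1(T, K), and this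
  functional comes from some \<open>h\<close> out of \<open>P\<close>. So \<open>\<eta>\<close> does
  not vanish on \<open>h\<close>, and \<open>g h\<close> does not factor either.\<close>

lemma K_cogenerated_determined:
  assumes xi: "(i, d) \<in> Confl C" and sep: "K_cogenerated (Dom C i)"
  shows "right_determined C P d"
  unfolding right_determined_def
proof (intro ballI)
  fix T g assume T: "T \<in> Ob C" and "g \<in> mor C T (Cod C d)"
  note I = conflD[OF xi]
  have g: "\<guillemotleft>g : T \<rightarrow> Cod C d\<guillemotright>" using \<open>g \<in> _\<close> in_hom_iff[OF T] I by auto
  have fac: "factors_through C c d \<longleftrightarrow> ext_pull C c (ext_class C (i, d)) = \<zero>\<^bsub>Ext C X (Dom C i)\<^esub>"
    if c: "\<guillemotleft>c : X \<rightarrow> Cod C d\<guillemotright>" for c X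
    unfolding pull_zero_iff[OF xi c] using factors_through_iff[of c d] c I by simp
  have xi_in: "ext_class C (i, d) \<in> carrier (Ext C (Cod C d) (Dom C i))" using ext_classI[OF xi] by simp
  let ?\<eta> = "ext_pull C g (ext_class C (i, d))"
  have eta: "?\<eta> \<in> carrier (Ext C T (Dom C i))" by (rule pull_closed[OF xi_in g])
  show "factors_through C g d \<longleftrightarrow> (\<forall>h\<in>mor C P T. factors_through C (g \<cdot> h) d)"
  proof
    assume l: "factors_through C g d"
    show "\<forall>h\<in>mor C P T. factors_through C (g \<cdot> h) d"
    proof
      fix h assume "h \<in> mor C P T"
      then have h: "\<guillemotleft>h : P \<rightarrow> T\<guillemotright>" using in_hom_iff[OF P T] by simp
      have gh: "\<guillemotleft>g \<cdot> h : P \<rightarrow> Cod C d\<guillemotright>" using g h by simp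
      show "factors_through C (g \<cdot> h) d"
        unfolding fac[OF gh] pull_comp[OF xi_in g h, symmetric] using l[unfolded fac[OF g]] pull_zero[OF h] I by simp
    qed
  next
    assume r: "\<forall>h\<in>mor C P T. factors_through C (g \<cdot> h) d"
    have "?\<eta> = \<zero>\<^bsub>Ext C T (Dom C i)\<^esub>"
    proof (rule K_cogeneratedD[OF sep eta])
      fix u assume u: "\<guillemotleft>u : Dom C i \<rightarrow> K\<guillemotright>"
      note E = ext_module[OF T K]
      show "ext_push C u ?\<eta> = \<zero>\<^bsub>Ext C T K\<^esub>"
      proof (rule ccontr)
        assume "ext_push C u ?\<eta> \<noteq> \<zero>\<^bsub>Ext C T K\<^esub>"
        then have nz: "ext_push C u ?\<eta> \<notin> {\<zero>\<^bsub>Ext C T K\<^esub>}" by simp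
        obtain \<alpha> where a: "\<alpha> \<in> lin_maps k (Ext C T K) J" "\<alpha> (ext_push C u ?\<eta>) \<noteq> \<zero>\<^bsub>J\<^esub>"
          by (rule separate_from_submodule[OF J_inj J_cog E module.submodule_zero[OF E] push_closed[OF eta u] nz]) blast
        obtain h where h: "\<guillemotleft>h : P \<rightarrow> T\<guillemotright>" "\<psi> T (under_class C h) = \<alpha>" using psi_surj[OF a(1) T] .
        have ide: "\<guillemotleft>Ide C P : P \<rightarrow> P\<guillemotright>" using P by simp
        have gh: "\<guillemotleft>g \<cdot> h : P \<rightarrow> Cod C d\<guillemotright>" using g h by simp
        \<comment> \<open>Yoneda: by naturality at the identity of \<open>P\<close>, the functional
          \<open>\<alpha>\<close> is pullback along \<open>h\<close> followed by a fixed functional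
          on Ext^1(P, K).\<close>
        have "\<alpha> (ext_push C u ?\<eta>) = \<psi> P (under_class C (Ide C P)) (ext_pull C h (ext_push C u ?\<eta>))"
          using psi_natural[OF ide h(1) push_closed[OF eta u]] h by simp
        also have "ext_pull C h (ext_push C u ?\<eta>) = ext_push C u (ext_pull C h ?\<eta>)"
          by (rule push_pull[OF eta u h(1), symmetric])
        also have "ext_pull C h ?\<eta> = ext_pull C (g \<cdot> h) (ext_class C (i, d))" by (rule pull_comp[OF xi_in g h(1)])
        also have "\<dots> = \<zero>\<^bsub>Ext C P (Dom C i)\<^esub>" using r h(1) fac[OF gh] in_hom_iff[OF P T] by simp
        also have "ext_push C u \<zero>\<^bsub>Ext C P (Dom C i)\<^esub> = \<zero>\<^bsub>Ext C P K\<^esub>" by (rule push_zero[OF u P])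
        also have "\<psi> P (under_class C (Ide C P)) \<zero>\<^bsub>Ext C P K\<^esub> = \<zero>\<^bsub>J\<^esub>" by (rule psi_zero[OF ide])
        finally show False using a(2) by simp
      qed
    qed
    then show "factors_through C g d" unfolding fac[OF g] .
  qed
qed

lemma pull_kernel_image:
  assumes "(i, d) \<in> Confl C"
  shows "pull_kernel d K = (\<lambda>g. ext_push C g (ext_class C (i, d))) ` {g. \<guillemotleft>g : Dom C i \<rightarrow> K\<guillemotright>}"
  unfolding pull_kernel_def using image_connecting[OF assms K] by simp

text \<open>The kernel for \<open>d'\<close> is the kernel for \<open>d\<close> plus the
  \<open>End_ring C K\<close>-submodule generated by \<open>e\<close>: a morphism
  \<open>S \<rightarrow> K\<close> splits into a part on \<open>Dom C i\<close>, which pushes the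
  class of \<open>(i, d)\<close>, and an endomorphism of \<open>K\<close>, which pushes
  \<open>e\<close>. Hence it stays inside \<open>L\<close>, and this is where stability of
  \<open>L\<close> under endomorphisms enters.\<close>

lemma enlarge_pull_kernel:
  assumes xi: "(i, d) \<in> Confl C" and Y: "Cod C d = Y" and sep: "K_cogenerated (Dom C i)"
    and L: "L \<in> submodules (End_ring C K) (Ext_End_module C Y K)" and sub: "pull_kernel d K \<subseteq> L" and e: "e \<in> L"
  obtains i' d' where "(i', d') \<in> Confl C" "Cod C d' = Y" "K_cogenerated (Dom C i')"
    "pull_kernel d K \<subseteq> pull_kernel d' K" "e \<in> pull_kernel d' K" "pull_kernel d' K \<subseteq> L"
proof -
  have ob: "Y \<in> Ob C" "Dom C i \<in> Ob C" using conflD[OF xi] Y by auto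
  note L' = L[unfolded ext_submodules_iff[OF ob(1) K]]
  interpret E: module k "Ext C Y K" by (rule ext_module[OF ob(1) K])
  note SL = E.submoduleD[OF conjunct1[OF L']]
  have ec: "e \<in> carrier (Ext C Y K)" using e SL(1) by auto
  have xi_in: "ext_class C (i, d) \<in> carrier (Ext C Y (Dom C i))" using ext_classI[OF xi] Y by simp
  obtain S \<iota> \<pi> where S: "is_biproduct C (Dom C i) K S \<iota> \<pi>" using biproduct_exists[OF ob(2) K] .
  note B = biproductD[OF S]
  obtain w where w: "w \<in> carrier (Ext C Y S)" "ext_push C (fst \<pi>) w = ext_class C (i, d)" "ext_push C (snd \<pi>) w = e"
    using ext_pair_exists[OF xi_in ec S] .
  obtain i' d' where xi': "(i', d') \<in> Confl C" "Dom C i' = S" "Cod C d' = Y" "w = ext_class C (i', d')"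
    by (rule ext_carrierE[OF w(1)]) (metis surj_pair fst_conv snd_conv)
  have ker: "pull_kernel d' K = (\<lambda>g. ext_push C g w) ` {g. \<guillemotleft>g : S \<rightarrow> K\<guillemotright>}"
    using pull_kernel_image[OF xi'(1)] xi' by simp
  show ?thesis
  proof (rule that[OF xi'(1,3)])
    show "K_cogenerated (Dom C i')" unfolding xi'(2) by (rule K_cogenerated_biproduct[OF sep S])
    show "pull_kernel d K \<subseteq> pull_kernel d' K"
    proof
      fix x assume "x \<in> pull_kernel d K"
      then obtain v where v: "\<guillemotleft>v : Dom C i \<rightarrow> K\<guillemotright>" "x = ext_push C v (ext_class C (i, d))" using pull_kernel_image[OF xi] by auto
      have "x = ext_push C (v \<cdot> fst \<pi>) w" using push_comp[OF w(1) B(6) v(1)] w(2) v(2) by simp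
      moreover have "\<guillemotleft>v \<cdot> fst \<pi> : S \<rightarrow> K\<guillemotright>" using v(1) B(6) by simp
      ultimately show "x \<in> pull_kernel d' K" unfolding ker by blast
    qed
    show "e \<in> pull_kernel d' K" unfolding ker using w(3) B(7) by blast
    show "pull_kernel d' K \<subseteq> L"
    proof
      fix x assume "x \<in> pull_kernel d' K"
      then obtain g where g: "\<guillemotleft>g : S \<rightarrow> K\<guillemotright>" "x = ext_push C g w" unfolding ker by auto
      have h: "\<guillemotleft>g \<cdot> fst \<iota> : Dom C i \<rightarrow> K\<guillemotright>" "\<guillemotleft>g \<cdot> snd \<iota> : K \<rightarrow> K\<guillemotright>"
        "\<guillemotleft>g \<cdot> fst \<iota> \<cdot> fst \<pi> : S \<rightarrow> K\<guillemotright>" "\<guillemotleft>g \<cdot> snd \<iota> \<cdot> snd \<pi> : S \<rightarrow> K\<guillemotright>" using g(1) B(1-7) by auto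
      have "g = g \<cdot> fst \<iota> \<cdot> fst \<pi> \<boxplus> g \<cdot> snd \<iota> \<cdot> snd \<pi>"
        using biproduct_decomp(1)[OF S, of g] g(1) B(1-7) by simp
      then have "x = ext_push C (g \<cdot> fst \<iota> \<cdot> fst \<pi> \<boxplus> g \<cdot> snd \<iota> \<cdot> snd \<pi>) w" using g(2) by simp
      also have "\<dots> = ext_push C (g \<cdot> fst \<iota>) (ext_class C (i, d)) \<oplus>\<^bsub>Ext C Y K\<^esub> ext_push C (g \<cdot> snd \<iota>) e"
        unfolding push_plus[OF w(1) h(3,4)] push_comp[OF w(1) B(6) h(1), symmetric] push_comp[OF w(1) B(7) h(2), symmetric] w(2,3) ..
      also have "\<dots> \<in> L"
      proof (rule SL(3))
        show "ext_push C (g \<cdot> fst \<iota>) (ext_class C (i, d)) \<in> L"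
          using sub h(1) unfolding pull_kernel_image[OF xi] by blast
        show "ext_push C (g \<cdot> snd \<iota>) e \<in> L" using L' h(2) e by blast
      qed
      finally show "x \<in> L" .
    qed
  qed
qed

text \<open>Descending chains of annihilators in \<open>Hom(P, Y)\<close> stop, so the enlargement step does too.\<close>

lemma submodule_is_pull_kernel:
  assumes Y: "Y \<in> Ob C" and L: "L \<in> submodules (End_ring C K) (Ext_End_module C Y K)"
  obtains i d where "(i, d) \<in> Confl C" "Cod C d = Y" "right_determined C P d" "pull_kernel d K = L"
proof -
  interpret E: module k "Ext C Y K" by (rule ext_module[OF Y K])
  interpret H: module k "Hom C P Y" by (rule hom_module[OF P Y])
  note L' = L[unfolded ext_submodules_iff[OF Y K]]
  note SL = E.submoduleD[OF conjunct1[OF L']]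
  let ?D = "{(i, d). (i, d) \<in> Confl C \<and> Cod C d = Y \<and> K_cogenerated (Dom C i) \<and> pull_kernel d K \<subseteq> L}"
  let ?S = "(\<lambda>(i, d). annihilator Y (pull_kernel d K)) ` ?D"
  \<comment> \<open>The family \<open>?D\<close> is not empty: the split deflation with kernel term
    \<open>K\<close> has zero kernel on Ext^1, because pulling back along its section undoes pulling
    back along it.\<close>
  obtain i0 d0 s where s: "(i0, d0) \<in> Confl C" "Dom C i0 = K" "Cod C d0 = Y" "\<guillemotleft>s : Y \<rightarrow> Dom C d0\<guillemotright>" "d0 \<cdot> s = Ide C Y"
    using split_confl_exists[OF Y K] .
  have d0: "\<guillemotleft>d0 : Dom C d0 \<rightarrow> Y\<guillemotright>" using conflD[OF s(1)] s(3) by simp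
  have "e = \<zero>\<^bsub>Ext C Y K\<^esub>" if "e \<in> pull_kernel d0 K" for e
  proof -
    have e: "e \<in> carrier (Ext C Y K)" "ext_pull C d0 e = \<zero>\<^bsub>Ext C (Dom C d0) K\<^esub>" using that s(3) by (auto simp: pull_kernel_def)
    have "e = ext_pull C s (ext_pull C d0 e)" unfolding pull_comp[OF e(1) d0 s(4)] s(5) by (rule pull_ide[OF e(1), symmetric])
    then show ?thesis unfolding e(2) pull_zero[OF s(4) K] .
  qed
  then have "(i0, d0) \<in> ?D" using s SL(2) K_cogenerated_K by auto
  then have "annihilator Y (pull_kernel d0 K) \<in> ?S" by force
  then obtain A where A: "A \<in> ?S" and min: "\<And>A'. \<lbrakk>A' \<in> ?S; A' \<subseteq> A\<rbrakk> \<Longrightarrow> A' = A"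
  proof (rule H.dcc_minimal[OF hom_dcc[OF P Y]])
    fix A assume "A \<in> ?S"
    then obtain i d where "pull_kernel d K \<subseteq> L" "A = annihilator Y (pull_kernel d K)" by auto
    then show "submodule A k (Hom C P Y) \<and> A \<subseteq> mor C P Y"
      using annihilator_submodule[OF Y] SL(1) H.submoduleD(1) by (metis subset_trans)
  qed blast
  from A obtain i d where xi: "(i, d) \<in> Confl C" "Cod C d = Y" "K_cogenerated (Dom C i)" "pull_kernel d K \<subseteq> L"
    and Ad: "A = annihilator Y (pull_kernel d K)" by auto
  have d: "\<guillemotleft>d : Dom C d \<rightarrow> Y\<guillemotright>" using conflD[OF xi(1)] xi(2) by simp
  \<comment> \<open>Adjoining any \<open>e\<close> can only shrink the annihilator, which is minimal
    already. Equal annihilators force the larger kernel into the smaller one, so \<open>e\<close>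
    was in the kernel before.\<close>
  have "L \<subseteq> pull_kernel d K"
  proof
    fix e assume e: "e \<in> L"
    obtain i' d' where xi': "(i', d') \<in> Confl C" "Cod C d' = Y" "K_cogenerated (Dom C i')"
      "pull_kernel d K \<subseteq> pull_kernel d' K" "e \<in> pull_kernel d' K" "pull_kernel d' K \<subseteq> L"
      using enlarge_pull_kernel[OF xi(1-3) L xi(4) e] .
    have "annihilator Y (pull_kernel d' K) \<in> ?S" using xi' by force
    moreover have "annihilator Y (pull_kernel d' K) \<subseteq> A" unfolding Ad annihilator_def using xi'(4) by auto
    ultimately have "annihilator Y (pull_kernel d' K) = A" by (rule min)
    then have "pull_kernel d' K \<subseteq> pull_kernel d K"
      using annihilator_antimono[of "pull_kernel d K" Y "pull_kernel d' K"] pull_kernel_submodule[OF d K]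
        ext_submodules_iff[OF Y K] Ad Y xi'(6) SL(1) by auto
    then show "e \<in> pull_kernel d K" using xi'(5) by blast
  qed
  then show ?thesis using that xi K_cogenerated_determined[OF xi(1,3)] by blast
qed

text \<open>The preimage \<open>?H\<close> of \<open>H\<close> in \<open>Hom C P Y\<close> is
  finitely generated over \<open>k\<close>. The morphism \<open>h\<close> is a row of generators of
  \<open>?H\<close> on a power of \<open>P\<close>, with one extra zero entry from the base case, so
  its source is \<open>P\<close> and not a zero object at the start.\<close>

lemma submodule_is_image:
  assumes Y: "Y \<in> Ob C" and H: "H \<in> submodules (op_ring (End_ring C P)) (under_End_module C P Y)"
  obtains Q h where "\<guillemotleft>h : Q \<rightarrow> Y\<guillemotright>" "Im_under_Hom C P h = H"
proof -
  interpret U: module k "Hom (under C) P Y" by (rule under_module[OF P Y])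
  interpret M: module k "Hom C P Y" by (rule hom_module[OF P Y])
  note H' = H[unfolded under_submodules_iff[OF P Y]]
  note SH = U.submoduleD[OF conjunct1[OF H']]
  let ?H = "{f. \<guillemotleft>f : P \<rightarrow> Y\<guillemotright> \<and> under_class C f \<in> H}"
  have n: "\<guillemotleft>nul P Y : P \<rightarrow> Y\<guillemotright>" using P Y by simp
  have Hn: "nul P Y \<in> ?H" using SH(2) under_class_nul[OF P Y] n by simp
  have Hplus: "f \<boxplus> g \<in> ?H" if "f \<in> ?H" "g \<in> ?H" for f g
    using SH(3)[of "under_class C f" "under_class C g"] under_class_plus[of f P Y g] that by simp
  have Hcomp: "f \<cdot> u \<in> ?H" if "f \<in> ?H" "\<guillemotleft>u : P \<rightarrow> P\<guillemotright>" for f u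
  proof -
    have f: "\<guillemotleft>f : P \<rightarrow> Y\<guillemotright>" "under_class C f \<in> H" using that(1) by auto
    then have "under_class C f \<cdot>\<^bsub>under C\<^esub> under_class C u \<in> H" using H' that(2) by blast
    then show ?thesis unfolding under_comp[OF that(2) f(1)] using f that(2) by simp
  qed
  have sub: "submodule ?H k (Hom C P Y)"
  proof (rule M.submoduleI')
    show "?H \<subseteq> mor C P Y" using in_hom_iff[OF P Y] by auto
    show "\<zero>\<^bsub>Hom C P Y\<^esub> \<in> ?H" by (rule Hn)
    show "f \<oplus>\<^bsub>Hom C P Y\<^esub> g \<in> ?H" if "f \<in> ?H" "g \<in> ?H" for f g
      using Hplus[OF that] hom_plus[of f P Y g] that by simp
    show "a \<odot>\<^bsub>Hom C P Y\<^esub> f \<in> ?H" if a: "a \<in> carrier k" and f: "f \<in> ?H" for a f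
    proof -
      have fh: "\<guillemotleft>f : P \<rightarrow> Y\<guillemotright>" using f by simp
      show ?thesis unfolding hom_scale[OF fh] scale_as_comp[OF fh a]
        by (rule Hcomp[OF f]) (use a P in simp)
    qed
  qed
  have "M.fg ?H" by (rule M.dcc_imp_fg[OF art hom_dcc[OF P Y] sub])
  \<comment> \<open>The bound from above is \<open>?H\<close> and not \<open>A\<close>: composites
    with \<open>h\<close> also produce \<open>f u\<close> with \<open>u\<close> an endomorphism of
    \<open>P\<close>, and \<open>A\<close> is stable only under scalars.\<close>
  have "\<exists>Q h. \<guillemotleft>h : Q \<rightarrow> Y\<guillemotright> \<and> (\<forall>f\<in>A. \<exists>u. \<guillemotleft>u : P \<rightarrow> Q\<guillemotright> \<and> f = h \<cdot> u) \<and> (\<forall>u. \<guillemotleft>u : P \<rightarrow> Q\<guillemotright> \<longrightarrow> h \<cdot> u \<in> ?H)"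
    if "M.fg A" "A \<subseteq> ?H" for A
    using that
  proof (induction rule: M.fg.induct)
    case zero
    have "nul P Y \<cdot> u \<in> ?H" if "\<guillemotleft>u : P \<rightarrow> P\<guillemotright>" for u using Hcomp[OF Hn that] .
    moreover have "nul P Y = nul P Y \<cdot> Ide C P" "\<guillemotleft>Ide C P : P \<rightarrow> P\<guillemotright>" using P Y by auto
    ultimately show ?case using n by blast
  next
    case (step A x)
    note A = M.fg_submodule[OF step(1)]
    have x: "x \<in> ?H" and AH: "A \<subseteq> ?H" using M.adjoin_incl[OF A step(2)] step.prems by auto
    have xh: "\<guillemotleft>x : P \<rightarrow> Y\<guillemotright>" using x by simp
    obtain Q h where h: "\<guillemotleft>h : Q \<rightarrow> Y\<guillemotright>" and ex: "\<And>f. f \<in> A \<Longrightarrow> \<exists>u. \<guillemotleft>u : P \<rightarrow> Q\<guillemotright> \<and> f = h \<cdot> u"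
      and all: "\<And>u. \<guillemotleft>u : P \<rightarrow> Q\<guillemotright> \<Longrightarrow> h \<cdot> u \<in> ?H" using step.IH[OF AH] by auto
    have Q: "Q \<in> Ob C" using h by auto
    obtain S \<iota> \<pi> where S: "is_biproduct C Q P S \<iota> \<pi>" using biproduct_exists[OF Q P] .
    note B = biproductD[OF S]
    let ?h = "h \<cdot> fst \<pi> \<boxplus> x \<cdot> snd \<pi>"
    have hh: "\<guillemotleft>?h : S \<rightarrow> Y\<guillemotright>" using h xh B(6,7) by simp
    have "\<exists>u. \<guillemotleft>u : P \<rightarrow> S\<guillemotright> \<and> f = ?h \<cdot> u" if fA: "f \<in> M.adjoin A x" for f
    proof -
      obtain a r where ar: "a \<in> A" "r \<in> carrier k" "f = a \<oplus>\<^bsub>Hom C P Y\<^esub> r \<odot>\<^bsub>Hom C P Y\<^esub> x" using fA by (auto simp: M.adjoin_def)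
      obtain u where u: "\<guillemotleft>u : P \<rightarrow> Q\<guillemotright>" "a = h \<cdot> u" using ex[OF ar(1)] by auto
      have ah: "\<guillemotleft>a : P \<rightarrow> Y\<guillemotright>" using ar(1) AH by auto
      have f: "f = h \<cdot> u \<boxplus> scale r x" using ar(3) hom_scale[OF xh] hom_plus[OF ah] u(2) by simp
      \<comment> \<open>The element \<open>a + r x\<close> is reached by lifting \<open>a\<close>
        through the old summand and taking \<open>r\<close> times the identity on the new
        one.\<close>
      let ?u = "fst \<iota> \<cdot> u \<boxplus> snd \<iota> \<cdot> scale r (Ide C P)"
      have uh: "\<guillemotleft>?u : P \<rightarrow> S\<guillemotright>" using u(1) B(4,5) ar(2) P by simp
      have "?h \<cdot> ?u = h \<cdot> u \<boxplus> scale r x"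
        using h xh u(1) B(1-7) B(8-11) ar(2) P by (simp add: biproduct_comp[OF S])
      then show ?thesis using f uh by metis
    qed
    moreover have "?h \<cdot> u \<in> ?H" if u: "\<guillemotleft>u : P \<rightarrow> S\<guillemotright>" for u
    proof -
      have eq: "?h \<cdot> u = h \<cdot> (fst \<pi> \<cdot> u) \<boxplus> x \<cdot> (snd \<pi> \<cdot> u)" using h xh u B(6,7) by simp
      show ?thesis unfolding eq
        by (rule Hplus[OF all Hcomp[OF x]]) (use u B(6,7) in simp_all)
    qed
    ultimately show ?case using hh by (intro exI[of _ S] exI[of _ ?h] conjI) blast+
  qed
  from this[OF \<open>M.fg ?H\<close> order_refl] obtain Q h where h: "\<guillemotleft>h : Q \<rightarrow> Y\<guillemotright>"
    "\<And>f. f \<in> ?H \<Longrightarrow> \<exists>u. \<guillemotleft>u : P \<rightarrow> Q\<guillemotright> \<and> f = h \<cdot> u" "\<And>u. \<guillemotleft>u : P \<rightarrow> Q\<guillemotright> \<Longrightarrow> h \<cdot> u \<in> ?H" by auto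
  have "Im_under_Hom C P h = H"
    unfolding Im_under_Hom_eq[OF h(1) P]
  proof (intro equalityI subsetI)
    fix a assume "a \<in> H"
    then obtain f where f: "\<guillemotleft>f : P \<rightarrow> Y\<guillemotright>" "a = under_class C f" using SH(1) under_carrier[OF P Y] by auto
    then have "f \<in> ?H" using \<open>a \<in> H\<close> by simp
    then show "a \<in> (\<lambda>u. under_class C (h \<cdot> u)) ` {u. \<guillemotleft>u : P \<rightarrow> Q\<guillemotright>}" using h(2) f(2) by auto
  qed (use h(3) in auto)
  with h(1) show ?thesis using that by blast
qed

text \<open>By determination it is enough to factor the composites \<open>d h\<close> with
  \<open>h\<close> out of \<open>P\<close>. Each agrees with some \<open>d' g\<close> up to a
  projectively trivial morphism; the latter pulls the conflation of \<open>d'\<close> back to zero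
  and so lifts through \<open>d'\<close> too.\<close>

lemma factors_through_of_image:
  assumes xi: "(i, d) \<in> Confl C" "(i', d') \<in> Confl C" and Y: "Cod C d = Cod C d'" and det: "right_determined C P d'"
    and sub: "Im_under_Hom C P d \<subseteq> Im_under_Hom C P d'"
  shows "factors_through C d d'"
proof -
  note I = conflD[OF xi(1)] and I' = conflD[OF xi(2)]
  have d: "\<guillemotleft>d : Dom C d \<rightarrow> Cod C d'\<guillemotright>" and d': "\<guillemotleft>d' : Dom C d' \<rightarrow> Cod C d'\<guillemotright>" using I I' Y by auto
  have ob: "Dom C d \<in> Ob C" "Cod C d' \<in> Ob C" using I I' by auto
  have "factors_through C (d \<cdot> h) d'" if "h \<in> mor C P (Dom C d)" for h
  proof -
    have h: "\<guillemotleft>h : P \<rightarrow> Dom C d\<guillemotright>" using that in_hom_iff[OF P ob(1)] by simp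
    have "under_class C (d \<cdot> h) \<in> Im_under_Hom C P d'" using sub h unfolding Im_under_Hom_eq[OF d P] by blast
    then obtain g where g: "\<guillemotleft>g : P \<rightarrow> Dom C d'\<guillemotright>" "under_class C (d \<cdot> h) = under_class C (d' \<cdot> g)"
      unfolding Im_under_Hom_eq[OF d' P] by auto
    have dh: "\<guillemotleft>d \<cdot> h : P \<rightarrow> Cod C d'\<guillemotright>" and dg: "\<guillemotleft>d' \<cdot> g : P \<rightarrow> Cod C d'\<guillemotright>" using d d' h g by auto
    let ?t = "d \<cdot> h \<boxplus> neg (d' \<cdot> g)"
    have t: "?t \<in> proj_trivial C P (Cod C d')" using under_class_eq_iff[OF dh dg] g(2) by simp
    then have th: "\<guillemotleft>?t : P \<rightarrow> Cod C d'\<guillemotright>" and "ext_pull C ?t (ext_class C (i', d')) = \<zero>\<^bsub>Ext C P (Dom C i')\<^esub>"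
      using proj_trivial_iff[OF P ob(2)] ext_classI[OF xi(2)] by auto
    then obtain v where v: "\<guillemotleft>v : P \<rightarrow> Dom C d'\<guillemotright>" "d' \<cdot> v = ?t" using pull_zero_iff[OF xi(2) th] by auto
    have "d' \<cdot> (g \<boxplus> v) = d' \<cdot> g \<boxplus> ?t" using d' g(1) v by simp
    also have "\<dots> = d \<cdot> h" by (rule plus_diff_cancel) (use dh dg in auto)
    finally have "\<guillemotleft>g \<boxplus> v : P \<rightarrow> Dom C d'\<guillemotright> \<and> d' \<cdot> (g \<boxplus> v) = d \<cdot> h" using g(1) v(1) by simp
    then show ?thesis using factors_through_iff[of "d \<cdot> h" d'] dh d' by auto
  qed
  moreover have "d \<in> mor C (Dom C d) (Cod C d')" using d in_hom_iff[OF ob] by simp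
  ultimately show ?thesis using det ob(1) unfolding right_determined_def by blast
qed

text \<open>The chosen deflation is right equivalent to \<open>d\<close>, so both have the same Ker
  Ext^1(-, K); the image of the stable Hom is recovered from this kernel by
  \<open>annihilator_pull_kernel\<close>.\<close>

lemma class_conflation:
  assumes xi: "(i, d) \<in> Confl C"
  shows "delta C K (right_class C d) = pull_kernel d K" "eta C P (right_class C d) = Im_under_Hom C P d"
proof -
  note I = conflD[OF xi]
  have "d \<in> right_class C d" using I factors_through_refl by (simp add: right_class_def)
  then have "\<exists>\<xi>. \<xi> \<in> Confl C \<and> snd \<xi> \<in> right_class C d" using xi by force
  then have s: "class_conflation C (right_class C d) \<in> Confl C \<and> snd (class_conflation C (right_class C d)) \<in> right_class C d"
    unfolding class_conflation_def by (rule someI_ex)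
  obtain i' d' where c: "class_conflation C (right_class C d) = (i', d')" by (metis surj_pair)
  have xi': "(i', d') \<in> Confl C" and d': "arr C d'" "Cod C d' = Cod C d" "factors_through C d d'" "factors_through C d' d"
    using s c right_classD[of d' d] by auto
  have ker: "pull_kernel d' K = pull_kernel d K"
    using pull_kernel_mono[OF d'(3) _ _ _ K] pull_kernel_mono[OF d'(4) _ _ _ K] d' I by auto
  show "delta C K (right_class C d) = pull_kernel d K"
    unfolding delta_def c Im_connecting_eq[OF xi' K] by (rule ker)
  have h: "\<guillemotleft>d' : Dom C d' \<rightarrow> Cod C d\<guillemotright>" "\<guillemotleft>d : Dom C d \<rightarrow> Cod C d\<guillemotright>" using d' I by auto
  show "eta C P (right_class C d) = Im_under_Hom C P d"
    unfolding eta_def c snd_conv annihilator_pull_kernel[OF h(1), symmetric] annihilator_pull_kernel[OF h(2), symmetric] ker ..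
qed

end

section \<open>The three bijections and the triangle\<close>

theorem theorem3p3:
  fixes k :: "'k ring" and J :: "('k, 'j) module" and C :: "('k, 'o, 'm) excat"
    and \<tau> \<tau>i :: "'o \<Rightarrow> 'o" and \<tau>m \<tau>im :: "'m set \<Rightarrow> 'm set"
    and \<phi> \<psi> :: "'o \<Rightarrow> 'o \<Rightarrow> 'm set \<Rightarrow> ('m \<times> 'm) set \<Rightarrow> 'j"
    and Y K :: 'o
  assumes "artinian_cring k"
    and "minimal_injective_cogenerator k J"
    and "exact_category k C"
    and "hom_finite k C"
    and "krull_schmidt C"
    and "generalized_AR_duality k J C \<tau> \<tau>m \<tau>i \<tau>im \<phi> \<psi>"
    and "Y \<in> Ob C"
    and "K \<in> obj_l k J C"
  shows "(\<forall>i d. (i, d) \<in> Confl C \<and> right_class C d \<in> determined_epi_classes C (\<tau>i K) Y \<longrightarrow>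
        delta C K (right_class C d) = Im_connecting C (i, d) K \<and>
        eta C (\<tau>i K) (right_class C d) = Im_under_Hom C (\<tau>i K) d)
    \<and> bij_betw (delta C K)
        (determined_epi_classes C (\<tau>i K) Y)
        (submodules (End_ring C K) (Ext_End_module C Y K))
    \<and> bij_betw (gamma k J C \<tau>i \<psi> K Y)
        (submodules (End_ring C K) (Ext_End_module C Y K))
        (submodules (op_ring (End_ring C (\<tau>i K))) (under_End_module C (\<tau>i K) Y))
    \<and> bij_betw (eta C (\<tau>i K))
        (determined_epi_classes C (\<tau>i K) Y)
        (submodules (op_ring (End_ring C (\<tau>i K))) (under_End_module C (\<tau>i K) Y))
    \<and> (\<forall>c \<in> determined_epi_classes C (\<tau>i K) Y. gamma k J C \<tau>i \<psi> K Y (delta C K c) = eta C (\<tau>i K) c)"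
proof -
  interpret ar: generalized_AR_duality k J C \<tau> \<tau>m \<tau>i \<tau>im \<phi> \<psi> by fact
  let ?P = "\<tau>i K"
  have K: "K \<in> Ob C" using assms(8) by (simp add: obj_l_def)
  \<comment> \<open>That \<open>\<tau>i K\<close> is an object of the category is part of the
    functoriality of \<open>\<tau>i\<close>, which lands in \<open>obj_r k J C\<close>.\<close>
  have "is_functor (full_subcategory (over C) (obj_l k J C)) (full_subcategory (under C) (obj_r k J C)) \<tau>i \<tau>im"
    using ar.tau_equivalences by (simp add: quasi_inverse_equivalences_def)
  then have "?P \<in> obj_r k J C" using assms(8) by (simp add: is_functor_def full_subcategory_def)
  then have P: "?P \<in> Ob C" by (simp add: obj_r_def)
  interpret represented_ext k C J K ?P "\<psi> K"
    using assms(1-4) K P ar.psi_represents[OF assms(8)]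
    by (intro represented_ext.intro represented_ext_axioms.intro) (simp_all add: minimal_injective_cogenerator_def)
  let ?A = "determined_epi_classes C ?P Y"
    and ?S = "submodules (End_ring C K) (Ext_End_module C Y K)"
    and ?H = "submodules (op_ring (End_ring C ?P)) (under_End_module C ?P Y)"
    and ?\<gamma> = "gamma k J C \<tau>i \<psi> K Y"
  note Y = assms(7)
  have gamma: "?\<gamma> L = under_class C ` annihilator Y L" for L
    by (rule gamma_eq[of \<psi> \<tau>i, OF refl refl Y])
  have gamma_ker: "?\<gamma> (pull_kernel h K) = Im_under_Hom C ?P h" if "\<guillemotleft>h : Q \<rightarrow> Y\<guillemotright>" for h Q
    unfolding gamma by (rule annihilator_pull_kernel[OF that])
  have cls: "\<exists>i d. (i, d) \<in> Confl C \<and> \<guillemotleft>d : Dom C d \<rightarrow> Y\<guillemotright> \<and> right_determined C ?P d \<and> c = right_class C d" if "c \<in> ?A" for c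
    using that conflD unfolding determined_epi_classes_def deflation_def by blast
  have first: "delta C K (right_class C d) = Im_connecting C (i, d) K" "eta C ?P (right_class C d) = Im_under_Hom C ?P d"
    if "(i, d) \<in> Confl C" for i d
    using class_conflation[OF that] Im_connecting_eq[OF that K] by simp_all
  have triangle: "?\<gamma> (delta C K c) = eta C ?P c" if "c \<in> ?A" for c
  proof -
    obtain i d where d: "(i, d) \<in> Confl C" "\<guillemotleft>d : Dom C d \<rightarrow> Y\<guillemotright>" "c = right_class C d" using cls[OF \<open>c \<in> ?A\<close>] by blast
    show ?thesis unfolding d(3) class_conflation[OF d(1)] by (rule gamma_ker[OF d(2)])
  qed
  have delta_in: "delta C K c \<in> ?S" if "c \<in> ?A" for c
  proof -
    obtain i d where d: "(i, d) \<in> Confl C" "\<guillemotleft>d : Dom C d \<rightarrow> Y\<guillemotright>" "c = right_class C d" using cls[OF \<open>c \<in> ?A\<close>] by blast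
    show ?thesis unfolding d(3) class_conflation[OF d(1)] by (rule pull_kernel_submodule[OF d(2) K])
  qed
  \<comment> \<open>Recovering a determined deflation from its image also gives the injectivity of
    \<open>delta\<close>, by way of the triangle.\<close>
  have eta_inj: "inj_on (eta C ?P) ?A"
  proof (rule inj_onI)
    fix c c' assume c: "c \<in> ?A" "c' \<in> ?A" "eta C ?P c = eta C ?P c'"
    obtain i d where d: "(i, d) \<in> Confl C" "\<guillemotleft>d : Dom C d \<rightarrow> Y\<guillemotright>" "right_determined C ?P d" "c = right_class C d"
      using cls[OF c(1)] by blast
    obtain i' d' where d': "(i', d') \<in> Confl C" "\<guillemotleft>d' : Dom C d' \<rightarrow> Y\<guillemotright>" "right_determined C ?P d'" "c' = right_class C d'"
      using cls[OF c(2)] by blast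
    have "Im_under_Hom C ?P d = Im_under_Hom C ?P d'" using c(3) unfolding d(4) d'(4) first(2)[OF d(1)] first(2)[OF d'(1)] .
    then have "factors_through C d d'" "factors_through C d' d"
      using factors_through_of_image[OF d(1) d'(1)] factors_through_of_image[OF d'(1) d(1)] d d' by auto
    then show "c = c'" unfolding d(4) d'(4) by (intro right_class_eqI) (use d d' in auto)
  qed
  have delta_bij: "bij_betw (delta C K) ?A ?S"
  proof (rule bij_betw_imageI)
    show "inj_on (delta C K) ?A"
    proof (rule inj_onI)
      fix c c' assume c: "c \<in> ?A" "c' \<in> ?A" "delta C K c = delta C K c'"
      then have "eta C ?P c = eta C ?P c'" using triangle[OF c(1)] triangle[OF c(2)] by simp
      then show "c = c'" using inj_onD[OF eta_inj] c by blast
    qed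
    show "delta C K ` ?A = ?S"
    proof (intro equalityI subsetI)
      fix L assume L: "L \<in> ?S"
      obtain i d where d: "(i, d) \<in> Confl C" "Cod C d = Y" "right_determined C ?P d" "pull_kernel d K = L"
        using submodule_is_pull_kernel[OF Y L] .
      then have "right_class C d \<in> ?A" unfolding determined_epi_classes_def deflation_def by blast
      moreover have "delta C K (right_class C d) = L" unfolding class_conflation(1)[OF d(1)] by (rule d(4))
      ultimately show "L \<in> delta C K ` ?A" by blast
    qed (use delta_in in blast)
  qed
  have gamma_bij: "bij_betw ?\<gamma> ?S ?H"
  proof (rule bij_betw_imageI)
    show "inj_on ?\<gamma> ?S"
    proof (rule inj_onI)
      fix L L' assume L: "L \<in> ?S" "L' \<in> ?S" "?\<gamma> L = ?\<gamma> L'"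
      have S: "submodule L k (Ext C Y K)" "submodule L' k (Ext C Y K)" using L ext_submodules_iff[OF Y K] by auto
      have E: "module k (Ext C Y K)" by (rule ext_module[OF Y K])
      show "L = L'"
        using annihilator_antimono[OF S(1) module.submoduleD(1)[OF E S(2)] Y]
          annihilator_antimono[OF S(2) module.submoduleD(1)[OF E S(1)] Y] L(3)[unfolded gamma] by blast
    qed
    show "?\<gamma> ` ?S = ?H"
    proof (intro equalityI subsetI)
      fix H assume "H \<in> ?\<gamma> ` ?S"
      then obtain L where L: "L \<in> ?S" "H = ?\<gamma> L" by auto
      \<comment> \<open>Writing \<open>L\<close> as the kernel for a deflation turns
        \<open>gamma\<close> of \<open>L\<close> into the image of a stable Hom, which is stable
        under precomposition with endomorphisms of \<open>\<tau>i K\<close>.\<close>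
      obtain i d where d: "(i, d) \<in> Confl C" "Cod C d = Y" "pull_kernel d K = L"
        using submodule_is_pull_kernel[OF Y L(1)] .
      have h: "\<guillemotleft>d : Dom C d \<rightarrow> Y\<guillemotright>" using conflD[OF d(1)] d(2) by simp
      show "H \<in> ?H" unfolding L(2) d(3)[symmetric] gamma_ker[OF h] by (rule Im_under_Hom_submodule[OF h P])
    next
      fix H assume H: "H \<in> ?H"
      obtain Q h where h: "\<guillemotleft>h : Q \<rightarrow> Y\<guillemotright>" "Im_under_Hom C ?P h = H" using submodule_is_image[OF Y H] .
      have "H = ?\<gamma> (pull_kernel h K)" unfolding gamma_ker[OF h(1)] by (rule h(2)[symmetric])
      then show "H \<in> ?\<gamma> ` ?S" using pull_kernel_submodule[OF h(1) K] by blast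
    qed
  qed
  have "bij_betw (?\<gamma> \<circ> delta C K) ?A ?H" by (rule bij_betw_trans[OF delta_bij gamma_bij])
  then have eta_bij: "bij_betw (eta C ?P) ?A ?H"
    by (rule iffD1[OF bij_betw_cong, rotated]) (use triangle in simp)
  show ?thesis using first triangle delta_bij gamma_bij eta_bij by blast
qed

end
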